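(* Let $1<p<\infty$, let $(X,d)$ be a locally compact separable metric space, let $\mathfrak m$ be a Radon measure on $(X,d)$ with full support, and let $(\mathcal E,\mathcal F)$ be a $p$-energy form on $(X,\mathfrak m)$ satisfying the following conditions. (E1) $\mathcal F\subset L^p(\mathfrak m)$, and $(\mathcal F,\|\cdot\|_{\mathcal E_1})$ is a Banach space, where $\|f\|_{\mathcal E_1}=\bigl(\mathcal E(f)+\|f\|_{L^p(\mathfrak m)}^p\bigr)^{1/p}$. (E2) If $f\in\mathcal F\cap C_c(X)$, then $g:=(f\wedge 1)^+\in\mathcal F\cap C_c(X)$ and $\mathcal E(g)\le\mathcal E(f)$. (E3) $\mathcal E(f+g)=\mathcal E(f)+\mathcal E(g)$ whenever $f,g\in\mathcal F\cap C_c(X)$ and $\operatorname{supp}(f)\cap\operatorname{supp}(g+a)=\emptyset$ for some $a\in\mathbb R$. (E4) $\mathcal F\cap C_c(X)$ is dense both in $(\mathcal F,\|\cdot\|_{\mathcal E_1})$ and in $(C_c(X),\|\cdot\|_\infty)$. (E5) The $p$-Clarkson inequalities for $\mathcal E^{1/p}$ hold on $\mathcal F$. Then there exists a unique family $\{\mu_{\langle f\rangle}\}_{f\in\mathcal F}$ of Radon measures on $(X,d)$ satisfying the following (M1)–(M4). (M1) $\mu_{\langle f\rangle}(X)=\mathcal E(f)$ for any $f\in\mathcal F$. (M2) If $f,g\in\mathcal F\cap C_c(X)$, $A\in\mathcal B(X)$ and $(f-g)|_A$ is constant, then $\mu_{\langle f\rangle}(A)=\mu_{\langle g\rangle}(A)$.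 (M3) For any $A\in\mathcal B(X)$, the functional $f\mapsto\mu_{\langle f\rangle}(A)^{1/p}$ is a seminorm on $\mathcal F$. (M4) For any $A\in\mathcal B(X)$, the $p$-Clarkson inequalities for the functional $f\mapsto\mu_{\langle f\rangle}(A)^{1/p}$ hold on $\mathcal F$. Moreover, this family satisfies the following (M5) and (M6), where for $f,g\in\mathcal F$ the signed measure $\mu_{\langle f;g\rangle}$ is defined by $\mu_{\langle f;g\rangle}(A):=\frac1p\frac{\mathrm d}{\mathrm dt}\mu_{\langle f+tg\rangle}(A)\big|_{t=0}$, $A\in\mathcal B(X)$. (M5) (Chain rule) For any $f,g\in\mathcal F\cap C_c(X)$ and any piecewise $C^1$ functions $\varphi,\psi:\mathbb R\to\mathbb R$ with $\varphi(0)=\psi(0)=0$, $$\mathrm d\mu_{\langle\varphi\circ f;\psi\circ g\rangle}=\operatorname{sgn}(\varphi'\circ f)\,|\varphi'\circ f|^{p-1}(\psi'\circ g)\,\mathrm d\mu_{\langle f;g\rangle}.$$ (M6) (Leibniz rule) $\mathrm d\mu_{\langle f;gh\rangle}=g\,\mathrm d\mu_{\langle f;h\rangle}+h\,\mathrm d\mu_{\langle f;g\rangle}$ for any $f,g,h\in\mathcal F\cap C_c(X)$.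
   Context: $C_c(X)$ is the set of continuous real functions on $X$ with compact support, $\operatorname{supp}(f)=\overline{\{f\neq0\}}$, $\mathcal B(X)$ is the Borel $\sigma$-algebra, $a\wedge b=\min\{a,b\}$, $a\vee b=\max\{a,b\}$, $a^+=a\vee0$, $\operatorname{sgn}(0)=0$ and $\operatorname{sgn}(t)=t/|t|$ for $t\ne0$. $L^0(\mathfrak m)$ is the space of real measurable functions modulo $\mathfrak m$-a.e. equality. A $p$-energy form on $(X,\mathfrak m)$ is a pair $(\mathcal E,\mathcal F)$ where $\mathcal F$ is a linear subspace of $L^0(\mathfrak m)$ and $\mathcal E:\mathcal F\to[0,\infty)$ is such that $\mathcal E^{1/p}$ is a seminorm on $\mathcal F$. $\mathcal F\cap C_c(X)$ denotes the set of $f\in C_c(X)$ whose $\mathfrak m$-class is in $\mathcal F$. The $p$-Clarkson inequalities for a nonnegative function $\Phi$ hold on a linear subspace $A$ of its domain if, for all $u,v\in A$: when $1<p<2$, $2\bigl(\Phi(u)^{\frac p{p-1}}+\Phi(v)^{\frac p{p-1}}\bigr)^{p-1}\le\Phi(u+v)^p+\Phi(u-v)^p$ and $2\bigl(\Phi(u)^p+\Phi(v)^p\bigr)\ge\Phi(u+v)^p+\Phi(u-v)^p$; when $p\ge2$, the same two inequalities with $\le$ and $\ge$ interchanged, i.e. $2\bigl(\Phi(u)^{\frac p{p-1}}+\Phi(v)^{\frac p{p-1}}\bigr)^{p-1}\ge\Phi(u+v)^p+\Phi(u-v)^p$ and $2\bigl(\Phi(u)^p+\Phi(v)^p\bigr)\le\Phi(u+v)^p+\Phi(u-v)^p$.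 It is known that (M3) and (M4) imply that the derivative defining $\mu_{\langle f;g\rangle}(A)$ exists for all $f,g\in\mathcal F$, $A\in\mathcal B(X)$, and that $\mu_{\langle f;g\rangle}$ is a (finite) signed Borel measure. Convention for the chain rule: piecewise $C^1$ functions are continuous, and $\varphi'\circ f(x):=0$ at points $x$ where $\varphi'(f(x))$ does not exist (similarly for $\psi'\circ g$). *)

theory Defs
  imports "HOL-Analysis.Analysis"
begin

section \<open>Radon measures and compactly supported functions\<close>

definition radon_measure :: "'a::topological_space measure \<Rightarrow> bool" where
  "radon_measure M \<longleftrightarrow>
     sets M = sets borel \<and>
     (\<forall>K. compact K \<longrightarrow> emeasure M K < \<infinity>) \<and>
     (\<forall>A\<in>sets borel. emeasure M A = (INF U\<in>{U. open U \<and> A \<subseteq> U}. emeasure M U)) \<and>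
     (\<forall>U. open U \<longrightarrow> emeasure M U = (SUP K\<in>{K. compact K \<and> K \<subseteq> U}. emeasure M K))"

definition full_support :: "'a::topological_space measure \<Rightarrow> bool" where
  "full_support M \<longleftrightarrow> (\<forall>U. open U \<and> U \<noteq> {} \<longrightarrow> 0 < emeasure M U)"

definition supp :: "('a::topological_space \<Rightarrow> real) \<Rightarrow> 'a set" where
  "supp f = closure {x. f x \<noteq> 0}"

definition C_c :: "('a::topological_space \<Rightarrow> real) set" where
  "C_c = {f. continuous_on UNIV f \<and> compact (supp f)}"

definition sup_norm :: "('a \<Rightarrow> real) \<Rightarrow> real" where
  "sup_norm f = (SUP x. \<bar>f x\<bar>)"

definition Lp_space :: "real \<Rightarrow> 'a measure \<Rightarrow> ('a \<Rightarrow> real) set" where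
  "Lp_space p M = {f \<in> borel_measurable M. integrable M (\<lambda>x. \<bar>f x\<bar> powr p)}"

definition Lp_norm :: "real \<Rightarrow> 'a measure \<Rightarrow> ('a \<Rightarrow> real) \<Rightarrow> real" where
  "Lp_norm p M f = (\<integral>x. \<bar>f x\<bar> powr p \<partial>M) powr (1 / p)"


section \<open>\<open>p\<close>-energy forms\<close>

definition linear_subspace :: "('a \<Rightarrow> real) set \<Rightarrow> bool" where
  "linear_subspace V \<longleftrightarrow>
     (\<lambda>x. 0) \<in> V \<and>
     (\<forall>f\<in>V. \<forall>g\<in>V. (\<lambda>x. f x + g x) \<in> V) \<and>
     (\<forall>c. \<forall>f\<in>V. (\<lambda>x. c * f x) \<in> V)"

definition seminorm_on :: "('a \<Rightarrow> real) set \<Rightarrow> (('a \<Rightarrow> real) \<Rightarrow> real) \<Rightarrow> bool" where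
  "seminorm_on V N \<longleftrightarrow>
     (\<forall>f\<in>V. 0 \<le> N f) \<and>
     (\<forall>f\<in>V. \<forall>g\<in>V. N (\<lambda>x. f x + g x) \<le> N f + N g) \<and>
     (\<forall>c. \<forall>f\<in>V. N (\<lambda>x. c * f x) = \<bar>c\<bar> * N f)"

text \<open>
  A linear subspace of \<open>L\<^sup>0(M)\<close> is represented by the set of all representatives of its
  elements, i.e. by a linear space of measurable functions that is saturated with respect to
  almost everywhere equality; a map defined on the subspace is a map on representatives
  that does not distinguish almost everywhere equal functions.
\<close>

definition L0_subspace :: "'a measure \<Rightarrow> ('a \<Rightarrow> real) set \<Rightarrow> bool" where
  "L0_subspace M V \<longleftrightarrow>
     V \<subseteq> borel_measurable M \<and> linear_subspace V \<and>
     (\<forall>f\<in>V. \<forall>g\<in>borel_measurable M. (AE x in M. f x = g x) \<longrightarrow> g \<in> V)"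

definition respects_AE :: "'a measure \<Rightarrow> ('a \<Rightarrow> real) set \<Rightarrow> (('a \<Rightarrow> real) \<Rightarrow> 'b) \<Rightarrow> bool" where
  "respects_AE M V T \<longleftrightarrow> (\<forall>f\<in>V. \<forall>g\<in>V. (AE x in M. f x = g x) \<longrightarrow> T f = T g)"

definition p_energy_form ::
  "real \<Rightarrow> 'a measure \<Rightarrow> (('a \<Rightarrow> real) \<Rightarrow> real) \<Rightarrow> ('a \<Rightarrow> real) set \<Rightarrow> bool" where
  "p_energy_form p M \<E> \<F> \<longleftrightarrow>
     L0_subspace M \<F> \<and> respects_AE M \<F> \<E> \<and>
     (\<forall>f\<in>\<F>. 0 \<le> \<E> f) \<and> seminorm_on \<F> (\<lambda>f. \<E> f powr (1 / p))"

definition energy_norm ::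
  "real \<Rightarrow> 'a measure \<Rightarrow> (('a \<Rightarrow> real) \<Rightarrow> real) \<Rightarrow> ('a \<Rightarrow> real) \<Rightarrow> real" where
  "energy_norm p M \<E> f = (\<E> f + Lp_norm p M f powr p) powr (1 / p)"

definition banach_mod_AE ::
  "'a measure \<Rightarrow> ('a \<Rightarrow> real) set \<Rightarrow> (('a \<Rightarrow> real) \<Rightarrow> real) \<Rightarrow> bool" where
  "banach_mod_AE M V N \<longleftrightarrow>
     L0_subspace M V \<and> respects_AE M V N \<and> seminorm_on V N \<and>
     (\<forall>f\<in>V. N f = 0 \<longrightarrow> (AE x in M. f x = 0)) \<and>
     (\<forall>u :: nat \<Rightarrow> 'a \<Rightarrow> real.
        (\<forall>n. u n \<in> V) \<and>
        (\<forall>\<epsilon>>0. \<exists>n0. \<forall>n\<ge>n0. \<forall>k\<ge>n0. N (\<lambda>x. u n x - u k x) < \<epsilon>) \<longrightarrow>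
        (\<exists>f\<in>V. (\<lambda>n. N (\<lambda>x. u n x - f x)) \<longlonglongrightarrow> 0))"

definition dense_wrt ::
  "(('a \<Rightarrow> real) \<Rightarrow> real) \<Rightarrow> ('a \<Rightarrow> real) set \<Rightarrow> ('a \<Rightarrow> real) set \<Rightarrow> bool" where
  "dense_wrt N D V \<longleftrightarrow>
     D \<subseteq> V \<and> (\<forall>f\<in>V. \<forall>\<epsilon>>0. \<exists>g\<in>D. N (\<lambda>x. f x - g x) < \<epsilon>)"

definition clarkson :: "real \<Rightarrow> ('a \<Rightarrow> real) set \<Rightarrow> (('a \<Rightarrow> real) \<Rightarrow> real) \<Rightarrow> bool" where
  "clarkson p V \<Phi> \<longleftrightarrow>
     (\<forall>u\<in>V. \<forall>v\<in>V.
        (p < 2 \<longrightarrow>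
           2 * (\<Phi> u powr (p / (p - 1)) + \<Phi> v powr (p / (p - 1))) powr (p - 1)
             \<le> \<Phi> (\<lambda>x. u x + v x) powr p + \<Phi> (\<lambda>x. u x - v x) powr p \<and>
           2 * (\<Phi> u powr p + \<Phi> v powr p)
             \<ge> \<Phi> (\<lambda>x. u x + v x) powr p + \<Phi> (\<lambda>x. u x - v x) powr p) \<and>
        (2 \<le> p \<longrightarrow>
           2 * (\<Phi> u powr (p / (p - 1)) + \<Phi> v powr (p / (p - 1))) powr (p - 1)
             \<ge> \<Phi> (\<lambda>x. u x + v x) powr p + \<Phi> (\<lambda>x. u x - v x) powr p \<and>
           2 * (\<Phi> u powr p + \<Phi> v powr p)
             \<le> \<Phi> (\<lambda>x. u x + v x) powr p + \<Phi> (\<lambda>x. u x - v x) powr p))"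


section \<open>Energy measures\<close>

text \<open>
  The total mass condition is stated with \<^const>\<open>emeasure\<close>, so all the measures are finite and
  the real-valued \<^const>\<open>measure\<close> carries no junk values in the last two conditions.
\<close>

definition energy_measures ::
  "real \<Rightarrow> 'a::topological_space measure \<Rightarrow> (('a \<Rightarrow> real) \<Rightarrow> real) \<Rightarrow> ('a \<Rightarrow> real) set \<Rightarrow>
   (('a \<Rightarrow> real) \<Rightarrow> 'a measure) \<Rightarrow> bool" where
  "energy_measures p M \<E> \<F> \<mu> \<longleftrightarrow>
     respects_AE M \<F> \<mu> \<and>
     (\<forall>f\<in>\<F>. radon_measure (\<mu> f)) \<and>
     (\<forall>f\<in>\<F>. emeasure (\<mu> f) UNIV = ennreal (\<E> f)) \<and>
     (\<forall>f\<in>\<F> \<inter> C_c. \<forall>g\<in>\<F> \<inter> C_c. \<forall>A\<in>sets borel.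
        (\<lambda>x. f x - g x) constant_on A \<longrightarrow> emeasure (\<mu> f) A = emeasure (\<mu> g) A) \<and>
     (\<forall>A\<in>sets borel. seminorm_on \<F> (\<lambda>f. measure (\<mu> f) A powr (1 / p))) \<and>
     (\<forall>A\<in>sets borel. clarkson p \<F> (\<lambda>f. measure (\<mu> f) A powr (1 / p)))"

definition mutual_energy ::
  "real \<Rightarrow> (('a \<Rightarrow> real) \<Rightarrow> 'a measure) \<Rightarrow> ('a \<Rightarrow> real) \<Rightarrow> ('a \<Rightarrow> real) \<Rightarrow> 'a set \<Rightarrow> real" where
  "mutual_energy p \<mu> f g A = deriv (\<lambda>t. measure (\<mu> (\<lambda>x. f x + t * g x)) A) 0 / p"


section \<open>Finite signed Borel measures\<close>

definition signed_borel_measure :: "('a::topological_space set \<Rightarrow> real) \<Rightarrow> bool" where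
  "signed_borel_measure \<nu> \<longleftrightarrow>
     \<nu> {} = 0 \<and>
     (\<forall>A :: nat \<Rightarrow> 'a set. range A \<subseteq> sets borel \<and> disjoint_family A \<longrightarrow>
        (\<lambda>n. \<nu> (A n)) sums \<nu> (\<Union>n. A n))"

text \<open>
  The Jordan decomposition: the positive variation of \<open>\<nu>\<close> on \<open>A\<close> is the supremum of \<open>\<nu> B\<close> over
  the Borel sets \<open>B \<subseteq> A\<close>. Negative values are sent to \<open>0\<close> by \<^const>\<open>ennreal\<close>, which is harmless
  since \<open>B = {}\<close> is admissible.
\<close>

definition pos_variation :: "('a::topological_space set \<Rightarrow> real) \<Rightarrow> 'a measure" where
  "pos_variation \<nu> =
     measure_of UNIV (sets borel) (\<lambda>A. SUP B\<in>{B \<in> sets borel. B \<subseteq> A}. ennreal (\<nu> B))"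

definition neg_variation :: "('a::topological_space set \<Rightarrow> real) \<Rightarrow> 'a measure" where
  "neg_variation \<nu> = pos_variation (\<lambda>A. - \<nu> A)"

definition signed_integrable ::
  "('a::topological_space set \<Rightarrow> real) \<Rightarrow> ('a \<Rightarrow> real) \<Rightarrow> bool" where
  "signed_integrable \<nu> w \<longleftrightarrow> integrable (pos_variation \<nu>) w \<and> integrable (neg_variation \<nu>) w"

definition signed_integral ::
  "('a::topological_space set \<Rightarrow> real) \<Rightarrow> 'a set \<Rightarrow> ('a \<Rightarrow> real) \<Rightarrow> real" where
  "signed_integral \<nu> A w = (LINT x:A|pos_variation \<nu>. w x) - (LINT x:A|neg_variation \<nu>. w x)"


section \<open>Piecewise continuously differentiable functions\<close>

text \<open>
  There are finitely many break points in every bounded interval, and \<open>\<phi>\<close> is continuously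
  differentiable on each closed piece, which for a continuous \<open>\<phi>\<close> means that the derivative has
  finite one-sided limits at the break points. The library's \<^term>\<open>(piecewise_C1_differentiable_on)\<close>
  does not ask for these limits and so would admit functions like \<open>\<lambda>t. sqrt \<bar>t\<bar>\<close>.
\<close>

definition piecewise_C1 :: "(real \<Rightarrow> real) \<Rightarrow> bool" where
  "piecewise_C1 \<phi> \<longleftrightarrow>
     continuous_on UNIV \<phi> \<and>
     (\<exists>S. (\<forall>a b. finite (S \<inter> {a..b})) \<and> \<phi> C1_differentiable_on (- S) \<and>
        (\<forall>s\<in>S. (\<exists>l. (deriv \<phi> \<longlongrightarrow> l) (at_left s)) \<and> (\<exists>r. (deriv \<phi> \<longlongrightarrow> r) (at_right s))))"

definition deriv0 :: "(real \<Rightarrow> real) \<Rightarrow> real \<Rightarrow> real" where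
  "deriv0 \<phi> t = (if \<phi> field_differentiable (at t) then deriv \<phi> t else 0)"

end

theory Submission
  imports Defs
begin

text \<open>
  Folding a function \<open>f\<close> by a zigzag function \<open>\<zeta>\<close> of slope \<open>1\<close> or \<open>- 1\<close> and small height does not change
  its energy, and by locality it should not change its energy measure either. As the folded function
  is small, the energy of \<open>min (\<zeta> \<circ> f) h\<close>, for \<open>h\<close> nonnegative in the core, tends to the mass of
  \<open>{h > 0}\<close> when the height of \<open>\<zeta>\<close> tends to \<open>0\<close> along dyadic numbers. This limit depends only on the
  form, hence uniqueness, and it determines a Radon measure through its values on open sets, hence
  existence. Locality of the measures is obtained by flattening \<open>f - g\<close> near a dyadic level, the
  Clarkson inequalities on \<open>{h > 0}\<close> by applying those of the form to folded pairs of functions, and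
  density of the core extends everything to the domain.

  By the Clarkson inequalities \<open>t \<mapsto> \<mu>\<^bsub>\<langle>f + t g\<rangle>\<^esub>(A)\<close> is convex and differentiable. For the chain rule a
  piecewise \<open>C\<^sup>1\<close> function is approximated by piecewise affine ones with a small Lipschitz error,
  for which it follows from locality and homogeneity.
\<close>

section \<open>Consequences of the Clarkson inequalities\<close>

text \<open>The form is not quadratic, so no bilinear expansion localises an energy. (E3) compares
  two functions, whereas a measure on sets needs four: E(g + a + b) + E(g) = E(g + a) + E(g + b)
  whenever a b = 0. This identity amounts to a licence to swap values pointwise between two
  functions without changing the total energy. Cuts are made by lattice operations: a folded
  function is small, so removing its minimum with a steep function of another core function
  separates two regions, at a cost that becomes negligible for a well chosen level.

  Capping a fold of height \<delta> by h costs at most the energy of min h \<delta>, which vanishes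
  with \<delta>; hence the capped energies are almost increasing under refinement. A fold only
  ignores shifts in 2 \<delta> Z, hence the dyadic heights and the detour for a general constant in
  (M2).

  The Clarkson inequalities act in two ways. The lower bound on sum and difference gives uniform
  convexity, which with completeness takes the place of a weak compactness argument, and convexity
  along lines; the upper bound gives differentiability.\<close>

lemma linear_subspaceD:
  assumes "linear_subspace V"
  shows "(\<lambda>x. 0) \<in> V"
    and "f \<in> V \<Longrightarrow> g \<in> V \<Longrightarrow> (\<lambda>x. f x + g x) \<in> V"
    and "f \<in> V \<Longrightarrow> (\<lambda>x. c * f x) \<in> V"
    and "f \<in> V \<Longrightarrow> (\<lambda>x. - f x) \<in> V"
    and "f \<in> V \<Longrightarrow> g \<in> V \<Longrightarrow> (\<lambda>x. f x - g x) \<in> V"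
proof -
  show z: "(\<lambda>x. 0) \<in> V" and a: "f \<in> V \<Longrightarrow> g \<in> V \<Longrightarrow> (\<lambda>x. f x + g x) \<in> V"
    and s: "f \<in> V \<Longrightarrow> (\<lambda>x. c * f x) \<in> V" for f g c
    using assms by (auto simp: linear_subspace_def)
  show n: "f \<in> V \<Longrightarrow> (\<lambda>x. - f x) \<in> V" for f using s[of f "-1"] by simp
  show "f \<in> V \<Longrightarrow> g \<in> V \<Longrightarrow> (\<lambda>x. f x - g x) \<in> V"
    using a[of f "\<lambda>x. - g x"] n by auto
qed

text \<open>The inequalities for one pair in terms of the p-th powers \<open>a\<close> =
  \<Phi>(u)^p, \<open>b\<close> = \<Phi>(v)^p and \<open>s\<close> = \<Phi>(u + v)^p + \<Phi>(u -
  v)^p. Energies and masses of sets are such powers, and a relation between three numbers passes to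
  limits.\<close>

definition clarkson_ineq :: "real \<Rightarrow> real \<Rightarrow> real \<Rightarrow> real \<Rightarrow> bool" where
  "clarkson_ineq p a b s \<longleftrightarrow>
     (p < 2 \<longrightarrow> 2 * (a powr (1 / (p - 1)) + b powr (1 / (p - 1))) powr (p - 1) \<le> s \<and> s \<le> 2 * (a + b)) \<and>
     (2 \<le> p \<longrightarrow> s \<le> 2 * (a powr (1 / (p - 1)) + b powr (1 / (p - 1))) powr (p - 1) \<and> 2 * (a + b) \<le> s)"

lemma clarkson_iff:
  assumes p: "1 < p" and V: "linear_subspace V" and Q: "\<And>f. f \<in> V \<Longrightarrow> 0 \<le> Q f"
  shows "clarkson p V (\<lambda>f. Q f powr (1 / p)) \<longleftrightarrow>
    (\<forall>u\<in>V. \<forall>v\<in>V. clarkson_ineq p (Q u) (Q v) (Q (\<lambda>x. u x + v x) + Q (\<lambda>x. u x - v x)))"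
proof -
  have e: "(x powr (1 / p)) powr (p / (p - 1)) = x powr (1 / (p - 1))" for x :: real
    using p by (simp add: powr_powr)
  have e2: "(Q f powr (1 / p)) powr p = Q f" if "f \<in> V" for f
    using p Q[OF that] by (simp add: powr_powr)
  show ?thesis
    unfolding clarkson_def clarkson_ineq_def e
    by (intro ball_cong refl) (simp add: e2 linear_subspaceD[OF V])
qed

lemma clarksonD:
  assumes "1 < p" "linear_subspace V" "\<And>f. f \<in> V \<Longrightarrow> 0 \<le> Q f"
    and "clarkson p V (\<lambda>f. Q f powr (1 / p))" "u \<in> V" "v \<in> V"
  shows "clarkson_ineq p (Q u) (Q v) (Q (\<lambda>x. u x + v x) + Q (\<lambda>x. u x - v x))"
  using assms(4-) clarkson_iff[of p V Q, OF assms(1-3)] by simp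

text \<open>The exponent merges the two ranges of p: it is \<open>1 / (p - 1)\<close> for p < 2 and
  \<open>1\<close> otherwise, and the lower bound for \<open>s\<close> then reads the same. The
  upper bound is treated likewise with the smaller exponent.\<close>

lemma clarkson_ineq_ge:
  assumes "1 < p" "clarkson_ineq p a b s" "0 \<le> a" "0 \<le> b" "r = max 1 (1 / (p - 1))"
  shows "2 * (a powr r + b powr r) powr (1 / r) \<le> s"
proof (cases "p < 2")
  case True
  then have "r = 1 / (p - 1)" using assms by (auto simp: max_def field_simps)
  then show ?thesis using assms True by (auto simp: clarkson_ineq_def)
next
  case False
  then have "r = 1" using assms by (auto simp: max_def field_simps)
  then show ?thesis using assms False by (auto simp: clarkson_ineq_def)
qed

lemma clarkson_ineq_le:
  assumes "1 < p" "clarkson_ineq p a b s" "0 \<le> a" "0 \<le> b" "r = min 1 (1 / (p - 1))"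
  shows "s \<le> 2 * (a powr r + b powr r) powr (1 / r)"
proof (cases "p < 2")
  case True
  then have "r = 1" using assms by (auto simp: min_def field_simps)
  then show ?thesis using assms True by (auto simp: clarkson_ineq_def)
next
  case False
  then have "r = 1 / (p - 1)" using assms by (auto simp: min_def field_simps)
  then show ?thesis using assms False by (auto simp: clarkson_ineq_def)
qed

text \<open>Drops \<open>b\<close> from the lower bound. With u a midpoint and v half the
  difference, \<open>s\<close> is the sum of the end values, so this is midpoint convexity.\<close>

lemma clarkson_ineq_midpoint:
  assumes "1 < p" "clarkson_ineq p a b s" "0 \<le> a" "0 \<le> b"
  shows "2 * a \<le> s"
proof -
  define r where "r = max 1 (1 / (p - 1))"
  have r: "r \<ge> 1" by (simp add: r_def)
  have "a = (a powr r) powr (1 / r)" using r assms by (simp add: powr_powr)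
  also have "\<dots> \<le> (a powr r + b powr r) powr (1 / r)"
    using r by (intro powr_mono2) auto
  finally show ?thesis using clarkson_ineq_ge[OF assms r_def] by simp
qed

text \<open>If \<open>a\<close> is nearly \<open>A\<close> and \<open>s\<close> at most nearly
  \<open>2 * A\<close>, then a^r + b^r \<le> (s / 2)^r leaves no room for \<open>b\<close>. In use
  \<open>a\<close> belongs to a midpoint and \<open>b\<close> to half the difference.\<close>

lemma clarkson_ineq_uniformly_convex:
  assumes p: "1 < p" and A: "0 \<le> A" and \<eta>: "0 < \<eta>"
  obtains \<epsilon> where "\<epsilon> > 0"
    "\<And>a b s. clarkson_ineq p a b s \<Longrightarrow> 0 \<le> a \<Longrightarrow> 0 \<le> b \<Longrightarrow> A - \<epsilon> \<le> a \<Longrightarrow> s \<le> 2 * (A + \<epsilon>) \<Longrightarrow> b < \<eta>"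
proof -
  define r where "r = max 1 (1 / (p - 1))"
  have r: "r \<ge> 1" by (simp add: r_def)
  \<comment> \<open>The maximum keeps the base nonnegative, since \<open>A\<close> may be
    \<open>0\<close>.\<close>
  have lim: "((\<lambda>\<epsilon>. (A + \<epsilon>) powr r - (max (A - \<epsilon>) 0) powr r) \<longlongrightarrow> (A + 0) powr r - (max (A - 0) 0) powr r) (at_right 0)"
    using A r
    by (intro tendsto_intros tendsto_powr' disjI2 conjI) (auto intro: eventually_at_right_less simp: eventually_at_right_less max_def eventually_at_filter)
  have "\<forall>\<^sub>F \<epsilon> in at_right 0. (A + \<epsilon>) powr r - (max (A - \<epsilon>) 0) powr r < \<eta> powr r"
    using order_tendstoD(2)[OF lim, of "\<eta> powr r"] \<eta> A by (simp add: max_def)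
  then have "\<forall>\<^sub>F \<epsilon> in at_right (0::real). \<epsilon> > 0 \<and> (A + \<epsilon>) powr r - (max (A - \<epsilon>) 0) powr r < \<eta> powr r"
    by (intro eventually_conj eventually_at_right_less)
  then obtain \<epsilon> where \<epsilon>: "\<epsilon> > 0" "(A + \<epsilon>) powr r - (max (A - \<epsilon>) 0) powr r < \<eta> powr r"
    by (metis (no_types, lifting) eventually_happens trivial_limit_at_right_real)
  show ?thesis
  proof
    fix a b s assume h: "clarkson_ineq p a b s" "0 \<le> a" "0 \<le> b" "A - \<epsilon> \<le> a" "s \<le> 2 * (A + \<epsilon>)"
    have "(a powr r + b powr r) powr (1 / r) \<le> A + \<epsilon>"
      using clarkson_ineq_ge[OF p h(1-3) r_def] h(5) by simp
    then have "((a powr r + b powr r) powr (1 / r)) powr r \<le> (A + \<epsilon>) powr r"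
      using r by (intro powr_mono2) auto
    then have "a powr r + b powr r \<le> (A + \<epsilon>) powr r" using r by (simp add: powr_powr)
    moreover have "(max (A - \<epsilon>) 0) powr r \<le> a powr r" using h r by (intro powr_mono2) auto
    ultimately have "b powr r < \<eta> powr r" using \<epsilon>(2) by linarith
    then show "b < \<eta>" using h(3) \<eta> r by (meson not_less powr_mono2 order_less_imp_le order.trans zero_le_one)
  qed fact
qed

text \<open>Powers with positive exponent are continuous up to \<open>0\<close>. This carries the
  inequalities from the form to superlevel sets, to Borel sets and finally to all of
  \<open>\<F>\<close>.\<close>

lemma clarkson_ineq_LIMSEQ:
  assumes p: "1 < p" and lim: "a \<longlonglongrightarrow> a'" "b \<longlonglongrightarrow> b'" "s \<longlonglongrightarrow> s'"
    and cl: "\<And>n. clarkson_ineq p (a n) (b n) (s n)" and nn: "\<And>n. 0 \<le> a n" "\<And>n. 0 \<le> b n"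
  shows "clarkson_ineq p a' b' s'"
proof -
  define q where "q = 1 / (p - 1)"
  have q: "q > 0" using p by (simp add: q_def)
  have l1: "(\<lambda>n. 2 * (a n + b n)) \<longlonglongrightarrow> 2 * (a' + b')" by (intro tendsto_intros lim)
  have l2: "(\<lambda>n. 2 * (a n powr q + b n powr q) powr (p - 1)) \<longlonglongrightarrow> 2 * (a' powr q + b' powr q) powr (p - 1)"
    using p q nn by (intro tendsto_mult tendsto_const tendsto_powr' tendsto_add lim disjI2 conjI always_eventually allI add_nonneg_nonneg) auto
  show ?thesis
    using cl LIMSEQ_le[OF l1 lim(3)] LIMSEQ_le[OF lim(3) l1] LIMSEQ_le[OF l2 lim(3)] LIMSEQ_le[OF lim(3) l2]
    unfolding clarkson_ineq_def q_def by blast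
qed

lemma powr_add_diff_le:
  fixes \<alpha> x k :: real
  assumes "0 \<le> \<alpha>" "0 \<le> x" "1 \<le> k"
  shows "(\<alpha> + x) powr k - \<alpha> powr k \<le> k * x * (\<alpha> + x) powr (k - 1)"
proof (cases "x = 0")
  case False
  then have x: "x > 0" using assms by simp
  have "\<exists>l z. \<alpha> < z \<and> z < \<alpha> + x \<and> ((\<lambda>z. z powr k) has_real_derivative l) (at z) \<and>
      (\<alpha> + x) powr k - \<alpha> powr k = (\<alpha> + x - \<alpha>) * l"
  proof (rule MVT)
    show "continuous_on {\<alpha>..\<alpha> + x} (\<lambda>z. z powr k)"
      using assms by (intro continuous_on_powr' continuous_intros) auto
    show "(\<lambda>z. z powr k) differentiable (at z)" if "\<alpha> < z" "z < \<alpha> + x" for z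
      using that assms has_real_derivative_powr[of z k] by (auto simp: real_differentiable_def)
  qed (use x in auto)
  then obtain l z where z: "\<alpha> < z" "z < \<alpha> + x" "((\<lambda>z. z powr k) has_real_derivative l) (at z)"
    "(\<alpha> + x) powr k - \<alpha> powr k = x * l" by auto
  have "l = k * z powr (k - 1)"
    using DERIV_unique[OF z(3) has_real_derivative_powr[of z k]] z(1) assms by auto
  also have "\<dots> \<le> k * (\<alpha> + x) powr (k - 1)"
    using z assms by (intro mult_left_mono powr_mono2) auto
  finally show ?thesis using z(4) x by (simp add: mult_left_mono mult.assoc mult.left_commute)
qed simp

text \<open>The upper Clarkson bound for f and t g, where the energy \<open>b\<close> of g enters as
  t^p b, exceeds the energy \<open>a\<close> of f by o(t): the excess is at most of order t^p for p
  < 2 and t^(p / (p - 1)) otherwise. This excludes a corner along the line f + t g.\<close>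

lemma clarkson_bound_smooth:
  fixes p a b r :: real
  assumes p: "1 < p" and a: "0 \<le> a" and b: "0 \<le> b" and r: "r = min 1 (1 / (p - 1))"
  shows "((\<lambda>t. ((a powr r + (t powr p * b) powr r) powr (1 / r) - a) / t) \<longlongrightarrow> 0) (at_right 0)"
proof -
  have small: "((\<lambda>t. c * t powr e) \<longlongrightarrow> 0) (at_right (0::real))" if "e > 0" for c e :: real
  proof -
    have "((\<lambda>t. c * t powr e) \<longlongrightarrow> c * 0 powr e) (at_right (0::real))"
      using that by (intro tendsto_mult tendsto_const tendsto_powr' disjI2 conjI tendsto_ident_at)
        (auto simp: eventually_at_filter)
    then show ?thesis by simp
  qed
  have pos: "\<forall>\<^sub>F t in at_right (0::real). 0 < t \<and> t < 1"
    by (intro eventually_conj eventually_at_right_less) (auto simp: eventually_at_right_field intro: exI[of _ 1])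
  show ?thesis
  proof (cases "p < 2")
    case True
    then have r1: "r = 1" using r p by (auto simp: min_def field_simps)
    have "((\<lambda>t. b * t powr (p - 1)) \<longlongrightarrow> 0) (at_right 0)" using p by (intro small) simp
    then show ?thesis
    proof (rule Lim_transform_eventually)
      show "\<forall>\<^sub>F t in at_right 0. b * t powr (p - 1) = ((a powr r + (t powr p * b) powr r) powr (1 / r) - a) / t"
        proof (rule eventually_mono[OF pos])
        fix t :: real assume t: "0 < t \<and> t < 1"
        then have "t powr (p - 1) = t powr p / t" by (simp add: powr_diff)
        then show "b * t powr (p - 1) = ((a powr r + (t powr p * b) powr r) powr (1 / r) - a) / t"
          using a b by (simp add: r1)
      qed
    qed
  next
    case False
    then have r1: "r = 1 / (p - 1)" using r p by (auto simp: min_def field_simps)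
    define e where "e = p * r"
    have e: "e > 1" using p by (simp add: e_def r1 field_simps)
    have k: "1 / r = p - 1" by (simp add: r1)
    have r0: "r > 0" using p r1 by simp
    have ar: "(a powr r) powr (p - 1) = a" using a p by (simp add: r1 powr_powr)
    have le: "((a powr r + (t powr p * b) powr r) powr (1 / r) - a) / t
        \<le> ((p - 1) * b powr r * (a powr r + b powr r) powr (p - 2)) * t powr (e - 1)" if t: "0 < t \<and> t < 1" for t
    proof -
      have tb: "(t powr p * b) powr r = t powr e * b powr r"
        using t b by (simp add: powr_mult powr_powr e_def)
      have t1: "t powr e \<le> 1" using t e by (simp add: powr_le1)
      \<comment> \<open>The mean value estimate, for the exponent \<open>p - 1 \<ge> 1\<close> and
        an increment of order t^e with \<open>e > 1\<close>.\<close>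
      have "(a powr r + t powr e * b powr r) powr (p - 1) - (a powr r) powr (p - 1)
          \<le> (p - 1) * (t powr e * b powr r) * (a powr r + t powr e * b powr r) powr (p - 1 - 1)"
        using False by (intro powr_add_diff_le) auto
      also have "\<dots> \<le> (p - 1) * (t powr e * b powr r) * (a powr r + b powr r) powr (p - 1 - 1)"
        using False t1 by (intro mult_left_mono powr_mono2 add_left_mono mult_left_le_one_le) auto
      finally have "((a powr r + (t powr p * b) powr r) powr (1 / r) - a) / t \<le>
          ((p - 1) * (t powr e * b powr r) * (a powr r + b powr r) powr (p - 2)) / t"
        using t unfolding tb k ar by (simp add: divide_right_mono)
      then show ?thesis using t by (simp add: powr_diff mult_ac)
    qed
    have ge: "0 \<le> ((a powr r + (t powr p * b) powr r) powr (1 / r) - a) / t" if t: "0 < t \<and> t < 1" for t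
    proof -
      have "(a powr r) powr (p - 1) \<le> (a powr r + (t powr p * b) powr r) powr (p - 1)"
        using p by (intro powr_mono2) auto
      then show ?thesis using t unfolding k ar by simp
    qed
    show ?thesis
    proof (rule tendsto_sandwich[OF _ _ tendsto_const small[of "e - 1" "(p - 1) * b powr r * (a powr r + b powr r) powr (p - 2)"]])
      show "\<forall>\<^sub>F t in at_right 0. 0 \<le> ((a powr r + (t powr p * b) powr r) powr (1 / r) - a) / t"
        by (rule eventually_mono[OF pos]) (rule ge)
      show "\<forall>\<^sub>F t in at_right 0. ((a powr r + (t powr p * b) powr r) powr (1 / r) - a) / t \<le>
          (p - 1) * b powr r * (a powr r + b powr r) powr (p - 2) * t powr (e - 1)"
        by (rule eventually_mono[OF pos]) (rule le)
    qed (use e in auto)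
  qed
qed

text \<open>
  On an interval subtract the chord: the difference vanishes at both end points, so by midpoint
  convexity its supremum is at most half of itself.
\<close>

lemma midpoint_convex_bounded_imp_convex_on:
  fixes \<phi> :: "real \<Rightarrow> real"
  assumes mid: "\<And>x y. \<phi> ((x + y) / 2) \<le> (\<phi> x + \<phi> y) / 2"
    and bdd: "\<And>a b. bdd_above (\<phi> ` {a..b})"
  shows "convex_on UNIV \<phi>"
proof -
  have main: "\<phi> ((1 - t) * a + t * b) \<le> (1 - t) * \<phi> a + t * \<phi> b" if t: "0 < t" "t < 1" and ab: "a < b" for t a b
  proof -
    define \<kappa> where "\<kappa> = (\<phi> b - \<phi> a) / (b - a)"
    have \<kappa>: "(b - a) * \<kappa> = \<phi> b - \<phi> a" using ab by (simp add: \<kappa>_def)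
    define l where "l x = \<phi> a + (x - a) * \<kappa>" for x
    define \<psi> where "\<psi> x = \<phi> x - l x" for x
    have la: "l ((x + y) / 2) = (l x + l y) / 2" for x y
      by (simp add: l_def field_simps)
    have p0: "\<psi> a = 0" "\<psi> b = 0" using \<kappa> by (auto simp: \<psi>_def l_def)
    have m2: "\<psi> ((x + y) / 2) \<le> (\<psi> x + \<psi> y) / 2" for x y
      using mid[of x y] unfolding \<psi>_def la by (simp add: field_simps)
    define S where "S = (SUP x\<in>{a..b}. \<psi> x)"
    obtain B where B: "\<And>x. x \<in> {a..b} \<Longrightarrow> \<phi> x \<le> B" using bdd[of a b] unfolding bdd_above_def by blast
    have "continuous_on {a..b} l" unfolding l_def by (intro continuous_intros)
    then have "bounded (l ` {a..b})" by (intro compact_imp_bounded compact_continuous_image) auto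
    then obtain B' where B': "\<And>x. x \<in> {a..b} \<Longrightarrow> \<bar>l x\<bar> \<le> B'"
      unfolding bounded_iff by (metis image_eqI real_norm_def)
    have bd: "bdd_above (\<psi> ` {a..b})"
      unfolding bdd_above_def
    proof (intro exI[of _ "B + B'"] ballI)
      fix y assume "y \<in> \<psi> ` {a..b}"
      then obtain x where "x \<in> {a..b}" "y = \<phi> x - l x" by (auto simp: \<psi>_def)
      then show "y \<le> B + B'" using B[of x] B'[of x] by (auto simp: abs_le_iff)
    qed
    have S: "\<psi> x \<le> S" if "x \<in> {a..b}" for x
      unfolding S_def using that bd by (intro cSUP_upper)
    have half: "\<psi> x \<le> S / 2" if x: "x \<in> {a..b}" for x
    proof (cases "x \<le> (a + b) / 2")
      case True
      \<comment> \<open>\<open>x\<close> is the midpoint of the nearer end point, where \<psi>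
        vanishes, and of its reflection, which is still in the interval.\<close>
      have "\<psi> x \<le> (\<psi> a + \<psi> (2 * x - a)) / 2" using m2[of a "2 * x - a"] by simp
      moreover have "\<psi> (2 * x - a) \<le> S" using True x by (intro S) (auto simp: field_simps)
      ultimately show ?thesis using p0 by simp
    next
      case False
      have "\<psi> x \<le> (\<psi> b + \<psi> (2 * x - b)) / 2" using m2[of b "2 * x - b"] by simp
      moreover have "\<psi> (2 * x - b) \<le> S" using False x by (intro S) (auto simp: field_simps)
      ultimately show ?thesis using p0 by simp
    qed
    have "S \<le> S / 2" unfolding S_def
      using half ab by (intro cSUP_least) (auto simp: S_def[symmetric])
    then have "S \<le> 0" by simp
    moreover have "(1 - t) * a + t * b \<in> {a..b}"
    proof -
      have "(1 - t) * a + t * b = a + t * (b - a)" by (simp add: algebra_simps)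
      moreover have "t * (b - a) \<ge> 0" "t * (b - a) \<le> 1 * (b - a)" using t ab by (auto intro!: mult_right_mono)
      ultimately show ?thesis by auto
    qed
    ultimately have "\<psi> ((1 - t) * a + t * b) \<le> 0" using S by force
    moreover have "l ((1 - t) * a + t * b) = (1 - t) * \<phi> a + t * \<phi> b"
    proof -
      have "(1 - t) * a + t * b - a = t * (b - a)" by (simp add: algebra_simps)
      then have "l ((1 - t) * a + t * b) = \<phi> a + t * ((b - a) * \<kappa>)" unfolding l_def by simp
      then show ?thesis unfolding \<kappa> by (simp add: algebra_simps)
    qed
    ultimately show ?thesis by (simp add: \<psi>_def)
  qed
  show ?thesis
  proof (rule convex_onI)
    fix t x y :: real assume t: "0 < t" "t < 1"
    show "\<phi> ((1 - t) *\<^sub>R x + t *\<^sub>R y) \<le> (1 - t) * \<phi> x + t * \<phi> y"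
    proof (cases x y rule: linorder_cases)
      case less then show ?thesis using main[OF t less] by simp
    next
      case equal then show ?thesis by (simp add: algebra_simps)
    next
      case greater then show ?thesis using main[of "1 - t" y x] t by (simp add: add.commute)
    qed
  qed simp
qed

text \<open>The points with parameters s and t have midpoint \<open>?a\<close> and half difference
  \<open>?b\<close>, so Clarkson gives midpoint convexity; local boundedness turns it into
  convexity.\<close>

lemma clarkson_convex_on_line:
  assumes p: "1 < p" and V: "linear_subspace V" and Q: "\<And>f. f \<in> V \<Longrightarrow> 0 \<le> Q f"
    and cl: "clarkson p V (\<lambda>f. Q f powr (1 / p))"
    and bdd: "\<And>a b. bdd_above ((\<lambda>t. Q (\<lambda>x. u x + t * v x)) ` {a..b})"
    and uv: "u \<in> V" "v \<in> V"
  shows "convex_on UNIV (\<lambda>t. Q (\<lambda>x. u x + t * v x))"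
proof (rule midpoint_convex_bounded_imp_convex_on[OF _ bdd])
  fix s t :: real
  let ?a = "\<lambda>x. u x + (s + t) / 2 * v x" and ?b = "\<lambda>x. (s - t) / 2 * v x"
  have ab: "?a \<in> V" "?b \<in> V" by (intro linear_subspaceD[OF V] uv)+
  have e1: "(\<lambda>x. ?a x + ?b x) = (\<lambda>x. u x + s * v x)" and e2: "(\<lambda>x. ?a x - ?b x) = (\<lambda>x. u x + t * v x)"
    by (auto simp: fun_eq_iff field_simps)
  have "2 * Q ?a \<le> Q (\<lambda>x. ?a x + ?b x) + Q (\<lambda>x. ?a x - ?b x)"
    by (rule clarkson_ineq_midpoint[OF p clarksonD[OF p V Q cl ab] Q[OF ab(1)] Q[OF ab(2)]])
  then show "Q ?a \<le> (Q (\<lambda>x. u x + s * v x) + Q (\<lambda>x. u x + t * v x)) / 2"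
    unfolding e1 e2 by simp
qed

text \<open>For a homogeneous functional the triangle inequality says that the unit ball is convex:
  after normalisation u + v is a multiple of a convex combination of two elements with
  \<open>Q \<le> 1\<close>, and \<open>Q\<close> is convex on the segment between them.\<close>

lemma clarkson_imp_seminorm_on:
  assumes p: "1 < p" and V: "linear_subspace V" and Q: "\<And>f. f \<in> V \<Longrightarrow> 0 \<le> Q f"
    and cl: "clarkson p V (\<lambda>f. Q f powr (1 / p))"
    and hom: "\<And>f c. f \<in> V \<Longrightarrow> Q (\<lambda>x. c * f x) = \<bar>c\<bar> powr p * Q f"
    and bdd: "\<And>u v a b. u \<in> V \<Longrightarrow> v \<in> V \<Longrightarrow> bdd_above ((\<lambda>t. Q (\<lambda>x. u x + t * v x)) ` {a..b})"
  shows "seminorm_on V (\<lambda>f. Q f powr (1 / p))"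
  unfolding seminorm_on_def
proof (intro conjI ballI allI)
  fix f c assume f: "f \<in> V"
  show "Q (\<lambda>x. c * f x) powr (1 / p) = \<bar>c\<bar> * Q f powr (1 / p)"
    using hom[OF f, of c] Q[OF f] p by (simp add: powr_mult powr_powr)
next
  fix u v assume uv: "u \<in> V" "v \<in> V"
  have "Q (\<lambda>x. u x + v x) powr (1 / p) \<le> (Q u powr (1 / p) + Q v powr (1 / p)) + \<eta>" if \<eta>: "\<eta> > 0" for \<eta>
  proof -
    \<comment> \<open>The summand \<open>\<eta> / 2\<close> keeps the normalising factors positive
      when \<open>Q u\<close> or \<open>Q v\<close> vanishes.\<close>
    define \<alpha> where "\<alpha> = Q u powr (1 / p) + \<eta> / 2"
    define \<beta> where "\<beta> = Q v powr (1 / p) + \<eta> / 2"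
    have ab: "\<alpha> > 0" "\<beta> > 0" using \<eta> by (auto simp: \<alpha>_def \<beta>_def add_nonneg_pos)
    let ?u = "\<lambda>x. (1 / \<alpha>) * u x" and ?v = "\<lambda>x. (1 / \<beta>) * v x"
    have mem: "?u \<in> V" "?v \<in> V" "(\<lambda>x. ?v x - ?u x) \<in> V" by (intro linear_subspaceD[OF V] uv)+
    have one: "Q (\<lambda>x. (1 / c) * w x) \<le> 1" if w: "w \<in> V" and c: "c > 0" "Q w powr (1 / p) \<le> c" for w c
    proof -
      have "(Q w powr (1 / p)) powr p \<le> c powr p" using c p by (intro powr_mono2) auto
      then have "Q w \<le> c powr p" using Q[OF w] p by (simp add: powr_powr)
      moreover have "\<bar>1 / c\<bar> powr p = 1 / c powr p" using c by (simp add: powr_divide)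
      ultimately show ?thesis using hom[OF w, of "1 / c"] c by simp
    qed
    have q1: "Q ?u \<le> 1" "Q ?v \<le> 1"
      by (rule one[OF uv(1) ab(1)], use \<eta> in \<open>simp add: \<alpha>_def\<close>)
        (rule one[OF uv(2) ab(2)], use \<eta> in \<open>simp add: \<beta>_def\<close>)
    define t where "t = \<beta> / (\<alpha> + \<beta>)"
    have t: "0 < t" "t < 1" using ab by (auto simp: t_def)
    have "convex_on UNIV (\<lambda>t. Q (\<lambda>x. ?u x + t * (?v x - ?u x)))"
      by (rule clarkson_convex_on_line[OF p V Q cl bdd[OF mem(1,3)] mem(1,3)])
    from convex_onD[OF this, of t 0 1] t
    have "Q (\<lambda>x. ?u x + t * (?v x - ?u x)) \<le> (1 - t) * Q ?u + t * Q ?v" by simp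
    also have "\<dots> \<le> (1 - t) * 1 + t * 1" using t q1 by (intro add_mono mult_left_mono) auto
    finally have le1: "Q (\<lambda>x. ?u x + t * (?v x - ?u x)) \<le> 1" by simp
    have e: "(\<lambda>x. u x + v x) = (\<lambda>x. (\<alpha> + \<beta>) * (?u x + t * (?v x - ?u x)))"
    proof
      fix x
      have "(\<alpha> + \<beta>) * (y + t * (z - y)) = \<alpha> * y + \<beta> * z" for y z
      proof -
        have "(\<alpha> + \<beta>) * t = \<beta>" using ab by (simp add: t_def)
        then have "((\<alpha> + \<beta>) * t) * (z - y) = \<beta> * (z - y)" by simp
        then show ?thesis by (simp add: algebra_simps)
      qed
      then show "u x + v x = (\<alpha> + \<beta>) * (?u x + t * (?v x - ?u x))" using ab by simp
    qed
    have memt: "(\<lambda>x. ?u x + t * (?v x - ?u x)) \<in> V"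
      using linear_subspaceD(2)[OF V mem(1) linear_subspaceD(3)[OF V mem(3)]] .
    have "Q (\<lambda>x. u x + v x) = \<bar>\<alpha> + \<beta>\<bar> powr p * Q (\<lambda>x. ?u x + t * (?v x - ?u x))"
      unfolding e by (rule hom[OF memt])
    also have "\<dots> \<le> \<bar>\<alpha> + \<beta>\<bar> powr p * 1" using le1 by (intro mult_left_mono) auto
    finally have "Q (\<lambda>x. u x + v x) powr (1 / p) \<le> ((\<alpha> + \<beta>) powr p) powr (1 / p)"
      using ab p Q linear_subspaceD(2)[OF V uv] by (intro powr_mono2) auto
    also have "\<dots> = \<alpha> + \<beta>" using ab p by (simp add: powr_powr)
    finally show ?thesis by (simp add: \<alpha>_def \<beta>_def)
  qed
  then show "Q (\<lambda>x. u x + v x) powr (1 / p) \<le> Q u powr (1 / p) + Q v powr (1 / p)"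
    by (rule field_le_epsilon)
qed auto

section \<open>The lattice of compactly supported functions of finite energy\<close>

lemma C_c_iff:
  fixes f :: "'a::metric_space \<Rightarrow> real"
  shows "f \<in> C_c \<longleftrightarrow> continuous_on UNIV f \<and> (\<exists>K. compact K \<and> {x. f x \<noteq> 0} \<subseteq> K)"
proof -
  have "compact (supp f)" if "compact K" "{x. f x \<noteq> 0} \<subseteq> K" for K
  proof -
    have "supp f \<subseteq> K" unfolding supp_def
      using that closure_minimal compact_imp_closed by blast
    then have "supp f = K \<inter> supp f" by auto
    then show ?thesis using that(1) compact_Int_closed[of K "supp f"] by (simp add: supp_def)
  qed
  moreover have "{x. f x \<noteq> 0} \<subseteq> supp f" unfolding supp_def by (rule closure_subset)
  ultimately show ?thesis unfolding C_c_def by blast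
qed

lemma C_cI: "continuous_on UNIV f \<Longrightarrow> compact K \<Longrightarrow> (\<And>x. f x \<noteq> 0 \<Longrightarrow> x \<in> K) \<Longrightarrow> f \<in> C_c"
  for f :: "'a::metric_space \<Rightarrow> real"
  unfolding C_c_iff by blast

lemma C_cE:
  fixes f :: "'a::metric_space \<Rightarrow> real"
  assumes "f \<in> C_c"
  obtains K where "continuous_on UNIV f" "compact K" "\<And>x. x \<notin> K \<Longrightarrow> f x = 0"
  using assms unfolding C_c_iff by blast

lemma C_c_bounded:
  fixes f :: "'a::metric_space \<Rightarrow> real"
  assumes "f \<in> C_c"
  obtains M where "M > 0" "\<And>x. \<bar>f x\<bar> \<le> M"
proof -
  obtain K where K: "continuous_on UNIV f" "compact K" "\<And>x. x \<notin> K \<Longrightarrow> f x = 0"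
    using assms by (auto elim: C_cE)
  have "bounded (f ` K)"
    using K by (intro compact_imp_bounded compact_continuous_image continuous_on_subset[OF K(1)]) auto
  then obtain B where B: "\<And>x. x \<in> K \<Longrightarrow> \<bar>f x\<bar> \<le> B" unfolding bounded_iff by (metis image_eqI real_norm_def)
  show ?thesis
  proof (rule that[of "\<bar>B\<bar> + 1"])
    fix x show "\<bar>f x\<bar> \<le> \<bar>B\<bar> + 1"
    proof (cases "x \<in> K")
      case True then show ?thesis using B[OF True] by linarith
    next
      case False then show ?thesis using K(3)[of x] by simp
    qed
  qed simp
qed

lemma C_c_compact_superlevel:
  fixes f :: "'a::metric_space \<Rightarrow> real"
  assumes "f \<in> C_c" "\<epsilon> > 0"
  shows "compact {x. \<epsilon> \<le> f x}"
proof -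
  obtain K where K: "continuous_on UNIV f" "compact K" "\<And>x. x \<notin> K \<Longrightarrow> f x = 0"
    using assms(1) by (auto elim: C_cE)
  have "closed {x. \<epsilon> \<le> f x}" using K(1) by (intro closed_Collect_le continuous_intros)
  then have "compact (K \<inter> {x. \<epsilon> \<le> f x})" using K(2) by (rule compact_Int_closed[rotated])
  also have "K \<inter> {x. \<epsilon> \<le> f x} = {x. \<epsilon> \<le> f x}" using K(3) assms(2) by force
  finally show ?thesis .
qed

locale p_energy_space =
  fixes p :: real
    and m :: "'a::metric_space measure"
    and \<E> :: "('a \<Rightarrow> real) \<Rightarrow> real"
    and \<F> :: "('a \<Rightarrow> real) set"
  assumes p: "1 < p"
    and locally_compact: "locally_compact_space (euclidean :: 'a topology)"
    and radon: "radon_measure m"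
    and form: "p_energy_form p m \<E> \<F>"
    and F_Lp: "\<F> \<subseteq> Lp_space p m"
    and banach: "banach_mod_AE m \<F> (energy_norm p m \<E>)"
    and contraction: "\<forall>f\<in>\<F> \<inter> C_c. (\<lambda>x. max (min (f x) 1) 0) \<in> \<F> \<inter> C_c \<and>
                \<E> (\<lambda>x. max (min (f x) 1) 0) \<le> \<E> f"
    and local: "\<forall>f\<in>\<F> \<inter> C_c. \<forall>g\<in>\<F> \<inter> C_c.
                (\<exists>a::real. supp f \<inter> supp (\<lambda>x. g x + a) = {}) \<longrightarrow>
                \<E> (\<lambda>x. f x + g x) = \<E> f + \<E> g"
    and dense_F: "dense_wrt (energy_norm p m \<E>) (\<F> \<inter> C_c) \<F>"
    and dense_C_c: "dense_wrt sup_norm (\<F> \<inter> C_c) C_c"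
    and clarkson: "clarkson p \<F> (\<lambda>f. \<E> f powr (1 / p))"
begin

abbreviation \<C> :: "('a \<Rightarrow> real) set" where "\<C> \<equiv> \<F> \<inter> C_c"

definition N :: "('a \<Rightarrow> real) \<Rightarrow> real" where "N f = \<E> f powr (1 / p)"

section \<open>The energy seminorm on the domain\<close>

lemma F_subspace: "linear_subspace \<F>"
  using form by (simp add: p_energy_form_def L0_subspace_def)

lemmas F_closed = linear_subspaceD[OF F_subspace]

lemma E_nonneg: "f \<in> \<F> \<Longrightarrow> 0 \<le> \<E> f"
  using form by (simp add: p_energy_form_def)

lemma N_nonneg: "0 \<le> N f"
  by (simp add: N_def)

lemma N_seminorm: "seminorm_on \<F> N"
  using form by (simp add: p_energy_form_def N_def[abs_def])

lemma N_add: "f \<in> \<F> \<Longrightarrow> g \<in> \<F> \<Longrightarrow> N (\<lambda>x. f x + g x) \<le> N f + N g"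
  using N_seminorm by (simp add: seminorm_on_def)

lemma N_scale: "f \<in> \<F> \<Longrightarrow> N (\<lambda>x. c * f x) = \<bar>c\<bar> * N f"
  using N_seminorm by (simp add: seminorm_on_def)

lemma N_minus: "f \<in> \<F> \<Longrightarrow> N (\<lambda>x. - f x) = N f"
  using N_scale[of f "-1"] by simp

lemma N_diff: "f \<in> \<F> \<Longrightarrow> g \<in> \<F> \<Longrightarrow> N (\<lambda>x. f x - g x) \<le> N f + N g"
  using N_add[of f "\<lambda>x. - g x"] by (simp add: N_minus F_closed)

lemma N_triangle_rev: assumes "f \<in> \<F>" "g \<in> \<F>" shows "\<bar>N f - N g\<bar> \<le> N (\<lambda>x. f x - g x)"
proof -
  have "N f \<le> N g + N (\<lambda>x. f x - g x)" using N_add[of g "\<lambda>x. f x - g x"] assms by (simp add: F_closed)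
  moreover have "N g \<le> N f + N (\<lambda>x. f x - g x)" using N_diff[of f "\<lambda>x. f x - g x"] assms by (simp add: F_closed)
  ultimately show ?thesis by linarith
qed

lemma E_eq_N: "f \<in> \<F> \<Longrightarrow> \<E> f = N f powr p"
  using p E_nonneg[of f] by (simp add: N_def powr_powr)

lemma E_scale: "f \<in> \<F> \<Longrightarrow> \<E> (\<lambda>x. c * f x) = \<bar>c\<bar> powr p * \<E> f"
  by (simp add: E_eq_N F_closed N_scale powr_mult N_nonneg)

lemma E_minus: "f \<in> \<F> \<Longrightarrow> \<E> (\<lambda>x. - f x) = \<E> f"
  by (simp add: E_eq_N F_closed N_minus)

lemma E_zero: "\<E> (\<lambda>x. 0) = 0"
  using E_scale[of "\<lambda>x. 0" 0] p by (simp add: F_closed)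

lemma E_clarkson:
  "u \<in> \<F> \<Longrightarrow> v \<in> \<F> \<Longrightarrow> clarkson_ineq p (\<E> u) (\<E> v) (\<E> (\<lambda>x. u x + v x) + \<E> (\<lambda>x. u x - v x))"
  by (rule clarksonD[OF p F_subspace E_nonneg clarkson])

lemma N_tendsto_iff: 
  assumes "\<And>n. f n \<in> \<F>" shows "((\<lambda>n. N (f n)) \<longlongrightarrow> 0) G \<longleftrightarrow> ((\<lambda>n. \<E> (f n)) \<longlongrightarrow> 0) G"
proof
  assume "((\<lambda>n. N (f n)) \<longlongrightarrow> 0) G"
  then have "((\<lambda>n. N (f n) powr p) \<longlongrightarrow> 0 powr p) G"
    using p by (intro tendsto_powr' tendsto_const disjI2 conjI) (auto simp: N_nonneg)
  then show "((\<lambda>n. \<E> (f n)) \<longlongrightarrow> 0) G" using assms by (simp add: E_eq_N)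
next
  assume "((\<lambda>n. \<E> (f n)) \<longlongrightarrow> 0) G"
  then have "((\<lambda>n. \<E> (f n) powr (1 / p)) \<longlongrightarrow> 0 powr (1 / p)) G"
    using p assms by (intro tendsto_powr' tendsto_const disjI2 conjI) (auto simp: E_nonneg)
  then show "((\<lambda>n. N (f n)) \<longlongrightarrow> 0) G" by (simp add: N_def)
qed

lemma E_tendsto:
  assumes "\<And>n. f n \<in> \<F>" "g \<in> \<F>" "((\<lambda>n. \<E> (\<lambda>x. f n x - g x)) \<longlongrightarrow> 0) G"
  shows "((\<lambda>n. \<E> (f n)) \<longlongrightarrow> \<E> g) G"
proof -
  have d: "(\<lambda>x. f n x - g x) \<in> \<F>" for n using assms by (simp add: F_closed)
  have "((\<lambda>n. N (\<lambda>x. f n x - g x)) \<longlongrightarrow> 0) G" using N_tendsto_iff[of "\<lambda>n x. f n x - g x"] d assms(3) by simp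
  then have "((\<lambda>n. N (f n) - N g) \<longlongrightarrow> 0) G"
    by (rule Lim_null_comparison[rotated]) (use N_triangle_rev assms in auto)
  then have "((\<lambda>n. N (f n)) \<longlongrightarrow> N g) G" by (simp add: LIM_zero_iff)
  then have "((\<lambda>n. N (f n) powr p) \<longlongrightarrow> N g powr p) G"
    using p by (intro tendsto_powr' tendsto_const disjI2 conjI) (auto simp: N_nonneg)
  then show ?thesis using assms by (simp add: E_eq_N)
qed

section \<open>The core as a vector lattice\<close>

lemma C_zero: "(\<lambda>x. 0) \<in> \<C>"
  using C_cI[of "\<lambda>x. 0" "{}"] by (auto simp: F_closed)

lemma C_add: assumes "f \<in> \<C>" "g \<in> \<C>" shows "(\<lambda>x. f x + g x) \<in> \<C>"
proof -
  obtain K where K: "continuous_on UNIV f" "compact K" "\<And>x. x \<notin> K \<Longrightarrow> f x = 0"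
    using assms(1) by (auto elim: C_cE)
  obtain L where L: "continuous_on UNIV g" "compact L" "\<And>x. x \<notin> L \<Longrightarrow> g x = 0"
    using assms(2) by (auto elim: C_cE)
  have "(\<lambda>x. f x + g x) \<in> C_c"
    by (rule C_cI[of _ "K \<union> L"]) (use K L in \<open>auto intro!: continuous_intros\<close>, force)
  then show ?thesis using assms by (simp add: F_closed)
qed

lemma C_scale: assumes "f \<in> \<C>" shows "(\<lambda>x. c * f x) \<in> \<C>"
proof -
  obtain K where K: "continuous_on UNIV f" "compact K" "\<And>x. x \<notin> K \<Longrightarrow> f x = 0"
    using assms(1) by (auto elim: C_cE)
  have "(\<lambda>x. c * f x) \<in> C_c"
    by (rule C_cI[of _ K]) (use K in \<open>auto intro!: continuous_intros\<close>)
  then show ?thesis using assms by (simp add: F_closed)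
qed

lemma C_minus: "f \<in> \<C> \<Longrightarrow> (\<lambda>x. - f x) \<in> \<C>"
  using C_scale[of f "-1"] by simp

lemma C_diff: "f \<in> \<C> \<Longrightarrow> g \<in> \<C> \<Longrightarrow> (\<lambda>x. f x - g x) \<in> \<C>"
  using C_add[of f "\<lambda>x. - g x"] C_minus[of g] by simp

text \<open>(E2) cuts at height \<open>1\<close>; homogeneity moves the cut to any height
  \<open>a > 0\<close>.\<close>

lemma C_trunc: assumes f: "f \<in> \<C>" and a: "0 \<le> a"
  shows "(\<lambda>x. max (min (f x) a) 0) \<in> \<C>" "\<E> (\<lambda>x. max (min (f x) a) 0) \<le> \<E> f"
proof -
  have "(\<lambda>x. max (min (f x) a) 0) \<in> \<C> \<and> \<E> (\<lambda>x. max (min (f x) a) 0) \<le> \<E> f"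
  proof (cases "a = 0")
    case True
    then have "(\<lambda>x. max (min (f x) a) 0) = (\<lambda>x. 0)" by auto
    then show ?thesis using C_zero E_zero E_nonneg f by simp
  next
    case False
    let ?g = "\<lambda>x. (1 / a) * f x"
    let ?h = "\<lambda>x. max (min (?g x) 1) 0"
    have e: "(\<lambda>x. max (min (f x) a) 0) = (\<lambda>x. a * ?h x)"
      using a False by (auto simp: fun_eq_iff max_def min_def field_simps)
    have g: "?g \<in> \<C>" using f by (rule C_scale)
    have h: "?h \<in> \<C>" "\<E> ?h \<le> \<E> ?g" using contraction[rule_format, OF g] by auto
    have "\<E> (\<lambda>x. a * ?h x) = \<bar>a\<bar> powr p * \<E> ?h" using h by (intro E_scale) simp
    also have "\<dots> \<le> \<bar>a\<bar> powr p * \<E> ?g" using h by (intro mult_left_mono) auto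
    also have "\<dots> = \<E> (\<lambda>x. a * ?g x)" using g by (intro E_scale[symmetric]) simp
    also have "(\<lambda>x. a * ?g x) = f" using False by auto
    finally show ?thesis unfolding e using C_scale[OF h(1), of a] by simp
  qed
  then show "(\<lambda>x. max (min (f x) a) 0) \<in> \<C>" "\<E> (\<lambda>x. max (min (f x) a) 0) \<le> \<E> f" by auto
qed

lemma C_pos: assumes f: "f \<in> \<C>"
  shows "(\<lambda>x. max (f x) 0) \<in> \<C>" "\<E> (\<lambda>x. max (f x) 0) \<le> \<E> f"
proof -
  obtain M where M: "M > 0" "\<And>x. \<bar>f x\<bar> \<le> M" using C_c_bounded f by blast
  have "(\<lambda>x. max (f x) 0) = (\<lambda>x. max (min (f x) M) 0)"
    using M(2) by (auto simp: fun_eq_iff min_def abs_le_iff)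
  then show "(\<lambda>x. max (f x) 0) \<in> \<C>" "\<E> (\<lambda>x. max (f x) 0) \<le> \<E> f" using C_trunc[OF f, of M] M(1) by auto
qed

lemma C_max: assumes "f \<in> \<C>" "g \<in> \<C>" shows "(\<lambda>x. max (f x) (g x)) \<in> \<C>"
proof -
  have "(\<lambda>x. max (f x) (g x)) = (\<lambda>x. g x + max (f x - g x) 0)" by (auto simp: fun_eq_iff max_def)
  then show ?thesis using C_add[OF assms(2) C_pos(1)[OF C_diff[OF assms]]] by simp
qed

lemma C_min: assumes "f \<in> \<C>" "g \<in> \<C>" shows "(\<lambda>x. min (f x) (g x)) \<in> \<C>"
proof -
  have "(\<lambda>x. min (f x) (g x)) = (\<lambda>x. f x - max (f x - g x) 0)" by (auto simp: fun_eq_iff max_def min_def)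
  then show ?thesis using C_diff[OF assms(1) C_pos(1)[OF C_diff[OF assms]]] by simp
qed

lemma C_abs: assumes "f \<in> \<C>" shows "(\<lambda>x. \<bar>f x\<bar>) \<in> \<C>"
proof -
  have "(\<lambda>x. \<bar>f x\<bar>) = (\<lambda>x. max (f x) (- f x))" by (auto simp: fun_eq_iff max_def)
  then show ?thesis using C_max[OF assms C_minus[OF assms]] by simp
qed

text \<open>For \<open>a \<ge> 0\<close> only the positive part is cut, so the support stays
  compact; the negative part is put back afterwards.\<close>

lemma C_min_const: assumes "f \<in> \<C>" "0 \<le> a" shows "(\<lambda>x. min (f x) a) \<in> \<C>"
proof -
  have "(\<lambda>x. min (f x) a) = (\<lambda>x. max (min (f x) a) 0 - max (- f x) 0)"
    using assms(2) by (auto simp: fun_eq_iff max_def min_def)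
  then show ?thesis using C_diff[OF C_trunc(1)[OF assms] C_pos(1)[OF C_minus[OF assms(1)]]] by simp
qed

lemma C_pos_part_diff: assumes "f \<in> \<C>" "0 \<le> a" shows "(\<lambda>x. max (f x - a) 0) \<in> \<C>"
proof -
  have "(\<lambda>x. max (f x - a) 0) = (\<lambda>x. f x - min (f x) a)" by (auto simp: fun_eq_iff max_def min_def)
  then show ?thesis using C_diff[OF assms(1) C_min_const[OF assms]] by simp
qed

lemmas C_closed = C_zero C_add C_diff C_scale C_minus C_max C_min C_abs C_min_const C_pos_part_diff C_pos(1)

lemma C_continuous: "f \<in> \<C> \<Longrightarrow> continuous_on UNIV f"
  by (auto simp: C_c_def)

section \<open>Completeness, lower semicontinuity and strong convergence\<close>

lemma energy_norm_eq: "energy_norm p m \<E> f = (\<E> f + (\<integral>x. \<bar>f x\<bar> powr p \<partial>m)) powr (1 / p)"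
proof -
  have "Lp_norm p m f powr p = (\<integral>x. \<bar>f x\<bar> powr p \<partial>m)"
    using p by (simp add: Lp_norm_def powr_powr)
  then show ?thesis by (simp add: energy_norm_def)
qed

lemma energy_norm_powr:
  assumes "f \<in> \<F>" shows "energy_norm p m \<E> f powr p = \<E> f + (\<integral>x. \<bar>f x\<bar> powr p \<partial>m)"
  using p E_nonneg[OF assms] by (simp add: energy_norm_eq powr_powr)

lemma energy_norm_tendsto_iff:
  assumes "\<And>n. f n \<in> \<F>"
  shows "(\<lambda>n. energy_norm p m \<E> (f n)) \<longlonglongrightarrow> 0 \<longleftrightarrow>
    (\<lambda>n. \<E> (f n)) \<longlonglongrightarrow> 0 \<and> (\<lambda>n. \<integral>x. \<bar>f n x\<bar> powr p \<partial>m) \<longlonglongrightarrow> 0"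
proof
  assume "(\<lambda>n. energy_norm p m \<E> (f n)) \<longlonglongrightarrow> 0"
  then have "(\<lambda>n. energy_norm p m \<E> (f n) powr p) \<longlonglongrightarrow> 0 powr p"
    using p by (intro tendsto_powr' tendsto_const disjI2 conjI) (auto simp: energy_norm_def)
  then have l: "(\<lambda>n. \<E> (f n) + (\<integral>x. \<bar>f n x\<bar> powr p \<partial>m)) \<longlonglongrightarrow> 0" using assms p by (simp add: energy_norm_powr)
  have "(\<lambda>n. \<E> (f n)) \<longlonglongrightarrow> 0"
    by (rule tendsto_sandwich[OF _ _ tendsto_const l]) (use assms E_nonneg in auto)
  moreover have "(\<lambda>n. \<integral>x. \<bar>f n x\<bar> powr p \<partial>m) \<longlonglongrightarrow> 0"
    by (rule tendsto_sandwich[OF _ _ tendsto_const l]) (use assms E_nonneg in auto)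
  ultimately show "(\<lambda>n. \<E> (f n)) \<longlonglongrightarrow> 0 \<and> (\<lambda>n. \<integral>x. \<bar>f n x\<bar> powr p \<partial>m) \<longlonglongrightarrow> 0" by simp
next
  assume a: "(\<lambda>n. \<E> (f n)) \<longlonglongrightarrow> 0 \<and> (\<lambda>n. \<integral>x. \<bar>f n x\<bar> powr p \<partial>m) \<longlonglongrightarrow> 0"
  have "(\<lambda>n. (\<E> (f n) + (\<integral>x. \<bar>f n x\<bar> powr p \<partial>m)) powr (1 / p)) \<longlonglongrightarrow> (0 + 0) powr (1 / p)"
    using a p assms E_nonneg by (intro tendsto_powr' tendsto_add tendsto_const disjI2 conjI) auto
  then show "(\<lambda>n. energy_norm p m \<E> (f n)) \<longlonglongrightarrow> 0" by (simp add: energy_norm_eq)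
qed

lemma sets_m: "sets m = sets borel"
  using radon by (simp add: radon_measure_def)

lemma Lp_integrable: "f \<in> \<F> \<Longrightarrow> integrable m (\<lambda>x. \<bar>f x\<bar> powr p)"
  using F_Lp by (auto simp: Lp_space_def)

text \<open>Compact sets have finite mass, so uniformly small functions with a common compact
  support are small in L^p.\<close>

lemma integral_powr_le_on_compact:
  assumes f: "continuous_on UNIV f" and K: "compact K" "\<And>x. x \<notin> K \<Longrightarrow> f x = 0" and b: "\<And>x. \<bar>f x\<bar> \<le> b"
  shows "integrable m (\<lambda>x. \<bar>f x\<bar> powr p)" "(\<integral>x. \<bar>f x\<bar> powr p \<partial>m) \<le> b powr p * measure m K"
proof -
  have Kb: "K \<in> sets m" using K by (simp add: sets_m compact_imp_closed)
  have Kf: "emeasure m K < \<infinity>" using radon K by (simp add: radon_measure_def)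
  have fm: "f \<in> borel_measurable m" using borel_measurable_continuous_onI[OF f] sets_m by (simp cong: measurable_cong_sets)
  have ind: "integrable m (\<lambda>x. b powr p * indicator K x :: real)"
    using Kb Kf by (intro integrable_mult_right integrable_real_indicator) auto
  have le: "\<bar>f x\<bar> powr p \<le> b powr p * indicator K x" for x
  proof (cases "x \<in> K")
    case True then show ?thesis using b[of x] p by (simp add: powr_mono2)
  next
    case False then show ?thesis using K(2)[of x] p by simp
  qed
  show i: "integrable m (\<lambda>x. \<bar>f x\<bar> powr p)"
    by (rule Bochner_Integration.integrable_bound[OF ind]) (use fm le in \<open>auto simp: abs_of_nonneg order_trans[OF _ abs_ge_self]\<close>)
  have "(\<integral>x. \<bar>f x\<bar> powr p \<partial>m) \<le> (\<integral>x. b powr p * indicator K x \<partial>m)"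
    by (rule integral_mono[OF i ind le])
  also have "\<dots> = b powr p * measure m K" using Kb Kf by simp
  finally show "(\<integral>x. \<bar>f x\<bar> powr p \<partial>m) \<le> b powr p * measure m K" .
qed

text \<open>
  Among the functions close to \<open>u\<close>, almost minimisers of the energy form a Cauchy sequence by
  uniform convexity, since midpoints stay close to \<open>u\<close>.
\<close>

proposition lower_semicontinuity:
  assumes u: "continuous_on UNIV u" and K: "compact K" "\<And>x. x \<notin> K \<Longrightarrow> u x = 0"
    and approx: "\<And>\<epsilon>. \<epsilon> > 0 \<Longrightarrow> \<exists>v\<in>\<C>. (\<forall>x. \<bar>v x - u x\<bar> \<le> \<epsilon>) \<and> (\<forall>x. x \<notin> K \<longrightarrow> v x = 0) \<and> \<E> v \<le> B"
  shows "u \<in> \<C>" "\<E> u \<le> B"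
proof -
  define r where "r n = 1 / real (Suc n)" for n
  have r_eq: "r = (\<lambda>n. inverse (real (Suc n)))" by (simp add: r_def fun_eq_iff inverse_eq_divide)
  have r: "r n > 0" "r \<longlonglongrightarrow> 0" "k \<le> n \<Longrightarrow> r n \<le> r k" for n k
    using LIMSEQ_inverse_real_of_nat unfolding r_eq[symmetric] by (auto simp: r_def frac_le)
  \<comment> \<open>Competitors: core functions within \<open>r n\<close> of \<open>u\<close> that
    vanish off \<open>K\<close>. Their infimal energies \<open>e n\<close> increase and stay below
    \<open>B\<close>.\<close>
  define D where "D n = {v \<in> \<C>. (\<forall>x. \<bar>v x - u x\<bar> \<le> r n) \<and> (\<forall>x. x \<notin> K \<longrightarrow> v x = 0)}" for n
  define e where "e n = Inf (\<E> ` D n)" for n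
  have bdd: "bdd_below (\<E> ` D n)" for n
    by (rule bdd_belowI[of _ 0]) (auto simp: D_def E_nonneg)
  have ex: "\<exists>v\<in>D n. \<E> v \<le> B" for n using approx[OF r(1)[of n]] unfolding D_def by blast
  have eB: "e n \<le> B" for n using ex[of n] bdd[of n] unfolding e_def by (meson cINF_lower2)
  have D_ne: "D n \<noteq> {}" for n using ex[of n] by blast
  have e0: "0 \<le> e n" for n unfolding e_def using D_ne by (rule cINF_greatest) (auto simp: D_def E_nonneg)
  have Dmono: "D n \<subseteq> D k" if "k \<le> n" for k n using r(3)[OF that] unfolding D_def by (auto intro: order_trans)
  have "incseq e" unfolding e_def
  proof (intro monoI cINF_superset_mono bdd Dmono)
  qed (use D_ne in auto)
  then obtain A where A: "e \<longlonglongrightarrow> A" "\<And>n. e n \<le> A"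
    using incseq_convergent[of e] eB by blast
  have AB: "A \<le> B" using LIMSEQ_le_const2[OF A(1)] eB by blast
  have A0: "0 \<le> A" using A(2)[of 0] e0[of 0] by simp
  have "\<exists>v\<in>D n. \<E> v < e n + r n" for n
    using cInf_lessD[of "\<E> ` D n" "e n + r n"] ex[of n] r(1)[of n] by (auto simp: e_def)
  then obtain v where v: "\<And>n. v n \<in> D n" "\<And>n. \<E> (v n) < e n + r n" by metis
  have vC: "v n \<in> \<C>" for n using v(1)[of n] by (simp add: D_def)
  then have vF: "v n \<in> \<F>" for n by simp
  \<comment> \<open>Closeness to \<open>u\<close> is a convex condition, so midpoints are again
    competitors and cannot fall below the infimum.\<close>
  have mid: "e k \<le> \<E> (\<lambda>x. (v i x + v j x) / 2)" if "k \<le> i" "k \<le> j" for i j k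
  proof -
    have vi: "v i \<in> D k" "v j \<in> D k" using v(1) Dmono that by blast+
    have "(\<lambda>x. (1/2) * (v i x + v j x)) \<in> \<C>" by (intro C_scale C_add vC)
    moreover have "\<bar>(v i x + v j x) / 2 - u x\<bar> \<le> r k" for x
    proof -
      have "\<bar>v i x - u x\<bar> \<le> r k" "\<bar>v j x - u x\<bar> \<le> r k" using vi by (auto simp: D_def)
      then show ?thesis unfolding abs_le_iff by (auto simp: field_simps)
    qed
    ultimately have "(\<lambda>x. (v i x + v j x) / 2) \<in> D k" using vi by (auto simp: D_def)
    then show ?thesis unfolding e_def using bdd by (intro cINF_lower)
  qed
  have cauchyE: "\<exists>k. \<forall>i\<ge>k. \<forall>j\<ge>k. \<E> (\<lambda>x. v i x - v j x) < \<eta>" if \<eta>: "\<eta> > 0" for \<eta>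
  proof -
    \<comment> \<open>Divided by 2^p because uniform convexity controls half of the
      difference.\<close>
    obtain \<epsilon> where \<epsilon>: "\<epsilon> > 0" "\<And>a b s. clarkson_ineq p a b s \<Longrightarrow> 0 \<le> a \<Longrightarrow> 0 \<le> b \<Longrightarrow> A - \<epsilon> \<le> a \<Longrightarrow> s \<le> 2 * (A + \<epsilon>) \<Longrightarrow> b < \<eta> / 2 powr p"
      using clarkson_ineq_uniformly_convex[OF p A0, of "\<eta> / 2 powr p"] \<eta> by auto
    have "\<forall>\<^sub>F n in sequentially. A - \<epsilon> < e n \<and> r n < \<epsilon>"
      using order_tendstoD(1)[OF A(1), of "A - \<epsilon>"] order_tendstoD(2)[OF r(2), of \<epsilon>] \<epsilon>(1) by (auto intro: eventually_conj)
    then obtain k where k: "A - \<epsilon> < e k" "r k < \<epsilon>" by (auto simp: eventually_sequentially)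
    have "\<E> (\<lambda>x. v i x - v j x) < \<eta>" if ij: "k \<le> i" "k \<le> j" for i j
    proof -
      let ?s = "\<lambda>x. (v i x + v j x) / 2" and ?d = "\<lambda>x. (v i x - v j x) / 2"
      have "(\<lambda>x. (1/2) * (v i x + v j x)) \<in> \<F>" "(\<lambda>x. (1/2) * (v i x - v j x)) \<in> \<F>"
        by (intro F_closed vF)+
      then have sd: "?s \<in> \<F>" "?d \<in> \<F>" by simp_all
      have e1: "(\<lambda>x. ?s x + ?d x) = v i" "(\<lambda>x. ?s x - ?d x) = v j" by (auto simp: fun_eq_iff field_simps)
      have "\<E> (v i) \<le> A + \<epsilon>" "\<E> (v j) \<le> A + \<epsilon>"
        using v(2)[of i] v(2)[of j] A(2)[of i] A(2)[of j] r(3)[OF ij(1)] r(3)[OF ij(2)] k(2) by linarith+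
      then have "\<E> ?d < \<eta> / 2 powr p"
        using E_clarkson[OF sd] mid[OF ij] k(1) sd unfolding e1 by (intro \<epsilon>(2)[of "\<E> ?s" "\<E> ?d" "\<E> (v i) + \<E> (v j)"]) (auto simp: E_nonneg)
      moreover have "\<E> (\<lambda>x. 2 * ?d x) = \<bar>2\<bar> powr p * \<E> ?d" by (rule E_scale[OF sd(2)])
      moreover have "(\<lambda>x. 2 * ?d x) = (\<lambda>x. v i x - v j x)" by auto
      ultimately show ?thesis by (simp add: field_simps)
    qed
    then show ?thesis by blast
  qed
  have vcont: "continuous_on UNIV (v n)" for n using C_continuous vC by blast
  have v0: "v n x = 0" if "x \<notin> K" for n x using v(1)[of n] that by (simp add: D_def)
  have vu: "\<bar>v n x - u x\<bar> \<le> r n" for n x using v(1)[of n] by (simp add: D_def)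
  have Lp_diff: "(\<integral>x. \<bar>v i x - v j x\<bar> powr p \<partial>m) \<le> (2 * r k) powr p * measure m K" if "k \<le> i" "k \<le> j" for i j k
  proof (rule integral_powr_le_on_compact(2)[OF _ K(1)])
    show "continuous_on UNIV (\<lambda>x. v i x - v j x)" by (intro continuous_intros vcont)
    show "\<bar>v i x - v j x\<bar> \<le> 2 * r k" for x
      using vu[of i x] vu[of j x] r(3)[OF that(1)] r(3)[OF that(2)] by linarith
  qed (use v0 in auto)
  have rK: "(\<lambda>k. (2 * r k) powr p * measure m K) \<longlonglongrightarrow> 0"
  proof -
    have "(\<lambda>k. (2 * r k) powr p * measure m K) \<longlonglongrightarrow> (2 * 0) powr p * measure m K"
      using p r by (intro tendsto_intros tendsto_powr' disjI2 conjI) (auto simp: less_imp_le)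
    then show ?thesis by simp
  qed
  have cauchy: "\<exists>n0. \<forall>n\<ge>n0. \<forall>k\<ge>n0. energy_norm p m \<E> (\<lambda>x. v n x - v k x) < \<epsilon>" if \<epsilon>: "\<epsilon> > 0" for \<epsilon>
  proof -
    have \<epsilon>p: "\<epsilon> powr p / 2 > 0" using \<epsilon> by simp
    obtain k1 where k1: "\<And>i j. i \<ge> k1 \<Longrightarrow> j \<ge> k1 \<Longrightarrow> \<E> (\<lambda>x. v i x - v j x) < \<epsilon> powr p / 2"
      using cauchyE[OF \<epsilon>p] by blast
    obtain k2 where k2: "\<And>k. k \<ge> k2 \<Longrightarrow> (2 * r k) powr p * measure m K < \<epsilon> powr p / 2"
      using order_tendstoD(2)[OF rK \<epsilon>p] by (auto simp: eventually_sequentially)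
    have "energy_norm p m \<E> (\<lambda>x. v i x - v j x) < \<epsilon>" if "max k1 k2 \<le> i" "max k1 k2 \<le> j" for i j
    proof -
      have "energy_norm p m \<E> (\<lambda>x. v i x - v j x) powr p < \<epsilon> powr p"
        using k1[of i j] k2[of k2] Lp_diff[of k2 i j] that
        by (subst energy_norm_powr) (auto simp: F_closed vF)
      then show ?thesis
        using p \<epsilon> by (smt (verit, best) powr_mono2)
    qed
    then show ?thesis by blast
  qed
  \<comment> \<open>Completeness yields a limit in energy norm; convergence in L^p then identifies
    it with \<open>u\<close> almost everywhere.\<close>
  obtain f where f: "f \<in> \<F>" "(\<lambda>n. energy_norm p m \<E> (\<lambda>x. v n x - f x)) \<longlonglongrightarrow> 0"
    using banach vF cauchy unfolding banach_mod_AE_def by blast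
  have vf: "(\<lambda>x. v n x - f x) \<in> \<F>" for n by (intro F_closed vF f)
  have lim: "(\<lambda>n. \<E> (\<lambda>x. v n x - f x)) \<longlonglongrightarrow> 0" "(\<lambda>n. \<integral>x. \<bar>v n x - f x\<bar> powr p \<partial>m) \<longlonglongrightarrow> 0"
    using f(2) energy_norm_tendsto_iff[of "\<lambda>n x. v n x - f x", OF vf] by auto
  have um: "u \<in> borel_measurable m" using borel_measurable_continuous_onI[OF u] sets_m by (simp cong: measurable_cong_sets)
  have fm: "f \<in> borel_measurable m" using F_Lp f by (auto simp: Lp_space_def)
  have lu: "integrable m (\<lambda>x. \<bar>v n x - u x\<bar> powr p)" "(\<integral>x. \<bar>v n x - u x\<bar> powr p \<partial>m) \<le> r n powr p * measure m K" for n
    using vu[of n] v0 K(2) by (auto intro!: integral_powr_le_on_compact[OF _ K(1)] continuous_intros vcont u)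
  have ineq: "\<bar>u x - f x\<bar> powr p \<le> 2 powr p * (\<bar>v n x - u x\<bar> powr p + \<bar>v n x - f x\<bar> powr p)" for x n
  proof -
    let ?M = "max \<bar>v n x - u x\<bar> \<bar>v n x - f x\<bar>"
    have "\<bar>v n x - u x\<bar> \<le> ?M" "\<bar>v n x - f x\<bar> \<le> ?M" by auto
    moreover have "\<bar>u x - f x\<bar> \<le> \<bar>v n x - u x\<bar> + \<bar>v n x - f x\<bar>"
      using abs_triangle_ineq4[of "v n x - f x" "v n x - u x"] by simp
    ultimately have "\<bar>u x - f x\<bar> \<le> ?M + ?M" by (meson add_mono order_trans)
    then have "\<bar>u x - f x\<bar> \<le> 2 * ?M" by (simp only: mult_2)
    then have "\<bar>u x - f x\<bar> powr p \<le> (2 * ?M) powr p" using p by (intro powr_mono2) auto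
    also have "\<dots> = 2 powr p * ?M powr p" by (simp add: powr_mult)
    also have "?M powr p \<le> \<bar>v n x - u x\<bar> powr p + \<bar>v n x - f x\<bar> powr p" by (auto simp: max_def)
    finally show ?thesis by simp
  qed
  have vfi: "integrable m (\<lambda>x. \<bar>v n x - f x\<bar> powr p)" for n using Lp_integrable[OF vf] .
  have rhs_int: "integrable m (\<lambda>x. 2 powr p * (\<bar>v n x - u x\<bar> powr p + \<bar>v n x - f x\<bar> powr p))" for n
    by (intro integrable_mult_right Bochner_Integration.integrable_add lu vfi)
  have ufi: "integrable m (\<lambda>x. \<bar>u x - f x\<bar> powr p)"
  proof (rule Bochner_Integration.integrable_bound[OF rhs_int[of 0]])
    show "(\<lambda>x. \<bar>u x - f x\<bar> powr p) \<in> borel_measurable m" using um fm by measurable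
    show "AE x in m. norm (\<bar>u x - f x\<bar> powr p) \<le> norm (2 powr p * (\<bar>v 0 x - u x\<bar> powr p + \<bar>v 0 x - f x\<bar> powr p))"
      using ineq[of _ 0] by (auto intro: order_trans[OF _ abs_ge_self])
  qed
  have "(\<integral>x. \<bar>u x - f x\<bar> powr p \<partial>m) \<le> 0"
  proof (rule LIMSEQ_le_const)
    show "(\<lambda>n. 2 powr p * (r n powr p * measure m K + (\<integral>x. \<bar>v n x - f x\<bar> powr p \<partial>m))) \<longlonglongrightarrow> 0"
    proof -
      have "(\<lambda>n. 2 powr p * (r n powr p * measure m K + (\<integral>x. \<bar>v n x - f x\<bar> powr p \<partial>m))) \<longlonglongrightarrow> 2 powr p * (0 powr p * measure m K + 0)"
        using p r lim by (intro tendsto_intros tendsto_powr' disjI2 conjI) (auto simp: less_imp_le)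
      then show ?thesis by simp
    qed
    have "(\<integral>x. \<bar>u x - f x\<bar> powr p \<partial>m) \<le> 2 powr p * (r n powr p * measure m K + (\<integral>x. \<bar>v n x - f x\<bar> powr p \<partial>m))" for n
    proof -
      have "(\<integral>x. \<bar>u x - f x\<bar> powr p \<partial>m) \<le> (\<integral>x. 2 powr p * (\<bar>v n x - u x\<bar> powr p + \<bar>v n x - f x\<bar> powr p) \<partial>m)"
        by (rule integral_mono[OF ufi rhs_int ineq])
      also have "\<dots> = 2 powr p * ((\<integral>x. \<bar>v n x - u x\<bar> powr p \<partial>m) + (\<integral>x. \<bar>v n x - f x\<bar> powr p \<partial>m))"
        using lu vfi by simp
      also have "\<dots> \<le> 2 powr p * (r n powr p * measure m K + (\<integral>x. \<bar>v n x - f x\<bar> powr p \<partial>m))"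
        by (intro mult_left_mono add_right_mono lu) simp
      finally show ?thesis .
    qed
    then show "\<exists>N. \<forall>n\<ge>N. (\<integral>x. \<bar>u x - f x\<bar> powr p \<partial>m) \<le> 2 powr p * (r n powr p * measure m K + (\<integral>x. \<bar>v n x - f x\<bar> powr p \<partial>m))"
      by blast
  qed
  then have "(\<integral>x. \<bar>u x - f x\<bar> powr p \<partial>m) = 0" by (simp add: antisym)
  then have "AE x in m. \<bar>u x - f x\<bar> powr p = 0"
    using integral_nonneg_eq_0_iff_AE[OF ufi] by simp
  then have ae: "AE x in m. f x = u x" by eventually_elim auto
  then have uF: "u \<in> \<F>"
    using f(1) um form by (auto simp: p_energy_form_def L0_subspace_def)
  then show "u \<in> \<C>" using C_cI[OF u K(1)] K(2) by auto
  have "\<E> u = \<E> f" using ae uF f(1) form unfolding p_energy_form_def respects_AE_def by metis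
  moreover have "(\<lambda>n. \<E> (v n)) \<longlonglongrightarrow> \<E> f" by (rule E_tendsto[OF vF f(1) lim(1)])
  moreover have "(\<lambda>n. e n + r n) \<longlonglongrightarrow> A + 0" by (intro tendsto_intros A r)
  ultimately have "\<E> u \<le> A" using v(2) by (auto intro!: LIMSEQ_le[of "\<lambda>n. \<E> (v n)" _ "\<lambda>n. e n + r n"] simp: less_imp_le)
  then show "\<E> u \<le> B" using AB by simp
qed

text \<open>Uniform convexity again: by lower semicontinuity the midpoints of \<open>v n\<close> and
  \<open>u\<close> eventually have energy at least E(u) - \<epsilon>, while the end points have at
  most about E(u), so half the difference has small energy.\<close>

proposition strong_convergence:
  assumes u: "u \<in> \<C>" and v: "\<And>n. v n \<in> \<C>" and K: "compact K" "\<And>n x. x \<notin> K \<Longrightarrow> v n x = 0"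
    and unif: "uniform_limit UNIV v u G"
    and en: "\<And>\<epsilon>. \<epsilon> > 0 \<Longrightarrow> \<forall>\<^sub>F n in G. \<E> (v n) \<le> \<E> u + \<epsilon>"
  shows "((\<lambda>n. \<E> (\<lambda>x. v n x - u x)) \<longlongrightarrow> 0) G"
proof (rule tendstoI)
  fix \<eta> :: real assume \<eta>: "\<eta> > 0"
  have uF: "u \<in> \<F>" and vF: "v n \<in> \<F>" for n using u v by auto
  define A where "A = \<E> u"
  have A0: "A \<ge> 0" using uF E_nonneg by (simp add: A_def)
  obtain \<epsilon> where \<epsilon>: "\<epsilon> > 0" "\<And>a b s. clarkson_ineq p a b s \<Longrightarrow> 0 \<le> a \<Longrightarrow> 0 \<le> b \<Longrightarrow> A - \<epsilon> \<le> a \<Longrightarrow> s \<le> 2 * (A + \<epsilon>) \<Longrightarrow> b < \<eta> / 2 powr p"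
    using clarkson_ineq_uniformly_convex[OF p A0, of "\<eta> / 2 powr p"] \<eta> by auto
  let ?s = "\<lambda>n x. (v n x + u x) / 2" and ?d = "\<lambda>n x. (v n x - u x) / 2"
  have "(\<lambda>x. (1/2) * (v n x + u x)) \<in> \<C>" "(\<lambda>x. (1/2) * (v n x - u x)) \<in> \<C>" for n
    by (intro C_closed v u)+
  then have sd: "?s n \<in> \<C>" "?d n \<in> \<C>" for n by simp_all
  have close: "\<forall>\<^sub>F n in G. \<forall>x. \<bar>v n x - u x\<bar> < \<delta>" if "\<delta> > 0" for \<delta>
    using uniform_limitD[OF unif that] by (simp add: dist_real_def)
  obtain L where L: "compact L" "\<And>x. x \<notin> L \<Longrightarrow> u x = 0" using u by (auto elim: C_cE)
  have low: "\<forall>\<^sub>F n in G. A - \<epsilon> \<le> \<E> (?s n)"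
  proof (rule ccontr)
    assume "\<not> ?thesis"
    then have fr: "\<exists>\<^sub>F n in G. \<E> (?s n) < A - \<epsilon>" by (simp add: frequently_def not_less)
    \<comment> \<open>Midpoints of low energy would approximate \<open>u\<close> uniformly, against
      lower semicontinuity.\<close>
    have "\<E> u \<le> A - \<epsilon>"
    proof (rule lower_semicontinuity(2)[of u "K \<union> L"])
      fix \<delta> :: real assume "\<delta> > 0"
      from frequently_eventually_frequently[OF fr close[OF this]]
      obtain n where n: "\<E> (?s n) < A - \<epsilon>" "\<And>x. \<bar>v n x - u x\<bar> < \<delta>" by (auto dest: frequently_ex)
      have "\<bar>?s n x - u x\<bar> \<le> \<delta>" for x using n(2)[of x] by (simp add: field_simps abs_le_iff abs_less_iff)
      then show "\<exists>v\<in>\<C>. (\<forall>x. \<bar>v x - u x\<bar> \<le> \<delta>) \<and> (\<forall>x. x \<notin> K \<union> L \<longrightarrow> v x = 0) \<and> \<E> v \<le> A - \<epsilon>"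
        using sd(1)[of n] n(1) K(2) L(2) by (intro bexI[of _ "?s n"]) auto
    qed (use L K C_continuous[OF u] in auto)
    then show False using \<epsilon>(1) by (simp add: A_def)
  qed
  show "\<forall>\<^sub>F n in G. dist (\<E> (\<lambda>x. v n x - u x)) 0 < \<eta>"
    using low en[OF \<epsilon>(1)]
  proof eventually_elim
    case (elim n)
    have sdF: "?s n \<in> \<F>" "?d n \<in> \<F>" using sd by auto
    have e1: "(\<lambda>x. ?s n x + ?d n x) = v n" "(\<lambda>x. ?s n x - ?d n x) = u" by (auto simp: fun_eq_iff field_simps)
    have "\<E> (?d n) < \<eta> / 2 powr p"
      using E_clarkson[OF sdF] elim \<epsilon>(1) sdF unfolding e1
      by (intro \<epsilon>(2)[of "\<E> (?s n)" "\<E> (?d n)" "\<E> (v n) + \<E> u"]) (auto simp: E_nonneg A_def)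
    moreover have "\<E> (\<lambda>x. 2 * ?d n x) = \<bar>2\<bar> powr p * \<E> (?d n)" by (rule E_scale[OF sdF(2)])
    moreover have "(\<lambda>x. 2 * ?d n x) = (\<lambda>x. v n x - u x)" by auto
    ultimately have "\<E> (\<lambda>x. v n x - u x) < \<eta>" by (simp add: field_simps)
    moreover have "0 \<le> \<E> (\<lambda>x. v n x - u x)" by (intro E_nonneg F_closed vF uF)
    ultimately show ?case by simp
  qed
qed

end

section \<open>Normal contractions and zigzag functions\<close>

text \<open>The distance from t to the lattice 2 \<delta> Z: a triangle wave of height \<delta> with
  valleys at the lattice points.\<close>

definition zigzag :: "real \<Rightarrow> real \<Rightarrow> real" where
  "zigzag \<delta> t = \<bar>t - 2 * \<delta> * of_int (round (t / (2 * \<delta>)))\<bar>"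

lemma zigzag_nonneg: "0 \<le> zigzag \<delta> t"
  by (simp add: zigzag_def)

lemma zigzag_cases: obtains k :: int where "zigzag \<delta> t = \<bar>t - 2 * \<delta> * of_int k\<bar>"
  unfolding zigzag_def by blast

lemma zigzag_le: assumes "\<delta> > 0" shows "zigzag \<delta> t \<le> \<delta>"
proof -
  have "\<bar>of_int (round (t / (2 * \<delta>))) - t / (2 * \<delta>)\<bar> \<le> 1 / 2" by (rule of_int_round_abs_le)
  then have "2 * \<delta> * \<bar>of_int (round (t / (2 * \<delta>))) - t / (2 * \<delta>)\<bar> \<le> 2 * \<delta> * (1 / 2)"
    using assms by (intro mult_left_mono) auto
  moreover have "2 * \<delta> * \<bar>of_int (round (t / (2 * \<delta>))) - t / (2 * \<delta>)\<bar> = \<bar>2 * \<delta> * (of_int (round (t / (2 * \<delta>))) - t / (2 * \<delta>))\<bar>"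
    using assms by (simp add: abs_mult)
  moreover have "2 * \<delta> * (of_int (round (t / (2 * \<delta>))) - t / (2 * \<delta>)) = 2 * \<delta> * of_int (round (t / (2 * \<delta>))) - t"
    using assms by (simp add: algebra_simps)
  ultimately show ?thesis by (simp add: zigzag_def abs_minus_commute)
qed

lemma zigzag_le_dist: assumes "\<delta> > 0" shows "zigzag \<delta> t \<le> \<bar>t - 2 * \<delta> * of_int k\<bar>"
proof -
  let ?y = "t / (2 * \<delta>)"
  have e: "\<bar>t - 2 * \<delta> * of_int j\<bar> = 2 * \<delta> * \<bar>of_int j - ?y\<bar>" for j :: int
  proof -
    have "t - 2 * \<delta> * of_int j = - (2 * \<delta> * (of_int j - ?y))" using assms by (simp add: algebra_simps)
    then show ?thesis using assms by (simp add: abs_mult)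
  qed
  have "\<bar>of_int (round ?y) - ?y\<bar> \<le> \<bar>of_int k - ?y\<bar>"
    using round_diff_minimal[of ?y k] by (simp add: abs_minus_commute)
  then show ?thesis unfolding zigzag_def e using assms by (intro mult_left_mono) auto
qed

lemma zigzag_le_abs: "\<delta> > 0 \<Longrightarrow> zigzag \<delta> t \<le> \<bar>t\<bar>"
  using zigzag_le_dist[of \<delta> t 0] by simp

lemma zigzag_0: "zigzag \<delta> 0 = 0"
  by (simp add: zigzag_def)

lemma zigzag_eqI:
  assumes "\<delta> > 0" "\<bar>t - 2 * \<delta> * of_int k\<bar> \<le> \<delta>" shows "zigzag \<delta> t = \<bar>t - 2 * \<delta> * of_int k\<bar>"
proof (rule antisym[OF zigzag_le_dist[OF assms(1)]])
  obtain j :: int where j: "zigzag \<delta> t = \<bar>t - 2 * \<delta> * of_int j\<bar>" by (rule zigzag_cases)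
  show "\<bar>t - 2 * \<delta> * of_int k\<bar> \<le> zigzag \<delta> t"
  proof (cases "j = k")
    case False
    then have "1 \<le> \<bar>real_of_int j - of_int k\<bar>" by linarith
    then have "2 * \<delta> * 1 \<le> 2 * \<delta> * \<bar>real_of_int j - of_int k\<bar>" using assms by (intro mult_left_mono) auto
    also have "\<dots> = \<bar>2 * \<delta> * of_int j - 2 * \<delta> * of_int k\<bar>"
      using assms by (simp add: abs_mult right_diff_distrib[symmetric])
    finally show ?thesis using assms(2) unfolding j by linarith
  qed (simp add: j)
qed

lemma zigzag_small: "\<delta> > 0 \<Longrightarrow> \<bar>t\<bar> \<le> \<delta> \<Longrightarrow> zigzag \<delta> t = \<bar>t\<bar>"
  using zigzag_eqI[of \<delta> t 0] by simp

lemma zigzag_lipschitz: assumes "\<delta> > 0" shows "\<bar>zigzag \<delta> s - zigzag \<delta> t\<bar> \<le> \<bar>s - t\<bar>"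
proof -
  have "zigzag \<delta> s \<le> zigzag \<delta> t + \<bar>s - t\<bar>" for s t
  proof -
    obtain k :: int where k: "zigzag \<delta> t = \<bar>t - 2 * \<delta> * of_int k\<bar>" by (rule zigzag_cases)
    show ?thesis using zigzag_le_dist[OF assms, of s k] k by linarith
  qed
  from this[of s t] this[of t s] show ?thesis by linarith
qed

lemma zigzag_periodic: assumes "\<delta> > 0" shows "zigzag \<delta> (t + 2 * \<delta> * of_int k) = zigzag \<delta> t"
proof -
  obtain j :: int where j: "zigzag \<delta> t = \<bar>t - 2 * \<delta> * of_int j\<bar>" by (rule zigzag_cases)
  have "t + 2 * \<delta> * of_int k - 2 * \<delta> * of_int (j + k) = t - 2 * \<delta> * of_int j" by (simp add: algebra_simps)
  then show ?thesis using zigzag_eqI[OF assms, of "t + 2 * \<delta> * of_int k" "j + k"] zigzag_le[OF assms, of t] j by simp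
qed

lemma zigzag_minus: assumes "\<delta> > 0" shows "zigzag \<delta> (- t) = zigzag \<delta> t"
proof -
  obtain j :: int where j: "zigzag \<delta> t = \<bar>t - 2 * \<delta> * of_int j\<bar>" by (rule zigzag_cases)
  have "\<bar>- t - 2 * \<delta> * of_int (- j)\<bar> = \<bar>t - 2 * \<delta> * of_int j\<bar>" by (simp add: abs_minus_commute)
  then show ?thesis using zigzag_eqI[OF assms, of "- t" "- j"] zigzag_le[OF assms, of t] j by simp
qed

text \<open>On each branch the coarse fold is a translation by a multiple of the fine period, up to
  a reflection, and the fine fold sees neither.\<close>

lemma zigzag_comp: assumes "\<delta> > 0" "n > 0" shows "zigzag \<delta> (zigzag (\<delta> * real n) t) = zigzag \<delta> t"
proof -
  obtain k :: int where k: "zigzag (\<delta> * real n) t = \<bar>t - 2 * (\<delta> * real n) * of_int k\<bar>" by (rule zigzag_cases)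
  have e: "t - 2 * (\<delta> * real n) * of_int k = t + 2 * \<delta> * of_int (- (int n * k))" by simp
  have "zigzag \<delta> \<bar>s\<bar> = zigzag \<delta> s" for s using zigzag_minus[OF assms(1), of s] by (simp add: abs_if)
  then show ?thesis unfolding k e by (simp only: zigzag_periodic[OF assms(1)])
qed

text \<open>Halving the height is one more reflection of the existing wave, at its middle level; the
  invariance of the energy is proved one such reflection at a time.\<close>

lemma zigzag_half: assumes "\<delta> > 0" shows "zigzag (\<delta> / 2) t = \<delta> / 2 - \<bar>zigzag \<delta> t - \<delta> / 2\<bar>"
proof -
  obtain k :: int where k: "zigzag \<delta> t = \<bar>t - 2 * \<delta> * of_int k\<bar>" by (rule zigzag_cases)
  have le: "zigzag \<delta> t \<le> \<delta>" by (rule zigzag_le[OF assms])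
  have h: "\<delta> / 2 > 0" using assms by simp
  show ?thesis
  proof (cases "zigzag \<delta> t \<le> \<delta> / 2")
    case True
    have "2 * (\<delta> / 2) * of_int (2 * k) = 2 * \<delta> * of_int k" by simp
    then have "zigzag (\<delta> / 2) t = \<bar>t - 2 * \<delta> * of_int k\<bar>"
      using zigzag_eqI[OF h, of t "2 * k"] True k by (metis)
    then show ?thesis using True k by simp
  next
    case False
    define j where "j = (if t - 2 * \<delta> * of_int k \<ge> 0 then 2 * k + 1 else 2 * k - 1)"
    have "t - 2 * (\<delta> / 2) * of_int j = (t - 2 * \<delta> * of_int k) - (if t - 2 * \<delta> * of_int k \<ge> 0 then \<delta> else - \<delta>)"
      by (simp add: j_def algebra_simps)
    then have e: "\<bar>t - 2 * (\<delta> / 2) * of_int j\<bar> = \<delta> - zigzag \<delta> t"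
      using k le by (auto split: if_splits)
    then have "zigzag (\<delta> / 2) t = \<delta> - zigzag \<delta> t"
      using zigzag_eqI[OF h, of t j] False by simp
    then show ?thesis using False by simp
  qed
qed

lemma uniform_limit_boundI:
  fixes u :: "'a \<Rightarrow> real"
  assumes "\<And>n x. \<bar>v n x - u x\<bar> \<le> r n" "(r \<longlongrightarrow> 0) G"
  shows "uniform_limit UNIV v u G"
proof (rule uniform_limitI)
  fix e :: real assume "e > 0"
  then have "\<forall>\<^sub>F n in G. r n < e" using assms(2) by (rule order_tendstoD(2)[rotated])
  then show "\<forall>\<^sub>F n in G. \<forall>x\<in>UNIV. dist (v n x) (u x) < e"
    by eventually_elim (use assms(1) in \<open>auto simp: dist_real_def intro: le_less_trans\<close>)
qed

lemma LIMSEQ_const_over_Suc: "(\<lambda>n. a / real (Suc n)) \<longlonglongrightarrow> 0"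
  using LIMSEQ_Suc[OF lim_const_over_n[of a]] by simp

section \<open>Additivity of the energy and composition with Lipschitz functions\<close>

context p_energy_space
begin

text \<open>(E3) in the form in which it is applied: disjoint closed sets enclose the two supports.
  As \<open>g\<close> equals \<open>a\<close> off \<open>B\<close>, the constant to add is
  \<open>- a\<close>.\<close>

lemma E_add_separated:
  assumes "f \<in> \<C>" "g \<in> \<C>" "closed A" "closed B" "A \<inter> B = {}"
    and "\<And>x. f x \<noteq> 0 \<Longrightarrow> x \<in> A" "\<And>x. g x \<noteq> a \<Longrightarrow> x \<in> B"
  shows "\<E> (\<lambda>x. f x + g x) = \<E> f + \<E> g"
proof -
  have "supp f \<subseteq> A" unfolding supp_def using assms by (intro closure_minimal) auto
  moreover have "supp (\<lambda>x. g x + - a) \<subseteq> B" unfolding supp_def using assms by (intro closure_minimal) auto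
  ultimately have "supp f \<inter> supp (\<lambda>x. g x + - a) = {}" using assms(5) by blast
  then show ?thesis using local assms(1,2) by blast
qed

lemma E_add_shift_tendsto:
  assumes "\<And>n. v n \<in> \<C>" "u \<in> \<C>" "b \<in> \<C>" "((\<lambda>n. \<E> (\<lambda>x. v n x - u x)) \<longlongrightarrow> 0) G"
  shows "((\<lambda>n. \<E> (\<lambda>x. v n x + b x)) \<longlongrightarrow> \<E> (\<lambda>x. u x + b x)) G"
proof (rule E_tendsto)
  show "(\<lambda>x. v n x + b x) \<in> \<F>" "(\<lambda>x. u x + b x) \<in> \<F>" for n using assms by (auto intro!: F_closed)
  show "((\<lambda>n. \<E> (\<lambda>x. v n x + b x - (u x + b x))) \<longlongrightarrow> 0) G" using assms(4) by simp
qed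

text \<open>\<open>b\<close> lives where the truncated function is constantly \<open>a\<close>, but
  (E3) asks for disjoint supports. Cutting at \<open>a - r n\<close> opens a gap between them, and
  strong convergence closes it again.\<close>

lemma E_add_above:
  assumes f: "f \<in> \<C>" "\<And>x. 0 \<le> f x" and a: "0 \<le> a" and b: "b \<in> \<C>" "\<And>x. b x \<noteq> 0 \<Longrightarrow> a \<le> f x"
  shows "\<E> (\<lambda>x. min (f x) a + b x) = \<E> (\<lambda>x. min (f x) a) + \<E> b"
proof (cases "a = 0")
  case True
  then have "(\<lambda>x. min (f x) a) = (\<lambda>x. 0)" using f(2) by (auto simp: fun_eq_iff min_def intro: antisym)
  then show ?thesis using E_zero by (simp add: fun_eq_iff)
next
  case False
  then have a0: "a > 0" using a by simp
  define r where "r n = a / real (Suc n)" for n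
  have r: "r n > 0" "r n \<le> a" "r \<longlonglongrightarrow> 0" for n
    using a0 LIMSEQ_const_over_Suc[of a] by (auto simp: r_def[abs_def] field_simps)
  define v where "v n x = min (f x) (a - r n)" for n x
  define u where "u x = min (f x) a" for x
  have uC: "u \<in> \<C>" unfolding u_def[abs_def] by (intro C_closed f a)
  have vC: "v n \<in> \<C>" for n unfolding v_def[abs_def] using r(2)[of n] by (intro C_closed f) simp
  obtain K where K: "compact K" "\<And>x. x \<notin> K \<Longrightarrow> f x = 0" using f(1) by (auto elim: C_cE)
  have lim: "((\<lambda>n. \<E> (\<lambda>x. v n x - u x)) \<longlongrightarrow> 0) sequentially"
  proof (rule strong_convergence[OF uC vC K(1)])
    show "v n x = 0" if "x \<notin> K" for n x using K(2)[OF that] r(2)[of n] by (simp add: v_def)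
    show "uniform_limit UNIV v u sequentially"
    proof (rule uniform_limit_boundI[OF _ r(3)])
      show "\<bar>v n x - u x\<bar> \<le> r n" for n x using r(1)[of n] by (auto simp: v_def u_def min_def)
    qed
    have "v n x = max (min (u x) (a - r n)) 0" for n x
      using r(1)[of n] r(2)[of n] f(2)[of x] by (auto simp: v_def u_def min_def max_def)
    then have "v n = (\<lambda>x. max (min (u x) (a - r n)) 0)" for n by (simp add: fun_eq_iff)
    then have "\<E> (v n) \<le> \<E> u" for n using C_trunc(2)[OF uC, of "a - r n"] r(2)[of n] by simp
    then show "\<forall>\<^sub>F n in sequentially. \<E> (v n) \<le> \<E> u + \<epsilon>" if "\<epsilon> > 0" for \<epsilon>
      using that by (auto intro!: always_eventually intro: add_increasing2)
  qed
  have "\<E> (\<lambda>x. b x + v n x) = \<E> b + \<E> (v n)" for n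
  proof (rule E_add_separated[OF b(1) vC])
    show "closed {x. a \<le> f x}" "closed {x. f x \<le> a - r n}"
      using C_continuous[OF f(1)] by (auto intro!: closed_Collect_le continuous_intros)
    show "{x. a \<le> f x} \<inter> {x. f x \<le> a - r n} = {}" using r(1)[of n] by auto
    show "x \<in> {x. a \<le> f x}" if "b x \<noteq> 0" for x using b(2)[OF that] by simp
    show "x \<in> {x. f x \<le> a - r n}" if "v n x \<noteq> a - r n" for x using that by (auto simp: v_def min_def split: if_splits)
  qed
  then have e: "\<E> (\<lambda>x. v n x + b x) = \<E> (v n) + \<E> b" for n by (simp add: add.commute)
  have "(\<lambda>n. \<E> (v n)) \<longlonglongrightarrow> \<E> u" by (rule E_tendsto[OF _ _ lim]) (use uC vC in auto)
  then have "(\<lambda>n. \<E> (\<lambda>x. v n x + b x)) \<longlonglongrightarrow> \<E> u + \<E> b" unfolding e by (intro tendsto_intros)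
  moreover have "(\<lambda>n. \<E> (\<lambda>x. v n x + b x)) \<longlonglongrightarrow> \<E> (\<lambda>x. u x + b x)" by (rule E_add_shift_tendsto[OF vC uC b(1) lim])
  ultimately have "\<E> (\<lambda>x. u x + b x) = \<E> u + \<E> b" using LIMSEQ_unique by blast
  then show ?thesis by (simp add: u_def[abs_def])
qed

text \<open>The upper layer is positive only where the lower one is constant, so horizontal layers
  do not interact.\<close>

lemma E_split:
  assumes f: "f \<in> \<C>" "\<And>x. 0 \<le> f x" and a: "0 \<le> a"
  shows "\<E> f = \<E> (\<lambda>x. min (f x) a) + \<E> (\<lambda>x. max (f x - a) 0)"
proof -
  have "f = (\<lambda>x. min (f x) a + max (f x - a) 0)" by (auto simp: fun_eq_iff)
  then show ?thesis using E_add_above[OF f a C_pos_part_diff[OF f(1) a]] by (simp add: max_def split: if_splits)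
qed

text \<open>Again a gap is opened: \<open>u\<close> lowered by \<open>r n\<close> and cut at
  \<open>0\<close> lives on {u \<ge> r n}, while \<open>v\<close> lives on {u = 0}.\<close>

lemma E_add_disjoint_nonneg:
  assumes u: "u \<in> \<C>" "\<And>x. 0 \<le> u x" and v: "v \<in> \<C>" and disj: "\<And>x. u x = 0 \<or> v x = 0"
  shows "\<E> (\<lambda>x. u x + v x) = \<E> u + \<E> v"
proof -
  define r where "r n = 1 / real (Suc n)" for n
  have r: "r n > 0" "r \<longlonglongrightarrow> 0" for n
    using LIMSEQ_const_over_Suc[of 1] by (auto simp: r_def[abs_def])
  define w where "w n x = max (u x - r n) 0" for n x
  have wC: "w n \<in> \<C>" for n unfolding w_def[abs_def] using r(1)[of n] by (intro C_closed u) simp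
  obtain K where K: "compact K" "\<And>x. x \<notin> K \<Longrightarrow> u x = 0" using u(1) by (auto elim: C_cE)
  have lim: "((\<lambda>n. \<E> (\<lambda>x. w n x - u x)) \<longlongrightarrow> 0) sequentially"
  proof (rule strong_convergence[OF u(1) wC K(1)])
    show "w n x = 0" if "x \<notin> K" for n x using K(2)[OF that] r(1)[of n] by (simp add: w_def)
    show "uniform_limit UNIV w u sequentially"
    proof (rule uniform_limit_boundI[OF _ r(2)])
      show "\<bar>w n x - u x\<bar> \<le> r n" for n x using r(1)[of n] u(2)[of x] by (auto simp: w_def max_def)
    qed
    \<comment> \<open>Lowering removes the bottom layer of \<open>u\<close> together with its
      energy.\<close>
    have "\<E> (w n) \<le> \<E> u" for n
    proof -
      have "0 \<le> \<E> (\<lambda>x. min (u x) (r n))" using C_min_const[OF u(1), of "r n"] r(1)[of n] by (intro E_nonneg) auto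
      then show ?thesis using E_split[OF u, of "r n"] r(1)[of n] unfolding w_def[abs_def] by linarith
    qed
    then show "\<forall>\<^sub>F n in sequentially. \<E> (w n) \<le> \<E> u + \<epsilon>" if "\<epsilon> > 0" for \<epsilon>
      using that by (auto intro!: always_eventually intro: add_increasing2)
  qed
  have e: "\<E> (\<lambda>x. w n x + v x) = \<E> (w n) + \<E> v" for n
  proof (rule E_add_separated[OF wC v])
    show "closed {x. r n \<le> u x}" "closed {x. u x \<le> 0}"
      using C_continuous[OF u(1)] by (auto intro!: closed_Collect_le continuous_intros)
    show "{x. r n \<le> u x} \<inter> {x. u x \<le> 0} = {}" using r(1)[of n] by auto
    show "x \<in> {x. r n \<le> u x}" if "w n x \<noteq> 0" for x using that by (auto simp: w_def max_def split: if_splits)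
    show "x \<in> {x. u x \<le> 0}" if "v x \<noteq> 0" for x using that disj[of x] by auto
  qed
  have "(\<lambda>n. \<E> (w n)) \<longlonglongrightarrow> \<E> u" by (rule E_tendsto[OF _ _ lim]) (use u wC in auto)
  then have "(\<lambda>n. \<E> (\<lambda>x. w n x + v x)) \<longlonglongrightarrow> \<E> u + \<E> v" unfolding e by (intro tendsto_intros)
  moreover have "(\<lambda>n. \<E> (\<lambda>x. w n x + v x)) \<longlonglongrightarrow> \<E> (\<lambda>x. u x + v x)" by (rule E_add_shift_tendsto[OF wC u(1) v lim])
  ultimately show ?thesis using LIMSEQ_unique by blast
qed

lemma E_pos_neg:
  assumes u: "u \<in> \<C>"
  shows "\<E> u = \<E> (\<lambda>x. max (u x) 0) + \<E> (\<lambda>x. max (- u x) 0)"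
proof -
  have c: "(\<lambda>x. max (u x) 0) \<in> \<C>" "(\<lambda>x. max (- u x) 0) \<in> \<C>" by (intro C_closed u)+
  have "u = (\<lambda>x. max (u x) 0 + - max (- u x) 0)" by (auto simp: fun_eq_iff)
  then have "\<E> u = \<E> (\<lambda>x. max (u x) 0) + \<E> (\<lambda>x. - max (- u x) 0)"
    using E_add_disjoint_nonneg[OF c(1) _ C_minus[OF c(2)]] by (simp add: max_def split: if_splits)
  then show ?thesis using E_minus c(2) by auto
qed

text \<open>The nonnegative case twice: for the negative part of \<open>u\<close> against
  \<open>- v\<close>, then for the positive part of \<open>u\<close> against that sum with its sign
  reversed.\<close>

lemma E_add_disjoint:
  assumes u: "u \<in> \<C>" and v: "v \<in> \<C>" and disj: "\<And>x. u x = 0 \<or> v x = 0"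
  shows "\<E> (\<lambda>x. u x + v x) = \<E> u + \<E> v"
proof -
  have c: "(\<lambda>x. max (u x) 0) \<in> \<C>" "(\<lambda>x. max (- u x) 0) \<in> \<C>" "(\<lambda>x. - v x) \<in> \<C>" by (intro C_closed u v)+
  have "\<E> (\<lambda>x. max (- u x) 0 + - v x) = \<E> (\<lambda>x. max (- u x) 0) + \<E> (\<lambda>x. - v x)"
  proof (rule E_add_disjoint_nonneg[OF c(2) _ c(3)])
    show "max (- u x) 0 = 0 \<or> - v x = 0" for x using disj[of x] by auto
  qed simp
  then have "\<E> (\<lambda>x. - (max (- u x) 0 + - v x)) = \<E> (\<lambda>x. max (- u x) 0) + \<E> v"
    using E_minus[of v] E_minus[of "\<lambda>x. max (- u x) 0 + - v x"] C_add[OF c(2,3)] v by simp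
  moreover have "\<E> (\<lambda>x. max (u x) 0 + - (max (- u x) 0 + - v x)) = \<E> (\<lambda>x. max (u x) 0) + \<E> (\<lambda>x. - (max (- u x) 0 + - v x))"
  proof (rule E_add_disjoint_nonneg[OF c(1) _ C_minus[OF C_add[OF c(2,3)]]])
    show "max (u x) 0 = 0 \<or> - (max (- u x) 0 + - v x) = 0" for x using disj[of x] by (auto simp: max_def)
  qed simp
  moreover have "(\<lambda>x. max (u x) 0 + - (max (- u x) 0 + - v x)) = (\<lambda>x. u x + v x)" by (auto simp: fun_eq_iff)
  ultimately show ?thesis using E_pos_neg[OF u] by simp
qed

lemma E_abs: assumes u: "u \<in> \<C>" shows "\<E> (\<lambda>x. \<bar>u x\<bar>) = \<E> u"
proof -
  have c: "(\<lambda>x. max (u x) 0) \<in> \<C>" "(\<lambda>x. max (- u x) 0) \<in> \<C>" by (intro C_closed u)+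
  have "(\<lambda>x. \<bar>u x\<bar>) = (\<lambda>x. max (u x) 0 + max (- u x) 0)" by (auto simp: fun_eq_iff)
  then show ?thesis using E_add_disjoint[OF c] E_pos_neg[OF u] by (simp add: max_def split: if_splits)
qed

text \<open>The sum is a piecewise linear function of \<open>f\<close> with slope \<open>c j\<close>
  on the layer between \<open>j d\<close> and \<open>(j + 1) d\<close>. Layers are peeled off from
  the bottom, each contributing |c j|^p times its energy.\<close>

lemma E_interpolation:
  assumes f: "f \<in> \<C>" "\<And>x. 0 \<le> f x" and d: "0 \<le> d" and c: "\<And>j. j < n \<Longrightarrow> \<bar>c j\<bar> \<le> L"
  shows "(\<lambda>x. \<Sum>j<n. c j * min (max (f x - real j * d) 0) d) \<in> \<C> \<and>
    \<E> (\<lambda>x. \<Sum>j<n. c j * min (max (f x - real j * d) 0) d) \<le> L powr p * \<E> f"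
  using f c
proof (induction n arbitrary: f c)
  case 0
  then show ?case using C_zero E_zero E_nonneg by auto
next
  case (Suc n)
  define f' where "f' x = max (f x - d) 0" for x
  have f': "f' \<in> \<C>" "\<And>x. 0 \<le> f' x" unfolding f'_def[abs_def] by (intro C_closed Suc.prems d) simp
  define b where "b x = (\<Sum>j<n. c (Suc j) * min (max (f' x - real j * d) 0) d)" for x
  have b: "b \<in> \<C>" "\<E> b \<le> L powr p * \<E> f'"
    using Suc.IH[OF f', of "\<lambda>j. c (Suc j)"] Suc.prems(3) unfolding b_def[abs_def] by auto
  have L: "\<bar>c 0\<bar> \<le> L" using Suc.prems(3)[of 0] by simp
  have mf: "(\<lambda>x. min (f x) d) \<in> \<C>" using Suc.prems(1) d by (intro C_closed)
  \<comment> \<open>Once the bottom layer is dropped, layer \<open>j + 1\<close> of \<open>f\<close>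
    is layer \<open>j\<close> of \<open>f'\<close>.\<close>
  have shift: "max (f x - real (Suc j) * d) 0 = max (f' x - real j * d) 0" for x j
    using d by (auto simp: f'_def max_def algebra_simps) (smt (verit) mult_nonneg_nonneg of_nat_0_le_iff)+
  have eq: "(\<lambda>x. \<Sum>j<Suc n. c j * min (max (f x - real j * d) 0) d) = (\<lambda>x. c 0 * min (f x) d + b x)"
    unfolding sum.lessThan_Suc_shift shift b_def using Suc.prems(2) by (simp add: fun_eq_iff max_absorb1)
  have b0: "d \<le> f x" if "b x \<noteq> 0" for x
  proof (rule ccontr)
    assume "\<not> d \<le> f x"
    then have "f' x = 0" by (simp add: f'_def)
    then have "b x = 0" using d by (simp add: b_def)
    with that show False by simp
  qed
  \<comment> \<open>\<open>E_add_above\<close> has slope \<open>1\<close> on the bottom layer, so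
    \<open>b\<close> is divided by \<open>c 0\<close> unless that slope is \<open>0\<close>.\<close>
  have "\<E> (\<lambda>x. c 0 * min (f x) d + b x) = \<bar>c 0\<bar> powr p * \<E> (\<lambda>x. min (f x) d) + \<E> b"
  proof (cases "c 0 = 0")
    case True then show ?thesis by simp
  next
    case False
    let ?b = "\<lambda>x. (1 / c 0) * b x"
    have bC: "?b \<in> \<C>" by (rule C_scale[OF b(1)])
    have "\<E> (\<lambda>x. min (f x) d + ?b x) = \<E> (\<lambda>x. min (f x) d) + \<E> ?b"
      by (rule E_add_above[OF Suc.prems(1,2) d bC]) (use b0 in auto)
    moreover have "\<E> (\<lambda>x. c 0 * (min (f x) d + ?b x)) = \<bar>c 0\<bar> powr p * \<E> (\<lambda>x. min (f x) d + ?b x)"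
      using C_add[OF mf bC] by (intro E_scale) auto
    moreover have "\<E> (\<lambda>x. c 0 * ?b x) = \<bar>c 0\<bar> powr p * \<E> ?b" using bC by (intro E_scale) auto
    moreover have "(\<lambda>x. c 0 * (min (f x) d + ?b x)) = (\<lambda>x. c 0 * min (f x) d + b x)" "(\<lambda>x. c 0 * ?b x) = b"
      using False by (auto simp: distrib_left)
    ultimately show ?thesis by (simp add: distrib_left)
  qed
  also have "\<dots> \<le> L powr p * \<E> (\<lambda>x. min (f x) d) + L powr p * \<E> f'"
    using mf L p b(2) by (intro add_mono mult_right_mono powr_mono2) (auto intro: E_nonneg)
  also have "\<dots> = L powr p * \<E> f"
    using E_split[OF Suc.prems(1,2) d] by (simp add: f'_def[abs_def] distrib_left)
  finally show ?case unfolding eq using C_add[OF C_scale[OF mf] b(1)] by simp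
qed

text \<open>The interpolant is exact at the nodes, and on the cell containing \<open>t\<close> both
  the chord and \<kappa> move by at most \<open>L * d\<close>; hence the factor 2. The induction
  shifts the origin by one cell.\<close>

lemma interpolation_close:
  fixes \<kappa> :: "real \<Rightarrow> real"
  assumes d: "0 < d" and L0: "0 \<le> L" and L: "\<And>s t. 0 \<le> s \<Longrightarrow> s \<le> real n * d \<Longrightarrow> 0 \<le> t \<Longrightarrow> t \<le> real n * d \<Longrightarrow> \<bar>\<kappa> s - \<kappa> t\<bar> \<le> L * \<bar>s - t\<bar>"
    and t: "0 \<le> t" "t \<le> real n * d"
  shows "\<bar>(\<Sum>j<n. (\<kappa> (real (Suc j) * d) - \<kappa> (real j * d)) / d * min (max (t - real j * d) 0) d) - (\<kappa> t - \<kappa> 0)\<bar> \<le> 2 * L * d"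
  using L t
proof (induction n arbitrary: \<kappa> t)
  case 0
  then have "t = 0" by simp
  then show ?case using L0 d by simp
next
  case (Suc n)
  define \<kappa>' where "\<kappa>' s = \<kappa> (s + d)" for s
  define S where "S = (\<Sum>j<n. (\<kappa>' (real (Suc j) * d) - \<kappa>' (real j * d)) / d * min (max ((t - d) - real j * d) 0) d)"
  have eq: "(\<Sum>j<Suc n. (\<kappa> (real (Suc j) * d) - \<kappa> (real j * d)) / d * min (max (t - real j * d) 0) d)
      = (\<kappa> d - \<kappa> 0) / d * min t d + S"
    unfolding sum.lessThan_Suc_shift S_def using Suc.prems(2)
    by (simp add: \<kappa>'_def algebra_simps)
  have nd: "0 \<le> real n * d" using d by simp
  show ?case
  proof (cases "t \<le> d")
    case True
    have "S = 0" unfolding S_def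
    proof (intro sum.neutral ballI)
      fix j assume "j \<in> {..<n}"
      have "0 \<le> real j * d" using d by simp
      then have "max ((t - d) - real j * d) 0 = 0" using True by linarith
      then show "(\<kappa>' (real (Suc j) * d) - \<kappa>' (real j * d)) / d * min (max ((t - d) - real j * d) 0) d = 0" using d by simp
    qed
    have 1: "\<bar>\<kappa> d - \<kappa> 0\<bar> \<le> L * \<bar>d - 0\<bar>" "\<bar>\<kappa> t - \<kappa> 0\<bar> \<le> L * \<bar>t - 0\<bar>"
      using d Suc.prems(2,3) nd by (intro Suc.prems(1); simp add: distrib_right)+
    have "\<bar>(\<kappa> d - \<kappa> 0) / d * t\<bar> = \<bar>\<kappa> d - \<kappa> 0\<bar> * (t / d)" using d Suc.prems(2) by (simp add: abs_mult)
    also have "\<dots> \<le> (L * d) * 1" using 1(1) d True Suc.prems(2) L0 by (intro mult_mono) auto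
    finally have 2: "\<bar>(\<kappa> d - \<kappa> 0) / d * t\<bar> \<le> L * d" by simp
    have "L * t \<le> L * d" using L0 True by (rule mult_left_mono[rotated])
    then have "\<bar>\<kappa> t - \<kappa> 0\<bar> \<le> L * d" using 1(2) Suc.prems(2) by simp
    then have "\<bar>(\<kappa> d - \<kappa> 0) / d * t - (\<kappa> t - \<kappa> 0)\<bar> \<le> L * d + L * d"
      using 2 abs_triangle_ineq4 by (meson add_mono order_trans)
    then show ?thesis unfolding eq \<open>S = 0\<close> using True by (simp add: min_absorb1)
  next
    case False
    have "\<bar>S - (\<kappa>' (t - d) - \<kappa>' 0)\<bar> \<le> 2 * L * d" unfolding S_def
    proof (rule Suc.IH)
      fix s s' assume s: "0 \<le> s" "s \<le> real n * d" "0 \<le> s'" "s' \<le> real n * d"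
      have "\<bar>\<kappa> (s + d) - \<kappa> (s' + d)\<bar> \<le> L * \<bar>(s + d) - (s' + d)\<bar>"
        using s d by (intro Suc.prems(1)) (auto simp: distrib_right)
      then show "\<bar>\<kappa>' s - \<kappa>' s'\<bar> \<le> L * \<bar>s - s'\<bar>" by (simp add: \<kappa>'_def)
    qed (use False Suc.prems(3) in \<open>auto simp: distrib_right\<close>)
    moreover have "\<kappa>' (t - d) - \<kappa>' 0 = \<kappa> t - \<kappa> d" by (simp add: \<kappa>'_def)
    moreover have "(\<kappa> d - \<kappa> 0) / d * min t d = \<kappa> d - \<kappa> 0" using False d by simp
    ultimately show ?thesis unfolding eq by (simp add: algebra_simps)
  qed
qed

text \<open>Piecewise linear interpolants of \<kappa> have slopes at most \<open>L\<close>, converge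
  uniformly and vanish where \<open>f\<close> does; lower semicontinuity carries the energy bound to
  the limit.\<close>

lemma C_lipschitz_nonneg:
  assumes f: "f \<in> \<C>" "\<And>x. 0 \<le> f x" "\<And>x. f x \<le> M" and \<kappa>0: "\<kappa> 0 = 0"
    and lip: "\<And>s t. 0 \<le> s \<Longrightarrow> s \<le> M \<Longrightarrow> 0 \<le> t \<Longrightarrow> t \<le> M \<Longrightarrow> \<bar>\<kappa> s - \<kappa> t\<bar> \<le> L * \<bar>s - t\<bar>"
    and M: "0 < M"
  shows "(\<lambda>x. \<kappa> (f x)) \<in> \<C>" "\<E> (\<lambda>x. \<kappa> (f x)) \<le> L powr p * \<E> f"
proof -
  obtain K where K: "compact K" "\<And>x. x \<notin> K \<Longrightarrow> f x = 0" using f(1) by (auto elim: C_cE)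
  have L0: "L \<ge> 0"
  proof -
    have "0 \<le> L * \<bar>0 - M\<bar>" using lip[of 0 M] M by linarith
    then show ?thesis using M by (simp add: zero_le_mult_iff)
  qed
  have "L-lipschitz_on {0..M} \<kappa>"
    using lip L0 by (auto simp: lipschitz_on_def dist_real_def)
  then have "continuous_on {0..M} \<kappa>" by (rule lipschitz_on_continuous_on)
  then have cont: "continuous_on UNIV (\<lambda>x. \<kappa> (f x))"
    using f by (intro continuous_on_compose2[of "{0..M}" \<kappa> UNIV f] C_continuous) auto
  have approx: "\<exists>v\<in>\<C>. (\<forall>x. \<bar>v x - \<kappa> (f x)\<bar> \<le> \<epsilon>) \<and> (\<forall>x. x \<notin> K \<longrightarrow> v x = 0) \<and> \<E> v \<le> L powr p * \<E> f" if \<epsilon>: "\<epsilon> > 0" for \<epsilon>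
  proof -
    obtain n :: nat where n: "real n > 2 * L * M / \<epsilon>" "n > 0"
      by (metis gr0I less_nat_zero_code of_nat_0_less_iff reals_Archimedean2 max_less_iff_conj)
    define d where "d = M / real n"
    have d: "d > 0" "real n * d = M" using M n(2) by (auto simp: d_def)
    define v where "v x = (\<Sum>j<n. (\<kappa> (real (Suc j) * d) - \<kappa> (real j * d)) / d * min (max (f x - real j * d) 0) d)" for x
    have "\<bar>(\<kappa> (real (Suc j) * d) - \<kappa> (real j * d)) / d\<bar> \<le> L" if j: "j < n" for j
    proof -
      have "real (Suc j) * d \<le> M" unfolding d(2)[symmetric] using j d(1) by (intro mult_right_mono) auto
      moreover have "real j * d \<le> M" unfolding d(2)[symmetric] using j d(1) by (intro mult_right_mono) auto
      ultimately have "\<bar>\<kappa> (real (Suc j) * d) - \<kappa> (real j * d)\<bar> \<le> L * \<bar>real (Suc j) * d - real j * d\<bar>"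
        using d(1) by (intro lip) auto
      also have "\<bar>real (Suc j) * d - real j * d\<bar> = d" using d(1) by (simp add: algebra_simps)
      finally show ?thesis using d(1) by (simp add: divide_le_eq)
    qed
    note E = E_interpolation[OF f(1,2), of d n "\<lambda>j. (\<kappa> (real (Suc j) * d) - \<kappa> (real j * d)) / d" L, OF less_imp_le[OF d(1)] this]
    have vC: "v \<in> \<C>" "\<E> v \<le> L powr p * \<E> f" using E unfolding v_def[abs_def] by auto
    have "\<bar>v x - (\<kappa> (f x) - \<kappa> 0)\<bar> \<le> 2 * L * d" for x
      unfolding v_def by (rule interpolation_close[OF d(1) L0]) (use f lip d(2) in auto)
    moreover have "2 * L * d \<le> \<epsilon>" using n \<epsilon> by (simp add: d_def field_simps)
    ultimately have "\<forall>x. \<bar>v x - \<kappa> (f x)\<bar> \<le> \<epsilon>" using \<kappa>0 by (auto intro: order_trans)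
    moreover have "v x = 0" if "x \<notin> K" for x unfolding v_def K(2)[OF that]
    proof (intro sum.neutral ballI)
      fix j assume "j \<in> {..<n}"
      have "0 \<le> real j * d" using d by simp
      then show "(\<kappa> (real (Suc j) * d) - \<kappa> (real j * d)) / d * min (max (0 - real j * d) 0) d = 0" using d(1) by simp
    qed
    ultimately show ?thesis using vC by blast
  qed
  show "(\<lambda>x. \<kappa> (f x)) \<in> \<C>" "\<E> (\<lambda>x. \<kappa> (f x)) \<le> L powr p * \<E> f"
    using lower_semicontinuity[OF cont K(1) _ approx] K(2) \<kappa>0 by auto
qed

text \<open>Since \<open>\<kappa> 0 = 0\<close>, the composition splits into disjoint contributions
  of the positive and the negative part of \<open>f\<close>.\<close>

proposition C_lipschitz:
  assumes f: "f \<in> \<C>" "\<And>x. \<bar>f x\<bar> \<le> M" and \<kappa>0: "\<kappa> 0 = 0"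
    and lip: "\<And>s t. \<bar>s\<bar> \<le> M \<Longrightarrow> \<bar>t\<bar> \<le> M \<Longrightarrow> \<bar>\<kappa> s - \<kappa> t\<bar> \<le> L * \<bar>s - t\<bar>"
  shows "(\<lambda>x. \<kappa> (f x)) \<in> \<C>" "\<E> (\<lambda>x. \<kappa> (f x)) \<le> L powr p * \<E> f"
proof -
  have "(\<lambda>x. \<kappa> (f x)) \<in> \<C> \<and> \<E> (\<lambda>x. \<kappa> (f x)) \<le> L powr p * \<E> f"
  proof (cases "M > 0")
    case False
    then have "f x = 0" for x using f(2)[of x] by linarith
    then have "(\<lambda>x. \<kappa> (f x)) = (\<lambda>x. 0)" using \<kappa>0 by auto
    then show ?thesis using C_zero E_zero E_nonneg f by auto
  next
    case True
    have fb: "f x \<le> M" "- f x \<le> M" for x using f(2)[of x] by (auto simp: abs_le_iff)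
    have c: "(\<lambda>x. max (f x) 0) \<in> \<C>" "(\<lambda>x. max (- f x) 0) \<in> \<C>" by (intro C_closed f)+
    have p1: "(\<lambda>x. \<kappa> (max (f x) 0)) \<in> \<C>" "\<E> (\<lambda>x. \<kappa> (max (f x) 0)) \<le> L powr p * \<E> (\<lambda>x. max (f x) 0)"
      by (rule C_lipschitz_nonneg[OF c(1), of M]; use fb True \<kappa>0 in \<open>auto intro!: lip\<close>)+
    have lip': "\<bar>\<kappa> (- s) - \<kappa> (- t)\<bar> \<le> L * \<bar>s - t\<bar>" if "\<bar>s\<bar> \<le> M" "\<bar>t\<bar> \<le> M" for s t
      using lip[of "-s" "-t"] that by (simp add: abs_minus_commute)
    have p2: "(\<lambda>x. \<kappa> (- max (- f x) 0)) \<in> \<C>" "\<E> (\<lambda>x. \<kappa> (- max (- f x) 0)) \<le> L powr p * \<E> (\<lambda>x. max (- f x) 0)"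
      by (rule C_lipschitz_nonneg[OF c(2), of M "\<lambda>t. \<kappa> (- t)"]; use fb True \<kappa>0 in \<open>auto intro!: lip'\<close>)+
    have e: "(\<lambda>x. \<kappa> (f x)) = (\<lambda>x. \<kappa> (max (f x) 0) + \<kappa> (- max (- f x) 0))"
      using \<kappa>0 by (auto simp: fun_eq_iff max_def)
    have "\<E> (\<lambda>x. \<kappa> (max (f x) 0) + \<kappa> (- max (- f x) 0)) = \<E> (\<lambda>x. \<kappa> (max (f x) 0)) + \<E> (\<lambda>x. \<kappa> (- max (- f x) 0))"
      by (rule E_add_disjoint[OF p1(1) p2(1)]) (use \<kappa>0 in \<open>auto simp: max_def\<close>)
    also have "\<dots> \<le> L powr p * \<E> f" unfolding E_pos_neg[OF f(1)] distrib_left by (intro add_mono p1 p2)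
    finally show ?thesis unfolding e using C_add[OF p1(1) p2(1)] by simp
  qed
  then show "(\<lambda>x. \<kappa> (f x)) \<in> \<C>" "\<E> (\<lambda>x. \<kappa> (f x)) \<le> L powr p * \<E> f" by auto
qed

lemma C_contraction:
  assumes f: "f \<in> \<C>" and \<kappa>0: "\<kappa> 0 = 0" and lip: "\<And>s t. \<bar>\<kappa> s - \<kappa> t\<bar> \<le> \<bar>s - t\<bar>"
  shows "(\<lambda>x. \<kappa> (f x)) \<in> \<C>" "\<E> (\<lambda>x. \<kappa> (f x)) \<le> \<E> f"
proof -
  obtain M where M: "\<And>x. \<bar>f x\<bar> \<le> M" using C_c_bounded f by blast
  show "(\<lambda>x. \<kappa> (f x)) \<in> \<C>" "\<E> (\<lambda>x. \<kappa> (f x)) \<le> \<E> f"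
    using C_lipschitz[where \<kappa> = \<kappa> and L = 1, OF f M \<kappa>0] lip by auto
qed

text \<open>Contractions do not increase the energy, so the energy hypothesis of
  \<open>strong_convergence\<close> is automatic and uniform closeness to the identity
  suffices.\<close>

lemma C_contraction_tendsto:
  assumes f: "f \<in> \<C>" and \<kappa>0: "\<And>n. \<kappa> n 0 = 0" and lip: "\<And>n s t. \<bar>\<kappa> n s - \<kappa> n t\<bar> \<le> \<bar>s - t\<bar>"
    and close: "\<And>n t. \<bar>\<kappa> n t - t\<bar> \<le> r n" "(r \<longlongrightarrow> 0) G"
  shows "((\<lambda>n. \<E> (\<lambda>x. \<kappa> n (f x) - f x)) \<longlongrightarrow> 0) G"
proof -
  obtain K where K: "compact K" "\<And>x. x \<notin> K \<Longrightarrow> f x = 0" using f(1) by (auto elim: C_cE)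
  show ?thesis
  proof (rule strong_convergence[OF f _ K(1)])
    show "(\<lambda>x. \<kappa> n (f x)) \<in> \<C>" for n by (rule C_contraction[OF f \<kappa>0 lip])
    show "\<kappa> n (f x) = 0" if "x \<notin> K" for n x using K(2)[OF that] \<kappa>0 by simp
    show "uniform_limit UNIV (\<lambda>n x. \<kappa> n (f x)) f G"
      by (rule uniform_limit_boundI[OF _ close(2)]) (rule close)
    show "\<forall>\<^sub>F n in G. \<E> (\<lambda>x. \<kappa> n (f x)) \<le> \<E> f + \<epsilon>" if "\<epsilon> > 0" for \<epsilon>
      using C_contraction(2)[OF f \<kappa>0 lip] that by (auto intro!: always_eventually intro: add_increasing2)
  qed
qed

section \<open>Invariance of the energy under folding\<close>

lemma C_zigzag: "f \<in> \<C> \<Longrightarrow> \<delta> > 0 \<Longrightarrow> (\<lambda>x. zigzag \<delta> (f x)) \<in> \<C>"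
  by (rule C_contraction) (auto simp: zigzag_0 zigzag_lipschitz)

text \<open>A fold higher than the bound of \<open>f\<close> is |f|. Each halving reflects the layer
  above the middle level, that is, changes the sign of one of two layers that do not
  interact.\<close>

proposition E_zigzag:
  assumes f: "f \<in> \<C>" and d: "\<delta> > 0"
  shows "\<E> (\<lambda>x. zigzag \<delta> (f x)) = \<E> f"
proof -
  obtain M where M: "M > 0" "\<And>x. \<bar>f x\<bar> \<le> M" using C_c_bounded f by blast
  have step: "\<E> (\<lambda>x. zigzag (D / 2 ^ n) (f x)) = \<E> f" if D: "D > 0" "M \<le> D" for D n
  proof (induction n)
    case 0
    have "zigzag D (f x) = \<bar>f x\<bar>" for x using D M(2)[of x] by (intro zigzag_small) auto
    then show ?case using E_abs[OF f] by simp
  next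
    case (Suc n)
    define a where "a = D / 2 ^ n / 2"
    have a: "a > 0" using D by (simp add: a_def)
    define T where "T x = zigzag (2 * a) (f x)" for x
    have T: "T \<in> \<C>" "\<And>x. 0 \<le> T x" unfolding T_def[abs_def] using a by (intro C_zigzag f zigzag_nonneg; simp)+
    have b: "(\<lambda>x. max (T x - a) 0) \<in> \<C>" using T a by (intro C_closed) auto
    have "zigzag a (f x) = min (T x) a + - max (T x - a) 0" for x
      using zigzag_half[of "2 * a" "f x"] a by (simp add: T_def min_def max_def abs_if)
    then have "\<E> (\<lambda>x. zigzag a (f x)) = \<E> (\<lambda>x. min (T x) a) + \<E> (\<lambda>x. - max (T x - a) 0)"
      using E_add_above[OF T less_imp_le[OF a] C_minus[OF b]] by (simp add: max_def split: if_splits)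
    also have "\<dots> = \<E> T" using E_split[OF T less_imp_le[OF a]] E_minus b by auto
    finally show ?case using Suc.IH by (simp add: a_def T_def[abs_def] mult.commute)
  qed
  \<comment> \<open>The starting height \<open>\<delta> * 2 ^ n\<close> dominates \<open>f\<close>
    and becomes \<open>\<delta>\<close> after \<open>n\<close> halvings.\<close>
  obtain n where "M / \<delta> < 2 ^ n" using real_arch_pow[of 2 "M / \<delta>"] by auto
  then have "M \<le> \<delta> * 2 ^ n" using d by (simp add: field_simps)
  then show ?thesis using step[of "\<delta> * 2 ^ n" n] d by simp
qed

end

section \<open>Locality for triples\<close>

text \<open>Mostly used through \<open>t - clip r t\<close>, the soft threshold: a contraction
  within \<open>r\<close> of the identity that vanishes for |t| \<le> r and thereby opens a gap
  around a level.\<close>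

definition clip :: "real \<Rightarrow> real \<Rightarrow> real" where
  "clip r t = max (- r) (min t r)"

lemma clip_0: "0 \<le> r \<Longrightarrow> clip r 0 = 0"
  by (simp add: clip_def)

lemma abs_clip_le: "0 \<le> r \<Longrightarrow> \<bar>clip r t\<bar> \<le> r"
  by (auto simp: clip_def)

lemma clip_id: "\<bar>t\<bar> \<le> r \<Longrightarrow> clip r t = t"
  by (auto simp: clip_def)

lemma minus_clip_lipschitz: "0 \<le> r \<Longrightarrow> \<bar>(s - clip r s) - (t - clip r t)\<bar> \<le> \<bar>s - t\<bar>"
  by (auto simp: clip_def max_def min_def)

text \<open>
  The part of a folded function \<open>u\<close> lying under the \<open>k\<close>-th tooth of a function \<open>t\<close>. Subtracting
  it from \<open>u\<close> leaves a function vanishing near \<open>t = (2 k + 1) \<delta>\<close>, which can be cut there.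
\<close>

definition tooth :: "real \<Rightarrow> nat \<Rightarrow> real \<Rightarrow> real \<Rightarrow> real" where
  "tooth \<delta> k u t = (if 2 * real k * \<delta> < t \<and> t \<le> 2 * real (Suc k) * \<delta> then min u (2 * zigzag \<delta> t) else 0)"

context p_energy_space
begin

lemma N_min_le: assumes "f \<in> \<C>" "g \<in> \<C>" shows "N (\<lambda>x. min (f x) (g x)) \<le> N f + N g"
proof -
  have c: "(\<lambda>x. f x - g x) \<in> \<C>" "(\<lambda>x. f x + g x) \<in> \<C>" "(\<lambda>x. \<bar>f x - g x\<bar>) \<in> \<C>"
    by (intro C_closed assms)+
  have e: "(\<lambda>x. min (f x) (g x)) = (\<lambda>x. (1/2) * ((f x + g x) - \<bar>f x - g x\<bar>))" by (auto simp: fun_eq_iff min_def)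
  have "N (\<lambda>x. (1/2) * ((f x + g x) - \<bar>f x - g x\<bar>)) = \<bar>1/2\<bar> * N (\<lambda>x. (f x + g x) - \<bar>f x - g x\<bar>)"
    using C_diff[OF c(2,3)] by (intro N_scale) auto
  also have "\<dots> \<le> \<bar>1/2\<bar> * (N (\<lambda>x. f x + g x) + N (\<lambda>x. \<bar>f x - g x\<bar>))"
    using c by (intro mult_left_mono N_diff) auto
  also have "N (\<lambda>x. \<bar>f x - g x\<bar>) = N (\<lambda>x. f x - g x)" unfolding N_def E_abs[OF c(1)] ..
  also have "\<bar>1/2\<bar> * (N (\<lambda>x. f x + g x) + N (\<lambda>x. f x - g x)) \<le> \<bar>1/2\<bar> * ((N f + N g) + (N f + N g))"
    using assms by (intro mult_left_mono add_mono N_diff N_add) auto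
  finally show ?thesis unfolding e by simp
qed

text \<open>The capped function \<open>w\<close> vanishes at the levels \<open>2 k \<delta>\<close>
  of \<open>h\<close>, so it can be cut there into disjoint teeth. Their energies add up to at most
  that of \<open>w\<close>, which is bounded independently of \<delta> because folding
  \<open>h\<close> preserves its energy.\<close>

lemma sum_E_tooth:
  assumes f: "f \<in> \<C>" "\<And>x. 0 \<le> f x" and h: "h \<in> \<C>" "\<And>x. 0 \<le> h x" and d: "\<delta> > 0"
  shows "(\<lambda>x. tooth \<delta> k (f x) (h x)) \<in> \<C>"
    and "(\<Sum>k<n. \<E> (\<lambda>x. tooth \<delta> k (f x) (h x))) \<le> (N f + 2 * N h) powr p"
proof -
  define w where "w x = min (f x) (2 * zigzag \<delta> (h x))" for x
  have zC: "(\<lambda>x. 2 * zigzag \<delta> (h x)) \<in> \<C>" by (intro C_scale C_zigzag h d)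
  have wC: "w \<in> \<C>" unfolding w_def[abs_def] by (intro C_min f zC)
  have w0: "0 \<le> w x" for x using f(2) zigzag_nonneg by (simp add: w_def)
  have wle: "w x \<le> 2 * (h x - 2 * real k * \<delta>)" if "2 * real k * \<delta> < h x" for x k
    using zigzag_le_dist[OF d, of "h x" "int k"] that by (simp add: w_def mult.commute mult.left_commute min_le_iff_disj)
  \<comment> \<open>Just above the level, \<open>w\<close> lies below a steep function of
    \<open>h\<close>; so the restriction of \<open>w\<close> to the set above the level is a minimum
    of core functions.\<close>
  define W where "W k x = min (w x) (2 * max (h x - 2 * real k * \<delta>) 0)" for k x
  have WC: "W k \<in> \<C>" for k unfolding W_def[abs_def] using d by (intro C_closed wC h) simp
  have W: "W k x = (if 2 * real k * \<delta> < h x then w x else 0)" for k x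
    using wle[of k x] w0[of x] by (auto simp: W_def)
  have mono: "2 * real k * \<delta> \<le> 2 * real (Suc k) * \<delta>" for k using d by simp
  have t: "tooth \<delta> k (f x) (h x) = W k x - W (Suc k) x" for k x
    using mono[of k] unfolding W tooth_def by (auto simp: w_def)
  show tC: "(\<lambda>x. tooth \<delta> k (f x) (h x)) \<in> \<C>" for k unfolding t by (intro C_diff WC)
  have step: "\<E> (W k) = \<E> (\<lambda>x. tooth \<delta> k (f x) (h x)) + \<E> (W (Suc k))" for k
  proof -
    have "\<E> (\<lambda>x. tooth \<delta> k (f x) (h x) + W (Suc k) x) = \<E> (\<lambda>x. tooth \<delta> k (f x) (h x)) + \<E> (W (Suc k))"
    proof (rule E_add_disjoint[OF tC WC])
      show "tooth \<delta> k (f x) (h x) = 0 \<or> W (Suc k) x = 0" for x by (auto simp: tooth_def W)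
    qed
    then show ?thesis by (simp add: t)
  qed
  have "\<E> (W 0) = (\<Sum>k<n. \<E> (\<lambda>x. tooth \<delta> k (f x) (h x))) + \<E> (W n)"
  proof (induction n)
    case (Suc n)
    then show ?case using step[of n] by simp
  qed simp
  moreover have "0 \<le> \<E> (W n)" using WC[of n] by (intro E_nonneg) auto
  ultimately have "(\<Sum>k<n. \<E> (\<lambda>x. tooth \<delta> k (f x) (h x))) \<le> \<E> (W 0)" by linarith
  also have "W 0 = w"
  proof
    fix x show "W 0 x = w x" using h(2)[of x] f(2)[of x] by (cases "h x = 0") (auto simp: W w_def zigzag_0)
  qed
  also have "\<E> w = N w powr p" using wC by (intro E_eq_N) auto
  also have "\<dots> \<le> (N f + 2 * N h) powr p"
  proof (rule powr_mono2)
    have "N (\<lambda>x. 2 * zigzag \<delta> (h x)) = \<bar>2\<bar> * N (\<lambda>x. zigzag \<delta> (h x))"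
      using C_zigzag[OF h(1) d] by (intro N_scale) auto
    also have "N (\<lambda>x. zigzag \<delta> (h x)) = N h" by (simp only: N_def E_zigzag[OF h(1) d])
    finally show "N w \<le> N f + 2 * N h" using N_min_le[OF f(1) zC] by (simp add: w_def[abs_def])
  qed (use p N_nonneg in auto)
  finally show "(\<Sum>k<n. \<E> (\<lambda>x. tooth \<delta> k (f x) (h x))) \<le> (N f + 2 * N h) powr p" .
qed

text \<open>The steepness 2 of the teeth pays off here: for \<open>h\<close> between (2 k + 1)
  \<delta> and (2 k + 1) \<delta> + \<delta> / 2 the cap exceeds the bound \<delta> of
  \<open>f\<close>, so nothing is left of \<open>f\<close> there. The part beyond the cut is then
  again a minimum with a function of \<open>h\<close>, hence in the core.\<close>

lemma E_cut:
  assumes f: "f \<in> \<C>" "\<And>x. 0 \<le> f x" "\<And>x. f x \<le> \<delta>" and h: "h \<in> \<C>" "\<And>x. 0 \<le> h x" and d: "\<delta> > 0"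
    and fh: "fh = (\<lambda>x. f x - tooth \<delta> k (f x) (h x))"
  shows "\<E> fh = \<E> (\<lambda>x. if (2 * real k + 1) * \<delta> < h x then fh x else 0)
    + \<E> (\<lambda>x. if (2 * real k + 1) * \<delta> < h x then 0 else fh x)"
proof -
  define c where "c = (2 * real k + 1) * \<delta>"
  have c0: "c \<ge> 0" using d by (simp add: c_def)
  have fhC: "fh \<in> \<C>" unfolding fh by (intro C_diff f sum_E_tooth h d)
  have t0: "0 \<le> tooth \<delta> k (f x) (h x)" "tooth \<delta> k (f x) (h x) \<le> f x" for x
    using f(2)[of x] zigzag_nonneg[of \<delta> "h x"] by (auto simp: tooth_def)
  have fb: "0 \<le> fh x" "fh x \<le> \<delta>" for x using t0[of x] f(3)[of x] by (auto simp: fh)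
  have plateau: "fh x = 0" if "c < h x" "h x \<le> c + \<delta> / 2" for x
  proof -
    have b: "2 * real k * \<delta> < h x" "h x \<le> 2 * real (Suc k) * \<delta>" using that d by (auto simp: c_def algebra_simps)
    have "zigzag \<delta> (h x) = \<bar>h x - 2 * \<delta> * of_int (int (Suc k))\<bar>"
      using that d by (intro zigzag_eqI) (auto simp: c_def algebra_simps abs_if)
    also have "\<dots> \<ge> \<delta> / 2" using that d by (simp add: c_def algebra_simps abs_if)
    finally have "f x \<le> 2 * zigzag \<delta> (h x)" using f(3)[of x] by simp
    then show ?thesis using b by (simp add: fh tooth_def)
  qed
  define P where "P x = (if c < h x then fh x else 0)" for x
  have Peq: "P x = min (fh x) (2 * max (h x - c) 0)" for x
    using fb[of x] plateau[of x] by (cases "h x \<le> c + \<delta> / 2") (auto simp: P_def)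
  have PC: "P \<in> \<C>" unfolding Peq[abs_def] by (intro C_closed fhC h c0)
  have QC: "(\<lambda>x. fh x - P x) \<in> \<C>" by (intro C_diff fhC PC)
  have "\<E> (\<lambda>x. P x + (fh x - P x)) = \<E> P + \<E> (\<lambda>x. fh x - P x)"
    by (rule E_add_disjoint[OF PC QC]) (auto simp: P_def)
  moreover have "(\<lambda>x. fh x - P x) = (\<lambda>x. if c < h x then 0 else fh x)" by (auto simp: P_def)
  ultimately show ?thesis by (simp add: P_def[abs_def] c_def)
qed

text \<open>
  After folding, all four functions are uniformly small, so they can be cut along a level set of
  \<open>h\<close> at small cost (a pigeonhole argument selects the level). The pieces then match up in pairs.
\<close>

lemma E_triple_separated:
  assumes C: "g \<in> \<C>" "a \<in> \<C>" "b \<in> \<C>" "h \<in> \<C>" and h0: "\<And>x. 0 \<le> h x" and \<epsilon>: "\<epsilon> > 0"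
    and a: "\<And>x. a x \<noteq> 0 \<Longrightarrow> \<epsilon> \<le> h x" and b: "\<And>x. b x \<noteq> 0 \<Longrightarrow> h x = 0"
  shows "\<E> (\<lambda>x. g x + a x + b x) + \<E> g = \<E> (\<lambda>x. g x + a x) + \<E> (\<lambda>x. g x + b x)"
proof -
  define S where "S G = (N G + 2 * N h) powr p" for G
  define G1 where "G1 x = g x + a x + b x" for x
  define G3 where "G3 x = g x + a x" for x
  define G4 where "G4 x = g x + b x" for x
  have GC: "G1 \<in> \<C>" "G3 \<in> \<C>" "G4 \<in> \<C>"
    unfolding G1_def[abs_def] G3_def[abs_def] G4_def[abs_def] by (intro C_add C)+
  define T where "T = S G1 + S g + S G3 + S G4"
  \<comment> \<open>With this width \<open>n + 1\<close> teeth fill the range of \<open>h\<close>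
    from \<open>0\<close> to \<open>\<epsilon>\<close>, in whose interior both \<open>a\<close> and
    \<open>b\<close> vanish.\<close>
  define \<delta> where "\<delta> n = \<epsilon> / (2 * real (Suc n))" for n
  have d: "\<delta> n > 0" for n using \<epsilon> by (simp add: \<delta>_def)
  define Z where "Z n G x = zigzag (\<delta> n) (G x)" for n and G :: "'a \<Rightarrow> real" and x
  have Z: "Z n G \<in> \<C>" "0 \<le> Z n G x" "Z n G x \<le> \<delta> n" "\<E> (Z n G) = \<E> G" "N (Z n G) = N G" if "G \<in> \<C>" for n G x
    unfolding Z_def[abs_def] using C_zigzag[OF that d] E_zigzag[OF that d] zigzag_nonneg zigzag_le[OF d] by (auto simp: N_def)
  define E\<^sub>t where "E\<^sub>t n k G = \<E> (\<lambda>x. tooth (\<delta> n) k (Z n G x) (h x))" for n k G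
  have Et0: "0 \<le> E\<^sub>t n k G" if "G \<in> \<C>" for n k G
    unfolding E\<^sub>t_def using sum_E_tooth(1)[OF Z(1,2)[OF that] C(4) h0 d] that by (intro E_nonneg) auto
  have sumt: "(\<Sum>k<Suc n. E\<^sub>t n k G) \<le> S G" if "G \<in> \<C>" for n G
  proof -
    have "Z n G \<in> \<C>" "\<And>x. 0 \<le> Z n G x" by (rule Z[OF that])+
    from sum_E_tooth(2)[OF this C(4) h0 d[of n], of "Suc n"] show ?thesis
      unfolding E\<^sub>t_def S_def Z(5)[OF that] .
  qed
  \<comment> \<open>Otherwise the \<open>n + 1\<close> teeth together would carry more than
    \<open>T\<close>, which does not depend on \<open>n\<close>.\<close>
  have "\<exists>k\<le>n. E\<^sub>t n k G1 + E\<^sub>t n k g + E\<^sub>t n k G3 + E\<^sub>t n k G4 \<le> T / real (Suc n)" for n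
  proof (rule ccontr)
    assume "\<not> ?thesis"
    then have "T / real (Suc n) < E\<^sub>t n k G1 + E\<^sub>t n k g + E\<^sub>t n k G3 + E\<^sub>t n k G4" if "k \<in> {..<Suc n}" for k
      using that by (meson lessThan_iff less_Suc_eq_le not_le)
    then have "(\<Sum>k<Suc n. T / real (Suc n)) < (\<Sum>k<Suc n. E\<^sub>t n k G1 + E\<^sub>t n k g + E\<^sub>t n k G3 + E\<^sub>t n k G4)"
      by (intro sum_strict_mono) auto
    also have "\<dots> = (\<Sum>k<Suc n. E\<^sub>t n k G1) + (\<Sum>k<Suc n. E\<^sub>t n k g) + (\<Sum>k<Suc n. E\<^sub>t n k G3) + (\<Sum>k<Suc n. E\<^sub>t n k G4)"
      by (simp only: sum.distrib)
    also have "\<dots> \<le> T" unfolding T_def by (intro add_mono sumt GC C)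
    finally show False by simp
  qed
  then obtain k where k: "\<And>n. k n \<le> n"
    "\<And>n. E\<^sub>t n (k n) G1 + E\<^sub>t n (k n) g + E\<^sub>t n (k n) G3 + E\<^sub>t n (k n) G4 \<le> T / real (Suc n)" by metis
  define H where "H n G x = Z n G x - tooth (\<delta> n) (k n) (Z n G x) (h x)" for n and G :: "'a \<Rightarrow> real" and x
  \<comment> \<open>Folding keeps the energy, and the removed tooth is cheap.\<close>
  have lim: "(\<lambda>n. \<E> (H n G)) \<longlonglongrightarrow> \<E> G" if G: "G \<in> \<C>" and Gk: "\<And>n. E\<^sub>t n (k n) G \<le> T / real (Suc n)" for G
  proof -
    have tC: "(\<lambda>x. tooth (\<delta> n) (k n) (Z n G x) (h x)) \<in> \<C>" for n
      by (rule sum_E_tooth(1)[OF Z(1,2)[OF G] C(4) h0 d])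
    have HC: "H n G \<in> \<C>" for n unfolding H_def[abs_def] by (intro C_diff Z(1)[OF G] tC)
    have "(\<lambda>n. E\<^sub>t n (k n) G) \<longlonglongrightarrow> 0"
      by (rule tendsto_sandwich[OF _ _ tendsto_const LIMSEQ_const_over_Suc[of T]]) (use Gk Et0[OF G] in auto)
    then have "(\<lambda>n. N (\<lambda>x. tooth (\<delta> n) (k n) (Z n G x) (h x))) \<longlonglongrightarrow> 0"
      using N_tendsto_iff[of "\<lambda>n x. tooth (\<delta> n) (k n) (Z n G x) (h x)"] tC by (simp add: E\<^sub>t_def)
    moreover have "\<bar>N (H n G) - N G\<bar> \<le> N (\<lambda>x. tooth (\<delta> n) (k n) (Z n G x) (h x))" for n
    proof -
      have "\<bar>N (Z n G) - N (H n G)\<bar> \<le> N (\<lambda>x. Z n G x - H n G x)" using Z(1)[OF G] HC by (intro N_triangle_rev) auto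
      then show ?thesis by (simp add: H_def Z(5)[OF G] abs_minus_commute)
    qed
    ultimately have "(\<lambda>n. N (H n G) - N G) \<longlonglongrightarrow> 0"
      by (intro Lim_null_comparison[of "\<lambda>n. N (H n G) - N G"]) auto
    then have "(\<lambda>n. N (H n G)) \<longlonglongrightarrow> N G" by (simp add: LIM_zero_iff)
    then have "(\<lambda>n. N (H n G) powr p) \<longlonglongrightarrow> N G powr p"
      using p by (intro tendsto_powr' tendsto_const disjI2 conjI) (auto simp: N_nonneg)
    then show ?thesis using HC G by (simp add: E_eq_N)
  qed
  have eq: "\<E> (H n G1) + \<E> (H n g) = \<E> (H n G3) + \<E> (H n G4)" for n
  proof -
    define c where "c = (2 * real (k n) + 1) * \<delta> n"
    have c: "0 < c" "c < \<epsilon>"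
    proof -
      show "0 < c" using d[of n] by (simp add: c_def add_nonneg_pos)
      have "c < (2 * real (Suc n)) * \<delta> n" unfolding c_def using k(1)[of n] d[of n] by (intro mult_strict_right_mono) auto
      also have "\<dots> = \<epsilon>" unfolding \<delta>_def by (simp del: of_nat_Suc)
      finally show "c < \<epsilon>" .
    qed
    have cut: "\<E> (H n G) = \<E> (\<lambda>x. if c < h x then H n G x else 0) + \<E> (\<lambda>x. if c < h x then 0 else H n G x)" if "G \<in> \<C>" for G
      unfolding c_def by (rule E_cut[OF Z(1,2,3)[OF that] C(4) h0 d]) (simp add: H_def[abs_def])
    have Hcong: "H n G x = H n G' x" if "G x = G' x" for G G' x using that by (simp add: H_def Z_def)
    \<comment> \<open>Above the cut \<open>b\<close> vanishes, below it \<open>a\<close> does, so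
      the four functions agree in pairs on either side.\<close>
    have hi: "G1 x = G3 x" "g x = G4 x" if "c < h x" for x
      using b[of x] that c(1) by (auto simp: G1_def G3_def G4_def)
    have lo: "G1 x = G4 x" "g x = G3 x" if "\<not> c < h x" for x
      using a[of x] that c(2) by (auto simp: G1_def G3_def G4_def)
    have e1: "(\<lambda>x. if c < h x then H n G1 x else 0) = (\<lambda>x. if c < h x then H n G3 x else 0)"
      "(\<lambda>x. if c < h x then H n g x else 0) = (\<lambda>x. if c < h x then H n G4 x else 0)"
      by (auto intro!: Hcong hi)
    have e2: "(\<lambda>x. if c < h x then 0 else H n G1 x) = (\<lambda>x. if c < h x then 0 else H n G4 x)"
      "(\<lambda>x. if c < h x then 0 else H n g x) = (\<lambda>x. if c < h x then 0 else H n G3 x)"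
      by (auto intro!: Hcong lo)
    show ?thesis unfolding cut[OF GC(1)] cut[OF GC(2)] cut[OF GC(3)] cut[OF C(1)] e1 e2 by simp
  qed
  have Gk: "E\<^sub>t n (k n) G1 \<le> T / real (Suc n)" "E\<^sub>t n (k n) g \<le> T / real (Suc n)"
    "E\<^sub>t n (k n) G3 \<le> T / real (Suc n)" "E\<^sub>t n (k n) G4 \<le> T / real (Suc n)" for n
    using k(2)[of n] Et0[OF GC(1), of n "k n"] Et0[OF GC(2), of n "k n"] Et0[OF GC(3), of n "k n"] Et0[OF C(1), of n "k n"]
    by linarith+
  have l1: "(\<lambda>n. \<E> (H n G1) + \<E> (H n g)) \<longlonglongrightarrow> \<E> G1 + \<E> g"
    by (intro tendsto_add lim GC C Gk)
  have l2: "(\<lambda>n. \<E> (H n G3) + \<E> (H n G4)) \<longlonglongrightarrow> \<E> G3 + \<E> G4"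
    by (intro tendsto_add lim GC C Gk)
  have "\<E> G1 + \<E> g = \<E> G3 + \<E> G4" using LIMSEQ_unique[OF l1] l2 unfolding eq by simp
  then show ?thesis by (simp add: G1_def[abs_def] G3_def[abs_def] G4_def[abs_def])
qed

text \<open>Disjointness without a gap: the soft threshold of \<open>a\<close> is nonzero only where
  |a| is at least \<open>r n\<close>, so |a| can serve as the separating function.\<close>

lemma E_triple:
  assumes C: "g \<in> \<C>" "a \<in> \<C>" "b \<in> \<C>" and disj: "\<And>x. a x = 0 \<or> b x = 0"
  shows "\<E> (\<lambda>x. g x + a x + b x) + \<E> g = \<E> (\<lambda>x. g x + a x) + \<E> (\<lambda>x. g x + b x)"
proof -
  define r where "r n = 1 / real (Suc n)" for n
  have r: "r n > 0" "r \<longlonglongrightarrow> 0" for n using LIMSEQ_const_over_Suc[of 1] by (auto simp: r_def[abs_def])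
  define A where "A n x = a x - clip (r n) (a x)" for n x
  have AC: "A n \<in> \<C>" for n unfolding A_def
    by (rule C_contraction[OF C(2)]) (use r(1)[of n] in \<open>auto simp: clip_0 less_imp_le minus_clip_lipschitz\<close>)
  have lim: "(\<lambda>n. \<E> (\<lambda>x. A n x - a x)) \<longlonglongrightarrow> 0" unfolding A_def
    by (rule C_contraction_tendsto[OF C(2) _ _ _ r(2), of "\<lambda>n t. t - clip (r n) t"])
      (use r(1) in \<open>auto simp: clip_0 less_imp_le minus_clip_lipschitz abs_clip_le\<close>)
  have eq: "\<E> (\<lambda>x. g x + A n x + b x) + \<E> g = \<E> (\<lambda>x. g x + A n x) + \<E> (\<lambda>x. g x + b x)" for n
  proof (rule E_triple_separated[OF C(1) AC C(3) C_abs[OF C(2)] _ r(1)])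
    show "r n \<le> \<bar>a x\<bar>" if "A n x \<noteq> 0" for x using that clip_id[of "a x" "r n"] by (force simp: A_def)
    show "\<bar>a x\<bar> = 0" if "b x \<noteq> 0" for x using that disj[of x] by simp
  qed simp
  have l1: "(\<lambda>n. \<E> (\<lambda>x. A n x + (g x + b x))) \<longlonglongrightarrow> \<E> (\<lambda>x. a x + (g x + b x))"
    by (rule E_add_shift_tendsto[OF AC C(2) C_add[OF C(1,3)] lim])
  have l2: "(\<lambda>n. \<E> (\<lambda>x. A n x + g x)) \<longlonglongrightarrow> \<E> (\<lambda>x. a x + g x)"
    by (rule E_add_shift_tendsto[OF AC C(2) C(1) lim])
  have "(\<lambda>n. \<E> (\<lambda>x. A n x + (g x + b x)) + \<E> g) \<longlonglongrightarrow> \<E> (\<lambda>x. a x + (g x + b x)) + \<E> g"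
    by (intro tendsto_intros l1)
  moreover have "(\<lambda>n. \<E> (\<lambda>x. A n x + g x) + \<E> (\<lambda>x. g x + b x)) \<longlonglongrightarrow> \<E> (\<lambda>x. a x + g x) + \<E> (\<lambda>x. g x + b x)"
    by (intro tendsto_intros l2)
  moreover have "\<E> (\<lambda>x. A n x + (g x + b x)) + \<E> g = \<E> (\<lambda>x. A n x + g x) + \<E> (\<lambda>x. g x + b x)" for n
    using eq[of n] by (simp add: add_ac)
  ultimately have "\<E> (\<lambda>x. a x + (g x + b x)) + \<E> g = \<E> (\<lambda>x. a x + g x) + \<E> (\<lambda>x. g x + b x)"
    using LIMSEQ_unique by simp
  then show ?thesis by (simp add: add_ac)
qed

text \<open>With \<open>v\<close> as base and increments \<open>u - v\<close> and
  \<open>w - v\<close>, one increment vanishes at each point and the sum of all three is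
  \<open>z\<close>. Locality is used in this form from here on.\<close>

proposition E_swap:
  assumes C: "u \<in> \<C>" "v \<in> \<C>" "w \<in> \<C>" "z \<in> \<C>"
    and sw: "\<And>x. (u x = v x \<and> w x = z x) \<or> (u x = z x \<and> w x = v x)"
  shows "\<E> u + \<E> w = \<E> v + \<E> z"
proof -
  have c: "(\<lambda>x. u x - v x) \<in> \<C>" "(\<lambda>x. w x - v x) \<in> \<C>" by (intro C_closed C)+
  have "\<E> (\<lambda>x. v x + (u x - v x) + (w x - v x)) + \<E> v = \<E> (\<lambda>x. v x + (u x - v x)) + \<E> (\<lambda>x. v x + (w x - v x))"
  proof (rule E_triple[OF C(2) c])
    show "u x - v x = 0 \<or> w x - v x = 0" for x using sw[of x] by auto
  qed
  moreover have "(\<lambda>x. v x + (u x - v x) + (w x - v x)) = z"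
  proof
    fix x show "v x + (u x - v x) + (w x - v x) = z x" using sw[of x] by auto
  qed
  ultimately show ?thesis by simp
qed

lemma E_modular:
  assumes "f \<in> \<C>" "g \<in> \<C>"
  shows "\<E> (\<lambda>x. max (f x) (g x)) + \<E> (\<lambda>x. min (f x) (g x)) = \<E> f + \<E> g"
  by (rule E_swap[OF C_max[OF assms] assms(1) C_min[OF assms] assms(2)]) auto

text \<open>Modularity bounds the minimum by E(u) + E(h) - E(max u h). As u \<le> \<delta>, the part
  of \<open>h\<close> above \<delta> is a contraction of max u h, so of E(h) only the layer below
  \<delta> remains.\<close>

lemma E_min_le:
  assumes u: "u \<in> \<C>" "\<And>x. u x \<le> \<delta>" and h: "h \<in> \<C>" "\<And>x. 0 \<le> h x" and d: "0 \<le> \<delta>"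
  shows "\<E> (\<lambda>x. min (u x) (h x)) \<le> \<E> u + \<E> (\<lambda>x. min (h x) \<delta>)"
proof -
  have mC: "(\<lambda>x. max (u x) (h x)) \<in> \<C>" by (intro C_closed u h)
  have "max (h x - \<delta>) 0 = max (max (u x) (h x) - \<delta>) 0" for x using u(2)[of x] by (simp add: max_def)
  then have "(\<lambda>x. max (h x - \<delta>) 0) = (\<lambda>x. max (max (u x) (h x) - \<delta>) 0)" by simp
  moreover have "\<E> (\<lambda>x. max (max (u x) (h x) - \<delta>) 0) \<le> \<E> (\<lambda>x. max (u x) (h x))"
    by (rule C_contraction[OF mC, of "\<lambda>t. max (t - \<delta>) 0"]) (use d in auto)
  ultimately show ?thesis using E_modular[OF u(1) h(1)] E_split[OF h d] by simp
qed

lemma E_min_const_tendsto: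
  assumes h: "h \<in> \<C>" "\<And>x. 0 \<le> h x" and r: "\<And>n. 0 \<le> r n" "(r \<longlongrightarrow> 0) G"
  shows "((\<lambda>n. \<E> (\<lambda>x. min (h x) (r n))) \<longlongrightarrow> 0) G"
proof -
  have "((\<lambda>n. \<E> (\<lambda>x. (h x - clip (r n) (h x)) - h x)) \<longlongrightarrow> 0) G"
    by (rule C_contraction_tendsto[OF h(1) _ _ _ r(2), of "\<lambda>n t. t - clip (r n) t"])
      (use r(1) in \<open>auto simp: clip_0 minus_clip_lipschitz abs_clip_le\<close>)
  moreover have "\<E> (\<lambda>x. (h x - clip (r n) (h x)) - h x) = \<E> (\<lambda>x. min (h x) (r n))" for n
  proof -
    have "clip (r n) (h x) = min (h x) (r n)" for x using h(2)[of x] r(1)[of n] by (auto simp: clip_def)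
    then have "(\<lambda>x. (h x - clip (r n) (h x)) - h x) = (\<lambda>x. - min (h x) (r n))" by auto
    then show ?thesis using E_minus C_min_const[OF h(1) r(1)] by simp
  qed
  ultimately show ?thesis by simp
qed

end

section \<open>Energy of a function on a superlevel set\<close>

text \<open>The limit is the supremum of \<open>x n - c n\<close>, which also gives the second
  claim.\<close>

lemma almost_incseq_convergent:
  fixes x c :: "nat \<Rightarrow> real"
  assumes inc: "\<And>n k. n \<le> k \<Longrightarrow> x n \<le> x k + c n" and c: "c \<longlonglongrightarrow> 0" and B: "\<And>n. x n \<le> B"
  shows "convergent x" "x n - c n \<le> lim x"
proof -
  define A where "A = (SUP n. x n - c n)"
  obtain Bc where Bc: "\<And>n. \<bar>c n\<bar> \<le> Bc" using c by (metis convergentI convergent_imp_Bseq Bseq_def real_norm_def)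
  have bdd: "bdd_above (range (\<lambda>n. x n - c n))"
  proof (rule bdd_aboveI2)
    show "x n - c n \<le> B + Bc" for n using B[of n] Bc[of n] by (simp add: abs_le_iff)
  qed
  have le: "x n - c n \<le> A" for n unfolding A_def using bdd by (rule cSUP_upper2[of _ _ n]) auto
  have "x \<longlonglongrightarrow> A"
  proof (rule order_tendstoI)
    fix a assume "a < A"
    then obtain n where n: "a < x n - c n" unfolding A_def less_cSUP_iff[OF UNIV_not_empty bdd] by auto
    have "a < x k" if "n \<le> k" for k using n inc[OF that] by simp
    then show "\<forall>\<^sub>F k in sequentially. a < x k" by (auto simp: eventually_sequentially)
  next
    fix a assume "A < a"
    then have "\<forall>\<^sub>F n in sequentially. c n < a - A" using c by (intro order_tendstoD(2)) auto
    then show "\<forall>\<^sub>F n in sequentially. x n < a"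
    proof eventually_elim
      case (elim n) then show ?case using le[of n] by simp
    qed
  qed
  then show "convergent x" "x n - c n \<le> lim x" using le limI by (auto simp: convergent_def)
qed

context p_energy_space
begin

definition trace_energy :: "nat \<Rightarrow> ('a \<Rightarrow> real) \<Rightarrow> ('a \<Rightarrow> real) \<Rightarrow> real" where
  "trace_energy n f h = \<E> (\<lambda>x. min (zigzag (1 / 2 ^ n) (f x)) (h x))"

text \<open>
  This will be the mass of \<open>{h > 0}\<close> under the energy measure of \<open>f\<close>: folding preserves the energy
  density, and a finely folded \<open>f\<close> lies below \<open>h\<close> on most of that set.
\<close>

definition lam :: "('a \<Rightarrow> real) \<Rightarrow> ('a \<Rightarrow> real) \<Rightarrow> real" where
  "lam f h = lim (\<lambda>n. trace_energy n f h)"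

definition Cp :: "('a \<Rightarrow> real) set" where "Cp = {h \<in> \<C>. \<forall>x. 0 \<le> h x}"

lemma CpD: "h \<in> Cp \<Longrightarrow> h \<in> \<C>" "h \<in> Cp \<Longrightarrow> 0 \<le> h x"
  by (auto simp: Cp_def)

lemma Cp_closed:
  "(\<lambda>x. 0) \<in> Cp"
  "h \<in> Cp \<Longrightarrow> k \<in> Cp \<Longrightarrow> (\<lambda>x. max (h x) (k x)) \<in> Cp"
  "h \<in> Cp \<Longrightarrow> k \<in> Cp \<Longrightarrow> (\<lambda>x. min (h x) (k x)) \<in> Cp"
  "h \<in> Cp \<Longrightarrow> 0 \<le> c \<Longrightarrow> (\<lambda>x. max (h x - c) 0) \<in> Cp"
  "f \<in> \<C> \<Longrightarrow> (\<lambda>x. \<bar>f x\<bar>) \<in> Cp"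
  unfolding Cp_def using C_closed by (auto intro: max.coboundedI1)

lemma dyadic_LIMSEQ: "(\<lambda>n. c / 2 ^ n :: real) \<longlonglongrightarrow> 0"
  using tendsto_mult[OF tendsto_const[of c] LIMSEQ_inverse_realpow_zero[of 2]] by (simp add: divide_inverse)

lemma trunc_energy_tendsto: "h \<in> Cp \<Longrightarrow> 0 \<le> c \<Longrightarrow> (\<lambda>n. \<E> (\<lambda>x. min (h x) (c / 2 ^ n))) \<longlonglongrightarrow> 0"
  by (rule E_min_const_tendsto[OF CpD _ dyadic_LIMSEQ]) auto

lemma trace_C: "f \<in> \<C> \<Longrightarrow> h \<in> Cp \<Longrightarrow> (\<lambda>x. min (zigzag (1 / 2 ^ n) (f x)) (h x)) \<in> \<C>"
  by (rule C_min[OF C_zigzag CpD(1)]) auto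

lemma trace_nonneg: "f \<in> \<C> \<Longrightarrow> h \<in> Cp \<Longrightarrow> 0 \<le> trace_energy n f h"
  unfolding trace_energy_def using trace_C by (intro E_nonneg) blast

lemma trace_le: assumes "f \<in> \<C>" "h \<in> Cp"
  shows "trace_energy n f h \<le> \<E> f + \<E> (\<lambda>x. min (h x) (1 / 2 ^ n))"
  unfolding trace_energy_def
  using E_min_le[of "\<lambda>x. zigzag (1 / 2 ^ n) (f x)" "1 / 2 ^ n" h] C_zigzag[OF assms(1), of "1 / 2 ^ n"] zigzag_le[of "1 / 2 ^ n"] CpD[OF assms(2)]
  by (simp add: E_zigzag[OF assms(1)])

text \<open>Folding the coarse capped function once more at the fine scale keeps its energy. The
  result is the fine capped fold where the cap was inactive, and the fine fold of min h \<delta>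
  elsewhere; \<open>w\<close> completes a swap, and its energy is discarded.\<close>

lemma trace_almost_mono:
  assumes f: "f \<in> \<C>" and h: "h \<in> Cp" and nk: "n \<le> k"
  shows "trace_energy n f h \<le> trace_energy k f h + \<E> (\<lambda>x. min (h x) (1 / 2 ^ n))"
proof -
  define \<delta> :: real where "\<delta> = 1 / 2 ^ n"
  define \<delta>' :: real where "\<delta>' = 1 / 2 ^ k"
  have d: "\<delta> > 0" "\<delta>' > 0" by (auto simp: \<delta>_def \<delta>'_def)
  have dd: "\<delta> = \<delta>' * real (2 ^ (k - n))"
    unfolding of_nat_power of_nat_numeral using nk by (simp add: \<delta>_def \<delta>'_def power_diff)
  have comp: "zigzag \<delta>' (zigzag \<delta> t) = zigzag \<delta>' t" for t unfolding dd using d by (intro zigzag_comp) auto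
  define q where "q x = min (zigzag \<delta> (f x)) (h x)" for x
  have qC: "q \<in> \<C>" unfolding q_def by (rule C_min[OF C_zigzag[OF f d(1)] CpD(1)[OF h]])
  define u where "u x = zigzag \<delta>' (q x)" for x
  define v where "v x = min (zigzag \<delta>' (f x)) (h x)" for x
  define z where "z x = zigzag \<delta>' (min (h x) \<delta>)" for x
  define w where "w x = v x + z x - u x" for x
  have hd: "(\<lambda>x. min (h x) \<delta>) \<in> \<C>" using d by (intro C_min_const CpD(1)[OF h]) simp
  have C: "u \<in> \<C>" "v \<in> \<C>" "z \<in> \<C>" unfolding u_def v_def z_def
    by (rule C_zigzag[OF qC d(2)], rule C_min[OF C_zigzag[OF f d(2)] CpD(1)[OF h]], rule C_zigzag[OF hd d(2)])
  have wC: "w \<in> \<C>" unfolding w_def by (intro C_closed C)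
  have "\<E> u + \<E> w = \<E> v + \<E> z"
  proof (rule E_swap[OF C(1,2) wC C(3)])
    fix x
    show "(u x = v x \<and> w x = z x) \<or> (u x = z x \<and> w x = v x)"
    proof (cases "zigzag \<delta> (f x) \<le> h x")
      case True
      have "zigzag \<delta>' (f x) \<le> \<bar>zigzag \<delta> (f x)\<bar>" using zigzag_le_abs[OF d(2), of "zigzag \<delta> (f x)"] comp by simp
      then have "zigzag \<delta>' (f x) \<le> h x" using True zigzag_nonneg[of \<delta> "f x"] by simp
      then have "u x = v x" using True by (simp add: u_def v_def q_def comp)
      then show ?thesis by (simp add: w_def)
    next
      case False
      then have "u x = z x" using zigzag_le[OF d(1), of "f x"] by (simp add: u_def z_def q_def)
      then show ?thesis by (simp add: w_def)
    qed
  qed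
  moreover have "0 \<le> \<E> w" using wC by (intro E_nonneg) auto
  moreover have "\<E> u = \<E> q" unfolding u_def by (rule E_zigzag[OF qC d(2)])
  moreover have "\<E> z = \<E> (\<lambda>x. min (h x) \<delta>)" unfolding z_def by (rule E_zigzag[OF hd d(2)])
  ultimately show ?thesis by (simp add: trace_energy_def q_def[abs_def] v_def[abs_def] \<delta>_def \<delta>'_def)
qed

lemma
  assumes f: "f \<in> \<C>" and h: "h \<in> Cp"
  shows trace_tendsto: "(\<lambda>n. trace_energy n f h) \<longlonglongrightarrow> lam f h"
    and trace_le_lam: "trace_energy n f h \<le> lam f h + \<E> (\<lambda>x. min (h x) (1 / 2 ^ n))"
proof -
  have bound: "trace_energy n f h \<le> \<E> f + \<E> h" for n
  proof -
    have "(\<lambda>x. max (min (h x) (1 / 2 ^ n)) 0) = (\<lambda>x. min (h x) (1 / 2 ^ n))" using CpD(2)[OF h] by (simp add: max_absorb1)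
    then have "\<E> (\<lambda>x. min (h x) (1 / 2 ^ n)) \<le> \<E> h" using C_trunc(2)[OF CpD(1)[OF h], of "1 / 2 ^ n"] by simp
    then show ?thesis using trace_le[OF f h, of n] by simp
  qed
  note conv = almost_incseq_convergent[of "\<lambda>n. trace_energy n f h", OF trace_almost_mono[OF f h] trunc_energy_tendsto[OF h, of 1] bound]
  show "(\<lambda>n. trace_energy n f h) \<longlonglongrightarrow> lam f h" unfolding lam_def using conv(1) by (simp add: convergent_LIMSEQ_iff)
  show "trace_energy n f h \<le> lam f h + \<E> (\<lambda>x. min (h x) (1 / 2 ^ n))" unfolding lam_def using conv(2)[of n] by simp
qed

lemma lam_le_if_trace_le:
  assumes f: "f \<in> \<C>" and h: "h \<in> Cp" and c: "0 \<le> c"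
    and le: "\<And>n. trace_energy n f h \<le> B + \<E> (\<lambda>x. min (h x) (c / 2 ^ n))"
  shows "lam f h \<le> B"
proof -
  have "(\<lambda>n. B + \<E> (\<lambda>x. min (h x) (c / 2 ^ n))) \<longlonglongrightarrow> B + 0"
    by (intro tendsto_intros trunc_energy_tendsto h c)
  from LIMSEQ_le[OF trace_tendsto[OF f h] this] le show ?thesis by auto
qed

lemma lam_nonneg: "f \<in> \<C> \<Longrightarrow> h \<in> Cp \<Longrightarrow> 0 \<le> lam f h"
  using trace_tendsto trace_nonneg LIMSEQ_le_const by metis

lemma lam_le_E: "f \<in> \<C> \<Longrightarrow> h \<in> Cp \<Longrightarrow> lam f h \<le> \<E> f"
  by (rule lam_le_if_trace_le[of _ _ 1]) (auto simp: trace_le)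

lemma lam_minus: "lam (\<lambda>x. - f x) h = lam f h"
  by (simp add: lam_def trace_energy_def zigzag_minus)

lemma lam_zero: assumes "f \<in> \<C>" shows "lam f (\<lambda>x. 0) = 0"
proof -
  have "trace_energy n f (\<lambda>x. 0) = 0" for n using E_zero by (simp add: trace_energy_def zigzag_nonneg min_absorb2)
  then show ?thesis by (simp add: lam_def)
qed

text \<open>The fold never exceeds |f|, so this cap is inactive: the set where \<open>f\<close> is
  nonzero carries the full mass.\<close>

lemma lam_abs_self: assumes "f \<in> \<C>" shows "lam f (\<lambda>x. \<bar>f x\<bar>) = \<E> f"
proof -
  have "trace_energy n f (\<lambda>x. \<bar>f x\<bar>) = \<E> f" for n
    using E_zigzag[OF assms, of "1 / 2 ^ n"] zigzag_le_abs[of "1 / 2 ^ n"] by (simp add: trace_energy_def min_absorb1)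
  then show ?thesis by (simp add: lam_def)
qed

lemma lam_modular:
  assumes f: "f \<in> \<C>" and h: "h \<in> Cp" "k \<in> Cp"
  shows "lam f (\<lambda>x. max (h x) (k x)) + lam f (\<lambda>x. min (h x) (k x)) = lam f h + lam f k"
proof -
  have "trace_energy n f (\<lambda>x. max (h x) (k x)) + trace_energy n f (\<lambda>x. min (h x) (k x)) = trace_energy n f h + trace_energy n f k" for n
    unfolding trace_energy_def
    by (rule E_swap; (intro trace_C Cp_closed f h)?) (auto simp: max_def min_def)
  moreover have "(\<lambda>n. trace_energy n f (\<lambda>x. max (h x) (k x)) + trace_energy n f (\<lambda>x. min (h x) (k x))) \<longlonglongrightarrow>
      lam f (\<lambda>x. max (h x) (k x)) + lam f (\<lambda>x. min (h x) (k x))"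
    by (intro tendsto_add trace_tendsto f Cp_closed h)
  moreover have "(\<lambda>n. trace_energy n f h + trace_energy n f k) \<longlonglongrightarrow> lam f h + lam f k"
    by (intro tendsto_add trace_tendsto f h)
  ultimately show ?thesis using LIMSEQ_unique by simp
qed

text \<open>Once the height \<open>1 / 2 ^ n\<close> is below \<open>c\<close>, the cap
  \<open>k\<close> is inactive where h > 0, so capping by \<open>h\<close> is the same as capping by
  \<open>k\<close> and then by \<open>h\<close>.\<close>

lemma lam_mono:
  assumes f: "f \<in> \<C>" and h: "h \<in> Cp" "k \<in> Cp" and c: "c > 0" "\<And>x. 0 < h x \<Longrightarrow> c \<le> k x"
  shows "lam f h \<le> lam f k"
proof -
  have "\<forall>\<^sub>F n in sequentially. 1 / 2 ^ n < c" using order_tendstoD(2)[OF dyadic_LIMSEQ c(1), of 1] .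
  then have "\<forall>\<^sub>F n in sequentially. trace_energy n f h \<le> trace_energy n f k + \<E> (\<lambda>x. min (h x) (1 / 2 ^ n))"
  proof eventually_elim
    case (elim n)
    let ?\<delta> = "1 / 2 ^ n :: real"
    have e: "(\<lambda>x. min (zigzag ?\<delta> (f x)) (h x)) = (\<lambda>x. min (min (zigzag ?\<delta> (f x)) (k x)) (h x))"
    proof
      fix x show "min (zigzag ?\<delta> (f x)) (h x) = min (min (zigzag ?\<delta> (f x)) (k x)) (h x)"
      proof (cases "h x = 0")
        case True
        then show ?thesis using CpD(2)[OF h(2), of x] zigzag_nonneg[of ?\<delta> "f x"] by simp
      next
        case False
        then have "0 < h x" using CpD(2)[OF h(1), of x] by simp
        then have "zigzag ?\<delta> (f x) \<le> k x" using c(2)[of x] elim zigzag_le[of ?\<delta> "f x"] by simp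
        then show ?thesis by simp
      qed
    qed
    have "\<E> (\<lambda>x. min (min (zigzag ?\<delta> (f x)) (k x)) (h x)) \<le> \<E> (\<lambda>x. min (zigzag ?\<delta> (f x)) (k x)) + \<E> (\<lambda>x. min (h x) ?\<delta>)"
      by (rule E_min_le[OF trace_C[OF f h(2)]]) (use CpD[OF h(1)] zigzag_le[of ?\<delta>] in \<open>auto simp: min_le_iff_disj\<close>)
    then show ?case unfolding trace_energy_def by (subst e)
  qed
  moreover have "(\<lambda>n. trace_energy n f k + \<E> (\<lambda>x. min (h x) (1 / 2 ^ n))) \<longlonglongrightarrow> lam f k + 0"
    using trunc_energy_tendsto[OF h(1), of 1] by (intro tendsto_add trace_tendsto f h) auto
  ultimately show ?thesis using tendsto_le[OF _ _ trace_tendsto[OF f h(1)]] by force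
qed

text \<open>For fixed \<open>n\<close> the capped folds of \<open>g\<close> approximate that of
  \<open>f\<close> uniformly, and \<open>trace_le_lam\<close> bounds their energies with an error
  that does not depend on \<open>g\<close>; so the energy is lower semicontinuous along them before
  \<open>n\<close> grows.\<close>

lemma lam_lsc:
  assumes f: "f \<in> \<C>" and h: "h \<in> Cp"
    and approx: "\<And>\<epsilon>. \<epsilon> > 0 \<Longrightarrow> \<exists>g\<in>\<C>. (\<forall>x. \<bar>g x - f x\<bar> \<le> \<epsilon>) \<and> lam g h \<le> B"
  shows "lam f h \<le> B"
proof (rule lam_le_if_trace_le[OF f h, of 1])
  fix n
  let ?\<delta> = "1 / 2 ^ n :: real"
  obtain K where K: "compact K" "\<And>x. x \<notin> K \<Longrightarrow> h x = 0" using CpD(1)[OF h] by (auto elim: C_cE)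
  have v0: "min (zigzag ?\<delta> (g x)) (h x) = 0" if "x \<notin> K" for x and g :: "'a \<Rightarrow> real"
    using K(2)[OF that] zigzag_nonneg[of ?\<delta> "g x"] by simp
  have "\<E> (\<lambda>x. min (zigzag ?\<delta> (f x)) (h x)) \<le> B + \<E> (\<lambda>x. min (h x) ?\<delta>)"
  proof (rule lower_semicontinuity(2)[OF C_continuous[OF trace_C[OF f h]] K(1) v0[where g = f]])
    fix \<epsilon> :: real assume "\<epsilon> > 0"
    then obtain g where g: "g \<in> \<C>" "\<And>x. \<bar>g x - f x\<bar> \<le> \<epsilon>" "lam g h \<le> B" using approx by blast
    have "\<bar>min (zigzag ?\<delta> (g x)) (h x) - min (zigzag ?\<delta> (f x)) (h x)\<bar> \<le> \<epsilon>" for x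
      using g(2)[of x] zigzag_lipschitz[of ?\<delta> "g x" "f x"] by (auto simp: min_def)
    moreover have "\<E> (\<lambda>x. min (zigzag ?\<delta> (g x)) (h x)) \<le> B + \<E> (\<lambda>x. min (h x) ?\<delta>)"
      using trace_le_lam[OF g(1) h, of n] g(3) by (simp add: trace_energy_def)
    ultimately show "\<exists>v\<in>\<C>. (\<forall>x. \<bar>v x - min (zigzag ?\<delta> (f x)) (h x)\<bar> \<le> \<epsilon>) \<and> (\<forall>x. x \<notin> K \<longrightarrow> v x = 0) \<and> \<E> v \<le> B + \<E> (\<lambda>x. min (h x) ?\<delta>)"
      using v0 by (intro bexI[OF _ trace_C[OF g(1) h, of n]] conjI allI impI) blast+
  qed
  then show "trace_energy n f h \<le> B + \<E> (\<lambda>x. min (h x) (1 / 2 ^ n))" by (simp add: trace_energy_def)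
qed simp

text \<open>Inner regularity: {h > 0} is exhausted by the sets {h > \<epsilon>}. For \<epsilon> at
  most the height of the fold, the error of the lowered cap is at most the energy of
  \<open>h\<close> cut at twice the height, independently of \<epsilon>.\<close>

lemma lam_inner:
  assumes f: "f \<in> \<C>" and h: "h \<in> Cp"
    and le: "\<And>\<epsilon>. \<epsilon> > 0 \<Longrightarrow> lam f (\<lambda>x. max (h x - \<epsilon>) 0) \<le> B"
  shows "lam f h \<le> B"
proof (rule lam_le_if_trace_le[OF f h, of 2])
  fix n
  let ?\<delta> = "1 / 2 ^ n :: real"
  obtain K where K: "compact K" "\<And>x. x \<notin> K \<Longrightarrow> h x = 0" using CpD(1)[OF h] by (auto elim: C_cE)
  have v0: "min (zigzag ?\<delta> (f x)) (h x) = 0" if "x \<notin> K" for x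
    using K(2)[OF that] zigzag_nonneg[of ?\<delta> "f x"] by simp
  have "\<E> (\<lambda>x. min (zigzag ?\<delta> (f x)) (h x)) \<le> B + \<E> (\<lambda>x. min (h x) (2 * ?\<delta>))"
  proof (rule lower_semicontinuity(2)[OF C_continuous[OF trace_C[OF f h]] K(1) v0])
    fix \<eta> :: real assume "\<eta> > 0"
    define \<epsilon> where "\<epsilon> = min \<eta> ?\<delta>"
    have e: "\<epsilon> > 0" "\<epsilon> \<le> \<eta>" "\<epsilon> \<le> ?\<delta>" using \<open>\<eta> > 0\<close> by (auto simp: \<epsilon>_def)
    let ?h = "\<lambda>x. max (h x - \<epsilon>) 0"
    have hp: "?h \<in> Cp" using e by (intro Cp_closed h) simp
    have m2: "(\<lambda>x. min (h x) (2 * ?\<delta>)) \<in> \<C>" by (rule C_min_const[OF CpD(1)[OF h]]) simp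
    have "(\<lambda>x. min (?h x) ?\<delta>) = (\<lambda>x. min (max (min (h x) (2 * ?\<delta>) - \<epsilon>) 0) ?\<delta>)"
      using e by (auto simp: fun_eq_iff min_def max_def)
    moreover have "\<E> (\<lambda>x. min (max (min (h x) (2 * ?\<delta>) - \<epsilon>) 0) ?\<delta>) \<le> \<E> (\<lambda>x. min (h x) (2 * ?\<delta>))"
      by (rule C_contraction[OF m2, of "\<lambda>t. min (max (t - \<epsilon>) 0) ?\<delta>"]) (use e in \<open>auto simp: min_def max_def\<close>)
    ultimately have "\<E> (\<lambda>x. min (zigzag ?\<delta> (f x)) (?h x)) \<le> B + \<E> (\<lambda>x. min (h x) (2 * ?\<delta>))"
      using trace_le_lam[OF f hp, of n] le[OF e(1)] by (simp add: trace_energy_def)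
    moreover have "\<bar>min (zigzag ?\<delta> (f x)) (?h x) - min (zigzag ?\<delta> (f x)) (h x)\<bar> \<le> \<eta>" for x
      using e CpD(2)[OF h, of x] zigzag_nonneg[of ?\<delta> "f x"] by (auto simp: min_def max_def)
    moreover have "min (zigzag ?\<delta> (f x)) (?h x) = 0" if "x \<notin> K" for x
      using K(2)[OF that] e zigzag_nonneg[of ?\<delta> "f x"] by simp
    ultimately show "\<exists>v\<in>\<C>. (\<forall>x. \<bar>v x - min (zigzag ?\<delta> (f x)) (h x)\<bar> \<le> \<eta>) \<and> (\<forall>x. x \<notin> K \<longrightarrow> v x = 0) \<and> \<E> v \<le> B + \<E> (\<lambda>x. min (h x) (2 * ?\<delta>))"
      by (intro bexI[OF _ trace_C[OF f hp, of n]] conjI allI impI)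
  qed
  then show "trace_energy n f h \<le> B + \<E> (\<lambda>x. min (h x) (2 / 2 ^ n))" by (simp add: trace_energy_def)
qed simp

text \<open>A shift by 2 j / 2^k is a multiple of the period 2 / 2^n for all n \<ge> k. Constants
  that are not dyadic are never periods and have to be reached by approximation.\<close>

lemma lam_local:
  assumes "\<And>x. 0 < h x \<Longrightarrow> f x = g x + 2 * of_int j / 2 ^ k" and h: "\<And>x. 0 \<le> h x"
  shows "lam f h = lam g h"
proof -
  have "trace_energy n f h = trace_energy n g h" if n: "k \<le> n" for n
  proof -
    have "min (zigzag (1 / 2 ^ n) (f x)) (h x) = min (zigzag (1 / 2 ^ n) (g x)) (h x)" for x
    proof (cases "0 < h x")
      case True
      have "2 * of_int j / 2 ^ k = 2 * (1 / 2 ^ n) * real_of_int (j * 2 ^ (n - k))"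
        unfolding of_int_mult of_int_power of_int_numeral using n by (simp add: power_diff)
      then have "zigzag (1 / 2 ^ n) (f x) = zigzag (1 / 2 ^ n) (g x)"
        using assms(1)[OF True] zigzag_periodic[of "1 / 2 ^ n" "g x" "j * 2 ^ (n - k)"] by simp
      then show ?thesis by simp
    next
      case False
      then have "h x = 0" using h[of x] by simp
      then show ?thesis by (simp add: zigzag_nonneg)
    qed
    then show ?thesis by (simp add: trace_energy_def)
  qed
  then have ev: "\<forall>\<^sub>F n in sequentially. trace_energy n f h = trace_energy n g h"
    by (auto simp: eventually_sequentially)
  show ?thesis unfolding lam_def lim_def using tendsto_cong[OF ev] by simp
qed

end

section \<open>Measures from set functions on open sets\<close>

definition open_outer :: "('a::topological_space set \<Rightarrow> ennreal) \<Rightarrow> 'a set \<Rightarrow> ennreal" where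
  "open_outer \<nu> A = (INF U\<in>{U. open U \<and> A \<subseteq> U}. \<nu> U)"

lemma open_outer_le: "open U \<Longrightarrow> A \<subseteq> U \<Longrightarrow> open_outer \<nu> A \<le> \<nu> U"
  unfolding open_outer_def by (rule INF_lower) simp

lemma open_outer_mono: "A \<subseteq> B \<Longrightarrow> open_outer \<nu> A \<le> open_outer \<nu> B"
  unfolding open_outer_def by (rule INF_superset_mono) auto

lemma open_outer_open:
  assumes "\<And>U V. open U \<Longrightarrow> open V \<Longrightarrow> U \<subseteq> V \<Longrightarrow> \<nu> U \<le> \<nu> V" "open U"
  shows "open_outer \<nu> U = \<nu> U"
  by (rule antisym[OF open_outer_le[OF assms(2)]]) (auto simp: open_outer_def intro!: INF_greatest assms)

lemma open_outer_countably_subadditive: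
  assumes sub: "\<And>U :: nat \<Rightarrow> 'a::topological_space set. (\<And>i. open (U i)) \<Longrightarrow> \<nu> (\<Union>i. U i) \<le> (\<Sum>i. \<nu> (U i))"
  shows "open_outer \<nu> (\<Union>i. A i) \<le> (\<Sum>i. open_outer \<nu> (A i))"
proof (rule ennreal_le_epsilon)
  fix e :: real assume e: "0 < e" and fin: "(\<Sum>n. open_outer \<nu> (A n)) < top"
  have "\<exists>U. open U \<and> A n \<subseteq> U \<and> \<nu> U \<le> open_outer \<nu> (A n) + e * (1/2)^Suc n" for n
  proof -
    have lt: "open_outer \<nu> (A n) < open_outer \<nu> (A n) + e * (1/2)^Suc n"
      using e fin by (auto simp add: less_top dest!: ennreal_suminf_lessD)
    then obtain U where "U \<in> {U. open U \<and> A n \<subseteq> U}" "\<nu> U < open_outer \<nu> (A n) + e * (1/2)^Suc n"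
      using lt[unfolded open_outer_def[of \<nu> "A n"]] unfolding INF_less_iff open_outer_def[of \<nu> "A n"] by blast
    then show ?thesis by (auto intro: less_imp_le)
  qed
  then obtain U where U: "\<And>n. open (U n)" "\<And>n. A n \<subseteq> U n" "\<And>n. \<nu> (U n) \<le> open_outer \<nu> (A n) + e * (1/2)^Suc n" by metis
  have "open_outer \<nu> (\<Union>i. A i) \<le> \<nu> (\<Union>i. U i)" using U by (intro open_outer_le) auto
  also have "\<dots> \<le> (\<Sum>i. \<nu> (U i))" by (rule sub[OF U(1)])
  also have "\<dots> \<le> (\<Sum>n. open_outer \<nu> (A n) + e * (1/2) ^ Suc n)"
    by (intro suminf_le allI U) auto
  also have "... = (\<Sum>n. open_outer \<nu> (A n)) + (\<Sum>n. ennreal e * ennreal ((1/2) ^ Suc n))"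
    using e by (subst suminf_add[symmetric])
      (auto simp del: ennreal_suminf_cmult simp add: ennreal_mult[symmetric])
  also have "\<dots> = (\<Sum>n. open_outer \<nu> (A n)) + e"
    unfolding ennreal_suminf_cmult
    by (subst suminf_ennreal_eq[OF zero_le_power power_half_series]) auto
  finally show "open_outer \<nu> (\<Union>i. A i) \<le> (\<Sum>n. open_outer \<nu> (A n)) + e" .
qed

text \<open>Caratheodory's construction. Hypothesis \<open>split\<close> tests the measurability of
  an open set against open sets only; since the outer measure is an infimum over open sets, this
  extends to all test sets.\<close>

theorem measure_from_open_sets:
  fixes \<nu> :: "'a::topological_space set \<Rightarrow> ennreal"
  assumes empty: "\<nu> {} = 0" and mono: "\<And>U V. open U \<Longrightarrow> open V \<Longrightarrow> U \<subseteq> V \<Longrightarrow> \<nu> U \<le> \<nu> V"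
    and sub: "\<And>U :: nat \<Rightarrow> 'a set. (\<And>i. open (U i)) \<Longrightarrow> \<nu> (\<Union>i. U i) \<le> (\<Sum>i. \<nu> (U i))"
    and split: "\<And>U V. open U \<Longrightarrow> open V \<Longrightarrow> \<nu> (V \<inter> U) + open_outer \<nu> (V - U) \<le> \<nu> V"
  obtains M where "sets M = sets borel" "\<And>A. A \<in> sets borel \<Longrightarrow> emeasure M A = open_outer \<nu> A"
proof -
  interpret P: sigma_algebra UNIV "Pow (UNIV :: 'a set)" by (rule sigma_algebra_Pow)
  let ?o = "open_outer \<nu>"
  have o_empty: "?o {} = 0" using open_outer_le[of "{}" "{}" \<nu>] empty by simp
  have oms: "outer_measure_space (Pow UNIV) ?o"
    unfolding outer_measure_space_def positive_def increasing_def countably_subadditive_def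
    using o_empty open_outer_countably_subadditive[of \<nu>, OF sub] open_outer_mono by auto
  note car = P.caratheodory_lemma[OF oms]
  let ?L = "lambda_system UNIV (Pow UNIV) ?o"
  have open_L: "U \<in> ?L" if U: "open U" for U
  proof -
    have le: "?o (A \<inter> U) + ?o (A - U) \<le> ?o A" for A
    proof -
      have "?o (A \<inter> U) + ?o (A - U) \<le> \<nu> V" if V: "open V" "A \<subseteq> V" for V
      proof -
        have "?o (A \<inter> U) \<le> \<nu> (V \<inter> U)" using U V by (intro open_outer_le) auto
        moreover have "?o (A - U) \<le> ?o (V - U)" using V by (intro open_outer_mono) auto
        ultimately show ?thesis using split[OF U V(1)] add_mono order_trans by blast
      qed
      then show ?thesis unfolding open_outer_def[of \<nu> A] by (intro INF_greatest) auto
    qed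
    have ge: "?o A \<le> ?o (A \<inter> U) + ?o (A - U)" for A
    proof -
      define B where "B i = (if i = 0 then A \<inter> U else if i = 1 then A - U else {})" for i :: nat
      have "A = (\<Union>i. B i)" unfolding B_def by (auto split: if_splits)
      then have "?o A \<le> (\<Sum>i. ?o (B i))" using open_outer_countably_subadditive[of \<nu> B, OF sub] by simp
      also have "\<dots> = (\<Sum>i\<in>{0, 1}. ?o (B i))" by (rule suminf_finite) (auto simp: B_def o_empty)
      finally show ?thesis by (simp add: B_def)
    qed
    show ?thesis unfolding P.lambda_system_eq using le ge by (auto intro: antisym)
  qed
  have sa: "sigma_algebra UNIV ?L" using car by (simp add: measure_space_def)
  have "sigma_sets UNIV {S. open S} \<subseteq> ?L" by (rule sigma_algebra.sigma_sets_subset[OF sa]) (use open_L in auto)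
  then have sub_L: "sets borel \<subseteq> ?L" by (simp add: sets_borel)
  have ms: "measure_space UNIV (sets borel) ?o"
    using measure_down[OF car _ sub_L] sets.sigma_algebra_axioms[of "borel :: 'a measure"] by simp
  show ?thesis
  proof
    show "sets (measure_of UNIV (sets borel) ?o) = sets borel" by (simp add: sets.sets_measure_of_eq[of borel, simplified])
    show "emeasure (measure_of UNIV (sets borel) ?o) A = ?o A" if "A \<in> sets borel" for A
      by (rule emeasure_measure_of_sigma[OF _ _ _ that]) (use ms in \<open>auto simp: measure_space_def\<close>)
  qed
qed

section \<open>Energy measures of functions in the core\<close>

context p_energy_space
begin

text \<open>Sets of the form {h > 0} serve as inner test sets: they form a base of the topology, by
  \<open>Cp_bump\<close>, and are stable under finite unions and intersections.\<close>

definition nu :: "('a \<Rightarrow> real) \<Rightarrow> 'a set \<Rightarrow> ennreal" where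
  "nu f U = (SUP h\<in>{h \<in> Cp. {x. 0 < h x} \<subseteq> U}. ennreal (lam f h))"

lemma nu_upper: "h \<in> Cp \<Longrightarrow> (\<And>x. 0 < h x \<Longrightarrow> x \<in> U) \<Longrightarrow> ennreal (lam f h) \<le> nu f U"
  unfolding nu_def by (rule SUP_upper) auto

lemma nu_mono: "U \<subseteq> V \<Longrightarrow> nu f U \<le> nu f V"
  unfolding nu_def by (rule SUP_subset_mono) auto

text \<open>By \<open>lam_inner\<close> it costs nothing to lower \<open>h\<close> by \<epsilon>.
  This replaces {h > 0} by a subset of the compact set {h \<ge> \<epsilon>}, for which finite
  subcovers exist.\<close>

lemma nu_leI:
  assumes f: "f \<in> \<C>"
    and le: "\<And>h \<epsilon>. h \<in> Cp \<Longrightarrow> (\<And>x. 0 < h x \<Longrightarrow> x \<in> U) \<Longrightarrow> 0 < \<epsilon> \<Longrightarrow> ennreal (lam f (\<lambda>x. max (h x - \<epsilon>) 0)) \<le> B"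
  shows "nu f U \<le> B"
proof (cases B)
  case (real b)
  show ?thesis unfolding nu_def
  proof (rule SUP_least)
    fix h assume h: "h \<in> {h \<in> Cp. {x. 0 < h x} \<subseteq> U}"
    have "lam f h \<le> b"
    proof (rule lam_inner[OF f])
      fix \<epsilon> :: real assume "\<epsilon> > 0"
      then have "ennreal (lam f (\<lambda>x. max (h x - \<epsilon>) 0)) \<le> ennreal b" using le[of h \<epsilon>] h real by auto
      then show "lam f (\<lambda>x. max (h x - \<epsilon>) 0) \<le> b" using real by (simp add: ennreal_le_iff)
    qed (use h in auto)
    then show "ennreal (lam f h) \<le> B" using real by (simp add: ennreal_leI)
  qed
qed simp

lemma nu_le_E: "f \<in> \<C> \<Longrightarrow> nu f U \<le> ennreal (\<E> f)"
  unfolding nu_def by (intro SUP_least ennreal_leI lam_le_E) auto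

lemma nu_empty: assumes "f \<in> \<C>" shows "nu f {} = 0"
proof -
  have "nu f {} \<le> 0"
    unfolding nu_def
  proof (rule SUP_least)
    fix h assume h: "h \<in> {h \<in> Cp. {x. 0 < h x} \<subseteq> {}}"
    then have "h x = 0" for x using CpD(2)[of h x] by (auto simp: not_less intro: antisym)
    then have "h = (\<lambda>x. 0)" by auto
    then show "ennreal (lam f h) \<le> 0" using lam_zero[OF assms] by simp
  qed
  then show ?thesis by simp
qed

lemma Cp_compact_pos:
  assumes k: "k \<in> Cp" and S: "compact S" "\<And>x. x \<in> S \<Longrightarrow> 0 < k x"
  obtains c where "c > 0" "\<And>x. x \<in> S \<Longrightarrow> c \<le> k x"
proof (cases "S = {}")
  case False
  have "continuous_on S k" using C_continuous[OF CpD(1)[OF k]] continuous_on_subset by blast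
  from continuous_attains_inf[OF S(1) False this] obtain y where "y \<in> S" "\<forall>x\<in>S. k y \<le> k x" by auto
  then show ?thesis using that[of "k y"] S(2) by auto
qed (use that[of 1] in auto)

text \<open>On the compact set {h \<ge> \<epsilon>} the function \<open>k\<close> has a positive
  lower bound, as \<open>lam_mono\<close> demands.\<close>

lemma lam_le_compact:
  assumes f: "f \<in> \<C>" and h: "h \<in> Cp" "k \<in> Cp" and e: "\<epsilon> > 0" and k: "\<And>x. \<epsilon> \<le> h x \<Longrightarrow> 0 < k x"
  shows "lam f (\<lambda>x. max (h x - \<epsilon>) 0) \<le> lam f k"
proof -
  obtain c where c: "c > 0" "\<And>x. x \<in> {x. \<epsilon> \<le> h x} \<Longrightarrow> c \<le> k x"
    using Cp_compact_pos[OF h(2) C_c_compact_superlevel[of h \<epsilon>]] CpD(1)[OF h(1)] e k by auto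
  have hp: "(\<lambda>x. max (h x - \<epsilon>) 0) \<in> Cp" using e by (intro Cp_closed h) simp
  show ?thesis by (rule lam_mono[OF f hp h(2) c(1)]) (use c(2) in auto)
qed

lemma nu_superlevel:
  assumes f: "f \<in> \<C>" and k: "k \<in> Cp"
  shows "nu f {x. 0 < k x} = ennreal (lam f k)"
proof (rule antisym)
  show "nu f {x. 0 < k x} \<le> ennreal (lam f k)"
  proof (rule nu_leI[OF f])
    fix h and \<epsilon> :: real assume h: "h \<in> Cp" "\<And>x. 0 < h x \<Longrightarrow> x \<in> {x. 0 < k x}" "\<epsilon> > 0"
    show "ennreal (lam f (\<lambda>x. max (h x - \<epsilon>) 0)) \<le> ennreal (lam f k)"
      by (intro ennreal_leI lam_le_compact[OF f h(1) k h(3)]) (use h(2,3) in force)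
  qed
qed (rule nu_upper[OF k], simp)

lemma sup_norm_less:
  fixes x :: 'a
  assumes "u \<in> C_c" "v \<in> C_c" "sup_norm (\<lambda>x. u x - v x) < c"
  shows "\<bar>u x - v x\<bar> < c"
proof -
  obtain M1 where M1: "\<And>x. \<bar>u x\<bar> \<le> M1" using C_c_bounded[OF assms(1)] by blast
  obtain M2 where M2: "\<And>x. \<bar>v x\<bar> \<le> M2" using C_c_bounded[OF assms(2)] by blast
  have "\<bar>u y - v y\<bar> \<le> M1 + M2" for y using M1[of y] M2[of y] by linarith
  then have "bdd_above (range (\<lambda>x. \<bar>u x - v x\<bar>))" by (intro bdd_aboveI2)
  then have "\<bar>u x - v x\<bar> \<le> sup_norm (\<lambda>x. u x - v x)" unfolding sup_norm_def by (rule cSUP_upper[OF UNIV_I])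
  then show ?thesis using assms(3) by simp
qed

text \<open>Local compactness provides a tent function of height 1 with compact support. A core
  function within 1/3 of it, lowered by 1/3 and cut at 0, is positive at the peak and vanishes
  wherever the tent does.\<close>

lemma Cp_bump:
  assumes U: "open U" "x \<in> U"
  obtains h where "h \<in> Cp" "0 < h x" "\<And>y. 0 < h y \<Longrightarrow> y \<in> U"
proof -
  have "\<forall>x\<in>UNIV. \<exists>U K. open U \<and> compact K \<and> x \<in> U \<and> U \<subseteq> (K :: 'a set)"
    using locally_compact unfolding locally_compact_space_def by simp
  then obtain V K where VK: "open V" "compact K" "x \<in> V" "V \<subseteq> K" by blast
  have "open (U \<inter> V)" "x \<in> U \<inter> V" using U VK by auto
  then obtain r where r: "r > 0" "ball x r \<subseteq> U \<inter> V" using open_contains_ball by blast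
  define \<phi> where "\<phi> y = max 0 (1 - dist x y / r)" for y
  have \<phi>U: "y \<in> U \<inter> V" if "\<phi> y \<noteq> 0" for y
  proof -
    have "0 < 1 - dist x y / r" using that unfolding \<phi>_def by linarith
    then have "dist x y < r" using r(1) by (simp add: divide_less_eq)
    then show ?thesis using r(2) by auto
  qed
  have \<phi>: "\<phi> \<in> C_c"
  proof (rule C_cI[OF _ VK(2)])
    show "continuous_on UNIV \<phi>" unfolding \<phi>_def[abs_def] using r(1) by (intro continuous_intros) auto
  qed (use \<phi>U VK(4) in blast)
  obtain g where g: "g \<in> \<C>" "sup_norm (\<lambda>y. \<phi> y - g y) < 1 / 3"
    using dense_C_c \<phi> unfolding dense_wrt_def by (metis zero_less_divide_1_iff zero_less_numeral)
  have close: "\<bar>\<phi> y - g y\<bar> < 1 / 3" for y using sup_norm_less[OF \<phi> _ g(2)] g(1) by auto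
  have gp: "(\<lambda>y. max (g y - 1/3) 0) \<in> Cp"
    using C_pos_part_diff[OF g(1), of "1/3"] by (simp add: Cp_def)
  show ?thesis
  proof (rule that[OF gp])
    have "\<phi> x = 1" by (simp add: \<phi>_def)
    then have "1/3 < g x" using close[of x] by linarith
    then show "0 < max (g x - 1/3) 0" by simp
    fix y assume "0 < max (g y - 1/3) 0"
    then have "1/3 < g y" by (simp add: less_max_iff_disj)
    then have "\<phi> y \<noteq> 0" using close[of y] by linarith
    then show "y \<in> U" using \<phi>U by blast
  qed
qed

lemma Cp_finite_max:
  assumes "finite F" "F \<subseteq> Cp"
  obtains k where "k \<in> Cp" "\<And>x. 0 < k x \<longleftrightarrow> (\<exists>h\<in>F. 0 < h x)"
proof -
  have "\<exists>k\<in>Cp. \<forall>x. 0 < k x \<longleftrightarrow> (\<exists>h\<in>F. 0 < h x)" using assms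
  proof (induction F rule: finite_induct)
    case empty
    then show ?case using Cp_closed(1) by (intro bexI[of _ "\<lambda>x. 0"]) auto
  next
    case (insert h F)
    then obtain k where k: "k \<in> Cp" "\<forall>x. 0 < k x \<longleftrightarrow> (\<exists>h\<in>F. 0 < h x)" by auto
    have "(\<lambda>x. max (h x) (k x)) \<in> Cp" using insert k by (intro Cp_closed) auto
    moreover have "\<forall>x. 0 < max (h x) (k x) \<longleftrightarrow> (\<exists>h\<in>insert h F. 0 < h x)" using k(2) by (auto simp: less_max_iff_disj)
    ultimately show ?case by (intro bexI[of _ "\<lambda>x. max (h x) (k x)"])
  qed
  then show ?thesis using that by blast
qed

text \<open>Finitely many bumps, each inside \<open>U\<close> or inside \<open>V\<close>, cover {h
  \<ge> \<epsilon>}; the maxima \<open>k1\<close> and \<open>k2\<close> of the two groups split the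
  mass by modularity.\<close>

lemma nu_Un_le:
  assumes f: "f \<in> \<C>" and U: "open U" "open V"
  shows "nu f (U \<union> V) \<le> nu f U + nu f V"
proof (rule nu_leI[OF f])
  fix h and \<epsilon> :: real assume h: "h \<in> Cp" "\<And>x. 0 < h x \<Longrightarrow> x \<in> U \<union> V" and e: "\<epsilon> > 0"
  define S where "S = {x. \<epsilon> \<le> h x}"
  have S: "compact S" unfolding S_def using C_c_compact_superlevel CpD(1)[OF h(1)] e by auto
  define H where "H W = {k \<in> Cp. \<forall>x. 0 < k x \<longrightarrow> x \<in> W}" for W
  have cov: "S \<subseteq> (\<Union>k\<in>H U \<union> H V. {x. 0 < k x})"
  proof
    fix x assume "x \<in> S"
    then have "0 < h x" using e by (simp add: S_def)
    then consider "x \<in> U" | "x \<in> V" using h(2) by blast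
    then show "x \<in> (\<Union>k\<in>H U \<union> H V. {x. 0 < k x})"
    proof cases
      case 1
      from Cp_bump[OF U(1) 1] obtain k where "k \<in> Cp" "0 < k x" "\<And>y. 0 < k y \<Longrightarrow> y \<in> U" by blast
      then show ?thesis by (auto simp: H_def)
    next
      case 2
      from Cp_bump[OF U(2) 2] obtain k where "k \<in> Cp" "0 < k x" "\<And>y. 0 < k y \<Longrightarrow> y \<in> V" by blast
      then show ?thesis by (auto simp: H_def)
    qed
  qed
  have op: "open {x. 0 < k x}" if "k \<in> H U \<union> H V" for k
  proof -
    have "k \<in> Cp" using that by (auto simp: H_def)
    then show ?thesis using C_continuous[OF CpD(1)] by (intro open_Collect_less continuous_intros) auto
  qed
  obtain F where F: "F \<subseteq> H U \<union> H V" "finite F" "S \<subseteq> (\<Union>k\<in>F. {x. 0 < k x})"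
    by (rule compactE_image[OF S op cov])
  obtain k1 where k1: "k1 \<in> Cp" "\<And>x. 0 < k1 x \<longleftrightarrow> (\<exists>h\<in>F \<inter> H U. 0 < h x)"
    by (rule Cp_finite_max[of "F \<inter> H U"]) (use F(2) in \<open>auto simp: H_def\<close>)
  obtain k2 where k2: "k2 \<in> Cp" "\<And>x. 0 < k2 x \<longleftrightarrow> (\<exists>h\<in>F \<inter> H V. 0 < h x)"
    by (rule Cp_finite_max[of "F \<inter> H V"]) (use F(2) in \<open>auto simp: H_def\<close>)
  have "lam f (\<lambda>x. max (h x - \<epsilon>) 0) \<le> lam f (\<lambda>x. max (k1 x) (k2 x))"
  proof (rule lam_le_compact[OF f h(1) Cp_closed(2)[OF k1(1) k2(1)] e])
    fix x assume "\<epsilon> \<le> h x"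
    then obtain k where "k \<in> F" "0 < k x" using F(3) by (auto simp: S_def)
    then show "0 < max (k1 x) (k2 x)" using F(1) k1(2) k2(2) by (auto simp: less_max_iff_disj)
  qed
  also have "\<dots> \<le> lam f k1 + lam f k2"
    using lam_modular[OF f k1(1) k2(1)] lam_nonneg[OF f Cp_closed(3)[OF k1(1) k2(1)]] by simp
  finally have "ennreal (lam f (\<lambda>x. max (h x - \<epsilon>) 0)) \<le> ennreal (lam f k1 + lam f k2)" by (rule ennreal_leI)
  also have "\<dots> = ennreal (lam f k1) + ennreal (lam f k2)" by (intro ennreal_plus lam_nonneg f k1 k2)
  also have "\<dots> \<le> nu f U + nu f V"
    by (intro add_mono nu_upper k1 k2) (use k1(2) k2(2) in \<open>auto simp: H_def\<close>)
  finally show "ennreal (lam f (\<lambda>x. max (h x - \<epsilon>) 0)) \<le> nu f U + nu f V" .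
qed

lemma nu_countably_subadditive:
  assumes f: "f \<in> \<C>" and U: "\<And>i :: nat. open (U i)"
  shows "nu f (\<Union>i. U i) \<le> (\<Sum>i. nu f (U i))"
proof (rule nu_leI[OF f])
  fix h and \<epsilon> :: real assume h: "h \<in> Cp" "\<And>x. 0 < h x \<Longrightarrow> x \<in> (\<Union>i. U i)" and e: "\<epsilon> > 0"
  define S where "S = {x. \<epsilon> \<le> h x}"
  have S: "compact S" unfolding S_def using C_c_compact_superlevel CpD(1)[OF h(1)] e by auto
  have cov: "S \<subseteq> (\<Union>i\<in>UNIV. U i)" using h(2) e by (force simp: S_def)
  obtain I where I: "I \<subseteq> UNIV" "finite I" "S \<subseteq> (\<Union>i\<in>I. U i)"
    by (rule compactE_image[OF S U cov])
  obtain n where n: "I \<subseteq> {..<n}" using I(2) finite_nat_iff_bounded by blast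
  have fin: "nu f (\<Union>i<n. U i) \<le> (\<Sum>i<n. nu f (U i))" for n
  proof (induction n)
    case 0 then show ?case using nu_empty[OF f] by simp
  next
    case (Suc n)
    have "(\<Union>i<Suc n. U i) = (\<Union>i<n. U i) \<union> U n" by (auto simp: less_Suc_eq)
    then have "nu f (\<Union>i<Suc n. U i) \<le> nu f (\<Union>i<n. U i) + nu f (U n)" using nu_Un_le[OF f open_UN[of "{..<n}" U] U[of n]] U by simp
    also have "\<dots> \<le> (\<Sum>i<n. nu f (U i)) + nu f (U n)" by (intro add_right_mono Suc)
    finally show ?case by simp
  qed
  have hp: "(\<lambda>x. max (h x - \<epsilon>) 0) \<in> Cp" using e by (intro Cp_closed h) simp
  have "ennreal (lam f (\<lambda>x. max (h x - \<epsilon>) 0)) \<le> nu f (\<Union>i<n. U i)"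
  proof (rule nu_upper[OF hp])
    fix x assume "0 < max (h x - \<epsilon>) 0"
    then have "x \<in> S" by (auto simp: S_def)
    then show "x \<in> (\<Union>i<n. U i)" using I(3) n by blast
  qed
  also have "\<dots> \<le> (\<Sum>i<n. nu f (U i))" by (rule fin)
  also have "\<dots> \<le> (\<Sum>i. nu f (U i))" by (intro sum_le_suminf) auto
  finally show "ennreal (lam f (\<lambda>x. max (h x - \<epsilon>) 0)) \<le> (\<Sum>i. nu f (U i))" .
qed

text \<open>{h > 0} approximates the mass of \<open>V \<inter> U\<close>. Removing the compact set
  {h \<ge> \<epsilon>} from \<open>V\<close> leaves an open set that still contains
  \<open>V - U\<close>; functions living there are disjoint from the lowered \<open>h\<close>, and
  modularity becomes additivity.\<close>

lemma nu_split:
  assumes f: "f \<in> \<C>" and U: "open U" "open V"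
  shows "nu f (V \<inter> U) + open_outer (nu f) (V - U) \<le> nu f V"
proof -
  have oV: "open_outer (nu f) (V - U) \<le> nu f V" using U by (intro open_outer_le) auto
  have "nu f (V \<inter> U) \<le> nu f V - open_outer (nu f) (V - U)"
  proof (rule nu_leI[OF f])
    fix h and \<epsilon> :: real assume h: "h \<in> Cp" "\<And>x. 0 < h x \<Longrightarrow> x \<in> V \<inter> U" and e: "\<epsilon> > 0"
    let ?h = "\<lambda>x. max (h x - \<epsilon>) 0"
    have hp: "?h \<in> Cp" using e by (intro Cp_closed h) simp
    define S where "S = {x. \<epsilon> \<le> h x}"
    have S: "compact S" unfolding S_def using C_c_compact_superlevel CpD(1)[OF h(1)] e by auto
    have op: "open (V - S)" using U compact_imp_closed[OF S] by (intro open_Diff)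
    have "V - U \<subseteq> V - S" using h(2) e by (force simp: S_def)
    then have o: "open_outer (nu f) (V - U) \<le> nu f (V - S)" by (intro open_outer_le op)
    have "nu f (V - S) \<le> nu f V - ennreal (lam f ?h)" unfolding nu_def[of f "V - S"]
    proof (rule SUP_least)
      fix k assume k: "k \<in> {h \<in> Cp. {x. 0 < h x} \<subseteq> V - S}"
      have mz: "(\<lambda>x. min (?h x) (k x)) = (\<lambda>x. 0)"
      proof
        fix x show "min (?h x) (k x) = 0"
        proof (cases "0 < k x")
          case True
          then have "x \<notin> S" using k by auto
          then show ?thesis using True by (simp add: S_def)
        next
          case False
          moreover have "0 \<le> k x" using k CpD(2) by blast
          ultimately show ?thesis by simp
        qed
      qed
      have "lam f (\<lambda>x. max (?h x) (k x)) = lam f ?h + lam f k"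
        using lam_modular[OF f hp, of k] k lam_zero[OF f] unfolding mz by simp
      moreover have "ennreal (lam f (\<lambda>x. max (?h x) (k x))) \<le> nu f V"
        by (rule nu_upper) (use k h e in \<open>auto intro!: Cp_closed(2) hp simp: less_max_iff_disj\<close>)
      ultimately have "ennreal (lam f ?h) + ennreal (lam f k) \<le> nu f V"
        using lam_nonneg[OF f hp] lam_nonneg[OF f, of k] k by (simp add: ennreal_plus)
      then show "ennreal (lam f k) \<le> nu f V - ennreal (lam f ?h)"
        by (simp add: ennreal_le_minus_iff add.commute)
    qed
    moreover have "ennreal (lam f ?h) \<le> nu f V" by (rule nu_upper[OF hp]) (use h e in auto)
    ultimately have "nu f (V - S) + ennreal (lam f ?h) \<le> nu f V"
      by (auto simp: ennreal_le_minus_iff)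
    then have "open_outer (nu f) (V - U) + ennreal (lam f ?h) \<le> nu f V" using o by (meson add_right_mono order_trans)
    then show "ennreal (lam f ?h) \<le> nu f V - open_outer (nu f) (V - U)" by (simp add: ennreal_le_minus_iff add.commute)
  qed
  then show ?thesis using oV by (auto simp: ennreal_le_minus_iff)
qed

text \<open>The two conditions determine the measure. As \<open>f\<close> enters through
  \<open>nu f\<close> alone, equal set functions give equal measures.\<close>

definition emu :: "('a \<Rightarrow> real) \<Rightarrow> 'a measure" where
  "emu f = (SOME M. sets M = sets borel \<and> (\<forall>A\<in>sets borel. emeasure M A = open_outer (nu f) A))"

lemma
  assumes f: "f \<in> \<C>"
  shows sets_emu: "sets (emu f) = sets borel"
    and emeasure_emu: "A \<in> sets borel \<Longrightarrow> emeasure (emu f) A = open_outer (nu f) A"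
proof -
  have "\<exists>M. sets M = sets borel \<and> (\<forall>A\<in>sets borel. emeasure M A = open_outer (nu f) A)"
  proof (rule measure_from_open_sets[of "nu f"])
    show "nu f {} = 0" by (rule nu_empty[OF f])
    show "nu f U \<le> nu f V" if "U \<subseteq> V" for U V by (rule nu_mono[OF that])
    show "nu f (\<Union>i. U i) \<le> (\<Sum>i. nu f (U i))" if "\<And>i :: nat. open (U i)" for U
      by (rule nu_countably_subadditive[OF f that])
    show "nu f (V \<inter> U) + open_outer (nu f) (V - U) \<le> nu f V" if "open U" "open V" for U V
      by (rule nu_split[OF f that])
    fix M :: "'a measure"
    assume "sets M = sets borel" "\<And>A. A \<in> sets borel \<Longrightarrow> emeasure M A = open_outer (nu f) A"
    then show "\<exists>M. sets M = sets borel \<and> (\<forall>A\<in>sets borel. emeasure M A = open_outer (nu f) A)"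
      by (intro exI[of _ M]) simp
  qed
  from someI_ex[OF this] have "sets (emu f) = sets borel \<and> (\<forall>A\<in>sets borel. emeasure (emu f) A = open_outer (nu f) A)"
    unfolding emu_def .
  then show "sets (emu f) = sets borel" "A \<in> sets borel \<Longrightarrow> emeasure (emu f) A = open_outer (nu f) A" by auto
qed

lemma emeasure_emu_open: "f \<in> \<C> \<Longrightarrow> open U \<Longrightarrow> emeasure (emu f) U = nu f U"
  by (simp add: emeasure_emu open_outer_open nu_mono)

lemma emeasure_emu_le: assumes "f \<in> \<C>" shows "emeasure (emu f) A \<le> ennreal (\<E> f)"
proof (cases "A \<in> sets borel")
  case True
  then have "emeasure (emu f) A \<le> nu f UNIV"
    using emeasure_emu[OF assms True] open_outer_le[of UNIV A] by simp
  then show ?thesis using nu_le_E[OF assms] order_trans by blast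
qed (simp add: sets_emu[OF assms] emeasure_notin_sets)

lemma finite_emu: "f \<in> \<C> \<Longrightarrow> finite_measure (emu f)"
  by (rule finite_measureI) (simp add: neq_top_trans[OF ennreal_neq_top emeasure_emu_le])

lemma emeasure_emu_eq_measure: "f \<in> \<C> \<Longrightarrow> emeasure (emu f) A = ennreal (measure (emu f) A)"
  using finite_measure.emeasure_eq_measure[OF finite_emu] .

lemma open_superlevel: "h \<in> Cp \<Longrightarrow> open {x. c < h x}"
  using C_continuous[OF CpD(1)] by (intro open_Collect_less continuous_intros)

lemma measure_emu_superlevel:
  assumes "f \<in> \<C>" "h \<in> Cp" shows "measure (emu f) {x. 0 < h x} = lam f h"
  using emeasure_emu_open[OF assms(1) open_superlevel[OF assms(2)], of 0] nu_superlevel[OF assms] lam_nonneg[OF assms]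
  by (simp add: measure_def)

lemma emeasure_emu_UNIV: assumes f: "f \<in> \<C>" shows "emeasure (emu f) UNIV = ennreal (\<E> f)"
proof (rule antisym[OF emeasure_emu_le[OF f]])
  have "ennreal (lam f (\<lambda>x. \<bar>f x\<bar>)) \<le> nu f UNIV" by (rule nu_upper[OF Cp_closed(5)[OF f]]) simp
  then show "ennreal (\<E> f) \<le> emeasure (emu f) UNIV" by (simp add: lam_abs_self[OF f] emeasure_emu_open[OF f])
qed

lemma measure_emu_UNIV: "f \<in> \<C> \<Longrightarrow> measure (emu f) UNIV = \<E> f"
  by (simp add: measure_def emeasure_emu_UNIV E_nonneg)

text \<open>Outer regularity is built in. For open sets, inner regularity holds because the
  superlevel set of the lowered \<open>h\<close> lies in the compact set {h \<ge>
  \<epsilon>}.\<close>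

lemma radon_emu: assumes f: "f \<in> \<C>" shows "radon_measure (emu f)"
  unfolding radon_measure_def
proof (intro conjI allI impI ballI)
  show "sets (emu f) = sets borel" by (rule sets_emu[OF f])
  show "emeasure (emu f) K < \<infinity>" for K
    using emeasure_emu_le[OF f, of K] by (simp add: le_less_trans)
  show "emeasure (emu f) A = (INF U\<in>{U. open U \<and> A \<subseteq> U}. emeasure (emu f) U)" if "A \<in> sets borel" for A
    unfolding emeasure_emu[OF f that] open_outer_def by (intro INF_cong) (auto simp: emeasure_emu_open[OF f])
  fix U :: "'a set" assume U: "open U"
  show "emeasure (emu f) U = (SUP K\<in>{K. compact K \<and> K \<subseteq> U}. emeasure (emu f) K)"
  proof (rule antisym)
    show "emeasure (emu f) U \<le> (SUP K\<in>{K. compact K \<and> K \<subseteq> U}. emeasure (emu f) K)"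
      unfolding emeasure_emu_open[OF f U]
    proof (rule nu_leI[OF f])
      fix h and \<epsilon> :: real assume h: "h \<in> Cp" "\<And>x. 0 < h x \<Longrightarrow> x \<in> U" and e: "\<epsilon> > 0"
      let ?h = "\<lambda>x. max (h x - \<epsilon>) 0"
      have hp: "?h \<in> Cp" using e by (intro Cp_closed h) simp
      define S where "S = {x. \<epsilon> \<le> h x}"
      have S: "compact S" unfolding S_def using C_c_compact_superlevel CpD(1)[OF h(1)] e by auto
      have "ennreal (lam f ?h) = emeasure (emu f) {x. 0 < ?h x}"
        using nu_superlevel[OF f hp] emeasure_emu_open[OF f open_superlevel[OF hp], of 0] by simp
      also have "\<dots> \<le> emeasure (emu f) S"
        by (intro emeasure_mono) (use S in \<open>auto simp: S_def sets_emu[OF f] borel_compact\<close>)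
      also have "\<dots> \<le> (SUP K\<in>{K. compact K \<and> K \<subseteq> U}. emeasure (emu f) K)"
        by (rule SUP_upper) (use S h(2) e in \<open>force simp: S_def\<close>)
      finally show "ennreal (lam f ?h) \<le> (SUP K\<in>{K. compact K \<and> K \<subseteq> U}. emeasure (emu f) K)" .
    qed
    show "(SUP K\<in>{K. compact K \<and> K \<subseteq> U}. emeasure (emu f) K) \<le> emeasure (emu f) U"
      by (rule SUP_least) (auto intro!: emeasure_mono simp: sets_emu[OF f] U)
  qed
qed

end

section \<open>Finite Borel measures\<close>

lemma finite_radon_measureD:
  assumes "radon_measure M" "emeasure M UNIV < \<infinity>"
  shows "sets M = sets borel" "space M = UNIV" "finite_measure M"
proof -
  show s: "sets M = sets borel" using assms by (simp add: radon_measure_def)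
  then show sp: "space M = UNIV" using sets_eq_imp_space_eq[OF s] by simp
  show "finite_measure M" using assms(2) by (intro finite_measureI) (simp add: sp)
qed

lemma radon_outer_approx:
  assumes M: "radon_measure M" "emeasure M UNIV < \<infinity>" and A: "A \<in> sets borel" and e: "\<epsilon> > 0"
  obtains U where "open U" "A \<subseteq> U" "measure M U < measure M A + \<epsilon>"
proof -
  interpret finite_measure M by (rule finite_radon_measureD[OF M])
  have "emeasure M A < ennreal (measure M A + \<epsilon>)"
    unfolding emeasure_eq_measure using e by (intro ennreal_lessI) (auto simp: add_nonneg_pos)
  moreover have "emeasure M A = (INF U\<in>{U. open U \<and> A \<subseteq> U}. emeasure M U)"
    using M(1) A unfolding radon_measure_def by blast
  ultimately have "(INF U\<in>{U. open U \<and> A \<subseteq> U}. emeasure M U) < ennreal (measure M A + \<epsilon>)"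
    by simp
  then obtain U where U: "open U" "A \<subseteq> U" "emeasure M U < ennreal (measure M A + \<epsilon>)"
    unfolding INF_less_iff by auto
  then have "measure M U < measure M A + \<epsilon>"
    unfolding emeasure_eq_measure by (simp add: ennreal_less_iff)
  then show ?thesis using that U by blast
qed

lemma radon_closed_approx:
  assumes M: "radon_measure M" "emeasure M UNIV < \<infinity>" and A: "A \<in> sets borel" and e: "\<epsilon> > 0"
  obtains F where "closed F" "F \<subseteq> A" "measure M A < measure M F + \<epsilon>"
proof -
  interpret finite_measure M by (rule finite_radon_measureD[OF M])
  note [simp] = finite_radon_measureD(1,2)[OF M]
  have cA: "- A \<in> sets borel" using A by (metis Compl_eq_Diff_UNIV sets.compl_sets space_borel)
  obtain U where U: "open U" "- A \<subseteq> U" "measure M U < measure M (- A) + \<epsilon>"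
    by (rule radon_outer_approx[OF M cA e])
  have "measure M (- A) = measure M UNIV - measure M A" "measure M (- U) = measure M UNIV - measure M U"
    using finite_measure_compl[of A] finite_measure_compl[of U] A U(1) by (simp_all add: Compl_eq_Diff_UNIV)
  then show ?thesis using that[of "- U"] U by auto
qed

lemma radon_compact_approx:
  assumes M: "radon_measure M" "emeasure M UNIV < \<infinity>" and U: "open U" and e: "\<epsilon> > 0"
  obtains K where "compact K" "K \<subseteq> U" "measure M U < measure M K + \<epsilon>"
proof (cases "measure M U < \<epsilon>")
  case True
  then show ?thesis using that[of "{}"] by simp
next
  case False
  interpret finite_measure M by (rule finite_radon_measureD[OF M])
  have "ennreal (measure M U - \<epsilon>) < emeasure M U"
    unfolding emeasure_eq_measure using e False by (intro ennreal_lessI) (auto simp: not_less)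
  moreover have "emeasure M U = (SUP K\<in>{K. compact K \<and> K \<subseteq> U}. emeasure M K)"
    using M(1) U unfolding radon_measure_def by blast
  ultimately have "ennreal (measure M U - \<epsilon>) < (SUP K\<in>{K. compact K \<and> K \<subseteq> U}. emeasure M K)"
    by simp
  then obtain K where K: "compact K" "K \<subseteq> U" "ennreal (measure M U - \<epsilon>) < emeasure M K"
    unfolding less_SUP_iff by auto
  then have "measure M U - \<epsilon> < measure M K"
    unfolding emeasure_eq_measure using False by (simp add: ennreal_less_iff not_less)
  then show ?thesis using that[OF K(1,2)] by simp
qed

lemma measure_le_if_closed_le:
  assumes M: "radon_measure M" "emeasure M UNIV < \<infinity>" and N: "finite_measure N" "sets N = sets borel"
    and A: "A \<in> sets borel" and le: "\<And>F. closed F \<Longrightarrow> F \<subseteq> A \<Longrightarrow> measure M F \<le> measure N F"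
  shows "measure M A \<le> measure N A"
proof (rule field_le_epsilon)
  fix \<epsilon> :: real assume "\<epsilon> > 0"
  then obtain F where F: "closed F" "F \<subseteq> A" "measure M A < measure M F + \<epsilon>" by (rule radon_closed_approx[OF M A])
  have "measure N F \<le> measure N A" using F A N by (intro finite_measure.finite_measure_mono) auto
  then show "measure M A \<le> measure N A + \<epsilon>" using F(3) le[OF F(1,2)] by simp
qed

lemma measure_le_if_open_le:
  assumes M: "radon_measure M" "emeasure M UNIV < \<infinity>" and N: "finite_measure N" "sets N = sets borel"
    and A: "A \<in> sets borel" and le: "\<And>U. open U \<Longrightarrow> measure N U \<le> measure M U"
  shows "measure N A \<le> measure M A"
proof (rule field_le_epsilon)
  fix \<epsilon> :: real assume "\<epsilon> > 0"
  then obtain U where U: "open U" "A \<subseteq> U" "measure M U < measure M A + \<epsilon>" by (rule radon_outer_approx[OF M A])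
  have "measure N A \<le> measure N U" using U A N by (intro finite_measure.finite_measure_mono) auto
  then show "measure N A \<le> measure M A + \<epsilon>" using U(3) le[OF U(1)] by simp
qed

section \<open>Comparison of signed measures\<close>

lemma signed_borel_measure_measure:
  assumes "finite_measure M" "sets M = sets borel" shows "signed_borel_measure (measure M)"
  using finite_measure.finite_measure_UNION[OF assms(1)] assms(2) by (simp add: signed_borel_measure_def)

lemma signed_borel_measure_add:
  "signed_borel_measure \<alpha> \<Longrightarrow> signed_borel_measure \<beta> \<Longrightarrow> signed_borel_measure (\<lambda>A. \<alpha> A + \<beta> A)"
  by (auto simp: signed_borel_measure_def intro!: sums_add)

lemma signed_borel_measure_scale:
  "signed_borel_measure \<alpha> \<Longrightarrow> signed_borel_measure (\<lambda>A. c * \<alpha> A)"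
  by (auto simp: signed_borel_measure_def intro!: sums_mult)

lemma signed_borel_measure_Un:
  assumes "signed_borel_measure \<alpha>" "A \<in> sets borel" "B \<in> sets borel" "A \<inter> B = {}"
  shows "\<alpha> (A \<union> B) = \<alpha> A + \<alpha> B"
proof -
  define S where "S i = (if i = 0 then A else if i = 1 then B else {})" for i :: nat
  have "range S \<subseteq> sets borel \<and> disjoint_family S"
    using assms by (auto simp: S_def disjoint_family_on_def)
  then have s: "(\<lambda>i. \<alpha> (S i)) sums \<alpha> (\<Union>i. S i)" using assms(1) unfolding signed_borel_measure_def by blast
  have U: "(\<Union>i. S i) = A \<union> B" by (auto simp: S_def split: if_splits)
  have "\<alpha> {} = 0" using assms(1) by (simp add: signed_borel_measure_def)
  then have "(\<lambda>i. \<alpha> (S i)) sums (\<Sum>i\<in>{0, 1}. \<alpha> (S i))" by (intro sums_finite) (auto simp: S_def)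
  then have "(\<Sum>i\<in>{0, 1}. \<alpha> (S i)) = \<alpha> (\<Union>i. S i)" using s by (rule sums_unique2)
  then show ?thesis unfolding U by (simp add: S_def)
qed

text \<open>The countable cover is made disjoint and the comparison summed over the pieces. Signed
  measures are not monotone, so the hypothesis speaks of all Borel subsets of a cell.\<close>

lemma signed_borel_measure_le_if_locally_le:
  fixes S :: "'i::countable \<Rightarrow> 'a::topological_space set"
  assumes ab: "signed_borel_measure \<alpha>" "signed_borel_measure \<beta>"
    and S: "\<And>i. S i \<in> sets borel" and B: "B \<in> sets borel" "B \<subseteq> (\<Union>i. S i)"
    and le: "\<And>A i. A \<in> sets borel \<Longrightarrow> A \<subseteq> S i \<Longrightarrow> A \<subseteq> B \<Longrightarrow> \<alpha> A \<le> \<beta> A"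
  shows "\<alpha> B \<le> \<beta> B"
proof -
  define T where "T n = B \<inter> S (from_nat n)" for n
  have T: "range T \<subseteq> sets borel" using S B(1) by (auto simp: T_def)
  have UT: "(\<Union>n. T n) = B"
  proof -
    have "x \<in> (\<Union>n. T n)" if x: "x \<in> B" for x
    proof -
      obtain i where "x \<in> S i" using B(2) x by blast
      then have "x \<in> T (to_nat i)" using x by (simp add: T_def)
      then show ?thesis by blast
    qed
    then show ?thesis by (auto simp: T_def)
  qed
  define D where "D = disjointed T"
  have D: "range D \<subseteq> sets borel \<and> disjoint_family D"
    unfolding D_def using sets.range_disjointed_sets[OF T] disjoint_family_disjointed by blast
  have UD: "(\<Union>n. D n) = B" unfolding D_def UN_disjointed_eq UT ..
  have s: "(\<lambda>n. \<alpha> (D n)) sums \<alpha> B" "(\<lambda>n. \<beta> (D n)) sums \<beta> B"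
    using ab D unfolding signed_borel_measure_def UD[symmetric] by blast+
  have "\<alpha> (D n) \<le> \<beta> (D n)" for n
  proof (rule le)
    show "D n \<in> sets borel" using D by auto
    show "D n \<subseteq> S (from_nat n)" "D n \<subseteq> B" using disjointed_subset[of T n] by (auto simp: D_def T_def)
  qed
  then show ?thesis using s by (rule sums_le)
qed

lemma signed_borel_measure_eq_if_locally_eq:
  fixes S :: "'i::countable \<Rightarrow> 'a::topological_space set"
  assumes "signed_borel_measure \<alpha>" "signed_borel_measure \<beta>"
    and "\<And>i. S i \<in> sets borel" and "B \<in> sets borel" "B \<subseteq> (\<Union>i. S i)"
    and "\<And>A i. A \<in> sets borel \<Longrightarrow> A \<subseteq> S i \<Longrightarrow> A \<subseteq> B \<Longrightarrow> \<alpha> A = \<beta> A"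
  shows "\<alpha> B = \<beta> B"
  by (rule antisym; rule signed_borel_measure_le_if_locally_le[of _ _ S]) (use assms in auto)

section \<open>Locality of the energy measures\<close>

text \<open>Flattening a function near the level \<open>c\<close> and normalising it to vanish at
  \<open>0\<close> moves the level to \<open>c + clip r (- c)\<close>. For r \<le> |c| this is a
  move by exactly \<open>r\<close> towards \<open>0\<close>, which can be made to end at a dyadic
  number.\<close>

lemma clip_dyadic:
  fixes c :: real
  assumes "\<eta> > 0"
  obtains r and j :: int and k where "0 < r" "r \<le> \<eta>" "c + clip r (- c) = 2 * of_int j / 2 ^ k"
proof (cases "c = 0")
  case True
  then show ?thesis using assms clip_0[of \<eta>] by (intro that[of \<eta> 0 0]) auto
next
  case False
  define b where "b = min \<eta> \<bar>c\<bar>"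
  have b: "b > 0" using assms False by (simp add: b_def)
  obtain k where "(1/2 :: real) ^ k < b / 2" using real_arch_pow_inv[of "b / 2" "1 / 2"] b by auto
  then have k: "2 / 2 ^ k < b" by (simp add: power_divide)
  show ?thesis
  proof (cases "c > 0")
    case True
    \<comment> \<open>The largest multiple of \<open>2 / 2 ^ k\<close> strictly below
      \<open>c\<close>; strictness makes \<open>r\<close> positive.\<close>
    define j where "j = \<lceil>c * 2 ^ k / 2\<rceil> - 1"
    define r where "r = c - 2 * of_int j / 2 ^ k"
    have "of_int j < c * 2 ^ k / 2" "c * 2 ^ k / 2 \<le> of_int j + 1" unfolding j_def by linarith+
    then have "2 * of_int j / 2 ^ k < c" "c \<le> (2 * of_int j + 2) / 2 ^ k"
      by (auto simp: pos_le_divide_eq pos_divide_less_eq)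
    then have r: "0 < r" "r \<le> 2 / 2 ^ k" by (auto simp: r_def add_divide_distrib)
    then have "r \<le> b" using k by simp
    then have "clip r (- c) = - r" using True by (auto simp: clip_def b_def)
    then show ?thesis using r(1) \<open>r \<le> b\<close> by (intro that[of r j k]) (auto simp: r_def b_def)
  next
    case neg: False
    define j where "j = \<lfloor>c * 2 ^ k / 2\<rfloor> + 1"
    define r where "r = 2 * of_int j / 2 ^ k - c"
    have "c * 2 ^ k / 2 < of_int j" "of_int j \<le> c * 2 ^ k / 2 + 1" unfolding j_def by linarith+
    then have "c < 2 * of_int j / 2 ^ k" "(2 * of_int j - 2) / 2 ^ k \<le> c"
      by (auto simp: pos_less_divide_eq pos_divide_le_eq)
    then have r: "0 < r" "r \<le> 2 / 2 ^ k" by (auto simp: r_def diff_divide_distrib)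
    then have "r \<le> b" using k by simp
    then have "clip r (- c) = r" using neg r(1) by (auto simp: clip_def b_def)
    then show ?thesis using r(1) \<open>r \<le> b\<close> by (intro that[of r j k]) (auto simp: r_def b_def)
  qed
qed

context p_energy_space
begin

lemma C_subspace: "linear_subspace \<C>"
  unfolding linear_subspace_def using C_closed by blast

lemma E_eq_measure_emu: "f \<in> \<C> \<Longrightarrow> emeasure (emu f) UNIV < \<infinity>"
  by (simp add: emeasure_emu_UNIV)

lemma emu_minus: "emu (\<lambda>x. - f x) = emu f"
proof -
  have "nu (\<lambda>x. - f x) = nu f" by (simp add: fun_eq_iff nu_def lam_minus)
  then show ?thesis by (simp add: emu_def)
qed

lemma measure_emu_open_local:
  assumes f: "f \<in> \<C>" and g: "g \<in> \<C>" and U: "open U"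
    and eq: "\<And>x. x \<in> U \<Longrightarrow> f x = g x + 2 * of_int j / 2 ^ k"
  shows "measure (emu f) U = measure (emu g) U"
proof -
  have "nu f U = nu g U" unfolding nu_def
  proof (rule SUP_cong)
    fix h assume "h \<in> {h \<in> Cp. {x. 0 < h x} \<subseteq> U}"
    then have "lam f h = lam g h" by (intro lam_local[of h f g j k]) (use eq CpD(2) in auto)
    then show "ennreal (lam f h) = ennreal (lam g h)" by simp
  qed simp
  then show ?thesis using emeasure_emu_open[OF f U] emeasure_emu_open[OF g U] by (simp add: measure_def)
qed

text \<open>
  Flatten \<open>f - g\<close> near the level \<open>c\<close>, shifting that level to a dyadic number. The resulting
  functions agree with \<open>g\<close> up to a dyadic constant near \<open>A\<close> and converge strongly to \<open>f\<close>.
\<close>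

lemma measure_emu_closed_le:
  assumes f: "f \<in> \<C>" and g: "g \<in> \<C>" and A: "closed A" and c: "\<And>x. x \<in> A \<Longrightarrow> f x - g x = c"
  shows "measure (emu g) A \<le> measure (emu f) A"
proof -
  define q where "q x = f x - g x" for x
  have qC: "q \<in> \<C>" unfolding q_def[abs_def] by (intro C_diff f g)
  have "\<exists>r j k. 0 < r \<and> r \<le> 1 / real (Suc n) \<and> c + clip r (- c) = 2 * of_int (j :: int) / 2 ^ k" for n
    by (rule clip_dyadic[of "1 / real (Suc n)" c]) auto
  then obtain r and j :: "nat \<Rightarrow> int" and k where r: "\<And>n. 0 < r n" "\<And>n. r n \<le> 1 / real (Suc n)"
    and jk: "\<And>n. c + clip (r n) (- c) = 2 * of_int (j n) / 2 ^ k n" by metis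
  have r0: "r \<longlonglongrightarrow> 0"
    by (rule tendsto_sandwich[OF _ _ tendsto_const LIMSEQ_const_over_Suc[of 1]]) (use r in \<open>auto simp: less_imp_le\<close>)
  \<comment> \<open>The last summand restores \<open>\<phi> n 0 = 0\<close>, so that the composition
    stays in the core.\<close>
  define \<phi> where "\<phi> n t = t - clip (r n) (t - c) + clip (r n) (- c)" for n t
  have \<phi>0: "\<phi> n 0 = 0" for n by (simp add: \<phi>_def)
  have \<phi>l: "\<bar>\<phi> n s - \<phi> n t\<bar> \<le> \<bar>s - t\<bar>" for n s t
    using minus_clip_lipschitz[of "r n" "s - c" "t - c"] r(1)[of n] by (simp add: \<phi>_def less_imp_le)
  have \<phi>c: "\<bar>\<phi> n t - t\<bar> \<le> 2 * r n" for n t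
    using abs_clip_le[of "r n" "t - c"] abs_clip_le[of "r n" "- c"] r(1)[of n] by (simp add: \<phi>_def)
  have lim: "(\<lambda>n. \<E> (\<lambda>x. \<phi> n (q x) - q x)) \<longlonglongrightarrow> 0"
    using tendsto_mult[OF tendsto_const[of 2] r0] by (intro C_contraction_tendsto[OF qC \<phi>0 \<phi>l \<phi>c]) simp
  define F where "F n x = \<phi> n (q x) + g x" for n x
  have \<phi>C: "(\<lambda>x. \<phi> n (q x)) \<in> \<C>" for n by (rule C_contraction[OF qC \<phi>0 \<phi>l])
  have FC: "F n \<in> \<C>" for n unfolding F_def[abs_def] by (intro C_add \<phi>C g)
  have EF: "(\<lambda>n. \<E> (F n)) \<longlonglongrightarrow> \<E> f"
  proof -
    have "(\<lambda>n. \<E> (F n)) \<longlonglongrightarrow> \<E> (\<lambda>x. q x + g x)" unfolding F_def by (rule E_add_shift_tendsto[OF \<phi>C qC g lim])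
    moreover have "(\<lambda>x. q x + g x) = f" by (simp add: q_def)
    ultimately show ?thesis by simp
  qed
  \<comment> \<open>Both functions give the same mass to the open sets \<open>U\<close> and
    \<open>U - A\<close>, hence to the closed set \<open>A\<close>.\<close>
  have FA: "measure (emu (F n)) A = measure (emu g) A" for n
  proof -
    define U where "U = {x. \<bar>q x - c\<bar> < r n}"
    have U: "open U" unfolding U_def using C_continuous[OF qC] by (intro open_Collect_less continuous_intros)
    have AU: "A \<subseteq> U" using c r(1)[of n] by (auto simp: U_def q_def)
    have eq: "F n x = g x + 2 * of_int (j n) / 2 ^ k n" if "x \<in> U" for x
    proof -
      have "clip (r n) (q x - c) = q x - c" using that by (intro clip_id) (simp add: U_def)
      then show ?thesis using jk[of n] by (simp add: F_def \<phi>_def)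
    qed
    have oU: "open (U - A)" using U A by (rule open_Diff)
    have e: "measure (emu (F n)) U = measure (emu g) U" "measure (emu (F n)) (U - A) = measure (emu g) (U - A)"
      by (intro measure_emu_open_local[OF FC g _ eq] U oU; simp)+
    have d: "measure (emu w) (U - A) = measure (emu w) U - measure (emu w) A" if "w \<in> \<C>" for w
      using finite_measure.finite_measure_Diff[OF finite_emu[OF that]] U A AU by (simp add: sets_emu[OF that])
    show ?thesis using e d[OF FC[of n]] d[OF g] by simp
  qed
  \<comment> \<open>{h > 0} avoids \<open>A\<close>, so under \<open>F n\<close> its mass is at most
    the total minus that of \<open>A\<close>; lower semicontinuity of \<open>lam\<close> passes this
    on to \<open>f\<close>.\<close>
  have bound: "lam f h \<le> \<E> f - measure (emu g) A" if h: "h \<in> Cp" and hA: "\<And>x. 0 < h x \<Longrightarrow> x \<notin> A" for h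
  proof (rule field_le_epsilon)
    fix \<eta> :: real assume \<eta>: "\<eta> > 0"
    show "lam f h \<le> \<E> f - measure (emu g) A + \<eta>"
    proof (rule lam_lsc[OF f h])
      fix \<epsilon> :: real assume \<epsilon>: "\<epsilon> > 0"
      have "\<forall>\<^sub>F n in sequentially. r n < \<epsilon> / 2 \<and> \<E> (F n) < \<E> f + \<eta>"
        using order_tendstoD(2)[OF r0, of "\<epsilon> / 2"] order_tendstoD(2)[OF EF, of "\<E> f + \<eta>"] \<epsilon> \<eta> by (intro eventually_conj) auto
      then obtain n where n: "r n < \<epsilon> / 2" "\<E> (F n) < \<E> f + \<eta>" by (auto simp: eventually_sequentially)
      interpret finite_measure "emu (F n)" by (rule finite_emu[OF FC])
      have s: "A \<in> sets (emu (F n))" "{x. 0 < h x} \<in> sets (emu (F n))"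
        using A open_superlevel[OF h, of 0] by (auto simp: sets_emu[OF FC])
      have "lam (F n) h + measure (emu (F n)) A = measure (emu (F n)) ({x. 0 < h x} \<union> A)"
        using hA s by (subst finite_measure_Union) (auto simp: measure_emu_superlevel[OF FC h])
      also have "\<dots> \<le> measure (emu (F n)) UNIV"
        using s by (intro finite_measure_mono) (auto simp: sets_emu[OF FC])
      finally have "lam (F n) h \<le> \<E> f - measure (emu g) A + \<eta>" using n(2) by (simp add: measure_emu_UNIV[OF FC] FA)
      moreover have "\<bar>F n x - f x\<bar> \<le> \<epsilon>" for x using \<phi>c[of n "q x"] n(1) by (simp add: F_def q_def)
      ultimately show "\<exists>g'\<in>\<C>. (\<forall>x. \<bar>g' x - f x\<bar> \<le> \<epsilon>) \<and> lam g' h \<le> \<E> f - measure (emu g) A + \<eta>"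
        using FC[of n] by blast
    qed
  qed
  have oA: "open (- A)" using A by (simp add: open_Compl)
  have "emeasure (emu f) (- A) \<le> ennreal (\<E> f - measure (emu g) A)"
    unfolding emeasure_emu_open[OF f oA] nu_def by (intro SUP_least ennreal_leI bound) auto
  moreover have "0 \<le> \<E> f - measure (emu g) A" using bound[OF Cp_closed(1)] lam_nonneg[OF f Cp_closed(1)] by simp
  ultimately have "measure (emu f) (- A) \<le> \<E> f - measure (emu g) A"
    by (simp add: emeasure_emu_eq_measure[OF f])
  moreover have "measure (emu f) (- A) = \<E> f - measure (emu f) A"
    using finite_measure.finite_measure_compl[OF finite_emu[OF f], of A] A sets_eq_imp_space_eq[OF sets_emu[OF f]]
    by (simp add: sets_emu[OF f] measure_emu_UNIV[OF f] Compl_eq_Diff_UNIV)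
  ultimately show ?thesis by simp
qed

text \<open>The closed case in both directions, extended to Borel sets by closed approximation from
  inside.\<close>

lemma measure_emu_local:
  assumes f: "f \<in> \<C>" and g: "g \<in> \<C>" and A: "A \<in> sets borel" and c: "\<And>x. x \<in> A \<Longrightarrow> f x - g x = c"
  shows "measure (emu f) A = measure (emu g) A"
proof (rule antisym)
  have "measure (emu f) F \<le> measure (emu g) F" if "closed F" "F \<subseteq> A" for F
    by (rule measure_emu_closed_le[OF g f that(1), of "- c"]) (use c that(2) in force)
  then show "measure (emu f) A \<le> measure (emu g) A"
    by (rule measure_le_if_closed_le[OF radon_emu[OF f] E_eq_measure_emu[OF f] finite_emu[OF g] sets_emu[OF g] A])
  have "measure (emu g) F \<le> measure (emu f) F" if "closed F" "F \<subseteq> A" for F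
    by (rule measure_emu_closed_le[OF f g that(1), of c]) (use c that(2) in force)
  then show "measure (emu g) A \<le> measure (emu f) A"
    by (rule measure_le_if_closed_le[OF radon_emu[OF g] E_eq_measure_emu[OF g] finite_emu[OF f] sets_emu[OF f] A])
qed

end

section \<open>Recovering the measures from the form\<close>

text \<open>What identifies a family on the core: total mass, locality and evenness. Instances are
  the constructed measures, rescaled versions of them, and any family with (M1)-(M4).\<close>

locale local_energy_family = p_energy_space +
  fixes \<mu> :: "('a \<Rightarrow> real) \<Rightarrow> 'a measure"
  assumes sets_mu: "f \<in> \<C> \<Longrightarrow> sets (\<mu> f) = sets borel"
    and emeasure_mu_UNIV: "f \<in> \<C> \<Longrightarrow> emeasure (\<mu> f) UNIV = ennreal (\<E> f)"
    and mu_local: "f \<in> \<C> \<Longrightarrow> g \<in> \<C> \<Longrightarrow> A \<in> sets borel \<Longrightarrow> (\<And>x. x \<in> A \<Longrightarrow> f x - g x = c) \<Longrightarrow>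
      measure (\<mu> f) A = measure (\<mu> g) A"
    and mu_even: "f \<in> \<C> \<Longrightarrow> A \<in> sets borel \<Longrightarrow> measure (\<mu> (\<lambda>x. - f x)) A = measure (\<mu> f) A"
begin

lemma space_mu: "f \<in> \<C> \<Longrightarrow> space (\<mu> f) = UNIV"
  using sets_eq_imp_space_eq[OF sets_mu] by simp

lemma finite_mu: "f \<in> \<C> \<Longrightarrow> finite_measure (\<mu> f)"
  by (rule finite_measureI) (simp add: space_mu emeasure_mu_UNIV)

lemma measure_mu_UNIV: "f \<in> \<C> \<Longrightarrow> measure (\<mu> f) UNIV = \<E> f"
  by (simp add: measure_def emeasure_mu_UNIV E_nonneg)

lemma measure_mu_zero: "measure (\<mu> (\<lambda>x. 0)) A = 0"
proof -
  have "measure (\<mu> (\<lambda>x. 0)) A \<le> measure (\<mu> (\<lambda>x. 0)) (space (\<mu> (\<lambda>x. 0)))"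
    by (rule finite_measure.bounded_measure[OF finite_mu[OF C_zero]])
  then show ?thesis using measure_mu_UNIV[OF C_zero] E_zero by (simp add: space_mu[OF C_zero] measure_le_0_iff)
qed

lemma mu_local_sign:
  assumes "f \<in> \<C>" "g \<in> \<C>" "A \<in> sets borel" "\<sigma> = 1 \<or> \<sigma> = -1" "\<And>x. x \<in> A \<Longrightarrow> f x = \<sigma> * g x + c"
  shows "measure (\<mu> f) A = measure (\<mu> g) A"
proof (cases "\<sigma> = 1")
  case True
  then show ?thesis using assms by (intro mu_local[of _ _ _ c]) auto
next
  case False
  then have "measure (\<mu> f) A = measure (\<mu> (\<lambda>x. - g x)) A"
    using assms by (intro mu_local[of _ _ _ c] C_minus) auto
  then show ?thesis using mu_even[OF assms(2,3)] by simp
qed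

definition pair_measure :: "('a \<Rightarrow> real) \<Rightarrow> ('a \<Rightarrow> real) \<Rightarrow> 'a set \<Rightarrow> real" where
  "pair_measure u v A = measure (\<mu> (\<lambda>x. u x + v x)) A + measure (\<mu> (\<lambda>x. u x - v x)) A"

lemma signed_pair_measure: "u \<in> \<C> \<Longrightarrow> v \<in> \<C> \<Longrightarrow> signed_borel_measure (pair_measure u v)"
  unfolding pair_measure_def[abs_def]
  by (intro signed_borel_measure_add signed_borel_measure_measure finite_mu sets_mu C_add C_diff)

lemma pair_measure_nonneg: "0 \<le> pair_measure u v A"
  by (simp add: pair_measure_def)

lemma pair_measure_UNIV: "u \<in> \<C> \<Longrightarrow> v \<in> \<C> \<Longrightarrow> pair_measure u v UNIV = \<E> (\<lambda>x. u x + v x) + \<E> (\<lambda>x. u x - v x)"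
  by (simp add: pair_measure_def measure_mu_UNIV C_add C_diff del: Int_iff)

text \<open>Changing one of two signs exchanges the sum and the difference.\<close>

lemma pair_measure_local:
  assumes C: "U \<in> \<C>" "V \<in> \<C>" "u \<in> \<C>" "v \<in> \<C>" and A: "A \<in> sets borel"
    and s: "\<sigma> = 1 \<or> \<sigma> = -1" "\<tau> = 1 \<or> \<tau> = -1"
    and U: "\<And>x. x \<in> A \<Longrightarrow> U x = \<sigma> * u x + a" and V: "\<And>x. x \<in> A \<Longrightarrow> V x = \<tau> * v x + b"
  shows "pair_measure U V A = pair_measure u v A"
proof -
  note c = C_add[OF C(1,2)] C_diff[OF C(1,2)] C_add[OF C(3,4)] C_diff[OF C(3,4)]
  show ?thesis
  proof (cases "\<sigma> = \<tau>")
    case True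
    have "measure (\<mu> (\<lambda>x. U x + V x)) A = measure (\<mu> (\<lambda>x. u x + v x)) A"
      by (rule mu_local_sign[OF c(1,3) A s(1), of "a + b"]) (simp add: U V True algebra_simps)
    moreover have "measure (\<mu> (\<lambda>x. U x - V x)) A = measure (\<mu> (\<lambda>x. u x - v x)) A"
      by (rule mu_local_sign[OF c(2,4) A s(1), of "a - b"]) (simp add: U V True algebra_simps)
    ultimately show ?thesis by (simp add: pair_measure_def)
  next
    case False
    then have t: "\<tau> = - \<sigma>" using s by auto
    have "measure (\<mu> (\<lambda>x. U x + V x)) A = measure (\<mu> (\<lambda>x. u x - v x)) A"
      by (rule mu_local_sign[OF c(1,4) A s(1), of "a + b"]) (simp add: U V t algebra_simps)
    moreover have "measure (\<mu> (\<lambda>x. U x - V x)) A = measure (\<mu> (\<lambda>x. u x + v x)) A"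
      by (rule mu_local_sign[OF c(2,3) A s(1), of "a - b"]) (simp add: U V t algebra_simps)
    ultimately show ?thesis by (simp add: pair_measure_def)
  qed
qed

lemma pair_measure_LIMSEQ:
  assumes u: "u \<in> \<C>" and v: "v \<in> \<C>" and h: "h \<in> Cp"
  shows "(\<lambda>n. pair_measure u v {x. 1 / 2 ^ n \<le> h x}) \<longlonglongrightarrow> pair_measure u v {x. 0 < h x}"
proof -
  have cl: "{x. 1 / 2 ^ n \<le> h x} \<in> sets borel" for n
    using C_continuous[OF CpD(1)[OF h]] by (intro borel_closed closed_Collect_le continuous_intros)
  have inc: "incseq (\<lambda>n. {x. 1 / 2 ^ n \<le> h x})"
  proof (rule incseq_SucI, rule subsetI)
    fix n x assume "x \<in> {x. 1 / 2 ^ n \<le> h x}"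
    moreover have "1 / 2 ^ Suc n \<le> (1 / 2 ^ n :: real)" by (simp add: field_simps)
    ultimately show "x \<in> {x. 1 / 2 ^ Suc n \<le> h x}" by (auto intro: order_trans)
  qed
  have un: "(\<Union>n. {x. 1 / 2 ^ n \<le> h x}) = {x. 0 < h x}"
  proof (intro equalityI subsetI)
    fix x assume "x \<in> (\<Union>n. {x. 1 / 2 ^ n \<le> h x})"
    then obtain n where "1 / 2 ^ n \<le> h x" by auto
    then show "x \<in> {x. 0 < h x}" by (simp add: less_le_trans[of 0 "1 / 2 ^ n"])
  next
    fix x assume "x \<in> {x. 0 < h x}"
    then obtain n where "(1/2 :: real) ^ n < h x" using real_arch_pow_inv[of "h x" "1 / 2"] by auto
    then show "x \<in> (\<Union>n. {x. 1 / 2 ^ n \<le> h x})" by (auto simp: power_divide intro: less_imp_le)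
  qed
  have lim: "(\<lambda>n. measure (\<mu> w) {x. 1 / 2 ^ n \<le> h x}) \<longlonglongrightarrow> measure (\<mu> w) {x. 0 < h x}" if "w \<in> \<C>" for w
    unfolding un[symmetric]
    by (rule finite_measure.finite_Lim_measure_incseq[OF finite_mu[OF that] _ inc]) (use cl in \<open>auto simp: sets_mu[OF that]\<close>)
  show ?thesis unfolding pair_measure_def by (intro tendsto_add lim C_add C_diff u v)
qed

lemma pair_measure_Un:
  "u \<in> \<C> \<Longrightarrow> v \<in> \<C> \<Longrightarrow> A \<in> sets borel \<Longrightarrow> B \<in> sets borel \<Longrightarrow> A \<inter> B = {} \<Longrightarrow>
    pair_measure u v (A \<union> B) = pair_measure u v A + pair_measure u v B"
  by (rule signed_borel_measure_Un[OF signed_pair_measure])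

text \<open>
  Where \<open>h\<close> is large, the folded functions differ from \<open>u\<close> and \<open>v\<close> by signs and constants; the
  rest of the set where \<open>h\<close> is positive carries little mass.
\<close>

proposition pair_energy_tendsto:
  assumes u: "u \<in> \<C>" and v: "v \<in> \<C>" and h: "h \<in> Cp"
  defines "U \<equiv> \<lambda>n x. min (zigzag (1 / 2 ^ n) (u x)) (h x)"
    and "V \<equiv> \<lambda>n x. min (zigzag (1 / 2 ^ n) (v x)) (h x)"
  shows "(\<lambda>n. \<E> (\<lambda>x. U n x + V n x) + \<E> (\<lambda>x. U n x - V n x)) \<longlonglongrightarrow> pair_measure u v {x. 0 < h x}"
proof -
  have hC: "h \<in> \<C>" using h by (rule CpD)
  have UC: "U n \<in> \<C>" and VC: "V n \<in> \<C>" for n unfolding U_def V_def by (intro trace_C u v h)+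
  \<comment> \<open>Here \<open>h\<close> is at least the height of the fold, so the cap is
    inactive.\<close>
  define G where "G n = {x. 1 / 2 ^ n \<le> h x}" for n :: nat
  define D where "D n = {x. 0 < h x} - G n" for n
  define Z where "Z = {x. h x \<le> 0}"
  have cont: "continuous_on UNIV u" "continuous_on UNIV v" "continuous_on UNIV h"
    "continuous_on UNIV (U n)" "continuous_on UNIV (V n)" for n
    using C_continuous u v hC UC VC by blast+
  have G: "G n \<in> sets borel" for n unfolding G_def using cont by (intro borel_closed closed_Collect_le continuous_intros)
  have P: "{x. 0 < h x} \<in> sets borel" using open_superlevel[OF h] by (rule borel_open)
  have D: "D n \<in> sets borel" for n unfolding D_def using G P by auto
  have Zb: "Z \<in> sets borel" unfolding Z_def using cont by (intro borel_closed closed_Collect_le continuous_intros)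
  define s where "s b = (if b then 1 else -1 :: real)" for b
  have s: "s b = 1 \<or> s b = -1" for b by (simp add: s_def)
  have zz: "\<exists>b j. zigzag (1 / 2 ^ n) t = s b * (t - 2 * (1 / 2 ^ n) * of_int (j :: int))" for n t
  proof -
    obtain j :: int where j: "zigzag (1 / 2 ^ n) t = \<bar>t - 2 * (1 / 2 ^ n) * of_int j\<bar>" by (rule zigzag_cases)
    show ?thesis unfolding j s_def by (auto simp: abs_if intro: exI[of _ j] exI[of _ True] exI[of _ False])
  qed
  \<comment> \<open>Cells on which both folds are affine with given signs and offsets; there are
    countably many.\<close>
  define S where "S n I = (case I of ((b, j), (c, i)) \<Rightarrow>
      {x. zigzag (1 / 2 ^ n) (u x) = s b * (u x - 2 * (1 / 2 ^ n) * of_int j) \<and>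
          zigzag (1 / 2 ^ n) (v x) = s c * (v x - 2 * (1 / 2 ^ n) * of_int i)})"
    for n :: nat and I :: "(bool \<times> int) \<times> (bool \<times> int)"
  have Scov: "x \<in> (\<Union>I. S n I)" for x n
  proof -
    obtain b j c i where "zigzag (1 / 2 ^ n) (u x) = s b * (u x - 2 * (1 / 2 ^ n) * of_int (j :: int))"
      "zigzag (1 / 2 ^ n) (v x) = s c * (v x - 2 * (1 / 2 ^ n) * of_int (i :: int))" using zz by metis
    then have "x \<in> S n ((b, j), (c, i))" by (simp add: S_def)
    then show ?thesis by blast
  qed
  have Sb: "S n I \<in> sets borel" for n I
  proof -
    have z: "continuous_on UNIV (\<lambda>x. zigzag (1 / 2 ^ n) (w x))" if "w \<in> \<C>" for w
      using C_continuous[OF C_zigzag[OF that, of "1 / 2 ^ n"]] by simp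
    obtain b j c i where I: "I = ((b, j), (c, i))" by (metis surj_pair)
    show ?thesis unfolding I S_def using z[OF u] z[OF v] cont(1,2)
      by (auto intro!: borel_closed closed_Collect_conj closed_Collect_eq continuous_intros)
  qed
  have onG: "pair_measure (U n) (V n) (G n) = pair_measure u v (G n)" for n
  proof (rule signed_borel_measure_eq_if_locally_eq[OF signed_pair_measure[OF UC VC] signed_pair_measure[OF u v] Sb[of n] G])
    show "G n \<subseteq> (\<Union>I. S n I)" using Scov by blast
    fix A I assume A: "A \<in> sets borel" "A \<subseteq> S n I" "A \<subseteq> G n"
    obtain b j c i where I: "I = ((b, j), (c, i))" by (metis surj_pair)
    have zle: "zigzag (1 / 2 ^ n) t \<le> h x" if "x \<in> A" for x t
      using zigzag_le[of "1 / 2 ^ n" t] that A(3) by (auto simp: G_def)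
    show "pair_measure (U n) (V n) A = pair_measure u v A"
    proof (rule pair_measure_local[OF UC VC u v A(1) s s])
      fix x assume x: "x \<in> A"
      then have e: "zigzag (1 / 2 ^ n) (u x) = s b * (u x - 2 * (1 / 2 ^ n) * of_int j)"
        "zigzag (1 / 2 ^ n) (v x) = s c * (v x - 2 * (1 / 2 ^ n) * of_int i)" using A(2) by (auto simp: S_def I)
      have UV: "U n x = zigzag (1 / 2 ^ n) (u x)" "V n x = zigzag (1 / 2 ^ n) (v x)"
        using zle[OF x] by (simp_all add: U_def V_def min_absorb1)
      show "U n x = s b * u x + (- (s b * (2 * (1 / 2 ^ n) * of_int j)))"
        "V n x = s c * v x + (- (s c * (2 * (1 / 2 ^ n) * of_int i)))"
        unfolding UV e by (simp_all add: right_diff_distrib)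
    qed
  qed
  \<comment> \<open>On \<open>D n\<close> each function is either a branch of its fold or
    \<open>h\<close> itself. The sum over the four combinations dominates whichever of them
    occurs.\<close>
  define \<gamma> where "\<gamma> A = (pair_measure u v A + pair_measure u h A) + (pair_measure h v A + pair_measure h h A)" for A
  have sg: "signed_borel_measure \<gamma>" unfolding \<gamma>_def[abs_def]
    by (intro signed_borel_measure_add signed_pair_measure u v hC)
  define T where "T n I = (case I of (I', d, e) \<Rightarrow> S n I' \<inter> {x. if d then U n x = zigzag (1 / 2 ^ n) (u x) else U n x = h x}
      \<inter> {x. if e then V n x = zigzag (1 / 2 ^ n) (v x) else V n x = h x})"
    for n and I :: "((bool \<times> int) \<times> (bool \<times> int)) \<times> bool \<times> bool"
  have Tcov: "x \<in> (\<Union>I. T n I)" for x n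
  proof -
    obtain I' where I': "x \<in> S n I'" using Scov by blast
    have "x \<in> T n (I', zigzag (1 / 2 ^ n) (u x) \<le> h x, zigzag (1 / 2 ^ n) (v x) \<le> h x)"
      using I' by (auto simp: T_def U_def V_def)
    then show ?thesis by blast
  qed
  have Tb: "T n I \<in> sets borel" for n I
  proof -
    have z: "continuous_on UNIV (\<lambda>x. zigzag (1 / 2 ^ n) (w x))" if "w \<in> \<C>" for w
      using C_continuous[OF C_zigzag[OF that, of "1 / 2 ^ n"]] by simp
    obtain I' d e where I: "I = (I', d, e)" by (metis surj_pair)
    have "{x. if d then U n x = zigzag (1 / 2 ^ n) (u x) else U n x = h x} \<in> sets borel"
      using z[OF u] cont by (cases d) (auto intro!: borel_closed closed_Collect_eq)
    moreover have "{x. if e then V n x = zigzag (1 / 2 ^ n) (v x) else V n x = h x} \<in> sets borel"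
      using z[OF v] cont by (cases e) (auto intro!: borel_closed closed_Collect_eq)
    ultimately show ?thesis unfolding I T_def using Sb[of n I'] by auto
  qed
  have onD: "pair_measure (U n) (V n) (D n) \<le> \<gamma> (D n)" for n
  proof (rule signed_borel_measure_le_if_locally_le[OF signed_pair_measure[OF UC VC] sg Tb[of n] D])
    show "D n \<subseteq> (\<Union>I. T n I)" using Tcov by blast
    fix A I assume A: "A \<in> sets borel" "A \<subseteq> T n I" "A \<subseteq> D n"
    obtain b j c i d e where I: "I = (((b, j), (c, i)), d, e)" by (metis surj_pair)
    define u' where "u' = (if d then u else h)"
    define v' where "v' = (if e then v else h)"
    define \<sigma> where "\<sigma> = (if d then s b else 1)"
    define \<tau> where "\<tau> = (if e then s c else 1)"
    have "pair_measure (U n) (V n) A = pair_measure u' v' A"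
    proof (rule pair_measure_local[OF UC VC _ _ A(1)])
      show "u' \<in> \<C>" "v' \<in> \<C>" using u v hC by (auto simp: u'_def v'_def)
      show "\<sigma> = 1 \<or> \<sigma> = -1" "\<tau> = 1 \<or> \<tau> = -1" using s by (auto simp: \<sigma>_def \<tau>_def)
      fix x assume x: "x \<in> A"
      then have e: "zigzag (1 / 2 ^ n) (u x) = s b * (u x - 2 * (1 / 2 ^ n) * of_int j)"
        "zigzag (1 / 2 ^ n) (v x) = s c * (v x - 2 * (1 / 2 ^ n) * of_int i)"
        "if d then U n x = zigzag (1 / 2 ^ n) (u x) else U n x = h x"
        "if e then V n x = zigzag (1 / 2 ^ n) (v x) else V n x = h x" using A(2) by (auto simp: S_def T_def I)
      show "U n x = \<sigma> * u' x + (if d then - (s b * (2 * (1 / 2 ^ n) * of_int j)) else 0)"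
        using e by (cases d) (simp_all add: \<sigma>_def u'_def right_diff_distrib)
      show "V n x = \<tau> * v' x + (if e then - (s c * (2 * (1 / 2 ^ n) * of_int i)) else 0)"
        using e by (cases e) (simp_all add: \<tau>_def v'_def right_diff_distrib)
    qed
    also have "\<dots> \<le> \<gamma> A" unfolding \<gamma>_def u'_def v'_def
      using pair_measure_nonneg[of u v A] pair_measure_nonneg[of u h A] pair_measure_nonneg[of h v A] pair_measure_nonneg[of h h A]
      by (cases d; cases e) simp_all
    finally show "pair_measure (U n) (V n) A \<le> \<gamma> A" .
  qed
  have onZ: "pair_measure (U n) (V n) Z = 0" for n
  proof -
    have "pair_measure (U n) (V n) Z = pair_measure (\<lambda>x. 0) (\<lambda>x. 0) Z"
    proof (rule pair_measure_local[OF UC[of n] VC[of n] C_zero C_zero Zb, of 1 1 0 0])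
      fix x assume "x \<in> Z"
      then have "h x = 0" using CpD(2)[OF h, of x] by (simp add: Z_def)
      then show "U n x = 1 * 0 + 0" "V n x = 1 * 0 + 0" by (simp_all add: U_def V_def zigzag_nonneg)
    qed auto
    then show ?thesis by (simp add: pair_measure_def measure_mu_zero)
  qed
  \<comment> \<open>The space splits into \<open>G n\<close>, \<open>D n\<close> and the zero set of
    \<open>h\<close>, where both capped folds vanish.\<close>
  have tot: "\<E> (\<lambda>x. U n x + V n x) + \<E> (\<lambda>x. U n x - V n x) = pair_measure u v (G n) + pair_measure (U n) (V n) (D n)" for n
  proof -
    have GP: "G n \<subseteq> {x. 0 < h x}" by (auto simp: G_def intro: less_le_trans[of 0 "1 / 2 ^ n"])
    have "(UNIV :: 'a set) = (G n \<union> D n) \<union> Z" using GP by (auto simp: D_def Z_def)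
    then have "pair_measure (U n) (V n) UNIV = pair_measure (U n) (V n) (G n \<union> D n) + pair_measure (U n) (V n) Z"
      using GP G D Zb by (metis (no_types, lifting) pair_measure_Un[OF UC VC] sets.Un Int_Un_distrib2 Un_empty disjoint_iff D_def DiffD1 Z_def mem_Collect_eq not_le subsetD)
    also have "pair_measure (U n) (V n) (G n \<union> D n) = pair_measure (U n) (V n) (G n) + pair_measure (U n) (V n) (D n)"
      by (rule pair_measure_Un[OF UC VC G D]) (auto simp: D_def)
    finally show ?thesis by (simp add: pair_measure_UNIV[OF UC VC] onG onZ)
  qed
  have lim: "(\<lambda>n. pair_measure w w' (G n)) \<longlonglongrightarrow> pair_measure w w' {x. 0 < h x}" if "w \<in> \<C>" "w' \<in> \<C>" for w w'
    unfolding G_def by (rule pair_measure_LIMSEQ[OF that h])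
  have limD: "(\<lambda>n. pair_measure w w' (D n)) \<longlonglongrightarrow> 0" if "w \<in> \<C>" "w' \<in> \<C>" for w w'
  proof -
    have "pair_measure w w' {x. 0 < h x} = pair_measure w w' (G n) + pair_measure w w' (D n)" for n
    proof -
      have "{x. 0 < h x} = G n \<union> D n" by (auto simp: G_def D_def intro: less_le_trans[of 0 "1 / 2 ^ n"])
      then show ?thesis using pair_measure_Un[OF that G D, of n n] by (auto simp: D_def)
    qed
    then have e: "pair_measure w w' (D n) = pair_measure w w' {x. 0 < h x} - pair_measure w w' (G n)" for n by (simp add: algebra_simps)
    have "(\<lambda>n. pair_measure w w' {x. 0 < h x} - pair_measure w w' (G n)) \<longlonglongrightarrow> pair_measure w w' {x. 0 < h x} - pair_measure w w' {x. 0 < h x}"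
      by (intro tendsto_diff tendsto_const lim that)
    then show ?thesis unfolding e by simp
  qed
  have "(\<lambda>n. \<gamma> (D n)) \<longlonglongrightarrow> (0 + 0) + (0 + 0)" unfolding \<gamma>_def
    by (intro tendsto_add limD u v hC)
  then have g0: "(\<lambda>n. \<gamma> (D n)) \<longlonglongrightarrow> 0" by simp
  have "(\<lambda>n. pair_measure (U n) (V n) (D n)) \<longlonglongrightarrow> 0"
    by (rule tendsto_sandwich[OF _ _ tendsto_const g0]) (use onD pair_measure_nonneg in auto)
  from tendsto_add[OF lim[OF u v] this] show ?thesis unfolding tot by simp
qed

lemma pair_energy_tendsto_self:
  assumes f: "f \<in> \<C>" and h: "h \<in> Cp"
  shows "(\<lambda>n. trace_energy n f h) \<longlonglongrightarrow> measure (\<mu> f) {x. 0 < h x}"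
proof -
  have z: "min (zigzag (1 / 2 ^ n) 0) (h x) = 0" for n x using CpD(2)[OF h, of x] by (simp add: zigzag_0)
  have "(\<lambda>n. trace_energy n f h + trace_energy n f h) \<longlonglongrightarrow> measure (\<mu> f) {x. 0 < h x} + measure (\<mu> f) {x. 0 < h x}"
    using pair_energy_tendsto[OF f C_zero h] unfolding z by (simp add: trace_energy_def pair_measure_def)
  from tendsto_mult[OF tendsto_const[of "1/2"] this] show ?thesis by simp
qed

text \<open>The limit of the capped energies does not involve \<mu>; so all families of this kind
  agree on superlevel sets.\<close>

corollary measure_mu_superlevel:
  assumes "f \<in> \<C>" "h \<in> Cp" shows "measure (\<mu> f) {x. 0 < h x} = lam f h"
  using LIMSEQ_unique[OF pair_energy_tendsto_self[OF assms] trace_tendsto[OF assms]] .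

end

context p_energy_space
begin

lemma local_energy_family_emu: "local_energy_family p m \<E> \<F> emu"
proof
  show "measure (emu f) A = measure (emu g) A"
    if "f \<in> \<C>" "g \<in> \<C>" "A \<in> sets borel" "\<And>x. x \<in> A \<Longrightarrow> f x - g x = c" for f g A c
    by (rule measure_emu_local[OF that])
qed (simp_all add: sets_emu emeasure_emu_UNIV emu_minus)

text \<open>A Clarkson inequality involves four measures, so one set has to work for several: open
  supersets are intersected, and the functions approximating from inside are combined by their
  maximum.\<close>

lemma superlevel_approx:
  assumes I: "finite I" "I \<subseteq> \<C>" and A: "A \<in> sets borel" and e: "\<epsilon> > 0"
  obtains h where "h \<in> Cp" "\<And>f. f \<in> I \<Longrightarrow> \<bar>measure (emu f) {x. 0 < h x} - measure (emu f) A\<bar> < \<epsilon>"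
proof -
  have "\<forall>f\<in>I. \<exists>U. open U \<and> A \<subseteq> U \<and> measure (emu f) U < measure (emu f) A + \<epsilon>"
    using radon_outer_approx[OF radon_emu E_eq_measure_emu A e] I(2) by (metis subsetD)
  then obtain W where W: "\<And>f. f \<in> I \<Longrightarrow> open (W f) \<and> A \<subseteq> W f \<and> measure (emu f) (W f) < measure (emu f) A + \<epsilon>" by metis
  define U where "U = (\<Inter>f\<in>I. W f)"
  have U: "open U" "A \<subseteq> U" using W I(1) by (auto simp: U_def)
  have "\<forall>f\<in>I. \<exists>h. h \<in> Cp \<and> {x. 0 < h x} \<subseteq> U \<and> measure (emu f) U - \<epsilon> < measure (emu f) {x. 0 < h x}"
  proof
    fix f assume "f \<in> I"
    then have f: "f \<in> \<C>" using I(2) by blast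
    show "\<exists>h. h \<in> Cp \<and> {x. 0 < h x} \<subseteq> U \<and> measure (emu f) U - \<epsilon> < measure (emu f) {x. 0 < h x}"
    proof (rule ccontr)
      assume c: "\<not> ?thesis"
      have le: "lam f h \<le> measure (emu f) U - \<epsilon>" if "h \<in> Cp" "{x. 0 < h x} \<subseteq> U" for h
        using c that measure_emu_superlevel[OF f that(1)] by (metis not_le)
      have nn: "0 \<le> measure (emu f) U - \<epsilon>" using le[OF Cp_closed(1)] lam_zero[OF f] by simp
      \<comment> \<open>The mass of \<open>U\<close> is the supremum of \<open>lam f h\<close>, so
        it would be at most itself minus \<epsilon>.\<close>
      have "emeasure (emu f) U \<le> ennreal (measure (emu f) U - \<epsilon>)"
        unfolding emeasure_emu_open[OF f U(1)] nu_def by (intro SUP_least ennreal_leI le) auto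
      then show False using nn e by (simp add: emeasure_emu_eq_measure[OF f])
    qed
  qed
  then obtain k where k: "\<And>f. f \<in> I \<Longrightarrow> k f \<in> Cp \<and> {x. 0 < k f x} \<subseteq> U \<and> measure (emu f) U - \<epsilon> < measure (emu f) {x. 0 < k f x}"
    by metis
  obtain h where h: "h \<in> Cp" "\<And>x. 0 < h x \<longleftrightarrow> (\<exists>k\<in>k ` I. 0 < k x)"
    by (rule Cp_finite_max[of "k ` I"]) (use I k in auto)
  show ?thesis
  proof (rule that[OF h(1)])
    fix f assume fI: "f \<in> I"
    then have f: "f \<in> \<C>" using I(2) by blast
    interpret finite_measure "emu f" by (rule finite_emu[OF f])
    have Ub: "U \<in> sets (emu f)" "W f \<in> sets (emu f)" "{x. 0 < h x} \<in> sets (emu f)"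
      using U W[OF fI] open_superlevel[OF h(1), of 0] by (auto simp: sets_emu[OF f])
    have "{x. 0 < h x} \<subseteq> U" using h(2) k by force
    then have "measure (emu f) {x. 0 < h x} \<le> measure (emu f) U" using Ub by (intro finite_measure_mono)
    also have "\<dots> \<le> measure (emu f) (W f)" using Ub fI by (intro finite_measure_mono) (auto simp: U_def)
    also have "\<dots> < measure (emu f) A + \<epsilon>" using W[OF fI] by simp
    finally have 1: "measure (emu f) {x. 0 < h x} < measure (emu f) A + \<epsilon>" .
    have "{x. 0 < k f x} \<subseteq> {x. 0 < h x}" using h(2) fI by auto
    then have "measure (emu f) {x. 0 < k f x} \<le> measure (emu f) {x. 0 < h x}" using Ub by (intro finite_measure_mono)
    moreover have "measure (emu f) A \<le> measure (emu f) U" using Ub U by (intro finite_measure_mono)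
    ultimately have 2: "measure (emu f) A - \<epsilon> < measure (emu f) {x. 0 < h x}" using k[OF fI] by linarith
    show "\<bar>measure (emu f) {x. 0 < h x} - measure (emu f) A\<bar> < \<epsilon>" using 1 2 by linarith
  qed
qed

lemma superlevel_LIMSEQ:
  assumes I: "finite I" "I \<subseteq> \<C>" and A: "A \<in> sets borel"
  obtains h where "\<And>n :: nat. h n \<in> Cp" "\<And>f. f \<in> I \<Longrightarrow> (\<lambda>n. measure (emu f) {x. 0 < h n x}) \<longlonglongrightarrow> measure (emu f) A"
proof -
  have "\<exists>h. h \<in> Cp \<and> (\<forall>f\<in>I. \<bar>measure (emu f) {x. 0 < h x} - measure (emu f) A\<bar> < 1 / real (Suc n))" for n
    by (rule superlevel_approx[OF I A, of "1 / real (Suc n)"]) auto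
  then obtain h where h: "\<And>n. h n \<in> Cp" "\<And>n f. f \<in> I \<Longrightarrow> \<bar>measure (emu f) {x. 0 < h n x} - measure (emu f) A\<bar> < 1 / real (Suc n)"
    by metis
  have "(\<lambda>n. measure (emu f) {x. 0 < h n x}) \<longlonglongrightarrow> measure (emu f) A" if "f \<in> I" for f
  proof (rule LIM_zero_cancel, rule Lim_null_comparison[OF _ LIMSEQ_const_over_Suc[of 1]])
    show "\<forall>\<^sub>F n in sequentially. norm (measure (emu f) {x. 0 < h n x} - measure (emu f) A) \<le> 1 / real (Suc n)"
      using h(2)[OF that] by (auto intro!: always_eventually less_imp_le)
  qed
  then show ?thesis using that h(1) by blast
qed

text \<open>Rescaled measures of rescaled functions again satisfy the hypotheses of uniqueness.\<close>

lemma measure_emu_scale: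
  assumes f: "f \<in> \<C>" and A: "A \<in> sets borel"
  shows "measure (emu (\<lambda>x. c * f x)) A = \<bar>c\<bar> powr p * measure (emu f) A"
proof (cases "c = 0")
  case True
  interpret local_energy_family p m \<E> \<F> emu by (rule local_energy_family_emu)
  show ?thesis using True measure_mu_zero by simp
next
  case False
  define r where "r = \<bar>c\<bar> powr p"
  have r: "r > 0" using False by (simp add: r_def)
  have ms: "measure (scale_measure (ennreal (1 / r)) M) B = 1 / r * measure M B" for M :: "'a measure" and B
    using r by (simp add: measure_def enn2real_mult)
  interpret L: local_energy_family p m \<E> \<F> "\<lambda>f. scale_measure (ennreal (1 / r)) (emu (\<lambda>x. c * f x))"
  proof
    show "sets (scale_measure (ennreal (1 / r)) (emu (\<lambda>x. c * f x))) = sets borel" if "f \<in> \<C>" for f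
      using sets_emu[OF C_scale[OF that, of c]] by simp
    show "emeasure (scale_measure (ennreal (1 / r)) (emu (\<lambda>x. c * f x))) UNIV = ennreal (\<E> f)" if "f \<in> \<C>" for f
    proof -
      have "\<E> (\<lambda>x. c * f x) = r * \<E> f" using that by (simp add: E_scale r_def)
      then show ?thesis using r that emeasure_emu_UNIV[OF C_scale[OF that, of c]]
        by (simp add: ennreal_mult'[symmetric] E_nonneg)
    qed
    show "measure (scale_measure (ennreal (1 / r)) (emu (\<lambda>x. c * f x))) A = measure (scale_measure (ennreal (1 / r)) (emu (\<lambda>x. c * g x))) A"
      if "f \<in> \<C>" "g \<in> \<C>" "A \<in> sets borel" "\<And>x. x \<in> A \<Longrightarrow> f x - g x = d" for f g A d
    proof -
      have "measure (emu (\<lambda>x. c * f x)) A = measure (emu (\<lambda>x. c * g x)) A"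
        by (rule measure_emu_local[OF C_scale[OF that(1)] C_scale[OF that(2)] that(3), of _ _ "c * d"])
          (simp add: that(4)[symmetric] right_diff_distrib)
      then show ?thesis by (simp add: ms)
    qed
    show "measure (scale_measure (ennreal (1 / r)) (emu (\<lambda>x. c * - f x))) A = measure (scale_measure (ennreal (1 / r)) (emu (\<lambda>x. c * f x))) A"
      if "f \<in> \<C>" "A \<in> sets borel" for f A
      using emu_minus[of "\<lambda>x. c * f x"] by simp
  qed
  have C: "{f, \<lambda>x. c * f x} \<subseteq> \<C>" using f C_scale[OF f, of c] by blast
  obtain h where h: "\<And>n. h n \<in> Cp"
    and l: "\<And>g. g \<in> {f, \<lambda>x. c * f x} \<Longrightarrow> (\<lambda>n. measure (emu g) {x. 0 < h n x}) \<longlonglongrightarrow> measure (emu g) A"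
    by (rule superlevel_LIMSEQ[OF _ C A]) auto
  have "measure (emu (\<lambda>x. c * f x)) {x. 0 < h n x} = r * measure (emu f) {x. 0 < h n x}" for n
    using L.measure_mu_superlevel[OF f h, of n] r by (simp add: ms measure_emu_superlevel[OF f h] field_simps)
  then have "(\<lambda>n. measure (emu (\<lambda>x. c * f x)) {x. 0 < h n x}) \<longlonglongrightarrow> r * measure (emu f) A"
    using tendsto_mult[OF tendsto_const l[of f]] by simp
  then show ?thesis using LIMSEQ_unique[OF l[of "\<lambda>x. c * f x"]] by (simp add: r_def)
qed

text \<open>On superlevel sets the inequalities are limits of those of the form for the capped folds
  of \<open>u\<close> and \<open>v\<close>; Borel sets follow by simultaneous approximation.\<close>

lemma clarkson_ineq_emu:
  assumes u: "u \<in> \<C>" and v: "v \<in> \<C>" and A: "A \<in> sets borel"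
  shows "clarkson_ineq p (measure (emu u) A) (measure (emu v) A)
    (measure (emu (\<lambda>x. u x + v x)) A + measure (emu (\<lambda>x. u x - v x)) A)"
proof -
  interpret local_energy_family p m \<E> \<F> emu by (rule local_energy_family_emu)
  have super: "clarkson_ineq p (measure (emu u) {x. 0 < h x}) (measure (emu v) {x. 0 < h x})
    (measure (emu (\<lambda>x. u x + v x)) {x. 0 < h x} + measure (emu (\<lambda>x. u x - v x)) {x. 0 < h x})" if h: "h \<in> Cp" for h
  proof (rule clarkson_ineq_LIMSEQ[OF p pair_energy_tendsto_self[OF u h] pair_energy_tendsto_self[OF v h]
        pair_energy_tendsto[OF u v h, unfolded pair_measure_def]])
    fix n
    have c: "(\<lambda>x. min (zigzag (1 / 2 ^ n) (u x)) (h x)) \<in> \<F>" "(\<lambda>x. min (zigzag (1 / 2 ^ n) (v x)) (h x)) \<in> \<F>"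
      using trace_C[OF u h] trace_C[OF v h] by auto
    show "clarkson_ineq p (trace_energy n u h) (trace_energy n v h)
       (\<E> (\<lambda>x. min (zigzag (1 / 2 ^ n) (u x)) (h x) + min (zigzag (1 / 2 ^ n) (v x)) (h x)) +
        \<E> (\<lambda>x. min (zigzag (1 / 2 ^ n) (u x)) (h x) - min (zigzag (1 / 2 ^ n) (v x)) (h x)))"
      unfolding trace_energy_def by (rule E_clarkson[OF c])
    show "0 \<le> trace_energy n u h" "0 \<le> trace_energy n v h" by (intro trace_nonneg u v h)+
  qed
  let ?I = "{u, v, \<lambda>x. u x + v x, \<lambda>x. u x - v x}"
  have C: "?I \<subseteq> \<C>" using u v C_add[OF u v] C_diff[OF u v] by blast
  obtain h where h: "\<And>n. h n \<in> Cp"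
    and l: "\<And>g. g \<in> ?I \<Longrightarrow> (\<lambda>n. measure (emu g) {x. 0 < h n x}) \<longlonglongrightarrow> measure (emu g) A"
    by (rule superlevel_LIMSEQ[OF _ C A]) auto
  show ?thesis
    by (rule clarkson_ineq_LIMSEQ[OF p l l tendsto_add[OF l l] super[OF h]]) auto
qed

lemma clarkson_emu: "A \<in> sets borel \<Longrightarrow> clarkson p \<C> (\<lambda>f. measure (emu f) A powr (1 / p))"
  unfolding clarkson_iff[of p \<C> "\<lambda>f. measure (emu f) A", OF p C_subspace measure_nonneg]
  using clarkson_ineq_emu by blast

lemma measure_emu_le: "f \<in> \<C> \<Longrightarrow> measure (emu f) A \<le> \<E> f"
  using emeasure_emu_le[of f A] emeasure_emu_eq_measure[of f A] by (simp add: E_nonneg)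

lemma seminorm_emu:
  assumes A: "A \<in> sets borel"
  shows "seminorm_on \<C> (\<lambda>f. measure (emu f) A powr (1 / p))"
proof (rule clarkson_imp_seminorm_on[OF p C_subspace measure_nonneg clarkson_emu[OF A] measure_emu_scale[OF _ A]])
  fix u v :: "'a \<Rightarrow> real" and a b :: real assume uv: "u \<in> \<C>" "v \<in> \<C>"
  show "bdd_above ((\<lambda>t. measure (emu (\<lambda>x. u x + t * v x)) A) ` {a..b})"
  proof (rule bdd_aboveI2)
    fix t assume t: "t \<in> {a..b}"
    have tv: "(\<lambda>x. t * v x) \<in> \<C>" by (rule C_scale[OF uv(2)])
    have "measure (emu (\<lambda>x. u x + t * v x)) A \<le> \<E> (\<lambda>x. u x + t * v x)" by (intro measure_emu_le C_add uv tv)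
    also have "\<dots> = N (\<lambda>x. u x + t * v x) powr p" using C_add[OF uv(1) tv] by (intro E_eq_N) auto
    also have "\<dots> \<le> (N u + (\<bar>a\<bar> + \<bar>b\<bar>) * N v) powr p"
    proof (intro powr_mono2 N_nonneg)
      have "N (\<lambda>x. u x + t * v x) \<le> N u + N (\<lambda>x. t * v x)" using uv tv by (intro N_add) auto
      also have "N (\<lambda>x. t * v x) = \<bar>t\<bar> * N v" using uv by (intro N_scale) auto
      also have "\<dots> \<le> (\<bar>a\<bar> + \<bar>b\<bar>) * N v" using t by (intro mult_right_mono N_nonneg) auto
      finally show "N (\<lambda>x. u x + t * v x) \<le> N u + (\<bar>a\<bar> + \<bar>b\<bar>) * N v" by simp
    qed (use p in auto)
    finally show "measure (emu (\<lambda>x. u x + t * v x)) A \<le> (N u + (\<bar>a\<bar> + \<bar>b\<bar>) * N v) powr p" .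
  qed
qed

end

section \<open>Existence and uniqueness of the energy measures\<close>

lemma seminorm_on_diff:
  assumes V: "linear_subspace V" and N: "seminorm_on V N" and fg: "f \<in> V" "g \<in> V"
  shows "\<bar>N f - N g\<bar> \<le> N (\<lambda>x. f x - g x)"
proof -
  have add: "\<forall>f\<in>V. \<forall>g\<in>V. N (\<lambda>x. f x + g x) \<le> N f + N g"
    using N unfolding seminorm_on_def by blast
  have tri: "N u \<le> N w + N (\<lambda>x. u x - w x)" if "u \<in> V" "w \<in> V" for u w
  proof -
    have "N (\<lambda>x. w x + (u x - w x)) \<le> N w + N (\<lambda>x. u x - w x)"
      by (rule bspec[OF bspec[OF add that(2)] linear_subspaceD(5)[OF V that]])
    then show ?thesis by simp
  qed
  have "(\<lambda>x. - 1 * (f x - g x)) = (\<lambda>x. g x - f x)" by auto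
  then have "N (\<lambda>x. g x - f x) = \<bar>- 1\<bar> * N (\<lambda>x. f x - g x)"
    using N linear_subspaceD(5)[OF V fg] unfolding seminorm_on_def by metis
  then show ?thesis using tri[OF fg] tri[OF fg(2,1)] by simp
qed

lemma radon_measureI:
  fixes M :: "'a::t2_space measure"
  assumes M: "finite_measure M" "sets M = sets borel"
    and outer: "\<And>A \<epsilon>. A \<in> sets borel \<Longrightarrow> \<epsilon> > 0 \<Longrightarrow> \<exists>U. open U \<and> A \<subseteq> U \<and> measure M U \<le> measure M A + \<epsilon>"
    and inner: "\<And>U \<epsilon>. open U \<Longrightarrow> \<epsilon> > 0 \<Longrightarrow> \<exists>K. compact K \<and> K \<subseteq> U \<and> measure M U \<le> measure M K + \<epsilon>"
  shows "radon_measure M"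
proof -
  interpret finite_measure M by fact
  show ?thesis unfolding radon_measure_def
  proof (intro conjI allI impI ballI M)
    show "emeasure M K < \<infinity>" for K by (simp add: emeasure_eq_measure)
    fix A :: "'a set" assume A: "A \<in> sets borel"
    show "emeasure M A = (INF U\<in>{U. open U \<and> A \<subseteq> U}. emeasure M U)"
    proof (rule antisym)
      show "emeasure M A \<le> (INF U\<in>{U. open U \<and> A \<subseteq> U}. emeasure M U)"
        by (rule INF_greatest) (auto intro!: emeasure_mono simp: M(2))
      show "(INF U\<in>{U. open U \<and> A \<subseteq> U}. emeasure M U) \<le> emeasure M A"
      proof (rule ennreal_le_epsilon)
        fix e :: real assume e: "0 < e"
        then obtain U where U: "open U" "A \<subseteq> U" "measure M U \<le> measure M A + e" using outer[OF A] by blast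
        then have "(INF U\<in>{U. open U \<and> A \<subseteq> U}. emeasure M U) \<le> emeasure M U" by (intro INF_lower) auto
        also have "\<dots> \<le> ennreal (measure M A + e)" unfolding emeasure_eq_measure using U(3) by (rule ennreal_leI)
        also have "\<dots> = emeasure M A + ennreal e" unfolding emeasure_eq_measure using e by (intro ennreal_plus) auto
        finally show "(INF U\<in>{U. open U \<and> A \<subseteq> U}. emeasure M U) \<le> emeasure M A + ennreal e" .
      qed
    qed
  next
    fix U :: "'a set" assume U: "open U"
    show "emeasure M U = (SUP K\<in>{K. compact K \<and> K \<subseteq> U}. emeasure M K)"
    proof (rule antisym)
      show "(SUP K\<in>{K. compact K \<and> K \<subseteq> U}. emeasure M K) \<le> emeasure M U"
        by (rule SUP_least) (use U in \<open>auto intro!: emeasure_mono simp: M(2)\<close>)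
      show "emeasure M U \<le> (SUP K\<in>{K. compact K \<and> K \<subseteq> U}. emeasure M K)"
      proof (rule ennreal_le_epsilon)
        fix e :: real assume e: "0 < e"
        then obtain K where K: "compact K" "K \<subseteq> U" "measure M U \<le> measure M K + e" using inner[OF U] by blast
        have "emeasure M U \<le> ennreal (measure M K + e)" unfolding emeasure_eq_measure using K(3) by (rule ennreal_leI)
        also have "\<dots> = emeasure M K + ennreal e" unfolding emeasure_eq_measure using e by (intro ennreal_plus) auto
        also have "emeasure M K \<le> (SUP K\<in>{K. compact K \<and> K \<subseteq> U}. emeasure M K)" using K by (intro SUP_upper) auto
        finally show "emeasure M U \<le> (SUP K\<in>{K. compact K \<and> K \<subseteq> U}. emeasure M K) + ennreal e" by (simp add: add_right_mono)
      qed
    qed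
  qed
qed

section \<open>Extension from the core to the domain\<close>

context p_energy_space
begin

lemma N_zero: "N (\<lambda>x. 0) = 0"
  by (simp add: N_def E_zero)

lemma N_minus_commute: "f \<in> \<F> \<Longrightarrow> g \<in> \<F> \<Longrightarrow> N (\<lambda>x. f x - g x) = N (\<lambda>x. g x - f x)"
  using N_minus[of "\<lambda>x. f x - g x"] F_closed(5) by simp

lemma N_triangle3: "f \<in> \<F> \<Longrightarrow> g \<in> \<F> \<Longrightarrow> h \<in> \<F> \<Longrightarrow> N (\<lambda>x. f x - h x) \<le> N (\<lambda>x. f x - g x) + N (\<lambda>x. g x - h x)"
  using N_add[of "\<lambda>x. f x - g x" "\<lambda>x. g x - h x"] F_closed(5) by simp

lemma dense_C: assumes f: "f \<in> \<F>" and e: "\<epsilon> > 0" obtains g where "g \<in> \<C>" "N (\<lambda>x. f x - g x) < \<epsilon>"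
proof -
  obtain g where g: "g \<in> \<C>" "energy_norm p m \<E> (\<lambda>x. f x - g x) < \<epsilon>"
    using dense_F f e unfolding dense_wrt_def by blast
  have "(\<lambda>x. f x - g x) \<in> \<F>" using f g by (intro F_closed) auto
  then have "N (\<lambda>x. f x - g x) \<le> energy_norm p m \<E> (\<lambda>x. f x - g x)"
    unfolding N_def energy_norm_eq using p E_nonneg by (intro powr_mono2) auto
  then show ?thesis using that g by (meson le_less_trans)
qed

text \<open>One sequence is fixed for all Borel sets, so that additivity in the set can be checked
  along it.\<close>

definition appr :: "('a \<Rightarrow> real) \<Rightarrow> nat \<Rightarrow> 'a \<Rightarrow> real" where
  "appr f = (SOME g. \<forall>n. g n \<in> \<C> \<and> N (\<lambda>x. f x - g n x) < 1 / real (Suc n))"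

lemma
  assumes f: "f \<in> \<F>"
  shows appr_C: "appr f n \<in> \<C>" and appr_N: "(\<lambda>n. N (\<lambda>x. f x - appr f n x)) \<longlonglongrightarrow> 0"
proof -
  have "\<exists>g. g \<in> \<C> \<and> N (\<lambda>x. f x - g x) < 1 / real (Suc n)" for n
    by (rule dense_C[OF f, of "1 / real (Suc n)"]) auto
  then have "\<exists>g. \<forall>n. g n \<in> \<C> \<and> N (\<lambda>x. f x - g n x) < 1 / real (Suc n)" by metis
  from someI_ex[OF this] have a: "appr f n \<in> \<C>" "N (\<lambda>x. f x - appr f n x) < 1 / real (Suc n)" for n
    unfolding appr_def by auto
  show "appr f n \<in> \<C>" by (rule a)
  show "(\<lambda>n. N (\<lambda>x. f x - appr f n x)) \<longlonglongrightarrow> 0"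
    by (rule tendsto_sandwich[OF _ _ tendsto_const LIMSEQ_const_over_Suc[of 1]])
      (use a(2) N_nonneg in \<open>auto intro!: always_eventually less_imp_le simp del: of_nat_Suc\<close>)
qed

definition Phi :: "'a set \<Rightarrow> ('a \<Rightarrow> real) \<Rightarrow> real" where
  "Phi A f = measure (emu f) A powr (1 / p)"

lemma Phi_nonneg: "0 \<le> Phi A f"
  by (simp add: Phi_def)

lemma Phi_powr: "Phi A f powr p = measure (emu f) A"
  using p by (simp add: Phi_def powr_powr)

lemma Phi_le_N: "f \<in> \<C> \<Longrightarrow> Phi A f \<le> N f"
  unfolding Phi_def N_def using p measure_emu_le by (intro powr_mono2) auto

lemma Phi_seminorm: "A \<in> sets borel \<Longrightarrow> seminorm_on \<C> (Phi A)"
  using seminorm_emu by (simp add: Phi_def[abs_def])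

text \<open>The bound is the same for all Borel sets; this uniformity lets countable additivity and
  regularity survive the limit.\<close>

lemma Phi_diff: "f \<in> \<C> \<Longrightarrow> g \<in> \<C> \<Longrightarrow> A \<in> sets borel \<Longrightarrow> \<bar>Phi A f - Phi A g\<bar> \<le> N (\<lambda>x. f x - g x)"
  using seminorm_on_diff[OF C_subspace Phi_seminorm] Phi_le_N[OF C_diff] order_trans by blast

definition R :: "'a set \<Rightarrow> ('a \<Rightarrow> real) \<Rightarrow> real" where
  "R A f = lim (\<lambda>n. Phi A (appr f n))"

lemma R_LIMSEQ_appr:
  assumes f: "f \<in> \<F>" and A: "A \<in> sets borel"
  shows "(\<lambda>n. Phi A (appr f n)) \<longlonglongrightarrow> R A f"
proof -
  have aF: "appr f n \<in> \<F>" for n using appr_C[OF f, of n] by simp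
  have "Cauchy (\<lambda>n. Phi A (appr f n))"
  proof (rule metric_CauchyI)
    fix e :: real assume "e > 0"
    then obtain M where M: "\<And>n. n \<ge> M \<Longrightarrow> N (\<lambda>x. f x - appr f n x) < e / 2"
      using order_tendstoD(2)[OF appr_N[OF f], of "e / 2"] by (auto simp: eventually_sequentially)
    have "dist (Phi A (appr f i)) (Phi A (appr f j)) < e" if "M \<le> i" "M \<le> j" for i j
    proof -
      have "dist (Phi A (appr f i)) (Phi A (appr f j)) \<le> N (\<lambda>x. appr f i x - appr f j x)"
        unfolding dist_real_def by (intro Phi_diff appr_C f A)
      also have "\<dots> \<le> N (\<lambda>x. appr f i x - f x) + N (\<lambda>x. f x - appr f j x)"
        by (intro N_triangle3 aF f)
      also have "N (\<lambda>x. appr f i x - f x) = N (\<lambda>x. f x - appr f i x)" by (intro N_minus_commute aF f)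
      finally show ?thesis using M[OF that(1)] M[OF that(2)] by linarith
    qed
    then show "\<exists>M. \<forall>i\<ge>M. \<forall>j\<ge>M. dist (Phi A (appr f i)) (Phi A (appr f j)) < e" by blast
  qed
  then show ?thesis unfolding R_def by (simp add: Cauchy_convergent_iff convergent_LIMSEQ_iff)
qed

lemma R_close:
  assumes f: "f \<in> \<F>" and A: "A \<in> sets borel" and g: "g \<in> \<C>"
  shows "\<bar>R A f - Phi A g\<bar> \<le> N (\<lambda>x. f x - g x)"
proof (rule LIMSEQ_le)
  have aF: "appr f n \<in> \<F>" for n using appr_C[OF f, of n] by simp
  show "(\<lambda>n. \<bar>Phi A (appr f n) - Phi A g\<bar>) \<longlonglongrightarrow> \<bar>R A f - Phi A g\<bar>"
    by (intro tendsto_intros R_LIMSEQ_appr f A)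
  show "(\<lambda>n. N (\<lambda>x. f x - appr f n x) + N (\<lambda>x. f x - g x)) \<longlonglongrightarrow> N (\<lambda>x. f x - g x)"
    using tendsto_add[OF appr_N[OF f] tendsto_const] by simp
  have "\<bar>Phi A (appr f n) - Phi A g\<bar> \<le> N (\<lambda>x. f x - appr f n x) + N (\<lambda>x. f x - g x)" for n
  proof -
    have "\<bar>Phi A (appr f n) - Phi A g\<bar> \<le> N (\<lambda>x. appr f n x - g x)" by (intro Phi_diff appr_C f g A)
    also have "\<dots> \<le> N (\<lambda>x. appr f n x - f x) + N (\<lambda>x. f x - g x)" using g by (intro N_triangle3 aF f) auto
    also have "N (\<lambda>x. appr f n x - f x) = N (\<lambda>x. f x - appr f n x)" by (intro N_minus_commute aF f)
    finally show ?thesis .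
  qed
  then show "\<exists>M. \<forall>n\<ge>M. \<bar>Phi A (appr f n) - Phi A g\<bar> \<le> N (\<lambda>x. f x - appr f n x) + N (\<lambda>x. f x - g x)" by blast
qed

lemma R_LIMSEQ:
  assumes f: "f \<in> \<F>" and A: "A \<in> sets borel" and g: "\<And>n. g n \<in> \<C>" and lim: "(\<lambda>n. N (\<lambda>x. f x - g n x)) \<longlonglongrightarrow> 0"
  shows "(\<lambda>n. Phi A (g n)) \<longlonglongrightarrow> R A f"
proof (rule LIM_zero_cancel, rule Lim_null_comparison[OF _ lim])
  show "\<forall>\<^sub>F n in sequentially. norm (Phi A (g n) - R A f) \<le> N (\<lambda>x. f x - g n x)"
    using R_close[OF f A g] by (auto simp: abs_minus_commute)
qed

lemma R_nonneg: "f \<in> \<F> \<Longrightarrow> A \<in> sets borel \<Longrightarrow> 0 \<le> R A f"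
  using R_LIMSEQ_appr Phi_nonneg LIMSEQ_le_const by metis

lemma R_C: "f \<in> \<C> \<Longrightarrow> A \<in> sets borel \<Longrightarrow> R A f = Phi A f"
  using R_close[of f A f] N_zero by simp

definition mF :: "('a \<Rightarrow> real) \<Rightarrow> 'a set \<Rightarrow> real" where
  "mF f A = R A f powr p"

lemma mF_nonneg: "0 \<le> mF f A"
  by (simp add: mF_def)

lemma mF_powr: "f \<in> \<F> \<Longrightarrow> A \<in> sets borel \<Longrightarrow> mF f A powr (1 / p) = R A f"
  using p R_nonneg by (simp add: mF_def powr_powr)

lemma mF_LIMSEQ:
  assumes f: "f \<in> \<F>" and A: "A \<in> sets borel" and g: "\<And>n. g n \<in> \<C>" and lim: "(\<lambda>n. N (\<lambda>x. f x - g n x)) \<longlonglongrightarrow> 0"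
  shows "(\<lambda>n. measure (emu (g n)) A) \<longlonglongrightarrow> mF f A"
proof -
  have "(\<lambda>n. Phi A (g n) powr p) \<longlonglongrightarrow> R A f powr p"
    using p by (intro tendsto_powr' R_LIMSEQ[OF f A g lim] tendsto_const disjI2 conjI) (auto simp: Phi_nonneg)
  then show ?thesis by (simp add: Phi_powr mF_def)
qed

lemmas mF_LIMSEQ_appr = mF_LIMSEQ[OF _ _ appr_C appr_N]

lemma mF_C: "f \<in> \<C> \<Longrightarrow> A \<in> sets borel \<Longrightarrow> mF f A = measure (emu f) A"
  by (simp add: mF_def R_C Phi_powr del: Int_iff)

lemma mF_Un:
  assumes f: "f \<in> \<F>" and A: "A \<in> sets borel" "B \<in> sets borel" "A \<inter> B = {}"
  shows "mF f (A \<union> B) = mF f A + mF f B"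
proof -
  have "measure (emu (appr f n)) (A \<union> B) = measure (emu (appr f n)) A + measure (emu (appr f n)) B" for n
    using A by (intro finite_measure.finite_measure_Union finite_emu appr_C f) (auto simp: sets_emu[OF appr_C[OF f]])
  moreover have "(\<lambda>n. measure (emu (appr f n)) A + measure (emu (appr f n)) B) \<longlonglongrightarrow> mF f A + mF f B"
    by (intro tendsto_add mF_LIMSEQ_appr f A)
  moreover have "(\<lambda>n. measure (emu (appr f n)) (A \<union> B)) \<longlonglongrightarrow> mF f (A \<union> B)"
    using A by (intro mF_LIMSEQ_appr f) auto
  ultimately show ?thesis using LIMSEQ_unique by simp
qed

lemma mF_UNIV: assumes f: "f \<in> \<F>" shows "mF f UNIV = \<E> f"
proof -
  have aF: "appr f n \<in> \<F>" for n using appr_C[OF f, of n] by simp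
  have "(\<lambda>n. N (\<lambda>x. appr f n x - f x)) \<longlonglongrightarrow> 0"
    using appr_N[OF f] N_minus_commute[OF aF f] by simp
  then have "(\<lambda>n. \<E> (\<lambda>x. appr f n x - f x)) \<longlonglongrightarrow> 0"
    using N_tendsto_iff[of "\<lambda>n x. appr f n x - f x"] aF f F_closed(5) by simp
  then have "(\<lambda>n. \<E> (appr f n)) \<longlonglongrightarrow> \<E> f" by (rule E_tendsto[OF aF f])
  moreover have "(\<lambda>n. measure (emu (appr f n)) UNIV) \<longlonglongrightarrow> mF f UNIV" by (intro mF_LIMSEQ_appr f) simp
  ultimately show ?thesis using LIMSEQ_unique measure_emu_UNIV[OF appr_C[OF f]] by simp
qed

text \<open>Absolute continuity: a core function \<open>g\<close> close to \<open>f\<close> is close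
  in the seminorms of all sets at once, so sets of small mass for \<open>g\<close> have small mass
  for \<open>f\<close>.\<close>

lemma mF_small:
  assumes f: "f \<in> \<F>" and e: "\<epsilon> > 0"
  obtains g \<delta> where "g \<in> \<C>" "\<delta> > 0" "\<And>A. A \<in> sets borel \<Longrightarrow> measure (emu g) A < \<delta> \<Longrightarrow> mF f A \<le> \<epsilon>"
proof -
  \<comment> \<open>Chosen so that (2 \<eta>)^p is \<open>\<epsilon>\<close>.\<close>
  define \<eta> where "\<eta> = \<epsilon> powr (1 / p) / 2"
  have \<eta>: "\<eta> > 0" using e by (simp add: \<eta>_def)
  obtain g where g: "g \<in> \<C>" "N (\<lambda>x. f x - g x) < \<eta>" by (rule dense_C[OF f \<eta>])
  have "mF f A \<le> \<epsilon>" if A: "A \<in> sets borel" and m: "measure (emu g) A < \<eta> powr p" for A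
  proof -
    have "Phi A g \<le> (\<eta> powr p) powr (1 / p)" unfolding Phi_def using m p by (intro powr_mono2) auto
    also have "\<dots> = \<eta>" using p \<eta> by (simp add: powr_powr)
    finally have "R A f \<le> 2 * \<eta>" using R_close[OF f A g(1)] g(2) by linarith
    then have "R A f powr p \<le> (2 * \<eta>) powr p" using R_nonneg[OF f A] p by (intro powr_mono2) auto
    also have "\<dots> = \<epsilon>" using e p by (simp add: \<eta>_def powr_powr)
    finally show ?thesis by (simp add: mF_def)
  qed
  then show ?thesis using that[OF g(1), of "\<eta> powr p"] \<eta> by simp
qed

definition muF :: "('a \<Rightarrow> real) \<Rightarrow> 'a measure" where
  "muF f = measure_of UNIV (sets borel) (\<lambda>A. ennreal (mF f A))"

lemma sets_muF: "sets (muF f) = sets borel"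
  unfolding muF_def by (simp add: sets.sets_measure_of_eq[of borel, simplified])

text \<open>Finite additivity is inherited from the approximants; continuity at the empty set is
  inherited from a single core function through \<open>mF_small\<close>.\<close>

lemma emeasure_muF:
  assumes f: "f \<in> \<F>" and A: "A \<in> sets borel" shows "emeasure (muF f) A = ennreal (mF f A)"
  unfolding muF_def
proof (rule emeasure_measure_of_sigma[OF _ _ _ A])
  show sa: "sigma_algebra UNIV (sets (borel :: 'a measure))" using sets.sigma_algebra_axioms[of "borel :: 'a measure"] by simp
  have e0: "mF f {} = 0" using mF_Un[OF f, of "{}" "{}"] by simp
  show pos: "positive (sets borel) (\<lambda>A. ennreal (mF f A))" using e0 by (simp add: positive_def)
  interpret B: ring_of_sets UNIV "sets (borel :: 'a measure)" using sa by (simp add: sigma_algebra_def algebra_def)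
  show "countably_additive (sets borel) (\<lambda>A. ennreal (mF f A))"
  proof (rule B.empty_continuous_imp_countably_additive[OF pos])
    show "additive (sets borel) (\<lambda>A. ennreal (mF f A))"
      unfolding additive_def using mF_Un[OF f] mF_nonneg by (simp add: ennreal_plus)
    fix S :: "nat \<Rightarrow> 'a set" assume S: "range S \<subseteq> sets borel" "decseq S" "(\<Inter>i. S i) = {}"
    have "(\<lambda>i. mF f (S i)) \<longlonglongrightarrow> 0"
    proof (rule LIMSEQ_I)
      fix e :: real assume "e > 0"
      then obtain g \<delta> where g: "g \<in> \<C>" "\<delta> > 0" "\<And>A. A \<in> sets borel \<Longrightarrow> measure (emu g) A < \<delta> \<Longrightarrow> mF f A \<le> e / 2"
        using mF_small[OF f, of "e / 2"] by (metis half_gt_zero)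
      have "(\<lambda>i. measure (emu g) (S i)) \<longlonglongrightarrow> measure (emu g) (\<Inter>i. S i)"
        using S by (intro finite_measure.finite_Lim_measure_decseq finite_emu g) (auto simp: sets_emu[OF g(1)])
      then have "\<forall>\<^sub>F i in sequentially. measure (emu g) (S i) < \<delta>" using g(2) S(3) by (intro order_tendstoD(2)[of _ 0]) auto
      then obtain n where "\<And>i. i \<ge> n \<Longrightarrow> measure (emu g) (S i) < \<delta>" by (auto simp: eventually_sequentially)
      then have "norm (mF f (S i) - 0) < e" if "i \<ge> n" for i
        using g(3)[of "S i"] S(1) that mF_nonneg[of f "S i"] \<open>e > 0\<close> by (force simp: abs_of_nonneg)
      then show "\<exists>n. \<forall>i\<ge>n. norm (mF f (S i) - 0) < e" by blast
    qed
    then show "(\<lambda>i. ennreal (mF f (S i))) \<longlonglongrightarrow> 0" using tendsto_ennrealI by fastforce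
  qed simp
qed

lemma measure_muF: "f \<in> \<F> \<Longrightarrow> A \<in> sets borel \<Longrightarrow> measure (muF f) A = mF f A"
  by (simp add: measure_def emeasure_muF mF_nonneg)

lemma finite_muF: "f \<in> \<F> \<Longrightarrow> finite_measure (muF f)"
  using sets_eq_imp_space_eq[OF sets_muF] by (intro finite_measureI) (simp add: emeasure_muF)

text \<open>Approximating sets are taken from the measure of a core function; by
  \<open>mF_small\<close> a difference of sets that is small for it is small for \<open>f\<close>
  too.\<close>

lemma radon_muF: assumes f: "f \<in> \<F>" shows "radon_measure (muF f)"
proof (rule radon_measureI[OF finite_muF[OF f] sets_muF])
  fix A :: "'a set" and \<epsilon> :: real assume A: "A \<in> sets borel" and e: "\<epsilon> > 0"
  obtain g \<delta> where g: "g \<in> \<C>" "\<delta> > 0" "\<And>A. A \<in> sets borel \<Longrightarrow> measure (emu g) A < \<delta> \<Longrightarrow> mF f A \<le> \<epsilon>"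
    using mF_small[OF f e] by blast
  obtain U where U: "open U" "A \<subseteq> U" "measure (emu g) U < measure (emu g) A + \<delta>"
    by (rule radon_outer_approx[OF radon_emu[OF g(1)] E_eq_measure_emu[OF g(1)] A g(2)])
  have "measure (emu g) (U - A) = measure (emu g) U - measure (emu g) A"
    using U A by (intro finite_measure.finite_measure_Diff finite_emu g) (auto simp: sets_emu[OF g(1)])
  then have "mF f (U - A) \<le> \<epsilon>" using U A by (intro g(3)) auto
  moreover have "mF f (A \<union> (U - A)) = mF f A + mF f (U - A)" using U A by (intro mF_Un f) auto
  moreover have "A \<union> (U - A) = U" using U(2) by blast
  ultimately have "measure (muF f) U \<le> measure (muF f) A + \<epsilon>" using U A by (simp add: measure_muF f)
  then show "\<exists>U. open U \<and> A \<subseteq> U \<and> measure (muF f) U \<le> measure (muF f) A + \<epsilon>" using U by blast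
next
  fix U :: "'a set" and \<epsilon> :: real assume U: "open U" and e: "\<epsilon> > 0"
  obtain g \<delta> where g: "g \<in> \<C>" "\<delta> > 0" "\<And>A. A \<in> sets borel \<Longrightarrow> measure (emu g) A < \<delta> \<Longrightarrow> mF f A \<le> \<epsilon>"
    using mF_small[OF f e] by blast
  obtain K where K: "compact K" "K \<subseteq> U" "measure (emu g) U < measure (emu g) K + \<delta>"
    by (rule radon_compact_approx[OF radon_emu[OF g(1)] E_eq_measure_emu[OF g(1)] U g(2)])
  have Kb: "K \<in> sets borel" using K(1) by (rule borel_compact)
  have "measure (emu g) (U - K) = measure (emu g) U - measure (emu g) K"
    using U K Kb by (intro finite_measure.finite_measure_Diff finite_emu g) (auto simp: sets_emu[OF g(1)])
  then have "mF f (U - K) \<le> \<epsilon>" using U K Kb by (intro g(3)) auto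
  moreover have "mF f (K \<union> (U - K)) = mF f K + mF f (U - K)" using U Kb by (intro mF_Un f) auto
  moreover have "K \<union> (U - K) = U" using K(2) by blast
  ultimately have "measure (muF f) U \<le> measure (muF f) K + \<epsilon>" using U Kb by (simp add: measure_muF f)
  then show "\<exists>K. compact K \<and> K \<subseteq> U \<and> measure (muF f) U \<le> measure (muF f) K + \<epsilon>" using K by blast
qed

text \<open>The difference has energy \<open>0\<close>, so a sequence approximating \<open>f\<close>
  approximates \<open>g\<close> as well.\<close>

lemma R_cong_AE:
  assumes fg: "f \<in> \<F>" "g \<in> \<F>" "AE x in m. f x = g x" and A: "A \<in> sets borel"
  shows "R A f = R A g"
proof -
  have d: "(\<lambda>x. g x - f x) \<in> \<F>" by (intro F_closed fg)
  have ae: "AE x in m. g x - f x = 0" using fg(3) by eventually_elim simp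
  have r: "respects_AE m \<F> \<E>" using form by (simp add: p_energy_form_def)
  have "\<E> (\<lambda>x. g x - f x) = \<E> (\<lambda>x. 0)"
    by (rule r[unfolded respects_AE_def, rule_format, OF d F_closed(1) ae])
  then have N0: "N (\<lambda>x. g x - f x) = 0" using E_zero by (simp add: N_def)
  have aF: "appr f n \<in> \<F>" for n using appr_C[OF fg(1), of n] by simp
  have "(\<lambda>n. N (\<lambda>x. g x - appr f n x)) \<longlonglongrightarrow> 0"
  proof (rule tendsto_sandwich[OF _ _ tendsto_const appr_N[OF fg(1)]])
    show "\<forall>\<^sub>F n in sequentially. N (\<lambda>x. g x - appr f n x) \<le> N (\<lambda>x. f x - appr f n x)"
      using N_triangle3[OF fg(2,1) aF] N0 by simp
  qed (simp add: N_nonneg)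
  from R_LIMSEQ[OF fg(2) A appr_C[OF fg(1)] this] R_LIMSEQ_appr[OF fg(1) A] show ?thesis
    using LIMSEQ_unique by blast
qed

lemma N_tendsto_add:
  assumes "u \<in> \<F>" "v \<in> \<F>" "\<And>n. a n \<in> \<C>" "\<And>n. b n \<in> \<C>"
    and "(\<lambda>n. N (\<lambda>x. u x - a n x)) \<longlonglongrightarrow> 0" "(\<lambda>n. N (\<lambda>x. v x - b n x)) \<longlonglongrightarrow> 0"
  shows "(\<lambda>n. N (\<lambda>x. (u x + v x) - (a n x + b n x))) \<longlonglongrightarrow> 0"
    and "(\<lambda>n. N (\<lambda>x. (u x - v x) - (a n x - b n x))) \<longlonglongrightarrow> 0"
proof -
  have d: "(\<lambda>x. u x - a n x) \<in> \<F>" "(\<lambda>x. v x - b n x) \<in> \<F>" for n using assms by (auto intro!: F_closed)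
  have s: "(\<lambda>n. N (\<lambda>x. u x - a n x) + N (\<lambda>x. v x - b n x)) \<longlonglongrightarrow> 0" using tendsto_add[OF assms(5,6)] by simp
  have e: "(\<lambda>x. (u x + v x) - (a n x + b n x)) = (\<lambda>x. (u x - a n x) + (v x - b n x))"
    "(\<lambda>x. (u x - v x) - (a n x - b n x)) = (\<lambda>x. (u x - a n x) - (v x - b n x))" for n by auto
  show "(\<lambda>n. N (\<lambda>x. (u x + v x) - (a n x + b n x))) \<longlonglongrightarrow> 0"
    by (rule tendsto_sandwich[OF _ _ tendsto_const s]) (use N_add[OF d] N_nonneg in \<open>auto simp: e\<close>)
  show "(\<lambda>n. N (\<lambda>x. (u x - v x) - (a n x - b n x))) \<longlonglongrightarrow> 0"
    by (rule tendsto_sandwich[OF _ _ tendsto_const s]) (use N_diff[OF d] N_nonneg in \<open>auto simp: e\<close>)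
qed

lemma R_seminorm: assumes A: "A \<in> sets borel" shows "seminorm_on \<F> (R A)"
  unfolding seminorm_on_def
proof (intro conjI ballI allI)
  show "0 \<le> R A f" if "f \<in> \<F>" for f by (rule R_nonneg[OF that A])
next
  fix f g assume fg: "f \<in> \<F>" "g \<in> \<F>"
  have tri: "Phi A (\<lambda>x. appr f n x + appr g n x) \<le> Phi A (appr f n) + Phi A (appr g n)" for n
    using Phi_seminorm[OF A] appr_C[OF fg(1), of n] appr_C[OF fg(2), of n] unfolding seminorm_on_def by blast
  have l1: "(\<lambda>n. Phi A (\<lambda>x. appr f n x + appr g n x)) \<longlonglongrightarrow> R A (\<lambda>x. f x + g x)"
    by (intro R_LIMSEQ F_closed fg A C_add appr_C N_tendsto_add appr_N)
  have l2: "(\<lambda>n. Phi A (appr f n) + Phi A (appr g n)) \<longlonglongrightarrow> R A f + R A g"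
    by (intro tendsto_add R_LIMSEQ_appr fg A)
  show "R A (\<lambda>x. f x + g x) \<le> R A f + R A g" using LIMSEQ_le[OF l1 l2] tri by blast
next
  fix c :: real and f assume f: "f \<in> \<F>"
  have aF: "appr f n \<in> \<F>" for n using appr_C[OF f, of n] by simp
  have "N (\<lambda>x. c * f x - c * appr f n x) = \<bar>c\<bar> * N (\<lambda>x. f x - appr f n x)" for n
    using N_scale[of "\<lambda>x. f x - appr f n x" c] F_closed(5)[OF f aF] by (simp add: right_diff_distrib)
  then have "(\<lambda>n. N (\<lambda>x. c * f x - c * appr f n x)) \<longlonglongrightarrow> 0"
    using tendsto_mult[OF tendsto_const[of "\<bar>c\<bar>"] appr_N[OF f]] by simp
  then have "(\<lambda>n. Phi A (\<lambda>x. c * appr f n x)) \<longlonglongrightarrow> R A (\<lambda>x. c * f x)"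
    by (intro R_LIMSEQ F_closed f A C_scale appr_C)
  moreover have "Phi A (\<lambda>x. c * appr f n x) = \<bar>c\<bar> * Phi A (appr f n)" for n
    using Phi_seminorm[OF A] appr_C[OF f, of n] unfolding seminorm_on_def by blast
  moreover have "(\<lambda>n. \<bar>c\<bar> * Phi A (appr f n)) \<longlonglongrightarrow> \<bar>c\<bar> * R A f" by (intro tendsto_intros R_LIMSEQ_appr f A)
  ultimately show "R A (\<lambda>x. c * f x) = \<bar>c\<bar> * R A f" using LIMSEQ_unique by simp
qed

lemma mF_clarkson:
  assumes uv: "u \<in> \<F>" "v \<in> \<F>" and A: "A \<in> sets borel"
  shows "clarkson_ineq p (mF u A) (mF v A) (mF (\<lambda>x. u x + v x) A + mF (\<lambda>x. u x - v x) A)"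
proof (rule clarkson_ineq_LIMSEQ[OF p])
  show "(\<lambda>n. measure (emu (appr u n)) A) \<longlonglongrightarrow> mF u A" "(\<lambda>n. measure (emu (appr v n)) A) \<longlonglongrightarrow> mF v A"
    by (intro mF_LIMSEQ_appr uv A)+
  show "(\<lambda>n. measure (emu (\<lambda>x. appr u n x + appr v n x)) A + measure (emu (\<lambda>x. appr u n x - appr v n x)) A)
      \<longlonglongrightarrow> mF (\<lambda>x. u x + v x) A + mF (\<lambda>x. u x - v x) A"
    by (intro tendsto_add mF_LIMSEQ F_closed uv A C_add C_diff appr_C N_tendsto_add appr_N)
  show "clarkson_ineq p (measure (emu (appr u n)) A) (measure (emu (appr v n)) A)
     (measure (emu (\<lambda>x. appr u n x + appr v n x)) A + measure (emu (\<lambda>x. appr u n x - appr v n x)) A)" for n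
    by (intro clarkson_ineq_emu appr_C uv A)
qed auto

text \<open>Stated for any family agreeing with \<open>muF\<close> on the domain, since the one
  wanted is the restriction of \<open>muF\<close>.\<close>

lemma energy_measures_cong:
  assumes "\<And>f. f \<in> \<F> \<Longrightarrow> \<mu> f = muF f"
  shows "energy_measures p m \<E> \<F> \<mu>"
  unfolding energy_measures_def
proof (intro conjI ballI impI)
  show "respects_AE m \<F> \<mu>"
    unfolding respects_AE_def
  proof (intro ballI impI)
    fix f g assume fg: "f \<in> \<F>" "g \<in> \<F>" "AE x in m. f x = g x"
    have "muF f = muF g"
      by (rule measure_eqI) (auto simp: sets_muF emeasure_muF fg mF_def R_cong_AE[OF fg])
    then show "\<mu> f = \<mu> g" using assms fg by simp
  qed
  show "radon_measure (\<mu> f)" if "f \<in> \<F>" for f using that assms radon_muF by simp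
  show "emeasure (\<mu> f) UNIV = ennreal (\<E> f)" if "f \<in> \<F>" for f using that assms emeasure_muF mF_UNIV by simp
  show "emeasure (\<mu> f) A = emeasure (\<mu> g) A"
    if fg: "f \<in> \<C>" "g \<in> \<C>" and A: "A \<in> sets borel" and c: "(\<lambda>x. f x - g x) constant_on A" for f g A
  proof -
    obtain d where d: "\<And>x. x \<in> A \<Longrightarrow> f x - g x = d" using c by (auto simp: constant_on_def)
    have "mF f A = mF g A" using measure_emu_local[OF fg A d] by (simp add: mF_C[OF fg(1) A] mF_C[OF fg(2) A])
    then show ?thesis using fg A assms by (simp add: emeasure_muF)
  qed
  fix A :: "'a set" assume A: "A \<in> sets borel"
  have e: "measure (\<mu> f) A = mF f A" if "f \<in> \<F>" for f using that assms A by (simp add: measure_muF)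
  show "seminorm_on \<F> (\<lambda>f. measure (\<mu> f) A powr (1 / p))"
    using R_seminorm[OF A] unfolding seminorm_on_def by (simp add: e F_closed mF_powr A)
  show "clarkson p \<F> (\<lambda>f. measure (\<mu> f) A powr (1 / p))"
    unfolding clarkson_iff[of p \<F> "\<lambda>f. measure (\<mu> f) A", OF p F_subspace measure_nonneg]
    using mF_clarkson[OF _ _ A] by (simp add: e F_closed)
qed

end

lemma energy_measures_facts:
  assumes "energy_measures p m \<E> \<F> \<mu>" "f \<in> \<F>"
  shows "radon_measure (\<mu> f)" "emeasure (\<mu> f) UNIV = ennreal (\<E> f)" "emeasure (\<mu> f) UNIV < \<infinity>"
  using assms unfolding energy_measures_def by auto

section \<open>Uniqueness\<close>

context p_energy_space
begin

lemma Cp_between: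
  assumes K: "compact K" "K \<subseteq> U" "open U"
  obtains h where "h \<in> Cp" "\<And>x. x \<in> K \<Longrightarrow> 0 < h x" "\<And>x. 0 < h x \<Longrightarrow> x \<in> U"
proof -
  define H where "H = {k \<in> Cp. \<forall>x. 0 < k x \<longrightarrow> x \<in> U}"
  have cov: "K \<subseteq> (\<Union>k\<in>H. {x. 0 < k x})"
  proof
    fix x assume "x \<in> K"
    then have "x \<in> U" using K(2) by blast
    from Cp_bump[OF K(3) this] obtain k where "k \<in> Cp" "0 < k x" "\<And>y. 0 < k y \<Longrightarrow> y \<in> U" by blast
    then show "x \<in> (\<Union>k\<in>H. {x. 0 < k x})" by (auto simp: H_def)
  qed
  have op: "open {x. 0 < k x}" if "k \<in> H" for k using that open_superlevel[of k 0] by (simp add: H_def)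
  obtain D where D: "D \<subseteq> H" "finite D" "K \<subseteq> (\<Union>k\<in>D. {x. 0 < k x})"
    by (rule compactE_image[OF K(1) op cov])
  obtain h where h: "h \<in> Cp" "\<And>x. 0 < h x \<longleftrightarrow> (\<exists>k\<in>D. 0 < k x)"
    by (rule Cp_finite_max[of D]) (use D in \<open>auto simp: H_def\<close>)
  show ?thesis by (rule that[OF h(1)]) (use D h(2) in \<open>auto simp: H_def\<close>)
qed

text \<open>Regularity reduces Borel sets to open sets and these to compact subsets; between a
  compact set and an open superset there is a superlevel set.\<close>

lemma radon_le_if_superlevel_le:
  assumes M: "radon_measure M" "emeasure M UNIV < \<infinity>" and M': "radon_measure M'" "emeasure M' UNIV < \<infinity>"
    and eq: "\<And>h. h \<in> Cp \<Longrightarrow> measure M {x. 0 < h x} \<le> measure M' {x. 0 < h x}" and A: "A \<in> sets borel"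
  shows "measure M A \<le> measure M' A"
proof (rule measure_le_if_open_le[OF M' finite_radon_measureD(3,1)[OF M] A])
  fix U :: "'a set" assume U: "open U"
  show "measure M U \<le> measure M' U"
  proof (rule field_le_epsilon)
    fix \<epsilon> :: real assume e: "\<epsilon> > 0"
    obtain K where K: "compact K" "K \<subseteq> U" "measure M U < measure M K + \<epsilon>" by (rule radon_compact_approx[OF M U e])
    obtain h where h: "h \<in> Cp" "\<And>x. x \<in> K \<Longrightarrow> 0 < h x" "\<And>x. 0 < h x \<Longrightarrow> x \<in> U"
      using Cp_between[OF K(1,2) U] by blast
    have hb: "{x. 0 < h x} \<in> sets borel" using open_superlevel[OF h(1)] by (rule borel_open)
    have "measure M K \<le> measure M {x. 0 < h x}"
      using h(2) hb by (intro finite_measure.finite_measure_mono finite_radon_measureD(3)[OF M]) (auto simp: finite_radon_measureD(1)[OF M])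
    also have "\<dots> \<le> measure M' {x. 0 < h x}" by (rule eq[OF h(1)])
    also have "\<dots> \<le> measure M' U"
      using h(3) U by (intro finite_measure.finite_measure_mono finite_radon_measureD(3)[OF M']) (auto simp: finite_radon_measureD(1)[OF M'])
    finally show "measure M U \<le> measure M' U + \<epsilon>" using K(3) by linarith
  qed
qed

lemma energy_measures_measure_scale:
  assumes \<mu>: "energy_measures p m \<E> \<F> \<mu>" and f: "f \<in> \<F>" and A: "A \<in> sets borel"
  shows "measure (\<mu> (\<lambda>x. c * f x)) A = \<bar>c\<bar> powr p * measure (\<mu> f) A"
proof -
  have "measure (\<mu> (\<lambda>x. c * f x)) A powr (1 / p) = \<bar>c\<bar> * measure (\<mu> f) A powr (1 / p)"
    using \<mu> A f unfolding energy_measures_def seminorm_on_def by blast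
  then have "(measure (\<mu> (\<lambda>x. c * f x)) A powr (1 / p)) powr p = (\<bar>c\<bar> * measure (\<mu> f) A powr (1 / p)) powr p" by simp
  then show ?thesis using p by (simp add: powr_powr powr_mult)
qed

lemma energy_measures_local_family:
  assumes \<mu>: "energy_measures p m \<E> \<F> \<mu>"
  shows "local_energy_family p m \<E> \<F> \<mu>"
proof
  show "sets (\<mu> f) = sets borel" if "f \<in> \<C>" for f
    using energy_measures_facts[OF \<mu>, of f] that by (auto simp: radon_measure_def)
  show "emeasure (\<mu> f) UNIV = ennreal (\<E> f)" if "f \<in> \<C>" for f
    using energy_measures_facts[OF \<mu>, of f] that by auto
  show "measure (\<mu> f) A = measure (\<mu> g) A"
    if "f \<in> \<C>" "g \<in> \<C>" "A \<in> sets borel" "\<And>x. x \<in> A \<Longrightarrow> f x - g x = c" for f g A c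
  proof -
    have "(\<lambda>x. f x - g x) constant_on A" using that(4) by (auto simp: constant_on_def)
    then have "emeasure (\<mu> f) A = emeasure (\<mu> g) A"
      using \<mu> that(1-3) unfolding energy_measures_def by blast
    then show ?thesis by (simp add: measure_def)
  qed
  show "measure (\<mu> (\<lambda>x. - f x)) A = measure (\<mu> f) A" if "f \<in> \<C>" "A \<in> sets borel" for f A
    using energy_measures_measure_scale[OF \<mu>, of f A "-1"] that by simp
qed

text \<open>On the core this is agreement on superlevel sets plus regularity. Beyond it, (M1) bounds
  the seminorm of (M3) by \<open>N\<close>, so density of the core decides.\<close>

lemma energy_measures_unique:
  assumes \<mu>: "energy_measures p m \<E> \<F> \<mu>" and f: "f \<in> \<F>" and A: "A \<in> sets borel"
  shows "measure (\<mu> f) A = mF f A"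
proof -
  interpret L: local_energy_family p m \<E> \<F> \<mu> by (rule energy_measures_local_family[OF \<mu>])
  have onC: "measure (\<mu> g) A = measure (emu g) A" if g: "g \<in> \<C>" for g
  proof -
    have gF: "g \<in> \<F>" using g by simp
    note r = energy_measures_facts(1,3)[OF \<mu> gF] and r' = radon_emu[OF g] E_eq_measure_emu[OF g]
    have "measure (\<mu> g) {x. 0 < h x} = measure (emu g) {x. 0 < h x}" if "h \<in> Cp" for h
      using that by (simp add: L.measure_mu_superlevel[OF g] measure_emu_superlevel[OF g] del: Int_iff)
    then show ?thesis
      using radon_le_if_superlevel_le[OF r r' _ A] radon_le_if_superlevel_le[OF r' r _ A] by (intro antisym) auto
  qed
  define \<rho> where "\<rho> g = measure (\<mu> g) A powr (1 / p)" for g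
  have \<rho>: "seminorm_on \<F> \<rho>" unfolding \<rho>_def[abs_def] using \<mu> A unfolding energy_measures_def by blast
  have \<rho>N: "\<rho> g \<le> N g" if g: "g \<in> \<F>" for g
  proof -
    note e = energy_measures_facts[OF \<mu> g]
    have "measure (\<mu> g) A \<le> measure (\<mu> g) (space (\<mu> g))"
      by (rule finite_measure.bounded_measure[OF finite_radon_measureD(3)[OF e(1,3)]])
    then have "measure (\<mu> g) A \<le> \<E> g" using e(2) E_nonneg[OF g] finite_radon_measureD(2)[OF e(1,3)] by (simp add: measure_def)
    then show ?thesis unfolding \<rho>_def N_def using p by (intro powr_mono2) auto
  qed
  have aF: "appr f n \<in> \<F>" for n using appr_C[OF f, of n] by simp
  have "\<bar>\<rho> (appr f n) - \<rho> f\<bar> \<le> N (\<lambda>x. f x - appr f n x)" for n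
    using seminorm_on_diff[OF F_subspace \<rho> f aF, of n] \<rho>N[OF F_closed(5)[OF f aF], of n] by (simp add: abs_minus_commute)
  then have "(\<lambda>n. \<rho> (appr f n)) \<longlonglongrightarrow> \<rho> f"
    by (intro LIM_zero_cancel[OF Lim_null_comparison[OF _ appr_N[OF f]]]) simp
  moreover have "\<rho> (appr f n) = Phi A (appr f n)" for n using onC[OF appr_C[OF f]] by (simp add: \<rho>_def Phi_def)
  ultimately have "\<rho> f = R A f" using LIMSEQ_unique R_LIMSEQ_appr[OF f A] by simp
  then have "\<rho> f powr p = mF f A" by (simp add: mF_def)
  then show ?thesis using p by (simp add: \<rho>_def powr_powr)
qed

text \<open>A family is a total function here; \<open>extensional\<close> fixes its values off the
  domain.\<close>

theorem ex1_energy_measures: "\<exists>!\<mu>. \<mu> \<in> extensional \<F> \<and> energy_measures p m \<E> \<F> \<mu>"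
proof (rule ex1I[of _ "restrict muF \<F>"])
  show "restrict muF \<F> \<in> extensional \<F> \<and> energy_measures p m \<E> \<F> (restrict muF \<F>)"
    using energy_measures_cong[of "restrict muF \<F>"] by simp
  fix \<mu> assume \<mu>: "\<mu> \<in> extensional \<F> \<and> energy_measures p m \<E> \<F> \<mu>"
  show "\<mu> = restrict muF \<F>"
  proof (rule extensionalityI[of _ \<F>])
    fix f assume f: "f \<in> \<F>"
    note e = energy_measures_facts[OF conjunct2[OF \<mu>] f]
    have "\<mu> f = muF f"
    proof (rule measure_eqI)
      show s: "sets (\<mu> f) = sets (muF f)" using finite_radon_measureD(1)[OF e(1,3)] by (simp add: sets_muF)
      show "emeasure (\<mu> f) A = emeasure (muF f) A" if "A \<in> sets (\<mu> f)" for A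
        using that energy_measures_unique[OF conjunct2[OF \<mu>] f, of A]
          finite_measure.emeasure_eq_measure[OF finite_radon_measureD(3)[OF e(1,3)]]
        by (simp add: s sets_muF emeasure_muF[OF f])
    qed
    then show "\<mu> f = restrict muF \<F> f" using f by simp
  qed (use \<mu> in auto)
qed

end

section \<open>Signed Borel measures and their integrals\<close>

lemma measure_LIMSEQ_0:
  assumes "finite_measure M" "sets M = sets borel" "range S \<subseteq> sets borel" "decseq S" "(\<Inter>i. S i) = {}"
  shows "(\<lambda>i. measure M (S i)) \<longlonglongrightarrow> 0"
  using finite_measure.finite_Lim_measure_decseq[OF assms(1) _ assms(4)] assms by simp

text \<open>Domination by a set function that vanishes along sequences decreasing to the empty set
  upgrades additivity to countable additivity. The last conclusion serves to recognise
  \<open>pos_variation\<close>.\<close>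

lemma measure_from_additive:
  fixes \<alpha> K :: "'a::topological_space set \<Rightarrow> real"
  assumes K: "\<And>S :: nat \<Rightarrow> 'a set. range S \<subseteq> sets borel \<Longrightarrow> decseq S \<Longrightarrow> (\<Inter>i. S i) = {} \<Longrightarrow> (\<lambda>i. K (S i)) \<longlonglongrightarrow> (0 :: real)"
    and nn: "\<And>A. A \<in> sets borel \<Longrightarrow> 0 \<le> \<alpha> A" and le: "\<And>A. A \<in> sets borel \<Longrightarrow> \<alpha> A \<le> K A"
    and add: "\<And>A B. A \<in> sets borel \<Longrightarrow> B \<in> sets borel \<Longrightarrow> A \<inter> B = {} \<Longrightarrow> \<alpha> (A \<union> B) = \<alpha> A + \<alpha> B"
  obtains M where "sets M = sets borel" "finite_measure M" "\<And>A. A \<in> sets borel \<Longrightarrow> measure M A = \<alpha> A"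
    "M = measure_of UNIV (sets borel) (\<lambda>A. ennreal (\<alpha> A))"
proof -
  define M where "M = measure_of UNIV (sets borel) (\<lambda>A. ennreal (\<alpha> A))"
  have sM: "sets M = sets borel" unfolding M_def by (simp add: sets.sets_measure_of_eq[of borel, simplified])
  have sa: "sigma_algebra UNIV (sets (borel :: 'a measure))" using sets.sigma_algebra_axioms[of "borel :: 'a measure"] by simp
  interpret B: ring_of_sets UNIV "sets (borel :: 'a measure)" using sa by (simp add: sigma_algebra_def algebra_def)
  have pos: "positive (sets borel) (\<lambda>A. ennreal (\<alpha> A))" using add[of "{}" "{}"] by (simp add: positive_def)
  have ca: "countably_additive (sets borel) (\<lambda>A. ennreal (\<alpha> A))"
  proof (rule B.empty_continuous_imp_countably_additive[OF pos])
    show "additive (sets borel) (\<lambda>A. ennreal (\<alpha> A))"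
      unfolding additive_def using add nn by (simp add: ennreal_plus)
    fix S :: "nat \<Rightarrow> 'a set" assume S: "range S \<subseteq> sets borel" "decseq S" "(\<Inter>i. S i) = {}"
    have "(\<lambda>i. \<alpha> (S i)) \<longlonglongrightarrow> 0"
      by (rule tendsto_sandwich[OF _ _ tendsto_const K[OF S]]) (use nn le S(1) in \<open>auto intro!: always_eventually\<close>)
    then show "(\<lambda>i. ennreal (\<alpha> (S i))) \<longlonglongrightarrow> 0" using tendsto_ennrealI by fastforce
  qed simp
  have em: "emeasure M A = ennreal (\<alpha> A)" if "A \<in> sets borel" for A
    unfolding M_def by (rule emeasure_measure_of_sigma[OF sa pos ca that])
  have "finite_measure M" using sets_eq_imp_space_eq[OF sM] by (intro finite_measureI) (simp add: em)
  then show ?thesis using that[OF sM] em nn by (simp add: measure_def M_def)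
qed

text \<open>The form in which mutual energies are obtained; a Hahn decomposition for the pair of
  measures then gives the variations.\<close>

definition jordan_measure :: "('a::topological_space set \<Rightarrow> real) \<Rightarrow> bool" where
  "jordan_measure \<nu> \<longleftrightarrow> (\<exists>P N. finite_measure P \<and> finite_measure N \<and> sets P = sets borel \<and> sets N = sets borel \<and>
     (\<forall>A\<in>sets borel. \<nu> A = measure P A - measure N A))"

lemma signed_jordan_measure:
  assumes "jordan_measure \<nu>" shows "signed_borel_measure \<nu>"
proof -
  obtain P N where PN: "finite_measure P" "finite_measure N" "sets P = sets borel" "sets N = sets borel"
    "\<And>A. A \<in> sets borel \<Longrightarrow> \<nu> A = measure P A - measure N A" using assms unfolding jordan_measure_def by blast
  have s: "signed_borel_measure (\<lambda>A. measure P A + (-1) * measure N A)"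
    by (intro signed_borel_measure_add signed_borel_measure_scale signed_borel_measure_measure PN)
  have "\<nu> (\<Union>n. A n) = measure P (\<Union>n. A n) + (-1) * measure N (\<Union>n. A n)" "\<And>n. \<nu> (A n) = measure P (A n) + (-1) * measure N (A n)"
    if "range A \<subseteq> sets borel" for A :: "nat \<Rightarrow> 'a set" using that PN(5) by (auto simp: sets.countable_UN)
  then show ?thesis using s PN(5)[of "{}"] unfolding signed_borel_measure_def by simp
qed

text \<open>The supremum defining the variation is attained on the positive part of a Hahn decomposition.\<close>

lemma pos_variation_Hahn:
  assumes P: "finite_measure P" "sets P = sets borel" and N: "finite_measure N" "sets N = sets borel"
    and \<nu>: "\<And>A. A \<in> sets borel \<Longrightarrow> \<nu> A = measure P A - measure N A"
    and Y: "Y \<in> sets borel" "\<And>X. X \<in> sets borel \<Longrightarrow> X \<subseteq> Y \<Longrightarrow> measure N X \<le> measure P X"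
      "\<And>X. X \<in> sets borel \<Longrightarrow> X \<inter> Y = {} \<Longrightarrow> measure P X \<le> measure N X"
  shows "sets (pos_variation \<nu>) = sets borel" "finite_measure (pos_variation \<nu>)"
    "\<And>A. A \<in> sets borel \<Longrightarrow> measure (pos_variation \<nu>) A = \<nu> (A \<inter> Y)"
proof -
  have add: "\<nu> (A \<union> B) = \<nu> A + \<nu> B" if "A \<in> sets borel" "B \<in> sets borel" "A \<inter> B = {}" for A B
    using that by (simp add: \<nu> finite_measure.finite_measure_Union[OF P(1)] finite_measure.finite_measure_Union[OF N(1)] P N)
  have sup: "(SUP B\<in>{B \<in> sets borel. B \<subseteq> A}. ennreal (\<nu> B)) = ennreal (\<nu> (A \<inter> Y))" if A: "A \<in> sets borel" for A
  proof (rule antisym)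
    show "ennreal (\<nu> (A \<inter> Y)) \<le> (SUP B\<in>{B \<in> sets borel. B \<subseteq> A}. ennreal (\<nu> B))"
      using A Y(1) by (intro SUP_upper) auto
    have "\<nu> B \<le> \<nu> (A \<inter> Y)" if B: "B \<in> sets borel" "B \<subseteq> A" for B
    proof -
      have "\<nu> ((B \<inter> Y) \<union> (B - Y)) = \<nu> (B \<inter> Y) + \<nu> (B - Y)" using B Y(1) by (intro add) auto
      moreover have "(B \<inter> Y) \<union> (B - Y) = B" by blast
      moreover have "\<nu> (B - Y) \<le> 0" using \<nu>[of "B - Y"] Y(3)[of "B - Y"] B Y(1) by auto
      moreover have "\<nu> ((B \<inter> Y) \<union> ((A - B) \<inter> Y)) = \<nu> (B \<inter> Y) + \<nu> ((A - B) \<inter> Y)" using A B Y(1) by (intro add) auto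
      moreover have "(B \<inter> Y) \<union> ((A - B) \<inter> Y) = A \<inter> Y" using B by blast
      moreover have "0 \<le> \<nu> ((A - B) \<inter> Y)" using \<nu>[of "(A - B) \<inter> Y"] Y(2)[of "(A - B) \<inter> Y"] A B Y(1) by auto
      ultimately show ?thesis by simp
    qed
    then show "(SUP B\<in>{B \<in> sets borel. B \<subseteq> A}. ennreal (\<nu> B)) \<le> ennreal (\<nu> (A \<inter> Y))"
      by (intro SUP_least ennreal_leI) auto
  qed
  obtain M where M: "sets M = sets borel" "finite_measure M" "\<And>A. A \<in> sets borel \<Longrightarrow> measure M A = \<nu> (A \<inter> Y)"
    "M = measure_of UNIV (sets borel) (\<lambda>A. ennreal (\<nu> (A \<inter> Y)))"
  proof (rule measure_from_additive[of "measure P" "\<lambda>A. \<nu> (A \<inter> Y)"])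
    show "(\<lambda>i. measure P (S i)) \<longlonglongrightarrow> 0" if "range S \<subseteq> sets borel" "decseq S" "(\<Inter>i. S i) = {}" for S :: "nat \<Rightarrow> 'a set"
      using measure_LIMSEQ_0[OF P that] .
    fix A :: "'a set" assume A: "A \<in> sets borel"
    have AY: "A \<inter> Y \<in> sets borel" using A Y(1) by auto
    show "0 \<le> \<nu> (A \<inter> Y)" using \<nu>[OF AY] Y(2)[OF AY] by simp
    have "measure P (A \<inter> Y) \<le> measure P A" using A P by (intro finite_measure.finite_measure_mono) auto
    then show "\<nu> (A \<inter> Y) \<le> measure P A" using \<nu>[OF AY] measure_nonneg[of N "A \<inter> Y"] by linarith
    show "\<nu> ((A \<union> B) \<inter> Y) = \<nu> (A \<inter> Y) + \<nu> (B \<inter> Y)" if "B \<in> sets borel" "A \<inter> B = {}" for B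
      unfolding Int_Un_distrib2 using A that Y(1) by (intro add) auto
  qed blast
  have "pos_variation \<nu> = M" unfolding pos_variation_def M(4)
    by (rule measure_of_eq) (use sup sets.sigma_sets_eq[of "borel :: 'a measure"] in \<open>auto\<close>)
  then show "sets (pos_variation \<nu>) = sets borel" "finite_measure (pos_variation \<nu>)"
    "\<And>A. A \<in> sets borel \<Longrightarrow> measure (pos_variation \<nu>) A = \<nu> (A \<inter> Y)" using M by auto
qed

text \<open>A Hahn set \<open>Y\<close> carries the positive variation and its complement the
  negative one, by the same lemma with \<open>P\<close> and \<open>N\<close> exchanged.\<close>

lemma jordan_variations:
  assumes "jordan_measure \<nu>"
  shows "sets (pos_variation \<nu>) = sets borel" "finite_measure (pos_variation \<nu>)"
    "sets (neg_variation \<nu>) = sets borel" "finite_measure (neg_variation \<nu>)"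
    "\<And>A. A \<in> sets borel \<Longrightarrow> \<nu> A = measure (pos_variation \<nu>) A - measure (neg_variation \<nu>) A"
    "\<And>A. A \<in> sets borel \<Longrightarrow> (\<And>B. B \<in> sets borel \<Longrightarrow> B \<subseteq> A \<Longrightarrow> \<nu> B = 0) \<Longrightarrow>
      measure (pos_variation \<nu>) A = 0 \<and> measure (neg_variation \<nu>) A = 0"
proof -
  obtain P N where P: "finite_measure P" "sets P = sets borel" and N: "finite_measure N" "sets N = sets borel"
    and \<nu>: "\<And>A. A \<in> sets borel \<Longrightarrow> \<nu> A = measure P A - measure N A" using assms unfolding jordan_measure_def by blast
  interpret P: finite_measure P by (rule P)
  interpret N: finite_measure N by (rule N)
  obtain Y where Y: "Y \<in> sets borel" "\<And>X. X \<in> sets borel \<Longrightarrow> X \<subseteq> Y \<Longrightarrow> measure N X \<le> measure P X"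
      "\<And>X. X \<in> sets borel \<Longrightarrow> X \<inter> Y = {} \<Longrightarrow> measure P X \<le> measure N X"
    using finite_unsigned_Hahn_decomposition[OF P(1) N(1)] P(2) N(2)
    by (auto simp: P.emeasure_eq_measure N.emeasure_eq_measure)
  have pv: "sets (pos_variation \<nu>) = sets borel" "finite_measure (pos_variation \<nu>)"
    "\<And>A. A \<in> sets borel \<Longrightarrow> measure (pos_variation \<nu>) A = \<nu> (A \<inter> Y)"
    by (rule pos_variation_Hahn[OF P N \<nu> Y]; blast)+
  have Yc: "- Y \<in> sets borel" using Y(1) by (simp add: borel_comp)
  have mm: "- \<nu> A = measure N A - measure P A" if "A \<in> sets borel" for A using \<nu>[OF that] by simp
  have nv: "sets (neg_variation \<nu>) = sets borel" "finite_measure (neg_variation \<nu>)"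
    "\<And>A. A \<in> sets borel \<Longrightarrow> measure (neg_variation \<nu>) A = - \<nu> (A \<inter> - Y)"
    unfolding neg_variation_def by (rule pos_variation_Hahn[OF N P mm Yc]; use Y in blast)+
  show "sets (pos_variation \<nu>) = sets borel" by (rule pv(1))
  show "finite_measure (pos_variation \<nu>)" by (rule pv(2))
  show "sets (neg_variation \<nu>) = sets borel" by (rule nv(1))
  show "finite_measure (neg_variation \<nu>)" by (rule nv(2))
  show "\<nu> A = measure (pos_variation \<nu>) A - measure (neg_variation \<nu>) A" if A: "A \<in> sets borel" for A
  proof -
    have "\<nu> ((A \<inter> Y) \<union> (A \<inter> - Y)) = \<nu> (A \<inter> Y) + \<nu> (A \<inter> - Y)"
      by (rule signed_borel_measure_Un[OF signed_jordan_measure[OF assms]]) (use A Y(1) Yc in auto)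
    moreover have "(A \<inter> Y) \<union> (A \<inter> - Y) = A" by blast
    ultimately show ?thesis using pv(3)[OF A] nv(3)[OF A] by simp
  qed
  show "measure (pos_variation \<nu>) A = 0 \<and> measure (neg_variation \<nu>) A = 0"
    if A: "A \<in> sets borel" and z: "\<And>B. B \<in> sets borel \<Longrightarrow> B \<subseteq> A \<Longrightarrow> \<nu> B = 0" for A
    using pv(3)[OF A] nv(3)[OF A] z[of "A \<inter> Y"] z[of "A \<inter> - Y"] A Y(1) Yc by auto
qed

lemma finite_integrable_bounded:
  assumes "finite_measure M" "sets M = sets borel" "w \<in> borel_measurable borel" "\<And>x. \<bar>w x\<bar> \<le> (B :: real)"
  shows "integrable M w"
  using assms measurable_cong_sets[OF assms(2) refl]
  by (intro finite_measure.integrable_const_bound[of M w B]) auto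

definition total_variation :: "('a::topological_space set \<Rightarrow> real) \<Rightarrow> 'a set \<Rightarrow> real" where
  "total_variation \<nu> A = measure (pos_variation \<nu>) A + measure (neg_variation \<nu>) A"

lemma set_integral_close:
  assumes M: "finite_measure M" "sets M = sets borel" and w: "w \<in> borel_measurable borel" "\<And>x. \<bar>w x\<bar> \<le> (B :: real)"
    and A: "A \<in> sets borel" and c: "\<And>x. x \<in> A \<Longrightarrow> \<bar>w x - c\<bar> \<le> \<eta>"
  shows "\<bar>(LINT x:A|M. w x) - c * measure M A\<bar> \<le> \<eta> * measure M A"
proof -
  interpret finite_measure M by fact
  have AM: "A \<in> sets M" using A M(2) by simp
  have i: "integrable M (\<lambda>x. indicator A x *\<^sub>R w x)" "integrable M (\<lambda>x. indicator A x * k)" for k :: real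
    by (rule integrable_mult_indicator[OF AM finite_integrable_bounded[OF M w]])
      (intro integrable_mult_left integrable_real_indicator AM, simp add: emeasure_eq_measure)
  have e: "(\<integral>x. indicator A x * k \<partial>M) = k * measure M A" for k :: real using A M(2) by simp
  have "\<bar>(LINT x:A|M. w x) - c * measure M A\<bar> = \<bar>\<integral>x. indicator A x *\<^sub>R w x - indicator A x * c \<partial>M\<bar>"
    unfolding set_lebesgue_integral_def by (simp only: Bochner_Integration.integral_diff[OF i] e)
  also have "\<dots> \<le> (\<integral>x. \<bar>indicator A x *\<^sub>R w x - indicator A x * c\<bar> \<partial>M)" by (rule integral_abs_bound)
  also have "\<dots> \<le> (\<integral>x. indicator A x * \<eta> \<partial>M)"
    using i c by (intro integral_mono) (auto split: split_indicator)
  finally show ?thesis unfolding e .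
qed

lemma
  assumes \<nu>: "jordan_measure \<nu>" and w: "w \<in> borel_measurable borel" "\<And>x. \<bar>w x\<bar> \<le> B"
  shows signed_integrable_bounded: "signed_integrable \<nu> w"
    and signed_integral_close: "A \<in> sets borel \<Longrightarrow> (\<And>x. x \<in> A \<Longrightarrow> \<bar>w x - c\<bar> \<le> \<eta>) \<Longrightarrow>
      \<bar>signed_integral \<nu> A w - c * \<nu> A\<bar> \<le> \<eta> * total_variation \<nu> A"
    and signed_integral_Un: "A \<in> sets borel \<Longrightarrow> A' \<in> sets borel \<Longrightarrow> A \<inter> A' = {} \<Longrightarrow>
      signed_integral \<nu> (A \<union> A') w = signed_integral \<nu> A w + signed_integral \<nu> A' w"
proof -
  note jv = jordan_variations[OF \<nu>]
  have i: "integrable (pos_variation \<nu>) w" "integrable (neg_variation \<nu>) w"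
    by (rule finite_integrable_bounded[OF _ _ w], rule jv, rule jv)+
  then show "signed_integrable \<nu> w" by (simp add: signed_integrable_def)
  show "\<bar>signed_integral \<nu> A w - c * \<nu> A\<bar> \<le> \<eta> * total_variation \<nu> A"
    if "A \<in> sets borel" "\<And>x. x \<in> A \<Longrightarrow> \<bar>w x - c\<bar> \<le> \<eta>"
  proof -
    have "c * \<nu> A = c * measure (pos_variation \<nu>) A - c * measure (neg_variation \<nu>) A"
      by (simp add: jv(5)[OF that(1)] right_diff_distrib)
    then show ?thesis
      using set_integral_close[OF jv(2,1) w that] set_integral_close[OF jv(4,3) w that]
      unfolding signed_integral_def total_variation_def distrib_left by linarith
  qed
  assume A: "A \<in> sets borel" "A' \<in> sets borel" "A \<inter> A' = {}"
  have "(LINT x:A \<union> A'|M. w x) = (LINT x:A|M. w x) + (LINT x:A'|M. w x)" if "integrable M w" "sets M = sets borel" for M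
    using that A unfolding set_integrable_def[symmetric]
    by (intro set_integral_Un) (simp_all add: set_integrable_def integrable_mult_indicator del: real_scaleR_def)
  then show "signed_integral \<nu> (A \<union> A') w = signed_integral \<nu> A w + signed_integral \<nu> A' w"
    using i jv by (simp add: signed_integral_def)
qed

lemma signed_integral_null:
  assumes "jordan_measure \<nu>" "w \<in> borel_measurable borel" "\<And>x. \<bar>w x\<bar> \<le> B" "A \<in> sets borel"
    and "\<And>B. B \<in> sets borel \<Longrightarrow> B \<subseteq> A \<Longrightarrow> \<nu> B = 0"
  shows "signed_integral \<nu> A w = 0"
  using signed_integral_close[OF assms(1-4), of 0 B] assms(3) jordan_variations(6)[OF assms(1,4,5)]
  by (simp add: total_variation_def)

lemma total_variation_Un:
  assumes "jordan_measure \<nu>" "A \<in> sets borel" "B \<in> sets borel" "A \<inter> B = {}"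
  shows "total_variation \<nu> (A \<union> B) = total_variation \<nu> A + total_variation \<nu> B"
proof -
  have "measure M (A \<union> B) = measure M A + measure M B" if "sets M = sets borel" "finite_measure M" for M
    using assms that by (intro finite_measure.finite_measure_Union) auto
  then show ?thesis using jordan_variations(1-4)[OF assms(1)] by (simp add: total_variation_def)
qed

lemma total_variation_nonneg: "0 \<le> total_variation \<nu> A"
  by (simp add: total_variation_def)

text \<open>A comparison over a finite cover that asks only for finite additivity, which is what is
  recorded for signed integrals.\<close>

lemma additive_le_if_locally_le:
  assumes \<alpha>: "\<And>A B. A \<in> sets borel \<Longrightarrow> B \<in> sets borel \<Longrightarrow> A \<inter> B = {} \<Longrightarrow> \<alpha> (A \<union> B) = \<alpha> A + (\<alpha> B :: real)"
    and \<beta>: "\<And>A B. A \<in> sets borel \<Longrightarrow> B \<in> sets borel \<Longrightarrow> A \<inter> B = {} \<Longrightarrow> \<beta> (A \<union> B) = \<beta> A + (\<beta> B :: real)"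
    and F: "finite F" "F \<subseteq> sets borel"
    and le: "\<And>S A. S \<in> F \<Longrightarrow> A \<in> sets borel \<Longrightarrow> A \<subseteq> S \<Longrightarrow> \<alpha> A \<le> \<beta> A"
    and A: "A \<in> sets borel" "A \<subseteq> \<Union>F"
  shows "\<alpha> A \<le> \<beta> A"
  using F le A
proof (induction F arbitrary: A rule: finite_induct)
  case empty
  then have "A = {}" by simp
  then show ?case using \<alpha>[of "{}" "{}"] \<beta>[of "{}" "{}"] by simp
next
  case (insert S F)
  have S: "S \<in> sets borel" using insert.prems(1) by simp
  have "\<alpha> (A \<inter> S) \<le> \<beta> (A \<inter> S)" using insert.prems S by (intro insert.prems(2)[of S]) auto
  moreover have "\<alpha> (A - S) \<le> \<beta> (A - S)"
    by (rule insert.IH) (use insert.prems S in auto)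
  moreover have "(A \<inter> S) \<union> (A - S) = A" "(A \<inter> S) \<inter> (A - S) = {}" by blast+
  moreover have "A \<inter> S \<in> sets borel" "A - S \<in> sets borel" using insert.prems(3) S by auto
  ultimately show ?case using \<alpha>[of "A \<inter> S" "A - S"] \<beta>[of "A \<inter> S" "A - S"] by simp
qed

text \<open>The variations of a sum are not the sums of the variations. But on a slice where
  \<open>w\<close> varies by at most \<eta>, each integral is a constant times the signed measure up
  to \<eta> times its total variation, and the signed measures do add up.\<close>

lemma signed_integral_add_measure:
  assumes \<nu>: "jordan_measure \<nu>1" "jordan_measure \<nu>2" "jordan_measure \<nu>"
    and eq: "\<And>A. A \<in> sets borel \<Longrightarrow> \<nu> A = \<nu>1 A + \<nu>2 A"
    and w: "w \<in> borel_measurable borel" "\<And>x. \<bar>w x\<bar> \<le> B" and A: "A \<in> sets borel"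
  shows "signed_integral \<nu> A w = signed_integral \<nu>1 A w + signed_integral \<nu>2 A w"
proof -
  define T where "T A = total_variation \<nu> A + total_variation \<nu>1 A + total_variation \<nu>2 A" for A
  define D where "D A = signed_integral \<nu> A w - signed_integral \<nu>1 A w - signed_integral \<nu>2 A w" for A
  have TU: "T (A \<union> A') = T A + T A'" if "A \<in> sets borel" "A' \<in> sets borel" "A \<inter> A' = {}" for A A'
    using total_variation_Un[OF \<nu>(1) that] total_variation_Un[OF \<nu>(2) that] total_variation_Un[OF \<nu>(3) that] by (simp add: T_def)
  have DU: "D (A \<union> A') = D A + D A'" if "A \<in> sets borel" "A' \<in> sets borel" "A \<inter> A' = {}" for A A'
    using signed_integral_Un[OF \<nu>(1) w that] signed_integral_Un[OF \<nu>(2) w that] signed_integral_Un[OF \<nu>(3) w that] by (simp add: D_def)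
  have T0: "0 \<le> T A" unfolding T_def by (intro add_nonneg_nonneg total_variation_nonneg)
  have small: "\<bar>D A\<bar> \<le> \<eta> * T A" if \<eta>: "\<eta> > 0" for \<eta>
  proof -
    \<comment> \<open>Slices of height \<eta>; finitely many of them cover the space because
      \<open>w\<close> is bounded.\<close>
    define C where "C k = {x. of_int k * \<eta> \<le> w x \<and> w x < (of_int k + 1) * \<eta>}" for k :: int
    define F where "F = C ` {\<lfloor>- B / \<eta>\<rfloor>..\<lfloor>B / \<eta>\<rfloor>}"
    have Cb: "C k \<in> sets borel" for k
    proof -
      have "C k = w -` {of_int k * \<eta>..<(of_int k + 1) * \<eta>}" by (auto simp: C_def)
      then show ?thesis using measurable_sets[OF w(1), of "{of_int k * \<eta>..<(of_int k + 1) * \<eta>}"] by simp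
    qed
    have cov: "x \<in> \<Union>F" for x
    proof -
      have "x \<in> C \<lfloor>w x / \<eta>\<rfloor>" using \<eta> by (simp add: C_def pos_le_divide_eq[symmetric] pos_divide_less_eq[symmetric])
      moreover have "- B \<le> w x" "w x \<le> B" using w(2)[of x] by auto
      then have "- B / \<eta> \<le> w x / \<eta>" "w x / \<eta> \<le> B / \<eta>"
        using divide_right_mono[of "- B" "w x" \<eta>] divide_right_mono[of "w x" B \<eta>] \<eta> by simp_all
      then have "\<lfloor>- B / \<eta>\<rfloor> \<le> \<lfloor>w x / \<eta>\<rfloor>" "\<lfloor>w x / \<eta>\<rfloor> \<le> \<lfloor>B / \<eta>\<rfloor>" by (auto intro: floor_mono)
      ultimately show ?thesis by (auto simp: F_def)
    qed
    have loc: "\<bar>D S\<bar> \<le> \<eta> * T S" if S: "S \<in> sets borel" "S \<subseteq> C k" for S k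
    proof -
      have c: "\<bar>w x - of_int k * \<eta>\<bar> \<le> \<eta>" if "x \<in> S" for x
      proof -
        have "of_int k * \<eta> \<le> w x" "w x < (of_int k + 1) * \<eta>" using that S(2) by (auto simp: C_def)
        then show ?thesis by (simp add: distrib_right)
      qed
      define k' where "k' = of_int k * \<eta>"
      have e: "k' * \<nu> S = k' * \<nu>1 S + k' * \<nu>2 S" by (simp add: eq[OF S(1)] distrib_left)
      have "\<eta> * T S = \<eta> * total_variation \<nu> S + \<eta> * total_variation \<nu>1 S + \<eta> * total_variation \<nu>2 S"
        by (simp add: T_def distrib_left)
      then show ?thesis
        using signed_integral_close[OF \<nu>(1) w S(1) c] signed_integral_close[OF \<nu>(2) w S(1) c] signed_integral_close[OF \<nu>(3) w S(1) c] e
        unfolding D_def k'_def[symmetric] by linarith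
    qed
    have F: "finite F" "F \<subseteq> sets borel" using Cb by (auto simp: F_def)
    have "D A \<le> \<eta> * T A"
      by (rule additive_le_if_locally_le[where F = F, OF DU _ F _ A])
        (use TU loc cov in \<open>auto simp: F_def distrib_left abs_le_iff\<close>)
    moreover have "- D A \<le> \<eta> * T A"
      by (rule additive_le_if_locally_le[where F = F and \<alpha> = "\<lambda>A. - D A", OF _ _ F _ A])
        (use DU TU loc cov in \<open>auto simp: F_def distrib_left abs_le_iff\<close>)
    ultimately show ?thesis by simp
  qed
  have "\<bar>D A\<bar> \<le> 0"
  proof (rule field_le_epsilon)
    fix e :: real assume e: "e > 0"
    have "\<bar>D A\<bar> \<le> e / (T A + 1) * T A" using T0 e by (intro small) auto
    also have "\<dots> \<le> e" using T0 e by (simp add: field_simps)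
    finally show "\<bar>D A\<bar> \<le> 0 + e" by simp
  qed
  then show ?thesis by (simp add: D_def)
qed

section \<open>Mutual energy measures\<close>

text \<open>Convexity puts every left difference quotient below every right one. Their gap at
  \<open>t\<close> is the second difference over \<open>t\<close>, so it closes as \<open>t\<close>
  tends to \<open>0\<close> and both sides meet in one value.\<close>

lemma convex_smooth_derivative:
  fixes \<phi> :: "real \<Rightarrow> real"
  assumes cv: "convex_on UNIV \<phi>" and sm: "((\<lambda>t. (\<phi> t + \<phi> (- t) - 2 * \<phi> 0) / t) \<longlongrightarrow> 0) (at_right 0)"
  obtains D where "(\<phi> has_real_derivative D) (at 0)"
    "\<And>t. t > 0 \<Longrightarrow> (\<phi> 0 - \<phi> (- t)) / t \<le> D" "\<And>t. t > 0 \<Longrightarrow> D \<le> (\<phi> t - \<phi> 0) / t"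
proof -
  have cross: "(\<phi> 0 - \<phi> (- t)) / t \<le> (\<phi> s - \<phi> 0) / s" if st: "s > 0" "t > 0" for s t
  proof -
    \<comment> \<open>The weight that exhibits \<open>0\<close> as a convex combination of
      \<open>- t\<close> and \<open>s\<close>.\<close>
    define \<theta> where "\<theta> = t / (s + t)"
    have \<theta>: "0 \<le> \<theta>" "\<theta> \<le> 1" using st by (auto simp: \<theta>_def)
    have e: "\<theta> * (s + t) = t" "(1 - \<theta>) * (s + t) = s" using st by (auto simp: \<theta>_def field_simps)
    have "(1 - \<theta>) * - t + \<theta> * s = 0"
      using st by (simp add: \<theta>_def field_simps)
    then have "\<phi> 0 \<le> (1 - \<theta>) * \<phi> (- t) + \<theta> * \<phi> s"
      using convex_onD[OF cv \<theta>, of "- t" s] by simp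
    then have "\<phi> 0 * (s + t) \<le> ((1 - \<theta>) * \<phi> (- t) + \<theta> * \<phi> s) * (s + t)" using st by (intro mult_right_mono) auto
    also have "\<dots> = ((1 - \<theta>) * (s + t)) * \<phi> (- t) + (\<theta> * (s + t)) * \<phi> s" by (simp add: algebra_simps)
    finally have "\<phi> 0 * (s + t) \<le> s * \<phi> (- t) + t * \<phi> s" unfolding e .
    then have "(\<phi> 0 - \<phi> (- t)) * s \<le> (\<phi> s - \<phi> 0) * t" by (simp add: algebra_simps)
    then show ?thesis using st by (simp add: divide_le_eq le_divide_eq field_simps)
  qed
  define D where "D = (INF s\<in>{0<..}. (\<phi> s - \<phi> 0) / s)"
  have bdd: "bdd_below ((\<lambda>s. (\<phi> s - \<phi> 0) / s) ` {0<..})"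
    by (rule bdd_belowI2[of _ "(\<phi> 0 - \<phi> (- 1)) / 1"]) (use cross[of _ 1] in auto)
  have up: "D \<le> (\<phi> t - \<phi> 0) / t" if "t > 0" for t unfolding D_def using bdd that by (intro cINF_lower) auto
  have lo: "(\<phi> 0 - \<phi> (- t)) / t \<le> D" if "t > 0" for t unfolding D_def using cross that by (intro cINF_greatest) auto
  define e where "e t = (\<phi> t + \<phi> (- t) - 2 * \<phi> 0) / t" for t
  have ee: "e t = (\<phi> t - \<phi> 0) / t - (\<phi> 0 - \<phi> (- t)) / t" for t
    unfolding e_def by (simp add: diff_divide_distrib[symmetric])
  have bound: "\<bar>(\<phi> t - \<phi> 0) / t - D\<bar> \<le> e \<bar>t\<bar>" if "t \<noteq> 0" for t
  proof (cases "t > 0")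
    case True
    then show ?thesis using up[OF True] lo[OF True] ee[of t] by simp
  next
    case False
    then have t: "- t > 0" using that by simp
    have "(\<phi> t - \<phi> 0) / t = (\<phi> 0 - \<phi> (- (- t))) / (- t)"
      using minus_divide_divide[of "\<phi> t - \<phi> 0" t] unfolding minus_diff_eq minus_minus by (rule sym)
    then show ?thesis using up[OF t] lo[OF t] ee[of "- t"] t by simp
  qed
  have "filterlim abs (at_right 0) (at (0 :: real))"
    by (rule filterlim_at_withinI) (auto simp: eventually_at_filter intro!: tendsto_eq_intros)
  from filterlim_compose[OF sm this] have l: "((\<lambda>t. e \<bar>t\<bar>) \<longlongrightarrow> 0) (at 0)" by (simp add: e_def)
  have "((\<lambda>t. (\<phi> t - \<phi> 0) / t - D) \<longlongrightarrow> 0) (at 0)"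
    by (rule Lim_null_comparison[OF _ l]) (use bound in \<open>auto simp: eventually_at_filter\<close>)
  then have "((\<lambda>t. (\<phi> t - \<phi> 0) / (t - 0)) \<longlongrightarrow> D) (at 0)" by (simp add: LIM_zero_iff)
  then show ?thesis using that up lo by (simp add: has_field_derivative_iff)
qed

lemma DERIV_0_LIMSEQ:
  fixes \<phi> :: "real \<Rightarrow> real"
  assumes "(\<phi> has_real_derivative D) (at 0)" "x \<longlonglongrightarrow> 0" "\<And>n. x n \<noteq> 0"
  shows "(\<lambda>n. (\<phi> (x n) - \<phi> 0) / x n) \<longlonglongrightarrow> D"
proof -
  have "((\<lambda>t. (\<phi> t - \<phi> 0) / t) \<longlongrightarrow> D) (at 0)" using assms(1) by (simp add: has_field_derivative_iff)
  moreover have "filterlim x (at 0) sequentially" using assms(2,3) by (intro filterlim_atI) auto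
  ultimately show ?thesis by (rule filterlim_compose)
qed

locale energy_measures_space = p_energy_space +
  fixes \<mu> :: "('a \<Rightarrow> real) \<Rightarrow> 'a measure"
  assumes em: "energy_measures p m \<E> \<F> \<mu>"
begin

abbreviation Q :: "'a set \<Rightarrow> ('a \<Rightarrow> real) \<Rightarrow> real" where "Q A f \<equiv> measure (\<mu> f) A"

abbreviation \<Gamma> :: "('a \<Rightarrow> real) \<Rightarrow> ('a \<Rightarrow> real) \<Rightarrow> 'a set \<Rightarrow> real" where "\<Gamma> \<equiv> mutual_energy p \<mu>"

lemma sets_mu: "f \<in> \<F> \<Longrightarrow> sets (\<mu> f) = sets borel"
  and finite_mu: "f \<in> \<F> \<Longrightarrow> finite_measure (\<mu> f)"
  and space_mu: "f \<in> \<F> \<Longrightarrow> space (\<mu> f) = UNIV"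
  using finite_radon_measureD[OF energy_measures_facts(1,3)[OF em]] by auto

lemma Q_le_E: assumes "f \<in> \<F>" shows "Q A f \<le> \<E> f"
proof -
  have "Q A f \<le> Q (space (\<mu> f)) f" by (rule finite_measure.bounded_measure[OF finite_mu[OF assms]])
  then show ?thesis using energy_measures_facts(2)[OF em assms] E_nonneg[OF assms]
    by (simp add: space_mu[OF assms] measure_def)
qed

lemma Q_seminorm: "A \<in> sets borel \<Longrightarrow> seminorm_on \<F> (\<lambda>f. Q A f powr (1 / p))"
  using em unfolding energy_measures_def by blast

lemma Q_clarkson: "A \<in> sets borel \<Longrightarrow> clarkson p \<F> (\<lambda>f. Q A f powr (1 / p))"
  using em unfolding energy_measures_def by blast

lemma Q_clarkson_ineq:
  "u \<in> \<F> \<Longrightarrow> v \<in> \<F> \<Longrightarrow> A \<in> sets borel \<Longrightarrow> clarkson_ineq p (Q A u) (Q A v) (Q A (\<lambda>x. u x + v x) + Q A (\<lambda>x. u x - v x))"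
  by (rule clarksonD[OF p F_subspace measure_nonneg Q_clarkson])

lemmas Q_scale = energy_measures_measure_scale[OF em]

lemma Q_local: "f \<in> \<C> \<Longrightarrow> g \<in> \<C> \<Longrightarrow> A \<in> sets borel \<Longrightarrow> (\<And>x. x \<in> A \<Longrightarrow> f x - g x = c) \<Longrightarrow> Q A f = Q A g"
  by (rule local_energy_family.mu_local[OF energy_measures_local_family[OF em]])

lemma Q_Un: "f \<in> \<F> \<Longrightarrow> A \<in> sets borel \<Longrightarrow> B \<in> sets borel \<Longrightarrow> A \<inter> B = {} \<Longrightarrow> Q (A \<union> B) f = Q A f + Q B f"
  by (intro finite_measure.finite_measure_Union finite_mu) (auto simp: sets_mu)

lemma Q_powr: "(Q A f powr (1 / p)) powr p = Q A f"
  using p by (simp add: powr_powr)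

lemma Q_add_le:
  assumes "f \<in> \<F>" "g \<in> \<F>" "A \<in> sets borel"
  shows "Q A (\<lambda>x. f x + g x) \<le> (Q A f powr (1 / p) + Q A g powr (1 / p)) powr p"
proof -
  have "Q A (\<lambda>x. f x + g x) powr (1 / p) \<le> Q A f powr (1 / p) + Q A g powr (1 / p)"
    using Q_seminorm[OF assms(3)] assms(1,2) unfolding seminorm_on_def by blast
  then have "(Q A (\<lambda>x. f x + g x) powr (1 / p)) powr p \<le> (Q A f powr (1 / p) + Q A g powr (1 / p)) powr p"
    using p by (intro powr_mono2) auto
  then show ?thesis by (simp add: Q_powr)
qed

lemma Q_LIMSEQ:
  assumes f: "\<And>n. f n \<in> \<F>" and g: "g \<in> \<F>" and A: "A \<in> sets borel" and lim: "(\<lambda>n. N (\<lambda>x. f n x - g x)) \<longlonglongrightarrow> 0"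
  shows "(\<lambda>n. Q A (f n)) \<longlonglongrightarrow> Q A g"
proof -
  have "\<bar>Q A (f n) powr (1 / p) - Q A g powr (1 / p)\<bar> \<le> N (\<lambda>x. f n x - g x)" for n
  proof -
    have d: "(\<lambda>x. f n x - g x) \<in> \<F>" using f g by (intro F_closed)
    have "Q A (\<lambda>x. f n x - g x) powr (1 / p) \<le> N (\<lambda>x. f n x - g x)"
      unfolding N_def using Q_le_E[OF d] p by (intro powr_mono2) auto
    then show ?thesis using seminorm_on_diff[OF F_subspace Q_seminorm[OF A] f g, of n] by linarith
  qed
  then have "(\<lambda>n. Q A (f n) powr (1 / p)) \<longlonglongrightarrow> Q A g powr (1 / p)"
    by (intro LIM_zero_cancel[OF Lim_null_comparison[OF _ lim]]) simp
  then have "(\<lambda>n. (Q A (f n) powr (1 / p)) powr p) \<longlonglongrightarrow> (Q A g powr (1 / p)) powr p"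
    by (rule tendsto_powr'[OF _ tendsto_const]) (use p in auto)
  then show ?thesis unfolding Q_powr .
qed

lemma Q_line_convex:
  assumes uv: "u \<in> \<F>" "v \<in> \<F>" and A: "A \<in> sets borel"
  shows "convex_on UNIV (\<lambda>t. Q A (\<lambda>x. u x + t * v x))"
proof (rule clarkson_convex_on_line[OF p F_subspace measure_nonneg Q_clarkson[OF A] _ uv])
  fix a b :: real
  show "bdd_above ((\<lambda>t. Q A (\<lambda>x. u x + t * v x)) ` {a..b})"
  proof (rule bdd_aboveI2)
    fix t assume t: "t \<in> {a..b}"
    have tv: "(\<lambda>x. t * v x) \<in> \<F>" by (rule F_closed(3)[OF uv(2)])
    have "Q A (\<lambda>x. u x + t * v x) \<le> (Q A u powr (1 / p) + Q A (\<lambda>x. t * v x) powr (1 / p)) powr p"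
      by (rule Q_add_le[OF uv(1) tv A])
    also have "Q A (\<lambda>x. t * v x) powr (1 / p) = \<bar>t\<bar> * Q A v powr (1 / p)"
      using Q_scale[OF uv(2) A, of t] p by (simp add: powr_mult powr_powr)
    also have "(Q A u powr (1 / p) + \<bar>t\<bar> * Q A v powr (1 / p)) powr p \<le> (Q A u powr (1 / p) + (\<bar>a\<bar> + \<bar>b\<bar>) * Q A v powr (1 / p)) powr p"
      using t p by (intro powr_mono2 add_left_mono mult_right_mono add_nonneg_nonneg) auto
    finally show "Q A (\<lambda>x. u x + t * v x) \<le> (Q A u powr (1 / p) + (\<bar>a\<bar> + \<bar>b\<bar>) * Q A v powr (1 / p)) powr p" .
  qed
qed

text \<open>The lower Clarkson bound gives convexity along the line, the upper one the vanishing
  second difference quotient. The two brackets turn the derivative into inequalities between masses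
  at a fixed step.\<close>

lemma
  assumes f: "f \<in> \<F>" and g: "g \<in> \<F>" and A: "A \<in> sets borel"
  shows mutual_DERIV: "((\<lambda>t. Q A (\<lambda>x. f x + t * g x)) has_real_derivative p * \<Gamma> f g A) (at 0)"
    and mutual_ge: "t > 0 \<Longrightarrow> (Q A f - Q A (\<lambda>x. f x - t * g x)) / t \<le> p * \<Gamma> f g A"
    and mutual_le: "t > 0 \<Longrightarrow> p * \<Gamma> f g A \<le> (Q A (\<lambda>x. f x + t * g x) - Q A f) / t"
proof -
  define r where "r = min 1 (1 / (p - 1))"
  have sm: "((\<lambda>t. (Q A (\<lambda>x. f x + t * g x) + Q A (\<lambda>x. f x + - t * g x) - 2 * Q A (\<lambda>x. f x + 0 * g x)) / t) \<longlongrightarrow> 0) (at_right 0)"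
  proof (rule tendsto_sandwich)
    have b: "0 \<le> Q A (\<lambda>x. f x + t * g x) + Q A (\<lambda>x. f x + - t * g x) - 2 * Q A (\<lambda>x. f x + 0 * g x) \<and>
      Q A (\<lambda>x. f x + t * g x) + Q A (\<lambda>x. f x + - t * g x) - 2 * Q A (\<lambda>x. f x + 0 * g x) \<le>
        2 * ((Q A f powr r + (t powr p * Q A g) powr r) powr (1 / r) - Q A f)" if "t > 0" for t
    proof -
      have tg: "(\<lambda>x. t * g x) \<in> \<F>" by (rule F_closed(3)[OF g])
      note c = Q_clarkson_ineq[OF f tg A]
      show ?thesis
        using clarkson_ineq_midpoint[OF p c] clarkson_ineq_le[OF p c _ _ r_def] Q_scale[OF g A, of t] that by simp
    qed
    show "\<forall>\<^sub>F t in at_right 0. 0 \<le> (Q A (\<lambda>x. f x + t * g x) + Q A (\<lambda>x. f x + - t * g x) - 2 * Q A (\<lambda>x. f x + 0 * g x)) / t"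
      using b by (auto simp: eventually_at_filter intro!: always_eventually divide_nonneg_pos)
    show "\<forall>\<^sub>F t in at_right 0. (Q A (\<lambda>x. f x + t * g x) + Q A (\<lambda>x. f x + - t * g x) - 2 * Q A (\<lambda>x. f x + 0 * g x)) / t
        \<le> 2 * (((Q A f powr r + (t powr p * Q A g) powr r) powr (1 / r) - Q A f) / t)"
      using b by (auto simp: eventually_at_filter divide_right_mono intro!: always_eventually)
    show "((\<lambda>t. 2 * (((Q A f powr r + (t powr p * Q A g) powr r) powr (1 / r) - Q A f) / t)) \<longlongrightarrow> 0) (at_right 0)"
      using tendsto_mult[OF tendsto_const[of 2] clarkson_bound_smooth[OF p _ _ r_def, of "Q A f" "Q A g"]] by simp
  qed simp
  obtain D where D: "((\<lambda>t. Q A (\<lambda>x. f x + t * g x)) has_real_derivative D) (at 0)"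
    "\<And>t. t > 0 \<Longrightarrow> (Q A (\<lambda>x. f x + 0 * g x) - Q A (\<lambda>x. f x + - t * g x)) / t \<le> D"
    "\<And>t. t > 0 \<Longrightarrow> D \<le> (Q A (\<lambda>x. f x + t * g x) - Q A (\<lambda>x. f x + 0 * g x)) / t"
    using convex_smooth_derivative[OF Q_line_convex[OF f g A] sm] by blast
  have "p * \<Gamma> f g A = D" using DERIV_imp_deriv[OF D(1)] p by (simp add: mutual_energy_def)
  then show "((\<lambda>t. Q A (\<lambda>x. f x + t * g x)) has_real_derivative p * \<Gamma> f g A) (at 0)"
    "t > 0 \<Longrightarrow> (Q A f - Q A (\<lambda>x. f x - t * g x)) / t \<le> p * \<Gamma> f g A"
    "t > 0 \<Longrightarrow> p * \<Gamma> f g A \<le> (Q A (\<lambda>x. f x + t * g x) - Q A f) / t" using D by auto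
qed

lemma mutual_eqI: "((\<lambda>t. Q A (\<lambda>x. f x + t * g x)) has_real_derivative p * d) (at 0) \<Longrightarrow> \<Gamma> f g A = d"
  using DERIV_imp_deriv p by (fastforce simp: mutual_energy_def)

lemma mutual_scale_right:
  assumes "f \<in> \<F>" "g \<in> \<F>" "A \<in> sets borel"
  shows "\<Gamma> f (\<lambda>x. c * g x) A = c * \<Gamma> f g A"
proof (rule mutual_eqI)
  have "((\<lambda>t. Q A (\<lambda>x. f x + (c * t) * g x)) has_real_derivative (p * \<Gamma> f g A) * c) (at 0)"
    by (rule DERIV_chain2[of "\<lambda>t. Q A (\<lambda>x. f x + t * g x)"]) (use mutual_DERIV[OF assms] in \<open>auto intro!: derivative_eq_intros\<close>)
  then show "((\<lambda>t. Q A (\<lambda>x. f x + t * (c * g x))) has_real_derivative p * (c * \<Gamma> f g A)) (at 0)"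
    by (simp add: mult_ac)
qed

text \<open>\<open>f + t / 2 * (g + h)\<close> is the midpoint of \<open>f + t * g\<close> and
  \<open>f + t * h\<close>, so convexity makes the derivative subadditive in the direction; the
  directions \<open>- g\<close> and \<open>- h\<close> give the reverse inequality.\<close>

lemma mutual_add_right:
  assumes f: "f \<in> \<F>" and g: "g \<in> \<F>" and h: "h \<in> \<F>" and A: "A \<in> sets borel"
  shows "\<Gamma> f (\<lambda>x. g x + h x) A = \<Gamma> f g A + \<Gamma> f h A"
proof -
  have sub: "p * \<Gamma> f (\<lambda>x. g x + h x) A \<le> p * \<Gamma> f g A + p * \<Gamma> f h A" if g: "g \<in> \<F>" and h: "h \<in> \<F>" for g h
  proof -
    define t where "t n = 1 / real (Suc n)" for n
    have t: "t n > 0" "t \<longlonglongrightarrow> 0" for n using LIMSEQ_const_over_Suc[of 1] by (auto simp: t_def[abs_def])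
    have gh: "(\<lambda>x. g x + h x) \<in> \<F>" by (intro F_closed g h)
    define q where "q n w = (Q A (\<lambda>x. f x + t n * w x) - Q A f) / t n" for n w
    have lim: "(\<lambda>n. q n w) \<longlonglongrightarrow> p * \<Gamma> f w A" if "w \<in> \<F>" for w
      using DERIV_0_LIMSEQ[OF mutual_DERIV[OF f that A] t(2)] t(1) by (simp add: q_def less_imp_neq[symmetric])
    have step: "p * \<Gamma> f (\<lambda>x. g x + h x) A \<le> q n g + q n h" for n
    proof -
      let ?s = "t n / 2"
      have c: "(\<lambda>x. f x + ?s * (g x + h x)) \<in> \<F>" "(\<lambda>x. ?s * (g x - h x)) \<in> \<F>" by (intro F_closed f g h)+
      have e: "(\<lambda>x. f x + ?s * (g x + h x) + ?s * (g x - h x)) = (\<lambda>x. f x + t n * g x)"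
        "(\<lambda>x. f x + ?s * (g x + h x) - ?s * (g x - h x)) = (\<lambda>x. f x + t n * h x)"
        by (simp_all add: fun_eq_iff algebra_simps) (simp_all add: field_simps)
      have "2 * Q A (\<lambda>x. f x + ?s * (g x + h x)) \<le> Q A (\<lambda>x. f x + t n * g x) + Q A (\<lambda>x. f x + t n * h x)"
        using clarkson_ineq_midpoint[OF p Q_clarkson_ineq[OF c A]] unfolding e by simp
      then have "(2 * Q A (\<lambda>x. f x + ?s * (g x + h x)) - 2 * Q A f) / t n
          \<le> ((Q A (\<lambda>x. f x + t n * g x) - Q A f) + (Q A (\<lambda>x. f x + t n * h x) - Q A f)) / t n"
        using t(1)[of n] by (intro divide_right_mono) auto
      then have "(Q A (\<lambda>x. f x + ?s * (g x + h x)) - Q A f) / ?s \<le> q n g + q n h"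
        unfolding q_def add_divide_distrib by (simp add: right_diff_distrib mult.commute)
      then show ?thesis using mutual_le[OF f gh A, of ?s] t(1)[of n] by simp
    qed
    have "(\<lambda>n. q n g + q n h) \<longlonglongrightarrow> p * \<Gamma> f g A + p * \<Gamma> f h A" by (intro tendsto_add lim g h)
    then show ?thesis using LIMSEQ_le_const step by blast
  qed
  have mg: "\<Gamma> f (\<lambda>x. - w x) A = - \<Gamma> f w A" if "w \<in> \<F>" for w using mutual_scale_right[OF f that A, of "-1"] by simp
  have "p * \<Gamma> f (\<lambda>x. - g x + - h x) A \<le> p * \<Gamma> f (\<lambda>x. - g x) A + p * \<Gamma> f (\<lambda>x. - h x) A"
    by (intro sub F_closed g h)
  moreover have "\<Gamma> f (\<lambda>x. - g x + - h x) A = - \<Gamma> f (\<lambda>x. g x + h x) A"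
    using mg[OF F_closed(2)[OF g h]] by simp
  ultimately have "p * (\<Gamma> f g A + \<Gamma> f h A) \<le> p * \<Gamma> f (\<lambda>x. g x + h x) A" by (simp add: mg g h distrib_left)
  moreover have "p * \<Gamma> f (\<lambda>x. g x + h x) A \<le> p * (\<Gamma> f g A + \<Gamma> f h A)" using sub[OF g h] by (simp add: distrib_left)
  ultimately show ?thesis using p by simp
qed

text \<open>If one argument is null on \<open>A\<close>, the mass grows by at most t^p times a
  constant, and p > 1 sends the quotient to \<open>0\<close>; the direction \<open>- g\<close> gives
  the other sign.\<close>

lemma mutual_null:
  assumes f: "f \<in> \<F>" and g: "g \<in> \<F>" and A: "A \<in> sets borel" and z: "Q A f = 0 \<or> Q A g = 0"
  shows "\<Gamma> f g A = 0"
proof -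
  define t where "t n = 1 / real (Suc n)" for n
  have t: "t n > 0" "t \<longlonglongrightarrow> 0" for n using LIMSEQ_const_over_Suc[of 1] by (auto simp: t_def[abs_def])
  have b: "p * \<Gamma> f w A \<le> t n powr (p - 1) * Q A w" if w: "w \<in> \<F>" and z: "Q A f = 0 \<or> Q A w = 0" for w n
  proof -
    have tw: "(\<lambda>x. t n * w x) \<in> \<F>" by (rule F_closed(3)[OF w])
    have s: "Q A (\<lambda>x. t n * w x) = t n powr p * Q A w" using Q_scale[OF w A, of "t n"] t(1)[of n] by simp
    have q: "(x powr (1 / p)) powr p = x" if "0 \<le> x" for x using that p by (simp add: powr_powr)
    have "Q A (\<lambda>x. f x + t n * w x) - Q A f \<le> t n powr p * Q A w"
      using Q_add_le[OF f tw A] z p by (auto simp: s q)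
    then have "(Q A (\<lambda>x. f x + t n * w x) - Q A f) / t n \<le> t n powr p * Q A w / t n"
      using t(1)[of n] by (simp add: divide_right_mono)
    then show ?thesis using mutual_le[OF f w A t(1)[of n]] t(1)[of n] by (simp add: powr_diff)
  qed
  have l: "(\<lambda>n. t n powr (p - 1) * c) \<longlonglongrightarrow> 0" for c
  proof -
    have "(\<lambda>n. t n powr (p - 1) * c) \<longlonglongrightarrow> 0 powr (p - 1) * c"
      using p t by (intro tendsto_mult tendsto_powr' tendsto_const disjI2 conjI) (auto simp: less_imp_le)
    then show ?thesis by simp
  qed
  have le: "p * \<Gamma> f w A \<le> 0" if "w \<in> \<F>" "Q A f = 0 \<or> Q A w = 0" for w
    using LIMSEQ_le_const[OF l] b[OF that] by blast
  have mg: "\<Gamma> f (\<lambda>x. - g x) A = - \<Gamma> f g A" "Q A (\<lambda>x. - g x) = Q A g"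
    using mutual_scale_right[OF f g A, of "-1"] Q_scale[OF g A, of "-1"] by simp_all
  show ?thesis using le[OF g z] le[of "\<lambda>x. - g x"] z g p by (auto simp: mg F_closed mult_le_0_iff zero_le_mult_iff)
qed

text \<open>For \<open>a \<noteq> 0\<close> the factor \<open>a\<close> is pulled out of the whole
  line, which leaves the direction scaled by \<open>b / a\<close>; then |a|^p / a = sgn a |a|^(p -
  1).\<close>

lemma mutual_scale:
  assumes f: "f \<in> \<F>" and g: "g \<in> \<F>" and A: "A \<in> sets borel"
  shows "\<Gamma> (\<lambda>x. a * f x) (\<lambda>x. b * g x) A = sgn a * \<bar>a\<bar> powr (p - 1) * b * \<Gamma> f g A"
proof (cases "a = 0")
  case True
  have "Q A (\<lambda>x. a * f x) = 0" using Q_scale[OF f A, of a] True by simp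
  then have "\<Gamma> (\<lambda>x. a * f x) (\<lambda>x. b * g x) A = 0" using A by (intro mutual_null F_closed f g) auto
  then show ?thesis using True by simp
next
  case False
  have bg: "(\<lambda>x. b / a * g x) \<in> \<F>" by (rule F_closed(3)[OF g])
  have e: "Q A (\<lambda>x. a * f x + t * (b * g x)) = \<bar>a\<bar> powr p * Q A (\<lambda>x. f x + t * (b / a * g x))" for t
  proof -
    have "(\<lambda>x. f x + t * (b / a * g x)) \<in> \<F>" by (intro F_closed f bg)
    moreover have "(\<lambda>x. a * f x + t * (b * g x)) = (\<lambda>x. a * (f x + t * (b / a * g x)))"
      using False by (simp add: fun_eq_iff field_simps)
    ultimately show ?thesis using Q_scale A by simp
  qed
  show ?thesis
  proof (rule mutual_eqI)
    have "((\<lambda>t. \<bar>a\<bar> powr p * Q A (\<lambda>x. f x + t * (b / a * g x))) has_real_derivative \<bar>a\<bar> powr p * (p * (b / a * \<Gamma> f g A))) (at 0)"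
      using mutual_DERIV[OF f bg A] mutual_scale_right[OF f g A, of "b / a"] by (intro DERIV_cmult) simp
    moreover have "\<bar>a\<bar> powr p * (p * (b / a * \<Gamma> f g A)) = p * (sgn a * \<bar>a\<bar> powr (p - 1) * b * \<Gamma> f g A)"
      using False by (simp add: powr_diff sgn_if)
    ultimately show "((\<lambda>t. Q A (\<lambda>x. a * f x + t * (b * g x))) has_real_derivative p * (sgn a * \<bar>a\<bar> powr (p - 1) * b * \<Gamma> f g A)) (at 0)"
      unfolding e by simp
  qed
qed

lemma mutual_Un:
  assumes f: "f \<in> \<F>" and g: "g \<in> \<F>" and A: "A \<in> sets borel" "B \<in> sets borel" "A \<inter> B = {}"
  shows "\<Gamma> f g (A \<union> B) = \<Gamma> f g A + \<Gamma> f g B"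
proof (rule mutual_eqI)
  have "Q (A \<union> B) (\<lambda>x. f x + t * g x) = Q A (\<lambda>x. f x + t * g x) + Q B (\<lambda>x. f x + t * g x)" for t
    by (intro Q_Un F_closed f g A)
  then show "((\<lambda>t. Q (A \<union> B) (\<lambda>x. f x + t * g x)) has_real_derivative p * (\<Gamma> f g A + \<Gamma> f g B)) (at 0)"
    unfolding distrib_left using DERIV_add[OF mutual_DERIV[OF f g A(1)] mutual_DERIV[OF f g A(2)]] by simp
qed

text \<open>By convexity, adding the measure of \<open>f - g\<close> makes the mutual energy nonnegative.\<close>

lemma jordan_mutual:
  assumes f: "f \<in> \<F>" and g: "g \<in> \<F>"
  shows "jordan_measure (\<Gamma> f g)"
proof -
  have fg: "(\<lambda>x. f x + g x) \<in> \<F>" "(\<lambda>x. f x - g x) \<in> \<F>" by (intro F_closed f g)+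
  have b: "Q A f - Q A (\<lambda>x. f x - g x) \<le> p * \<Gamma> f g A" "p * \<Gamma> f g A \<le> Q A (\<lambda>x. f x + g x) - Q A f" if "A \<in> sets borel" for A
    using mutual_ge[OF f g that, of 1] mutual_le[OF f g that, of 1] by simp_all
  \<comment> \<open>Dominates the shifted set function, by the brackets at step
    \<open>1\<close>.\<close>
  define K where "K A = (Q A (\<lambda>x. f x + g x) + Q A (\<lambda>x. f x - g x)) / p" for A
  obtain P where P: "sets P = sets borel" "finite_measure P" "\<And>A. A \<in> sets borel \<Longrightarrow> measure P A = \<Gamma> f g A + Q A (\<lambda>x. f x - g x) / p"
  proof (rule measure_from_additive[of K "\<lambda>A. \<Gamma> f g A + Q A (\<lambda>x. f x - g x) / p"])
    show "(\<lambda>i. K (S i)) \<longlonglongrightarrow> 0" if "range S \<subseteq> sets borel" "decseq S" "(\<Inter>i. S i) = {}" for S :: "nat \<Rightarrow> 'a set"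
    proof -
      have "(\<lambda>i. K (S i)) \<longlonglongrightarrow> (0 + 0) / p" unfolding K_def
        using p by (intro tendsto_divide tendsto_add tendsto_const measure_LIMSEQ_0 finite_mu sets_mu fg that) auto
      then show ?thesis by simp
    qed
    fix A :: "'a set" assume A: "A \<in> sets borel"
    have "0 \<le> p * (\<Gamma> f g A + Q A (\<lambda>x. f x - g x) / p)"
    proof -
      have "0 \<le> Q A f" by simp
      then have "0 \<le> p * \<Gamma> f g A + Q A (\<lambda>x. f x - g x)" using b[OF A] by linarith
      then show ?thesis using p by (simp add: distrib_left)
    qed
    then show "0 \<le> \<Gamma> f g A + Q A (\<lambda>x. f x - g x) / p" using p by (simp add: zero_le_mult_iff)
    have "p * (\<Gamma> f g A + Q A (\<lambda>x. f x - g x) / p) \<le> p * K A"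
    proof -
      have "0 \<le> Q A f" by simp
      then have "p * \<Gamma> f g A + Q A (\<lambda>x. f x - g x) \<le> Q A (\<lambda>x. f x + g x) + Q A (\<lambda>x. f x - g x)" using b[OF A] by linarith
      then show ?thesis using p by (simp add: distrib_left[of p "\<Gamma> f g A"] K_def)
    qed
    then show "\<Gamma> f g A + Q A (\<lambda>x. f x - g x) / p \<le> K A" using p by simp
    show "\<Gamma> f g (A \<union> B) + Q (A \<union> B) (\<lambda>x. f x - g x) / p = \<Gamma> f g A + Q A (\<lambda>x. f x - g x) / p + (\<Gamma> f g B + Q B (\<lambda>x. f x - g x) / p)"
      if "B \<in> sets borel" "A \<inter> B = {}" for B
      using mutual_Un[OF f g A that] Q_Un[OF fg(2) A that] by (simp add: add_divide_distrib)
  qed blast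
  define S where "S = scale_measure (ennreal (1 / p)) (\<mu> (\<lambda>x. f x - g x))"
  have S: "sets S = sets borel" "measure S A = Q A (\<lambda>x. f x - g x) / p" for A
    using sets_mu[OF fg(2)] p by (simp_all add: S_def measure_def enn2real_mult)
  have "finite_measure S"
    unfolding S_def using finite_mu[OF fg(2)]
    by (intro finite_measureI) (simp add: space_scale_measure finite_measure.emeasure_eq_measure ennreal_mult_eq_top_iff)
  then show ?thesis unfolding jordan_measure_def using P S by (intro exI[of _ P] exI[of _ S]) auto
qed

text \<open>Difference quotients at a fixed step converge, and by convexity they bound the
  derivatives from above and, for negative steps, from below; differentiability of the limit closes
  the bracket.\<close>

lemma mutual_LIMSEQ:
  assumes f: "\<And>n. f n \<in> \<F>" "f' \<in> \<F>" and g: "\<And>n. g n \<in> \<F>" "g' \<in> \<F>" and A: "A \<in> sets borel"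
    and lim: "(\<lambda>n. N (\<lambda>x. f n x - f' x)) \<longlonglongrightarrow> 0" "(\<lambda>n. N (\<lambda>x. g n x - g' x)) \<longlonglongrightarrow> 0"
  shows "(\<lambda>n. \<Gamma> (f n) (g n) A) \<longlonglongrightarrow> \<Gamma> f' g' A"
proof -
  have Ql: "(\<lambda>n. Q A (\<lambda>x. f n x + t * g n x)) \<longlonglongrightarrow> Q A (\<lambda>x. f' x + t * g' x)" for t
  proof (rule Q_LIMSEQ[OF _ _ A])
    show "(\<lambda>x. f n x + t * g n x) \<in> \<F>" "(\<lambda>x. f' x + t * g' x) \<in> \<F>" for n by (intro F_closed f g)+
    have b: "N (\<lambda>x. (f n x + t * g n x) - (f' x + t * g' x)) \<le> N (\<lambda>x. f n x - f' x) + \<bar>t\<bar> * N (\<lambda>x. g n x - g' x)" for n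
    proof -
      have "N (\<lambda>x. (f n x - f' x) + t * (g n x - g' x)) \<le> N (\<lambda>x. f n x - f' x) + N (\<lambda>x. t * (g n x - g' x))"
        by (intro N_add F_closed f g)
      also have "N (\<lambda>x. t * (g n x - g' x)) = \<bar>t\<bar> * N (\<lambda>x. g n x - g' x)" by (intro N_scale F_closed g)
      also have "(\<lambda>x. (f n x - f' x) + t * (g n x - g' x)) = (\<lambda>x. (f n x + t * g n x) - (f' x + t * g' x))"
        by (simp add: fun_eq_iff algebra_simps)
      finally show ?thesis .
    qed
    have "(\<lambda>n. N (\<lambda>x. f n x - f' x) + \<bar>t\<bar> * N (\<lambda>x. g n x - g' x)) \<longlonglongrightarrow> 0 + \<bar>t\<bar> * 0" by (intro tendsto_intros lim)
    then have l: "(\<lambda>n. N (\<lambda>x. f n x - f' x) + \<bar>t\<bar> * N (\<lambda>x. g n x - g' x)) \<longlonglongrightarrow> 0" by simp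
    show "(\<lambda>n. N (\<lambda>x. (f n x + t * g n x) - (f' x + t * g' x))) \<longlonglongrightarrow> 0"
      by (rule tendsto_sandwich[OF _ _ tendsto_const l]) (use b N_nonneg in auto)
  qed
  define t where "t n = 1 / real (Suc n)" for n
  have t: "t n > 0" "t \<longlonglongrightarrow> 0" "- t n \<noteq> 0" "(\<lambda>n. - t n) \<longlonglongrightarrow> 0" for n
    using LIMSEQ_const_over_Suc[of 1] tendsto_minus[OF LIMSEQ_const_over_Suc[of 1]] by (auto simp: t_def[abs_def])
  have Q0: "(\<lambda>n. Q A (f n)) \<longlonglongrightarrow> Q A f'" using Ql[of 0] by simp
  note D = mutual_DERIV[OF f(2) g(2) A]
  have "(\<lambda>n. p * \<Gamma> (f n) (g n) A) \<longlonglongrightarrow> p * \<Gamma> f' g' A"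
  proof (rule order_tendstoI)
    fix a assume a: "p * \<Gamma> f' g' A < a"
    have "\<forall>\<^sub>F k in sequentially. (Q A (\<lambda>x. f' x + t k * g' x) - Q A f') / t k < a"
      using order_tendstoD(2)[OF DERIV_0_LIMSEQ[OF D t(2)] a] t(1) by (simp add: less_imp_neq[symmetric])
    then obtain k where k: "(Q A (\<lambda>x. f' x + t k * g' x) - Q A f') / t k < a" by (auto simp: eventually_sequentially)
    have "(\<lambda>n. (Q A (\<lambda>x. f n x + t k * g n x) - Q A (f n)) / t k) \<longlonglongrightarrow> (Q A (\<lambda>x. f' x + t k * g' x) - Q A f') / t k"
      using t(1)[of k] by (intro tendsto_divide tendsto_diff Ql Q0 tendsto_const) auto
    from order_tendstoD(2)[OF this k] show "\<forall>\<^sub>F n in sequentially. p * \<Gamma> (f n) (g n) A < a"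
      by eventually_elim (use mutual_le[OF f(1) g(1) A t(1)[of k]] in \<open>auto intro: le_less_trans\<close>)
  next
    fix a assume a: "a < p * \<Gamma> f' g' A"
    have "\<forall>\<^sub>F k in sequentially. a < (Q A (\<lambda>x. f' x + - t k * g' x) - Q A (\<lambda>x. f' x + 0 * g' x)) / (- t k)"
      by (rule order_tendstoD(1)[OF DERIV_0_LIMSEQ[OF D t(4) t(3)] a])
    then obtain k where "a < (Q A (\<lambda>x. f' x + - t k * g' x) - Q A (\<lambda>x. f' x + 0 * g' x)) / (- t k)" by (auto simp: eventually_sequentially)
    then have k: "a < (Q A f' - Q A (\<lambda>x. f' x + - t k * g' x)) / t k"
      by (simp add: minus_divide_left[symmetric] minus_divide_right[symmetric] diff_divide_distrib)
    have "(\<lambda>n. (Q A (f n) - Q A (\<lambda>x. f n x + - t k * g n x)) / t k) \<longlonglongrightarrow> (Q A f' - Q A (\<lambda>x. f' x + - t k * g' x)) / t k"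
      using t(1)[of k] by (intro tendsto_divide tendsto_diff Ql Q0 tendsto_const) auto
    from order_tendstoD(1)[OF this k] show "\<forall>\<^sub>F n in sequentially. a < p * \<Gamma> (f n) (g n) A"
      by eventually_elim (use mutual_ge[OF f(1) g(1) A t(1)[of k]] in \<open>auto intro: less_le_trans\<close>)
  qed
  from tendsto_mult[OF tendsto_const[of "1 / p"] this] show ?thesis using p by simp
qed

end

section \<open>The chain rule\<close>

text \<open>Break points are locally finite, so each point has a punctured neighbourhood free of
  them, and countable, so \<open>deriv0 \<phi>\<close> differs from a measurable function only on a
  countable set.\<close>

lemma piecewise_C1_one_sided:
  assumes "piecewise_C1 \<phi>"
  shows "\<exists>l. (deriv \<phi> \<longlongrightarrow> l) (at_left x)" "\<exists>r. (deriv \<phi> \<longlongrightarrow> r) (at_right x)"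
    and "\<forall>\<^sub>F t in at x. \<phi> field_differentiable (at t)"
    and "deriv0 \<phi> \<in> borel_measurable borel"
proof -
  obtain S where fin: "\<And>a b. finite (S \<inter> {a..b})" and C1: "\<phi> C1_differentiable_on (- S)"
    and S: "\<And>s. s \<in> S \<Longrightarrow> \<exists>l. (deriv \<phi> \<longlongrightarrow> l) (at_left s)" "\<And>s. s \<in> S \<Longrightarrow> \<exists>r. (deriv \<phi> \<longlongrightarrow> r) (at_right s)"
    using assms unfolding piecewise_C1_def by blast
  have out: "\<forall>\<^sub>F t in at y. t \<notin> S" for y
  proof -
    have "\<not> y islimpt (S \<inter> {y - 1..y + 1})" by (rule islimpt_finite[OF fin])
    then have "\<forall>\<^sub>F t in at y. t \<notin> S \<inter> {y - 1..y + 1}" by (simp add: islimpt_iff_eventually)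
    moreover have "\<forall>\<^sub>F t in at y. t \<in> {y - 1<..<y + 1}" by (intro eventually_at_in_open') auto
    ultimately show ?thesis by eventually_elim auto
  qed
  have df: "\<phi> field_differentiable (at t)" if "t \<notin> S" for t
    using C1 that unfolding C1_differentiable_on_eq real_differentiable_def field_differentiable_def by auto
  have "vector_derivative \<phi> (at t) = deriv \<phi> t" if "t \<notin> S" for t
    using field_derivative_eq_vector_derivative[of \<phi> t] by simp
  then have cont: "continuous_on (- S) (deriv \<phi>)"
    using C1 unfolding C1_differentiable_on_eq by (elim conjE continuous_on_eq) simp
  have lim: "(deriv \<phi> \<longlongrightarrow> deriv \<phi> y) (at y)" if "y \<notin> S" for y
  proof -
    have "(deriv \<phi> \<longlongrightarrow> deriv \<phi> y) (at y within - S)" using cont that by (auto simp: continuous_on_def)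
    moreover have "\<forall>\<^sub>F t in at y. t \<in> - S \<longleftrightarrow> t \<in> UNIV" using out[of y] by simp
    ultimately show ?thesis by (subst (asm) Lim_transform_within_set_eq) auto
  qed
  show "\<exists>l. (deriv \<phi> \<longlongrightarrow> l) (at_left x)" "\<exists>r. (deriv \<phi> \<longlongrightarrow> r) (at_right x)"
    using S[of x] lim[of x] by (auto simp: filterlim_at_split)
  show "\<forall>\<^sub>F t in at x. \<phi> field_differentiable (at t)" using out[of x] by eventually_elim (rule df)
  have Seq: "S = (\<Union>n::nat. S \<inter> {- real n..real n})"
  proof (intro equalityI subsetI)
    fix s assume "s \<in> S"
    moreover obtain n where "\<bar>s\<bar> \<le> real n" using real_arch_simple by blast
    ultimately have "s \<in> S \<inter> {- real n..real n}" by auto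
    then show "s \<in> (\<Union>n::nat. S \<inter> {- real n..real n})" by blast
  qed auto
  have cS: "countable S"
    by (subst Seq) (rule countable_UN[OF countableI_type countable_finite[OF fin]])
  then have "S \<in> sets borel" by (rule sets.countable[rotated]) simp
  then have Sb: "- S \<in> sets borel" by (rule borel_comp)
  show "deriv0 \<phi> \<in> borel_measurable borel"
    by (rule measurable_discrete_difference[OF borel_measurable_continuous_on_indicator[OF Sb cont] cS])
      (auto simp: deriv0_def df)
qed

lemma lipschitz_on_derivative_bound:
  fixes h :: "real \<Rightarrow> real"
  assumes cont: "continuous_on {a..b} h" and d: "\<And>t. a < t \<Longrightarrow> t < b \<Longrightarrow> \<exists>h'. (h has_real_derivative h') (at t) \<and> \<bar>h'\<bar> \<le> L"
    and L: "0 \<le> L"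
  shows "L-lipschitz_on {a..b} h"
proof -
  have "dist (h t) (h s) \<le> L * dist t s" if st: "s \<in> {a..b}" "t \<in> {a..b}" "s < t" for s t
  proof -
    have "\<exists>l z. s < z \<and> z < t \<and> (h has_real_derivative l) (at z) \<and> h t - h s = (t - s) * l"
    proof (rule MVT[OF st(3)])
      show "continuous_on {s..t} h" by (rule continuous_on_subset[OF cont]) (use st in auto)
      show "h differentiable at z" if "s < z" "z < t" for z
        using d[of z] that st by (auto simp: real_differentiable_def)
    qed
    then obtain l z where z: "s < z" "z < t" "(h has_real_derivative l) (at z)" "h t - h s = (t - s) * l" by blast
    obtain h' where "(h has_real_derivative h') (at z)" "\<bar>h'\<bar> \<le> L" using d[of z] z st by auto
    then have "\<bar>l\<bar> \<le> L" using DERIV_unique z(3) by metis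
    then show ?thesis using st(3) z(4) by (simp add: dist_real_def abs_mult mult.commute mult_left_mono)
  qed
  note w = this
  show ?thesis
  proof (rule lipschitz_onI[OF _ L])
    fix s t assume "s \<in> {a..b}" "t \<in> {a..b}"
    then show "dist (h s) (h t) \<le> L * dist s t"
      using w[of s t] w[of t s] by (cases s t rule: linorder_cases) (auto simp: dist_commute)
  qed
qed

text \<open>The finite set \<open>Nd\<close> holds the break points of \<open>\<psi>\<close>. Energy measures do not charge level sets, so it is harmless.\<close>

definition affine_approximable :: "(real \<Rightarrow> real) \<Rightarrow> real \<Rightarrow> real \<Rightarrow> real \<Rightarrow> bool" where
  "affine_approximable \<phi> \<epsilon> a b \<longleftrightarrow> (\<exists>\<psi> Sl Nd L. finite Sl \<and> finite Nd \<and>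
     (\<forall>t\<in>{a..b}. t \<notin> Nd \<longrightarrow> (\<exists>(s, c)\<in>Sl. \<psi> t = s * t + c \<and> \<bar>deriv0 \<phi> t - s\<bar> \<le> \<epsilon>)) \<and>
     \<epsilon>-lipschitz_on {a..b} (\<lambda>t. \<phi> t - \<psi> t) \<and> L-lipschitz_on {a..b} \<phi> \<and> (\<forall>t\<in>{a..b}. \<bar>deriv0 \<phi> t\<bar> \<le> L))"

text \<open>The second approximant is shifted by a constant to match at \<open>b\<close>; the
  Lipschitz errors then concatenate without loss.\<close>

lemma affine_approximable_trans:
  assumes 1: "affine_approximable \<phi> \<epsilon> a b" and 2: "affine_approximable \<phi> \<epsilon> b c" and abc: "a \<le> b" "b \<le> c"
  shows "affine_approximable \<phi> \<epsilon> a c"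
proof -
  obtain \<psi>1 Sl1 Nd1 L1 where A: "finite Sl1" "finite Nd1"
    "\<And>t. t \<in> {a..b} \<Longrightarrow> t \<notin> Nd1 \<Longrightarrow> \<exists>(s, c)\<in>Sl1. \<psi>1 t = s * t + c \<and> \<bar>deriv0 \<phi> t - s\<bar> \<le> \<epsilon>"
    "\<epsilon>-lipschitz_on {a..b} (\<lambda>t. \<phi> t - \<psi>1 t)" "L1-lipschitz_on {a..b} \<phi>" "\<And>t. t \<in> {a..b} \<Longrightarrow> \<bar>deriv0 \<phi> t\<bar> \<le> L1"
    using 1 unfolding affine_approximable_def by blast
  obtain \<psi>2 Sl2 Nd2 L2 where B: "finite Sl2" "finite Nd2"
    "\<And>t. t \<in> {b..c} \<Longrightarrow> t \<notin> Nd2 \<Longrightarrow> \<exists>(s, c)\<in>Sl2. \<psi>2 t = s * t + c \<and> \<bar>deriv0 \<phi> t - s\<bar> \<le> \<epsilon>"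
    "\<epsilon>-lipschitz_on {b..c} (\<lambda>t. \<phi> t - \<psi>2 t)" "L2-lipschitz_on {b..c} \<phi>" "\<And>t. t \<in> {b..c} \<Longrightarrow> \<bar>deriv0 \<phi> t\<bar> \<le> L2"
    using 2 unfolding affine_approximable_def by blast
  define k where "k = \<psi>1 b - \<psi>2 b"
  define \<psi> where "\<psi> t = (if t \<le> b then \<psi>1 t else \<psi>2 t + k)" for t
  define Sl where "Sl = Sl1 \<union> (\<lambda>(s, c). (s, c + k)) ` Sl2"
  have "\<exists>(s, c)\<in>Sl. \<psi> t = s * t + c \<and> \<bar>deriv0 \<phi> t - s\<bar> \<le> \<epsilon>" if t: "t \<in> {a..c}" "t \<notin> Nd1 \<union> Nd2" for t
  proof (cases "t \<le> b")
    case True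
    then show ?thesis using A(3)[of t] t by (fastforce simp: Sl_def \<psi>_def)
  next
    case False
    then obtain s d where "(s, d) \<in> Sl2" "\<psi>2 t = s * t + d" "\<bar>deriv0 \<phi> t - s\<bar> \<le> \<epsilon>" using B(3)[of t] t by auto
    then show ?thesis using False by (intro bexI[of _ "(s, d + k)"]) (auto simp: Sl_def \<psi>_def image_iff)
  qed
  moreover have "\<epsilon>-lipschitz_on {a..c} (\<lambda>t. \<phi> t - \<psi> t)"
  proof -
    have B4: "\<epsilon>-lipschitz_on {b..c} (\<lambda>t. \<phi> t - (\<psi>2 t + k))"
      using B(4) by (simp add: lipschitz_on_def dist_real_def algebra_simps)
    have eq: "(\<lambda>t. \<phi> t - \<psi> t) = (\<lambda>t. if t \<le> b then \<phi> t - \<psi>1 t else \<phi> t - (\<psi>2 t + k))"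
      by (simp add: fun_eq_iff \<psi>_def)
    show ?thesis unfolding eq by (rule lipschitz_on_concat[OF A(4) B4]) (simp add: k_def)
  qed
  moreover have "(max L1 L2)-lipschitz_on {a..c} \<phi>"
  proof -
    have "(max L1 L2)-lipschitz_on {a..c} (\<lambda>t. if t \<le> b then \<phi> t else \<phi> t)"
      by (rule lipschitz_on_concat) (auto intro: lipschitz_on_le[OF A(5)] lipschitz_on_le[OF B(5)])
    then show ?thesis by simp
  qed
  moreover have "\<bar>deriv0 \<phi> t\<bar> \<le> max L1 L2" if "t \<in> {a..c}" for t
    using A(6)[of t] B(6)[of t] that by (cases "t \<le> b") (auto simp: le_max_iff_disj)
  moreover have "finite Sl" "finite (Nd1 \<union> Nd2)" using A(1,2) B(1,2) by (auto simp: Sl_def)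
  ultimately show ?thesis unfolding affine_approximable_def by blast
qed

text \<open>While the derivative stays near \<open>s\<close>, one line of slope \<open>s\<close>
  suffices. The end points, where the derivative is not controlled, become exceptional.\<close>

lemma affine_approximable_piece:
  assumes cont: "continuous_on UNIV \<phi>" and \<epsilon>: "0 < \<epsilon>"
    and d: "\<And>t. a < t \<Longrightarrow> t < b \<Longrightarrow> \<phi> field_differentiable (at t) \<and> \<bar>deriv \<phi> t - s\<bar> \<le> \<epsilon>"
  shows "affine_approximable \<phi> \<epsilon> a b"
proof -
  define L where "L = max (\<bar>s\<bar> + \<epsilon>) (max \<bar>deriv0 \<phi> a\<bar> \<bar>deriv0 \<phi> b\<bar>)"
  have D: "(\<phi> has_real_derivative deriv \<phi> t) (at t)" "deriv0 \<phi> t = deriv \<phi> t" "\<bar>deriv \<phi> t - s\<bar> \<le> \<epsilon>" "\<bar>deriv \<phi> t\<bar> \<le> L"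
    if "a < t" "t < b" for t
    using d[OF that] DERIV_deriv_iff_field_differentiable by (auto simp: deriv0_def L_def)
  have "\<epsilon>-lipschitz_on {a..b} (\<lambda>t. \<phi> t - s * t)"
  proof (rule lipschitz_on_derivative_bound)
    show "continuous_on {a..b} (\<lambda>t. \<phi> t - s * t)" by (intro continuous_intros continuous_on_subset[OF cont]) auto
    fix t assume t: "a < t" "t < b"
    have "((\<lambda>t. \<phi> t - s * t) has_real_derivative deriv \<phi> t - s) (at t)" using D(1)[OF t] by (auto intro!: derivative_eq_intros)
    then show "\<exists>h'. ((\<lambda>t. \<phi> t - s * t) has_real_derivative h') (at t) \<and> \<bar>h'\<bar> \<le> \<epsilon>" using D(3)[OF t] by blast
  qed (use \<epsilon> in simp)
  moreover have "L-lipschitz_on {a..b} \<phi>"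
  proof (rule lipschitz_on_derivative_bound)
    show "continuous_on {a..b} \<phi>" by (rule continuous_on_subset[OF cont]) auto
    show "0 \<le> L" using \<epsilon> by (simp add: L_def le_max_iff_disj)
    show "\<exists>h'. (\<phi> has_real_derivative h') (at t) \<and> \<bar>h'\<bar> \<le> L" if "a < t" "t < b" for t using D(1,4)[OF that] by blast
  qed
  moreover have "\<bar>deriv0 \<phi> t\<bar> \<le> L" if "t \<in> {a..b}" for t
  proof (cases "t = a \<or> t = b")
    case False
    then show ?thesis using D(2,4)[of t] that by auto
  qed (auto simp: L_def)
  moreover have "\<exists>(s', c)\<in>{(s, 0)}. s * t = s' * t + c \<and> \<bar>deriv0 \<phi> t - s'\<bar> \<le> \<epsilon>" if "t \<in> {a..b}" "t \<notin> {a, b}" for t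
    using D(2,3)[of t] that by auto
  ultimately show ?thesis unfolding affine_approximable_def
    by (intro exI[of _ "\<lambda>t. s * t"] exI[of _ "{(s, 0)}"] exI[of _ "{a, b}"] exI[of _ L] conjI ballI impI) auto
qed

text \<open>By bisection it is enough to treat small intervals around each point; there the two
  one-sided limits of the derivative serve as slopes.\<close>

lemma piecewise_C1_affine_approximable:
  assumes \<phi>: "piecewise_C1 \<phi>" and \<epsilon>: "0 < \<epsilon>" and ab: "a \<le> b"
  shows "affine_approximable \<phi> \<epsilon> a b"
  using ab
proof (induction rule: Bolzano)
  case (trans a b c)
  then show ?case by (rule affine_approximable_trans)
next
  case (local x)
  have cont: "continuous_on UNIV \<phi>" using \<phi> by (simp add: piecewise_C1_def)
  note pc = piecewise_C1_one_sided(1-3)[OF \<phi>, of x]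
  obtain l where l: "(deriv \<phi> \<longlongrightarrow> l) (at_left x)" using pc(1) by blast
  obtain r where r: "(deriv \<phi> \<longlongrightarrow> r) (at_right x)" using pc(2) by blast
  have fd: "\<forall>\<^sub>F t in at_left x. \<phi> field_differentiable (at t)" "\<forall>\<^sub>F t in at_right x. \<phi> field_differentiable (at t)"
    using pc(3) by (auto simp: eventually_at_split)
  have "\<forall>\<^sub>F t in at_left x. \<phi> field_differentiable (at t) \<and> \<bar>deriv \<phi> t - l\<bar> \<le> \<epsilon>"
    using fd(1) tendstoD[OF l \<epsilon>] by eventually_elim (simp add: dist_real_def)
  moreover have "\<forall>\<^sub>F t in at_right x. \<phi> field_differentiable (at t) \<and> \<bar>deriv \<phi> t - r\<bar> \<le> \<epsilon>"
    using fd(2) tendstoD[OF r \<epsilon>] by eventually_elim (simp add: dist_real_def)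
  ultimately obtain \<alpha> \<beta> where \<alpha>: "\<alpha> < x" "\<And>t. \<alpha> < t \<Longrightarrow> t < x \<Longrightarrow> \<phi> field_differentiable (at t) \<and> \<bar>deriv \<phi> t - l\<bar> \<le> \<epsilon>"
    and \<beta>: "x < \<beta>" "\<And>t. x < t \<Longrightarrow> t < \<beta> \<Longrightarrow> \<phi> field_differentiable (at t) \<and> \<bar>deriv \<phi> t - r\<bar> \<le> \<epsilon>"
    unfolding eventually_at_left_field eventually_at_right_field by blast
  show ?case
  proof (intro exI[of _ "min (x - \<alpha>) (\<beta> - x)"] conjI allI impI)
    show "0 < min (x - \<alpha>) (\<beta> - x)" using \<alpha>(1) \<beta>(1) by simp
    fix a b assume ab: "a \<le> x \<and> x \<le> b \<and> b - a < min (x - \<alpha>) (\<beta> - x)"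
    show "affine_approximable \<phi> \<epsilon> a b"
    proof (rule affine_approximable_trans)
      show "affine_approximable \<phi> \<epsilon> a x" by (rule affine_approximable_piece[OF cont \<epsilon>, where s = l]) (use ab \<alpha>(2) in auto)
      show "affine_approximable \<phi> \<epsilon> x b" by (rule affine_approximable_piece[OF cont \<epsilon>, where s = r]) (use ab \<beta>(2) in auto)
    qed (use ab in auto)
  qed
qed

lemma piecewise_C1_bounds:
  assumes \<phi>: "piecewise_C1 \<phi>"
  obtains L where "L-lipschitz_on {- M..M} \<phi>" "\<And>t. \<bar>t\<bar> \<le> M \<Longrightarrow> \<bar>deriv0 \<phi> t\<bar> \<le> L"
proof -
  have "\<exists>L. L-lipschitz_on {- M..M} \<phi> \<and> (\<forall>t\<in>{- M..M}. \<bar>deriv0 \<phi> t\<bar> \<le> L)"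
  proof (cases "0 \<le> M")
    case True
    then have "affine_approximable \<phi> 1 (- M) M" by (intro piecewise_C1_affine_approximable[OF \<phi>]) auto
    then show ?thesis unfolding affine_approximable_def by blast
  qed (auto intro!: exI[of _ 0] simp: lipschitz_on_def)
  then show ?thesis using that by (auto simp: abs_le_iff)
qed

text \<open>Normalised at \<open>0\<close>, so that \<phi> and its approximant differ by a Lipschitz
  function vanishing at \<open>0\<close>, to which \<open>C_lipschitz\<close> applies.\<close>

lemma piecewise_C1_approx:
  assumes \<phi>: "piecewise_C1 \<phi>" and \<epsilon>: "0 < \<epsilon>" and M: "0 \<le> M"
  shows "\<exists>\<psi> Sl Nd. finite Sl \<and> finite Nd \<and> \<psi> 0 = \<phi> 0 \<and> \<epsilon>-lipschitz_on {- M..M} (\<lambda>t. \<phi> t - \<psi> t) \<and>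
    (\<forall>t. \<bar>t\<bar> \<le> M \<longrightarrow> t \<notin> Nd \<longrightarrow> (\<exists>(s, c)\<in>Sl. \<psi> t = s * t + c \<and> \<bar>deriv0 \<phi> t - s\<bar> \<le> \<epsilon>))"
proof -
  have "affine_approximable \<phi> \<epsilon> (- M) M" using M by (intro piecewise_C1_affine_approximable[OF \<phi> \<epsilon>]) auto
  then obtain \<psi> Sl Nd where A: "finite Sl" "finite Nd"
    "\<And>t. t \<in> {- M..M} \<Longrightarrow> t \<notin> Nd \<Longrightarrow> \<exists>(s, c)\<in>Sl. \<psi> t = s * t + c \<and> \<bar>deriv0 \<phi> t - s\<bar> \<le> \<epsilon>"
    "\<epsilon>-lipschitz_on {- M..M} (\<lambda>t. \<phi> t - \<psi> t)"
    unfolding affine_approximable_def by blast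
  define k where "k = \<phi> 0 - \<psi> 0"
  show ?thesis
  proof (intro exI[of _ "\<lambda>t. \<psi> t + k"] exI[of _ "(\<lambda>(s, c). (s, c + k)) ` Sl"] exI[of _ Nd] conjI allI impI)
    show "\<epsilon>-lipschitz_on {- M..M} (\<lambda>t. \<phi> t - (\<psi> t + k))" using A(4) by (simp add: lipschitz_on_def dist_real_def algebra_simps)
    fix t assume "\<bar>t\<bar> \<le> M" "t \<notin> Nd"
    then obtain s c where "(s, c) \<in> Sl" "\<psi> t = s * t + c" "\<bar>deriv0 \<phi> t - s\<bar> \<le> \<epsilon>" using A(3)[of t] by (auto simp: abs_le_iff)
    then show "\<exists>(s, c)\<in>(\<lambda>(s, c). (s, c + k)) ` Sl. \<psi> t + k = s * t + c \<and> \<bar>deriv0 \<phi> t - s\<bar> \<le> \<epsilon>"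
      by (intro bexI[of _ "(s, c + k)"] image_eqI[of _ _ "(s, c)"]) auto
  qed (use A in \<open>auto simp: k_def\<close>)
qed

text \<open>The density in the chain rule as a function of the two slopes, with q = p - 1.\<close>

definition power_slope :: "real \<Rightarrow> real \<Rightarrow> real \<Rightarrow> real" where
  "power_slope q a b = sgn a * \<bar>a\<bar> powr q * b"

lemma continuous_power_slope:
  assumes "0 < q" shows "continuous_on UNIV (\<lambda>z. power_slope q (fst z) (snd z))"
proof -
  have eq: "(\<lambda>z. power_slope q (fst z) (snd z)) = (\<lambda>z. (max (fst z) 0 powr q - max (- fst z) 0 powr q) * snd z)"
    by (auto simp: fun_eq_iff power_slope_def sgn_if max_def)
  show ?thesis unfolding eq using assms by (intro continuous_intros continuous_on_powr') auto
qed

text \<open>Uniform continuity on a box, enlarged by \<open>1\<close> so that it also contains the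
  perturbed slopes.\<close>

lemma power_slope_uniform:
  assumes q: "0 < q" and \<eta>: "0 < \<eta>"
  obtains \<epsilon> where "0 < \<epsilon>" "\<epsilon> \<le> 1"
    "\<And>a b s t. \<bar>a\<bar> \<le> L \<Longrightarrow> \<bar>b\<bar> \<le> L \<Longrightarrow> \<bar>a - s\<bar> \<le> \<epsilon> \<Longrightarrow> \<bar>b - t\<bar> \<le> \<epsilon> \<Longrightarrow> \<bar>power_slope q a b - power_slope q s t\<bar> \<le> \<eta>"
proof -
  let ?K = "{- L - 1..L + 1} \<times> {- L - 1..L + 1}"
  have "uniformly_continuous_on ?K (\<lambda>z. power_slope q (fst z) (snd z))"
    by (intro compact_uniformly_continuous continuous_on_subset[OF continuous_power_slope[OF q]] compact_Times) auto
  from uniformly_continuous_onE[OF this \<eta>] obtain d where d: "d > 0"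
    "\<And>y z. y \<in> ?K \<Longrightarrow> z \<in> ?K \<Longrightarrow> dist z y < d \<Longrightarrow> dist (power_slope q (fst z) (snd z)) (power_slope q (fst y) (snd y)) < \<eta>" by blast
  show ?thesis
  proof (rule that[of "min 1 (d / 3)"])
    fix a b s t assume h: "\<bar>a\<bar> \<le> L" "\<bar>b\<bar> \<le> L" "\<bar>a - s\<bar> \<le> min 1 (d / 3)" "\<bar>b - t\<bar> \<le> min 1 (d / 3)"
    have "dist (a, b) (s, t) \<le> \<bar>a - s\<bar> + \<bar>b - t\<bar>" by (simp add: dist_prod_def dist_real_def sqrt_sum_squares_le_sum_abs)
    also have "\<dots> < d" using h d(1) by simp
    finally show "\<bar>power_slope q a b - power_slope q s t\<bar> \<le> \<eta>"
      using d(2)[of "(s, t)" "(a, b)"] h by (auto simp: dist_real_def abs_le_iff)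
  qed (use d(1) in auto)
qed

lemma signed_integral_lincomb:
  assumes \<nu>: "jordan_measure \<nu>" and u: "u \<in> borel_measurable borel" "\<And>x. \<bar>u x\<bar> \<le> B"
    and v: "v \<in> borel_measurable borel" "\<And>x. \<bar>v x\<bar> \<le> B'" and A: "A \<in> sets borel"
  shows "signed_integral \<nu> A (\<lambda>x. a * u x + b * v x) = a * signed_integral \<nu> A u + b * signed_integral \<nu> A v"
proof -
  note jv = jordan_variations[OF \<nu>]
  have i: "set_integrable M A w" if "integrable M w" "sets M = sets borel" for M and w :: "'a \<Rightarrow> real"
    using that A unfolding set_integrable_def by (intro integrable_mult_indicator) auto
  have "(LINT x:A|M. a * u x + b * v x) = a * (LINT x:A|M. u x) + b * (LINT x:A|M. v x)"
    if "integrable M u" "integrable M v" "sets M = sets borel" for M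
  proof -
    have "set_integrable M A (\<lambda>x. a * u x)" "set_integrable M A (\<lambda>x. b * v x)"
      using that by (auto intro!: i)
    from set_integral_add(2)[OF this] show ?thesis by simp
  qed
  moreover have "integrable (pos_variation \<nu>) u" "integrable (neg_variation \<nu>) u"
    "integrable (pos_variation \<nu>) v" "integrable (neg_variation \<nu>) v"
    using signed_integrable_bounded[OF \<nu> u] signed_integrable_bounded[OF \<nu> v] by (auto simp: signed_integrable_def)
  ultimately show ?thesis using jv(1,3) by (simp add: signed_integral_def algebra_simps)
qed

section \<open>Mutual energies of compositions and products\<close>

context energy_measures_space
begin

text \<open>Offsets disappear by locality, applied to \<open>u + t * v\<close> for every
  \<open>t\<close>; slopes come out by homogeneity.\<close>

lemma mutual_eq_scale:
  assumes f: "f \<in> \<C>" and u: "u \<in> \<C>" and A: "A \<in> sets borel" and eq: "\<And>x. x \<in> A \<Longrightarrow> u x = s * f x + c"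
    and g: "g \<in> \<C>" and v: "v \<in> \<C>" and eq': "\<And>x. x \<in> A \<Longrightarrow> v x = s' * g x + c'"
  shows "\<Gamma> u v A = power_slope (p - 1) s s' * \<Gamma> f g A"
proof -
  have "Q A (\<lambda>x. u x + t * v x) = Q A (\<lambda>x. s * f x + t * (s' * g x))" for t
  proof (rule Q_local[OF _ _ A])
    show "(\<lambda>x. u x + t * v x) \<in> \<C>" "(\<lambda>x. s * f x + t * (s' * g x)) \<in> \<C>" by (intro C_closed f g u v)+
    show "u x + t * v x - (s * f x + t * (s' * g x)) = c + t * c'" if "x \<in> A" for x
      using eq[OF that] eq'[OF that] by (simp add: algebra_simps)
  qed
  then have "\<Gamma> u v A = \<Gamma> (\<lambda>x. s * f x) (\<lambda>x. s' * g x) A" by (simp add: mutual_energy_def)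
  also have "\<dots> = power_slope (p - 1) s s' * \<Gamma> f g A"
    unfolding power_slope_def using mutual_scale[OF _ _ A] f g by blast
  finally show ?thesis .
qed

lemma Q_const:
  assumes f: "f \<in> \<C>" and A: "A \<in> sets borel" and eq: "\<And>x. x \<in> A \<Longrightarrow> f x = c"
  shows "Q A f = 0"
proof -
  have "Q A f = Q A (\<lambda>x. 0)" by (rule Q_local[OF f C_zero A]) (simp add: eq)
  also have "\<dots> = 0" using Q_scale[OF F_closed(1) A, of 0] by simp
  finally show ?thesis .
qed

text \<open>
  Cut \<open>A\<close> into finitely many pieces on which both functions are affine in \<open>f\<close> and \<open>g\<close>; there the
  chain rule holds by locality and homogeneity, and \<open>w\<close> is almost constant.
\<close>

lemma mutual_approx:
  assumes f: "f \<in> \<C>" "(\<lambda>x. \<alpha> (f x)) \<in> \<C>" and g: "g \<in> \<C>" "(\<lambda>x. \<beta> (g x)) \<in> \<C>"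
    and w: "w \<in> borel_measurable borel" "\<And>x. \<bar>w x\<bar> \<le> B"
    and fin: "finite S1" "finite S2" "finite N1" "finite N2"
    and cover: "\<And>x. f x \<notin> N1 \<Longrightarrow> g x \<notin> N2 \<Longrightarrow> \<exists>(s, c)\<in>S1. \<exists>(s', c')\<in>S2.
      \<alpha> (f x) = s * f x + c \<and> \<beta> (g x) = s' * g x + c' \<and> \<bar>w x - power_slope (p - 1) s s'\<bar> \<le> \<eta>"
    and A: "A \<in> sets borel" and \<eta>: "0 \<le> \<eta>"
  shows "\<bar>\<Gamma> (\<lambda>x. \<alpha> (f x)) (\<lambda>x. \<beta> (g x)) A - signed_integral (\<Gamma> f g) A w\<bar> \<le> \<eta> * total_variation (\<Gamma> f g) A"
proof -
  let ?u = "\<lambda>x. \<alpha> (f x)" and ?v = "\<lambda>x. \<beta> (g x)"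
  have F: "f \<in> \<F>" "?u \<in> \<F>" "g \<in> \<F>" "?v \<in> \<F>" using f g by auto
  note J = jordan_mutual[OF F(1,3)]
  have [measurable]: "f \<in> borel_measurable borel" "?u \<in> borel_measurable borel"
    "g \<in> borel_measurable borel" "?v \<in> borel_measurable borel"
    by (intro borel_measurable_continuous_onI C_continuous f g)+
  note [measurable] = w(1)
  \<comment> \<open>On a cell both approximants have fixed slopes and \<open>w\<close> is within
    \<eta> of the corresponding density. Together with the level sets of exceptional values the
    cells cover the space.\<close>
  define cell where "cell = (\<lambda>(s, c) (s', c'). {x. \<alpha> (f x) = s * f x + c \<and> \<beta> (g x) = s' * g x + c' \<and> \<bar>w x - power_slope (p - 1) s s'\<bar> \<le> \<eta>})"
  define FF where "FF = (\<lambda>(z, z'). cell z z') ` (S1 \<times> S2) \<union> (\<lambda>c. {x. f x = c}) ` N1 \<union> (\<lambda>c. {x. g x = c}) ` N2"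
  have FFf: "finite FF" using fin by (simp add: FF_def)
  have cellb: "cell z z' \<in> sets borel" for z z'
  proof -
    have "{x \<in> space borel. \<alpha> (f x) = fst z * f x + snd z \<and> \<beta> (g x) = fst z' * g x + snd z' \<and>
        \<bar>w x - power_slope (p - 1) (fst z) (fst z')\<bar> \<le> \<eta>} \<in> sets borel" by measurable
    then show ?thesis by (simp add: cell_def split_beta)
  qed
  have nb: "{x. f x = c} \<in> sets borel" "{x. g x = c} \<in> sets borel" for c
  proof -
    have "{x \<in> space borel. f x = c} \<in> sets borel" "{x \<in> space borel. g x = c} \<in> sets borel" by measurable
    then show "{x. f x = c} \<in> sets borel" "{x. g x = c} \<in> sets borel" by simp_all
  qed
  have FFb: "FF \<subseteq> sets borel" using cellb nb by (auto simp: FF_def)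
  have cov: "A \<subseteq> \<Union>FF"
  proof
    fix x
    show "x \<in> \<Union>FF"
    proof (cases "f x \<in> N1 \<or> g x \<in> N2")
      case False
      then obtain z z' where "z \<in> S1" "z' \<in> S2" "x \<in> cell z z'" using cover[of x] by (fastforce simp: cell_def)
      then show ?thesis by (auto simp: FF_def)
    qed (auto simp: FF_def)
  qed
  have main: "\<bar>\<Gamma> ?u ?v C - signed_integral (\<Gamma> f g) C w\<bar> \<le> \<eta> * total_variation (\<Gamma> f g) C"
    if S: "S \<in> FF" and C: "C \<in> sets borel" "C \<subseteq> S" for S C
  proof -
    \<comment> \<open>For exceptional values: on a level set of \<open>f\<close> or of
      \<open>g\<close> one argument is null, so both sides vanish.\<close>
    have null: ?thesis if z: "\<And>D. D \<in> sets borel \<Longrightarrow> D \<subseteq> C \<Longrightarrow> (Q D f = 0 \<and> Q D ?u = 0) \<or> (Q D g = 0 \<and> Q D ?v = 0)"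
    proof -
      have "\<Gamma> ?u ?v C = 0" using z[OF C(1) subset_refl] by (intro mutual_null F C) auto
      moreover have "signed_integral (\<Gamma> f g) C w = 0"
        by (rule signed_integral_null[OF J w C(1)], rule mutual_null[OF F(1,3)]) (use z in auto)
      ultimately show ?thesis using \<eta> total_variation_nonneg[of "\<Gamma> f g" C] by simp
    qed
    consider (cell) z z' where "S = cell z z'" | (f) c where "S = {x. f x = c}" | (g) c where "S = {x. g x = c}"
      using S by (auto simp: FF_def)
    then show ?thesis
    proof cases
      case cell
      obtain s c s' c' where z: "z = (s, c)" "z' = (s', c')" by (cases z, cases z')
      have sub: "\<alpha> (f x) = s * f x + c" "\<beta> (g x) = s' * g x + c'" "\<bar>w x - power_slope (p - 1) s s'\<bar> \<le> \<eta>" if "x \<in> C" for x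
        using that C(2) by (auto simp: cell z cell_def)
      have "\<Gamma> ?u ?v C = power_slope (p - 1) s s' * \<Gamma> f g C" by (rule mutual_eq_scale[OF f C(1) sub(1) g sub(2)])
      then show ?thesis using signed_integral_close[OF J w C(1) sub(3)] by (simp add: abs_minus_commute)
    next
      case (f c)
      show ?thesis
      proof (rule null)
        fix D assume D: "D \<in> sets borel" "D \<subseteq> C"
        then have "f x = c" if "x \<in> D" for x using that C(2) f by auto
        then have "Q D f = 0" "Q D ?u = 0" using Q_const[OF assms(1) D(1), of c] Q_const[OF assms(2) D(1), of "\<alpha> c"] by auto
        then show "(Q D f = 0 \<and> Q D ?u = 0) \<or> (Q D g = 0 \<and> Q D ?v = 0)" by simp
      qed
    next
      case (g c)
      show ?thesis
      proof (rule null)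
        fix D assume D: "D \<in> sets borel" "D \<subseteq> C"
        then have "g x = c" if "x \<in> D" for x using that C(2) g by auto
        then have "Q D g = 0" "Q D ?v = 0" using Q_const[OF assms(3) D(1), of c] Q_const[OF assms(4) D(1), of "\<beta> c"] by auto
        then show "(Q D f = 0 \<and> Q D ?u = 0) \<or> (Q D g = 0 \<and> Q D ?v = 0)" by simp
      qed
    qed
  qed
  have b: "\<sigma> * (\<Gamma> ?u ?v A - signed_integral (\<Gamma> f g) A w) \<le> \<eta> * total_variation (\<Gamma> f g) A" if "\<sigma> \<in> {1, - 1}" for \<sigma>
  proof (rule additive_le_if_locally_le[where \<alpha>="\<lambda>A. \<sigma> * (\<Gamma> ?u ?v A - signed_integral (\<Gamma> f g) A w)"
        and \<beta>="\<lambda>A. \<eta> * total_variation (\<Gamma> f g) A", OF _ _ FFf FFb _ A cov])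
    fix C D :: "'a set" assume CD: "C \<in> sets borel" "D \<in> sets borel" "C \<inter> D = {}"
    show "\<sigma> * (\<Gamma> ?u ?v (C \<union> D) - signed_integral (\<Gamma> f g) (C \<union> D) w) =
        \<sigma> * (\<Gamma> ?u ?v C - signed_integral (\<Gamma> f g) C w) + \<sigma> * (\<Gamma> ?u ?v D - signed_integral (\<Gamma> f g) D w)"
      using mutual_Un[OF F(2,4) CD] signed_integral_Un[OF J w CD] by (simp add: algebra_simps)
    show "\<eta> * total_variation (\<Gamma> f g) (C \<union> D) = \<eta> * total_variation (\<Gamma> f g) C + \<eta> * total_variation (\<Gamma> f g) D"
      using total_variation_Un[OF J CD] by (simp add: distrib_left)
  next
    show "\<sigma> * (\<Gamma> ?u ?v C - signed_integral (\<Gamma> f g) C w) \<le> \<eta> * total_variation (\<Gamma> f g) C"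
      if "S \<in> FF" "C \<in> sets borel" "C \<subseteq> S" for S C
      using main[OF that] \<open>\<sigma> \<in> {1, - 1}\<close> by auto
  qed
  show ?thesis using b[of 1] b[of "- 1"] by (simp add: abs_le_iff)
qed

lemma piecewise_C1_comp:
  assumes f: "f \<in> \<C>" and \<phi>: "piecewise_C1 \<phi>" "\<phi> 0 = 0"
  shows "(\<lambda>x. \<phi> (f x)) \<in> \<C>"
proof -
  obtain M where M: "\<And>x. \<bar>f x\<bar> \<le> M" using C_c_bounded f by blast
  obtain L where L: "L-lipschitz_on {- M..M} \<phi>" using piecewise_C1_bounds[OF \<phi>(1), of M] by blast
  show ?thesis
    by (rule C_lipschitz(1)[where \<kappa> = \<phi> and f = f and M = M and L = L])
      (use f M \<phi>(2) lipschitz_onD[OF L] in \<open>auto simp: dist_real_def abs_le_iff\<close>)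
qed

text \<open>It is the small Lipschitz constant of the error, rather than its small size, that makes
  the energy of the difference small.\<close>

lemma piecewise_C1_comp_approx:
  assumes f: "f \<in> \<C>" and \<phi>: "piecewise_C1 \<phi>" "\<phi> 0 = 0" and \<epsilon>: "0 < \<epsilon>"
  shows "\<exists>\<psi> Sl Nd. finite Sl \<and> finite Nd \<and> (\<lambda>x. \<psi> (f x)) \<in> \<C> \<and> \<E> (\<lambda>x. \<psi> (f x) - \<phi> (f x)) \<le> \<epsilon> powr p * \<E> f \<and>
    (\<forall>x. f x \<notin> Nd \<longrightarrow> (\<exists>(s, c)\<in>Sl. \<psi> (f x) = s * f x + c \<and> \<bar>deriv0 \<phi> (f x) - s\<bar> \<le> \<epsilon>))"
proof -
  obtain M where M: "M > 0" "\<And>x. \<bar>f x\<bar> \<le> M" using C_c_bounded f by blast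
  obtain \<psi> Sl Nd where A: "finite Sl" "finite Nd" "\<psi> 0 = \<phi> 0" "\<epsilon>-lipschitz_on {- M..M} (\<lambda>t. \<phi> t - \<psi> t)"
    "\<And>t. \<bar>t\<bar> \<le> M \<Longrightarrow> t \<notin> Nd \<Longrightarrow> \<exists>(s, c)\<in>Sl. \<psi> t = s * t + c \<and> \<bar>deriv0 \<phi> t - s\<bar> \<le> \<epsilon>"
    using piecewise_C1_approx[OF \<phi>(1) \<epsilon> less_imp_le[OF M(1)]] by blast
  have d: "(\<lambda>x. \<phi> (f x) - \<psi> (f x)) \<in> \<C>" "\<E> (\<lambda>x. \<phi> (f x) - \<psi> (f x)) \<le> \<epsilon> powr p * \<E> f"
    using C_lipschitz[OF f M(2), of "\<lambda>t. \<phi> t - \<psi> t" \<epsilon>] A(3) lipschitz_onD[OF A(4)] by (auto simp: dist_real_def abs_le_iff)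
  have c: "(\<lambda>x. \<phi> (f x) - (\<phi> (f x) - \<psi> (f x))) \<in> \<C>" by (intro C_closed(3) d piecewise_C1_comp[OF f \<phi>])
  have "\<E> (\<lambda>x. \<psi> (f x) - \<phi> (f x)) = \<E> (\<lambda>x. \<phi> (f x) - \<psi> (f x))"
    using E_minus[of "\<lambda>x. \<phi> (f x) - \<psi> (f x)"] d(1) by simp
  then show ?thesis using A(1,2,5) M(2) c d(2)
    by (intro exI[of _ \<psi>] exI[of _ Sl] exI[of _ Nd]) simp
qed

text \<open>For the approximants the identity holds up to \<eta> times the total variation, with the
  weight \<open>w\<close> kept fixed. Mutual energies are continuous in the energy seminorm, so the
  bound survives the limit, and \<eta> is arbitrary.\<close>

proposition chain_rule:
  assumes f: "f \<in> \<C>" and g: "g \<in> \<C>" and \<phi>: "piecewise_C1 \<phi>" "\<phi> 0 = 0" and \<psi>: "piecewise_C1 \<psi>" "\<psi> 0 = 0"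
  defines "w \<equiv> \<lambda>x. sgn (deriv0 \<phi> (f x)) * \<bar>deriv0 \<phi> (f x)\<bar> powr (p - 1) * deriv0 \<psi> (g x)"
  shows "signed_integrable (\<Gamma> f g) w"
    and "A \<in> sets borel \<Longrightarrow> \<Gamma> (\<lambda>x. \<phi> (f x)) (\<lambda>x. \<psi> (g x)) A = signed_integral (\<Gamma> f g) A w"
proof -
  let ?u = "\<lambda>x. \<phi> (f x)" and ?v = "\<lambda>x. \<psi> (g x)"
  have q: "0 < p - 1" using p by simp
  have F: "f \<in> \<F>" "g \<in> \<F>" "?u \<in> \<F>" "?v \<in> \<F>"
    using f g piecewise_C1_comp[OF f \<phi>] piecewise_C1_comp[OF g \<psi>] by auto
  note J = jordan_mutual[OF F(1,2)]
  obtain M where M: "\<And>x. \<bar>f x\<bar> \<le> M" using C_c_bounded f by blast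
  obtain M' where M': "\<And>x. \<bar>g x\<bar> \<le> M'" using C_c_bounded g by blast
  obtain L1 where L1: "\<And>t. \<bar>t\<bar> \<le> M \<Longrightarrow> \<bar>deriv0 \<phi> t\<bar> \<le> L1" using piecewise_C1_bounds[OF \<phi>(1), of M] by blast
  obtain L2 where L2: "\<And>t. \<bar>t\<bar> \<le> M' \<Longrightarrow> \<bar>deriv0 \<psi> t\<bar> \<le> L2" using piecewise_C1_bounds[OF \<psi>(1), of M'] by blast
  define L where "L = max L1 L2"
  have L: "\<bar>deriv0 \<phi> (f x)\<bar> \<le> L" "\<bar>deriv0 \<psi> (g x)\<bar> \<le> L" for x
    using L1[OF M] L2[OF M'] by (auto simp: L_def le_max_iff_disj)
  have [measurable]: "f \<in> borel_measurable borel" "g \<in> borel_measurable borel" "deriv0 \<phi> \<in> borel_measurable borel" "deriv0 \<psi> \<in> borel_measurable borel"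
    by (intro borel_measurable_continuous_onI C_continuous f g piecewise_C1_one_sided(4) \<phi> \<psi>)+
  have w: "w \<in> borel_measurable borel" "\<bar>w x\<bar> \<le> L powr (p - 1) * L" for x
  proof -
    show "w \<in> borel_measurable borel" unfolding w_def by measurable
    have "\<bar>deriv0 \<phi> (f x)\<bar> powr (p - 1) * \<bar>deriv0 \<psi> (g x)\<bar> \<le> L powr (p - 1) * L"
      using L[of x] q by (intro mult_mono powr_mono2) auto
    then show "\<bar>w x\<bar> \<le> L powr (p - 1) * L" by (auto simp: w_def abs_mult abs_sgn_eq intro: order_trans)
  qed
  show "signed_integrable (\<Gamma> f g) w" by (rule signed_integrable_bounded[OF J w])
  assume A: "A \<in> sets borel"
  define \<epsilon> where "\<epsilon> n = 1 / real (Suc n)" for n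
  have \<epsilon>: "\<epsilon> n > 0" "\<epsilon> \<longlonglongrightarrow> 0" for n using LIMSEQ_const_over_Suc[of 1] by (auto simp: \<epsilon>_def[abs_def])
  \<comment> \<open>One predicate for all properties, so that the approximants for all
    \<open>n\<close> can be chosen at once.\<close>
  define approx where "approx h \<theta> n \<alpha> S Nd \<longleftrightarrow> finite S \<and> finite Nd \<and> (\<lambda>x. \<alpha> (h x)) \<in> \<C> \<and> \<E> (\<lambda>x. \<alpha> (h x) - \<theta> (h x)) \<le> \<epsilon> n powr p * \<E> h \<and>
      (\<forall>x. h x \<notin> Nd \<longrightarrow> (\<exists>(s, c)\<in>S. \<alpha> (h x) = s * h x + c \<and> \<bar>deriv0 \<theta> (h x) - s\<bar> \<le> \<epsilon> n))"
    for h :: "'a \<Rightarrow> real" and \<theta> :: "real \<Rightarrow> real" and n :: nat and \<alpha> :: "real \<Rightarrow> real" and S Nd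
  have ex: "\<exists>\<alpha> S Nd. approx h \<theta> n \<alpha> S Nd" if "h \<in> \<C>" "piecewise_C1 \<theta>" "\<theta> 0 = 0" for h \<theta> n
    unfolding approx_def by (rule piecewise_C1_comp_approx[OF that \<epsilon>(1)])
  obtain \<alpha> S1 N1 where a: "\<And>n. approx f \<phi> n (\<alpha> n) (S1 n) (N1 n)" using ex[OF f \<phi>] by metis
  obtain \<beta> S2 N2 where b: "\<And>n. approx g \<psi> n (\<beta> n) (S2 n) (N2 n)" using ex[OF g \<psi>] by metis
  have \<alpha>: "finite (S1 n)" "finite (N1 n)" "(\<lambda>x. \<alpha> n (f x)) \<in> \<C>" "\<E> (\<lambda>x. \<alpha> n (f x) - \<phi> (f x)) \<le> \<epsilon> n powr p * \<E> f"
    "\<And>x. f x \<notin> N1 n \<Longrightarrow> \<exists>(s, c)\<in>S1 n. \<alpha> n (f x) = s * f x + c \<and> \<bar>deriv0 \<phi> (f x) - s\<bar> \<le> \<epsilon> n" for n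
    using a[of n] unfolding approx_def by blast+
  have \<beta>: "finite (S2 n)" "finite (N2 n)" "(\<lambda>x. \<beta> n (g x)) \<in> \<C>" "\<E> (\<lambda>x. \<beta> n (g x) - \<psi> (g x)) \<le> \<epsilon> n powr p * \<E> g"
    "\<And>x. g x \<notin> N2 n \<Longrightarrow> \<exists>(s, c)\<in>S2 n. \<beta> n (g x) = s * g x + c \<and> \<bar>deriv0 \<psi> (g x) - s\<bar> \<le> \<epsilon> n" for n
    using b[of n] unfolding approx_def by blast+
  have nlim: "(\<lambda>n. N (\<lambda>x. h n x - k x)) \<longlonglongrightarrow> 0"
    if h: "\<And>n. h n \<in> \<C>" "k \<in> \<F>" "\<And>n. \<E> (\<lambda>x. h n x - k x) \<le> \<epsilon> n powr p * e" for h k e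
  proof -
    have d: "(\<lambda>x. h n x - k x) \<in> \<F>" for n using h(1)[of n] h(2) by (auto intro: F_closed)
    have "(\<lambda>n. \<epsilon> n powr p * e) \<longlonglongrightarrow> 0 powr p * e"
      by (intro tendsto_mult tendsto_const tendsto_powr'[OF \<epsilon>(2) tendsto_const]) (use p \<epsilon>(1) in \<open>auto simp: less_imp_le\<close>)
    then have l: "(\<lambda>n. \<epsilon> n powr p * e) \<longlonglongrightarrow> 0" by simp
    have "(\<lambda>n. \<E> (\<lambda>x. h n x - k x)) \<longlonglongrightarrow> 0"
      by (rule tendsto_sandwich[OF _ _ tendsto_const l]) (use h(3) E_nonneg[OF d] in auto)
    then show ?thesis using N_tendsto_iff[of "\<lambda>n x. h n x - k x"] d by simp
  qed
  have lim: "(\<lambda>n. \<Gamma> (\<lambda>x. \<alpha> n (f x)) (\<lambda>x. \<beta> n (g x)) A) \<longlonglongrightarrow> \<Gamma> ?u ?v A"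
    by (rule mutual_LIMSEQ[OF _ F(3) _ F(4) A nlim[OF \<alpha>(3) F(3) \<alpha>(4)] nlim[OF \<beta>(3) F(4) \<beta>(4)]]) (use \<alpha>(3) \<beta>(3) in blast)+
  have close: "\<bar>\<Gamma> ?u ?v A - signed_integral (\<Gamma> f g) A w\<bar> \<le> \<eta> * total_variation (\<Gamma> f g) A" if \<eta>: "\<eta> > 0" for \<eta>
  proof -
    \<comment> \<open>Uniform continuity of the density turns slopes within \<delta> into weights
      within \<eta>.\<close>
    obtain \<delta> where \<delta>: "0 < \<delta>" "\<And>a b s t. \<bar>a\<bar> \<le> L \<Longrightarrow> \<bar>b\<bar> \<le> L \<Longrightarrow> \<bar>a - s\<bar> \<le> \<delta> \<Longrightarrow> \<bar>b - t\<bar> \<le> \<delta> \<Longrightarrow>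
        \<bar>power_slope (p - 1) a b - power_slope (p - 1) s t\<bar> \<le> \<eta>" using power_slope_uniform[OF q \<eta>] by metis
    have "\<forall>\<^sub>F n in sequentially. \<epsilon> n < \<delta>" using order_tendstoD(2)[OF \<epsilon>(2) \<delta>(1)] .
    then have "\<forall>\<^sub>F n in sequentially. \<bar>\<Gamma> (\<lambda>x. \<alpha> n (f x)) (\<lambda>x. \<beta> n (g x)) A - signed_integral (\<Gamma> f g) A w\<bar> \<le> \<eta> * total_variation (\<Gamma> f g) A"
    proof eventually_elim
      case (elim n)
      show ?case
      proof (rule mutual_approx[OF f \<alpha>(3) g \<beta>(3) w \<alpha>(1) \<beta>(1) \<alpha>(2) \<beta>(2) _ A])
        fix x assume x: "f x \<notin> N1 n" "g x \<notin> N2 n"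
        obtain s c where s: "(s, c) \<in> S1 n" "\<alpha> n (f x) = s * f x + c" "\<bar>deriv0 \<phi> (f x) - s\<bar> \<le> \<epsilon> n" using \<alpha>(5)[OF x(1)] by blast
        obtain s' c' where s': "(s', c') \<in> S2 n" "\<beta> n (g x) = s' * g x + c'" "\<bar>deriv0 \<psi> (g x) - s'\<bar> \<le> \<epsilon> n" using \<beta>(5)[OF x(2)] by blast
        have "\<bar>power_slope (p - 1) (deriv0 \<phi> (f x)) (deriv0 \<psi> (g x)) - power_slope (p - 1) s s'\<bar> \<le> \<eta>"
          using \<delta>(2) L s(3) s'(3) elim by (meson less_imp_le order_trans)
        then have "\<bar>w x - power_slope (p - 1) s s'\<bar> \<le> \<eta>" by (simp add: w_def power_slope_def)
        then show "\<exists>(s, c)\<in>S1 n. \<exists>(s', c')\<in>S2 n. \<alpha> n (f x) = s * f x + c \<and> \<beta> n (g x) = s' * g x + c' \<and>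
            \<bar>w x - power_slope (p - 1) s s'\<bar> \<le> \<eta>" using s s' by blast
      qed (use \<eta> in simp)
    qed
    moreover have "(\<lambda>n. \<bar>\<Gamma> (\<lambda>x. \<alpha> n (f x)) (\<lambda>x. \<beta> n (g x)) A - signed_integral (\<Gamma> f g) A w\<bar>) \<longlonglongrightarrow>
        \<bar>\<Gamma> ?u ?v A - signed_integral (\<Gamma> f g) A w\<bar>" by (intro tendsto_intros lim)
    ultimately show ?thesis by (intro tendsto_upperbound) auto
  qed
  have "\<bar>\<Gamma> ?u ?v A - signed_integral (\<Gamma> f g) A w\<bar> \<le> 0"
  proof (rule field_le_epsilon)
    fix e :: real assume e: "e > 0"
    define T where "T = total_variation (\<Gamma> f g) A"
    have T: "0 \<le> T" by (simp add: T_def total_variation_nonneg)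
    have "\<bar>\<Gamma> ?u ?v A - signed_integral (\<Gamma> f g) A w\<bar> \<le> e / (T + 1) * T" using close[of "e / (T + 1)"] e T by (simp add: T_def)
    also have "\<dots> \<le> e" using e T by (simp add: field_simps)
    finally show "\<bar>\<Gamma> ?u ?v A - signed_integral (\<Gamma> f g) A w\<bar> \<le> 0 + e" by simp
  qed
  then show "\<Gamma> ?u ?v A = signed_integral (\<Gamma> f g) A w" by simp
qed

lemma
  assumes f: "f \<in> \<C>" and g: "g \<in> \<C>"
  shows C_square: "(\<lambda>x. g x * g x) \<in> \<C>"
    and mutual_square: "A \<in> sets borel \<Longrightarrow> \<Gamma> f (\<lambda>x. g x * g x) A = signed_integral (\<Gamma> f g) A (\<lambda>x. 2 * g x)"
proof -
  have id: "piecewise_C1 (\<lambda>t. t)" unfolding piecewise_C1_def C1_differentiable_on_def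
    by (auto intro!: exI[of _ "{}"] exI[of _ "\<lambda>t. 1"] derivative_eq_intros continuous_intros)
  have sq: "piecewise_C1 (\<lambda>t. t * t)" unfolding piecewise_C1_def C1_differentiable_on_def
    by (auto intro!: exI[of _ "{}"] exI[of _ "\<lambda>t. 2 * t"] derivative_eq_intros continuous_intros)
  have D: "((\<lambda>t. t) has_real_derivative 1) (at y)" "((\<lambda>t. t * t) has_real_derivative 2 * y) (at y)" for y :: real
    by (auto intro!: derivative_eq_intros)
  have d: "deriv0 (\<lambda>t. t) y = 1" "deriv0 (\<lambda>t. t * t) y = 2 * y" for y
    using D DERIV_imp_deriv[OF D(1)] DERIV_imp_deriv[OF D(2)] unfolding deriv0_def field_differentiable_def by (metis, metis)
  show "(\<lambda>x. g x * g x) \<in> \<C>" using piecewise_C1_comp[OF g sq] by simp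
  show "\<Gamma> f (\<lambda>x. g x * g x) A = signed_integral (\<Gamma> f g) A (\<lambda>x. 2 * g x)" if "A \<in> sets borel"
    using chain_rule(2)[OF f g id _ sq _ that] by (simp add: d)
qed

proposition leibniz_rule:
  assumes f: "f \<in> \<C>" and g: "g \<in> \<C>" and h: "h \<in> \<C>"
  shows "(\<lambda>x. g x * h x) \<in> \<C>" "signed_integrable (\<Gamma> f h) g" "signed_integrable (\<Gamma> f g) h"
    and "A \<in> sets borel \<Longrightarrow> \<Gamma> f (\<lambda>x. g x * h x) A = signed_integral (\<Gamma> f h) A g + signed_integral (\<Gamma> f g) A h"
proof -
  \<comment> \<open>polarisation reduces products to squares, and those to the chain rule\<close>
  let ?a = "\<lambda>x. g x + h x" and ?b = "\<lambda>x. g x - h x"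
  have ab: "?a \<in> \<C>" "?b \<in> \<C>" by (intro C_closed g h)+
  have sq: "(\<lambda>x. ?a x * ?a x) \<in> \<C>" "(\<lambda>x. -1 * (?b x * ?b x)) \<in> \<C>" by (rule C_square[OF f ab(1)], rule C_scale[OF C_square[OF f ab(2)]])
  have polar: "(\<lambda>x. g x * h x) = (\<lambda>x. 1 / 4 * (?a x * ?a x + -1 * (?b x * ?b x)))"
    by (simp add: fun_eq_iff algebra_simps)
  show "(\<lambda>x. g x * h x) \<in> \<C>" unfolding polar by (rule C_scale[OF C_add[OF sq]])
  have F: "f \<in> \<F>" "g \<in> \<F>" "h \<in> \<F>" "?a \<in> \<F>" "?b \<in> \<F>" "(\<lambda>x. ?a x * ?a x) \<in> \<F>" "(\<lambda>x. -1 * (?b x * ?b x)) \<in> \<F>" "(\<lambda>x. ?b x * ?b x) \<in> \<F>"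
    using f g h ab sq C_square[OF f ab(2)] by blast+
  note J = jordan_mutual[OF F(1)]
  have bd: "\<exists>M. \<forall>x. \<bar>k x\<bar> \<le> M" if "k \<in> \<C>" for k using C_c_bounded that by blast
  obtain Mg Mh where Mg: "\<And>x. \<bar>g x\<bar> \<le> Mg" and Mh: "\<And>x. \<bar>h x\<bar> \<le> Mh" using bd[OF g] bd[OF h] by blast
  have mb: "k \<in> borel_measurable borel" if "k \<in> \<C>" for k by (intro borel_measurable_continuous_onI C_continuous that)
  show "signed_integrable (\<Gamma> f h) g" by (rule signed_integrable_bounded[OF J[OF F(3)] mb[OF g] Mg])
  show "signed_integrable (\<Gamma> f g) h" by (rule signed_integrable_bounded[OF J[OF F(2)] mb[OF h] Mh])
  assume A: "A \<in> sets borel"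
  have "\<Gamma> f (\<lambda>x. g x * h x) A = 1 / 4 * (\<Gamma> f (\<lambda>x. ?a x * ?a x) A + -1 * \<Gamma> f (\<lambda>x. ?b x * ?b x) A)"
    unfolding polar mutual_scale_right[OF F(1) F_closed(2)[OF F(6,7)] A] mutual_add_right[OF F(1,6,7) A]
      mutual_scale_right[OF F(1,8) A] ..
  also have "\<dots> = 1 / 4 * (signed_integral (\<Gamma> f ?a) A (\<lambda>x. 2 * ?a x) + -1 * signed_integral (\<Gamma> f ?b) A (\<lambda>x. 2 * ?b x))"
    using mutual_square[OF f ab(1) A] mutual_square[OF f ab(2) A] by simp
  finally have 1: "\<Gamma> f (\<lambda>x. g x * h x) A = 1 / 4 * (signed_integral (\<Gamma> f ?a) A (\<lambda>x. 2 * ?a x) + -1 * signed_integral (\<Gamma> f ?b) A (\<lambda>x. 2 * ?b x))" .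
  have bm: "(\<lambda>x. 2 * ?a x) \<in> borel_measurable borel" "(\<lambda>x. 2 * ?b x) \<in> borel_measurable borel" by (intro mb C_scale ab)+
  have bb: "\<bar>2 * ?a x\<bar> \<le> 2 * (Mg + Mh)" "\<bar>2 * ?b x\<bar> \<le> 2 * (Mg + Mh)" for x using Mg[of x] Mh[of x] by auto
  have 2: "signed_integral (\<Gamma> f ?a) A (\<lambda>x. 2 * ?a x) = signed_integral (\<Gamma> f g) A (\<lambda>x. 2 * ?a x) + signed_integral (\<Gamma> f h) A (\<lambda>x. 2 * ?a x)"
    by (rule signed_integral_add_measure[OF J[OF F(2)] J[OF F(3)] J[OF F(4)] mutual_add_right[OF F(1,2,3)] bm(1) bb(1) A])
  \<comment> \<open>Additivity is read as g = (g - h) + h, so that only sums of signed measures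
    occur.\<close>
  have 3: "signed_integral (\<Gamma> f g) A (\<lambda>x. 2 * ?b x) = signed_integral (\<Gamma> f ?b) A (\<lambda>x. 2 * ?b x) + signed_integral (\<Gamma> f h) A (\<lambda>x. 2 * ?b x)"
  proof (rule signed_integral_add_measure[OF J[OF F(5)] J[OF F(3)] J[OF F(2)] _ bm(2) bb(2) A])
    show "\<Gamma> f g A = \<Gamma> f ?b A + \<Gamma> f h A" if "A \<in> sets borel" for A using mutual_add_right[OF F(1,5,3) that] by simp
  qed
  have 4: "signed_integral (\<Gamma> f k) A (\<lambda>x. 2 * ?a x) = 2 * signed_integral (\<Gamma> f k) A g + 2 * signed_integral (\<Gamma> f k) A h"
    "signed_integral (\<Gamma> f k) A (\<lambda>x. 2 * ?b x) = 2 * signed_integral (\<Gamma> f k) A g + (- 2) * signed_integral (\<Gamma> f k) A h"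
    if "k \<in> \<F>" for k
    using signed_integral_lincomb[OF J[OF that] mb[OF g] Mg mb[OF h] Mh A, of 2 2]
      signed_integral_lincomb[OF J[OF that] mb[OF g] Mg mb[OF h] Mh A, of 2 "- 2"] by (simp_all add: algebra_simps)
  show "\<Gamma> f (\<lambda>x. g x * h x) A = signed_integral (\<Gamma> f h) A g + signed_integral (\<Gamma> f g) A h"
    using 1 unfolding 2 eq_diff_eq[THEN iffD2, OF 3[symmetric]] 4[OF F(2)] 4[OF F(3)] by (simp add: algebra_simps)
qed

end

theorem theorem2p4:
  fixes p :: real
    and m :: "'a::metric_space measure"
    and \<E> :: "('a \<Rightarrow> real) \<Rightarrow> real"
    and \<F> :: "('a \<Rightarrow> real) set"
  assumes "1 < p"
    and "locally_compact_space (euclidean :: 'a topology)"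
    and "separable_space (euclidean :: 'a topology)"
    and "radon_measure m"
    and "full_support m"
    and "p_energy_form p m \<E> \<F>"
    and E1: "\<F> \<subseteq> Lp_space p m" "banach_mod_AE m \<F> (energy_norm p m \<E>)"
    and E2: "\<forall>f\<in>\<F> \<inter> C_c. (\<lambda>x. max (min (f x) 1) 0) \<in> \<F> \<inter> C_c \<and>
                \<E> (\<lambda>x. max (min (f x) 1) 0) \<le> \<E> f"
    and E3: "\<forall>f\<in>\<F> \<inter> C_c. \<forall>g\<in>\<F> \<inter> C_c.
                (\<exists>a::real. supp f \<inter> supp (\<lambda>x. g x + a) = {}) \<longrightarrow>
                \<E> (\<lambda>x. f x + g x) = \<E> f + \<E> g"
    and E4: "dense_wrt (energy_norm p m \<E>) (\<F> \<inter> C_c) \<F>" "dense_wrt sup_norm (\<F> \<inter> C_c) C_c"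
    and E5: "clarkson p \<F> (\<lambda>f. \<E> f powr (1 / p))"
  shows "(\<exists>!\<mu>. \<mu> \<in> extensional \<F> \<and> energy_measures p m \<E> \<F> \<mu>) \<and>
    (\<forall>\<mu>. \<mu> \<in> extensional \<F> \<and> energy_measures p m \<E> \<F> \<mu> \<longrightarrow>
      \<comment> \<open>the mutual energy measures are well defined\<close>
      (\<forall>f\<in>\<F>. \<forall>g\<in>\<F>.
         (\<forall>A\<in>sets borel. (\<lambda>t::real. measure (\<mu> (\<lambda>x. f x + t * g x)) A) field_differentiable (at 0)) \<and>
         signed_borel_measure (mutual_energy p \<mu> f g)) \<and>
      \<comment> \<open>chain rule\<close>
      (\<forall>f\<in>\<F> \<inter> C_c. \<forall>g\<in>\<F> \<inter> C_c. \<forall>\<phi> \<psi>.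
         piecewise_C1 \<phi> \<and> piecewise_C1 \<psi> \<and> \<phi> 0 = 0 \<and> \<psi> 0 = 0 \<longrightarrow>
         \<phi> \<circ> f \<in> \<F> \<and> \<psi> \<circ> g \<in> \<F> \<and>
         (let w = (\<lambda>x. sgn (deriv0 \<phi> (f x)) * \<bar>deriv0 \<phi> (f x)\<bar> powr (p - 1) * deriv0 \<psi> (g x))
          in signed_integrable (mutual_energy p \<mu> f g) w \<and>
             (\<forall>A\<in>sets borel. mutual_energy p \<mu> (\<phi> \<circ> f) (\<psi> \<circ> g) A =
                signed_integral (mutual_energy p \<mu> f g) A w))) \<and>
      \<comment> \<open>Leibniz rule\<close>
      (\<forall>f\<in>\<F> \<inter> C_c. \<forall>g\<in>\<F> \<inter> C_c. \<forall>h\<in>\<F> \<inter> C_c.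
         (\<lambda>x. g x * h x) \<in> \<F> \<and>
         signed_integrable (mutual_energy p \<mu> f h) g \<and>
         signed_integrable (mutual_energy p \<mu> f g) h \<and>
         (\<forall>A\<in>sets borel. mutual_energy p \<mu> f (\<lambda>x. g x * h x) A =
            signed_integral (mutual_energy p \<mu> f h) A g +
            signed_integral (mutual_energy p \<mu> f g) A h)))"
proof -
  interpret p_energy_space p m \<E> \<F>
    by (rule p_energy_space.intro) (use assms in blast)+
  show ?thesis
  proof (intro conjI allI impI)
    show "\<exists>!\<mu>. \<mu> \<in> extensional \<F> \<and> energy_measures p m \<E> \<F> \<mu>" by (rule ex1_energy_measures)
    fix \<mu> assume "\<mu> \<in> extensional \<F> \<and> energy_measures p m \<E> \<F> \<mu>"
    then interpret energy_measures_space p m \<E> \<F> \<mu> by unfold_locales blast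
    show "\<forall>f\<in>\<F>. \<forall>g\<in>\<F>.
         (\<forall>A\<in>sets borel. (\<lambda>t::real. measure (\<mu> (\<lambda>x. f x + t * g x)) A) field_differentiable (at 0)) \<and>
         signed_borel_measure (mutual_energy p \<mu> f g)"
      unfolding field_differentiable_def using mutual_DERIV signed_jordan_measure[OF jordan_mutual] by blast
    show "\<forall>f\<in>\<F> \<inter> C_c. \<forall>g\<in>\<F> \<inter> C_c. \<forall>\<phi> \<psi>.
         piecewise_C1 \<phi> \<and> piecewise_C1 \<psi> \<and> \<phi> 0 = 0 \<and> \<psi> 0 = 0 \<longrightarrow>
         \<phi> \<circ> f \<in> \<F> \<and> \<psi> \<circ> g \<in> \<F> \<and>
         (let w = (\<lambda>x. sgn (deriv0 \<phi> (f x)) * \<bar>deriv0 \<phi> (f x)\<bar> powr (p - 1) * deriv0 \<psi> (g x))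
          in signed_integrable (mutual_energy p \<mu> f g) w \<and>
             (\<forall>A\<in>sets borel. mutual_energy p \<mu> (\<phi> \<circ> f) (\<psi> \<circ> g) A =
                signed_integral (mutual_energy p \<mu> f g) A w))"
      unfolding Let_def o_def using piecewise_C1_comp chain_rule by blast
    show "\<forall>f\<in>\<F> \<inter> C_c. \<forall>g\<in>\<F> \<inter> C_c. \<forall>h\<in>\<F> \<inter> C_c.
         (\<lambda>x. g x * h x) \<in> \<F> \<and>
         signed_integrable (mutual_energy p \<mu> f h) g \<and>
         signed_integrable (mutual_energy p \<mu> f g) h \<and>
         (\<forall>A\<in>sets borel. mutual_energy p \<mu> f (\<lambda>x. g x * h x) A =
            signed_integral (mutual_energy p \<mu> f h) A g +
            signed_integral (mutual_energy p \<mu> f g) A h)"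
    proof (intro ballI conjI)
      fix f g h A assume *: "f \<in> \<F> \<inter> C_c" "g \<in> \<F> \<inter> C_c" "h \<in> \<F> \<inter> C_c"
      show "(\<lambda>x. g x * h x) \<in> \<F>" using leibniz_rule(1)[OF *] by (rule IntD1)
      show "signed_integrable (mutual_energy p \<mu> f h) g" "signed_integrable (mutual_energy p \<mu> f g) h"
        by (rule leibniz_rule(2,3)[OF *])+
      show "mutual_energy p \<mu> f (\<lambda>x. g x * h x) A =
          signed_integral (mutual_energy p \<mu> f h) A g + signed_integral (mutual_energy p \<mu> f g) A h" if "A \<in> sets borel"
        using that by (rule leibniz_rule(4)[OF *])
    qed
  qed
qed

end
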